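(* Consider the system with no input noise ($u=0$) described in the context, with $z(t)=e^{At}x$, $y(t)=C\int_0^t e^{As}x\,ds+w(t)$, and the estimates $\hat z_{T,n}=\mathbb{E}\big(z(T)\,|\,\{y(iT/n)\}_{i=1}^n\big)$ and $\hat z(T)=\mathbb{E}\big(z(T)\,|\,\{y(s),\,s\le T\}\big)$. Assume that $A$ is the generator of an analytic $C_0$-semigroup and, in addition, that $-A$ is a sectorial operator. Assume $C\in\mathcal{L}(\mathscr{D}((-A)^{\nu}),\mathcal{Y})$ and $x\in\mathscr{D}((-A)^{\eta})$ almost surely, where $\nu,\eta\in\mathbb{R}$ are such that $|\eta-\nu|<1/2$. Then $$\mathbb{E}\big(\|\hat z_{T,n}-\hat z(T)\|_{\mathcal{X}}^2\big)\le\frac{M\,T^{1+2(\eta-\nu)}}{n^{1+2(\eta-\nu)}},$$ where $$M=\frac{2\|C\|_{\mathcal{L}(\mathscr{D}((-A)^{\nu}),\mathcal{Y})}^2\,\mathbb{E}\big(\|z(T)-\hat z_{T,n}\|_{\mathcal{X}}^2\big)\,\mathbb{E}\big(\|x\|_{\mathscr{D}((-A)^{\eta})}^2\big)}{(2^{1+2(\eta-\nu)}-1)\min(\mathrm{eig}(R))}\Big(M_{\nu,\eta}+\frac{c(1-\eta+\nu)^2}{2^{4-2(\eta-\nu)}}\,\frac{2-2(\eta-\nu)}{1-2(\eta-\nu)}\Big)$$ and $$M_{\nu,\eta}=\begin{cases}\dfrac{4(\ln2)^2\,c(1-\eta+\nu)^2}{(1+\eta-\nu)^2}&\text{if }\eta>\nu,\\[2mm]\dfrac{2^{2+2(\eta-\nu)}\,c(\nu-\eta)^2}{(1+\eta-\nu)^2}&\text{if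 }\eta\le\nu.\end{cases}$$ Here, for $\kappa\ge0$, $c(\kappa)$ is a constant such that $\|(-A)^{\kappa}e^{At}\|_{\mathcal{L}(\mathcal{X})}\le c(\kappa)/t^{\kappa}$ for $0<t\le T$.
   Context: Setting. $\mathcal{X}$ is a separable Hilbert space (state space), $\mathcal{Y}=\mathbb{R}^r$ (output space). $A$ generates a $C_0$-semigroup $e^{At}$ on $\mathcal{X}$ with domain $\mathscr{D}(A)$. $C\in\mathcal{L}(\mathscr{D}(A),\mathcal{Y})$ is the (possibly unbounded on $\mathcal{X}$) observation operator. $T>0$ is fixed and $n$ is a positive integer. The initial state $x\sim N(m,P_0)$ is an $\mathcal{X}$-valued Gaussian random variable, $w$ is an $r$-dimensional Brownian motion with incremental covariance $R>0$, and $x$ and $w$ are independent. There is no input noise: the state is $z(t)=e^{At}x$ and the output is $y(t)=C\int_0^te^{As}x\,ds+w(t)$ (well defined since $\int_0^te^{As}x\,ds\in\mathscr{D}(A)$), i.e. $dz=Az\,dt$, $dy=Cz\,dt+dw$, $z(0)=x$. $\min(\mathrm{eig}(R))$ is the smallest eigenvalue of $R$. Fractional powers. Sectoriality of $-A$ (including $0\in\rho(A)$) allows one to define the fractional powers $(-A)^{\eta}$, $\eta\in\mathbb{R}$, and the spaces $\mathscr{D}((-A)^{\eta})$ with norm $\|\xi\|_{\mathscr{D}((-A)^{\eta})}=\|(-A)^{\eta}\xi\|_{\mathcal{X}}$ (for $\eta<0$, the completion of $\mathcal{X}$ in this norm). For example, a strictly negative definite $A$ satisfies this. If $x\in\mathscr{D}((-A)^\eta)$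 a.s. then $x$ is a Gaussian random variable in that space, so $\mathbb{E}(\|x\|^2_{\mathscr{D}((-A)^\eta)})<\infty$. *)

theory Defs
  imports "HOL-Probability.Probability"
begin

text \<open>The state space is a real separable Hilbert space, i.e. a type of sort
  \<open>{real_inner, banach, second_countable_topology}\<close>. A linear operator that is not
  everywhere defined is a pair of a domain and a total function whose values off the domain
  are irrelevant.\<close>


subsection \<open>Semigroups and generators\<close>

definition C0_semigroup :: "(real \<Rightarrow> 'a::real_normed_vector \<Rightarrow>\<^sub>L 'a) \<Rightarrow> bool" where
  "C0_semigroup S \<longleftrightarrow>
     S 0 = id_blinfun \<and>
     (\<forall>s\<ge>0. \<forall>t\<ge>0. S (s + t) = S s o\<^sub>L S t) \<and>
     (\<forall>\<xi>. ((\<lambda>t. S t \<xi>) \<longlongrightarrow> \<xi>) (at_right 0))"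

definition gen_dom :: "(real \<Rightarrow> 'a::real_normed_vector \<Rightarrow>\<^sub>L 'a) \<Rightarrow> 'a set" where
  "gen_dom S = {\<xi>. \<exists>l. ((\<lambda>h. (S h \<xi> - \<xi>) /\<^sub>R h) \<longlongrightarrow> l) (at_right 0)}"

definition gen :: "(real \<Rightarrow> 'a::real_normed_vector \<Rightarrow>\<^sub>L 'a) \<Rightarrow> 'a \<Rightarrow> 'a" where
  "gen S \<xi> = Lim (at_right 0) (\<lambda>h. (S h \<xi> - \<xi>) /\<^sub>R h)"


subsection \<open>Complexification\<close>

text \<open>Analyticity and sectoriality refer to the complexification of the real space, realised
  as the product of the space with itself, the pair \<open>(u, v)\<close> standing for \<open>u + i v\<close>. The
  product norm is its Hilbert norm, and an operator \<open>B\<close> on \<open>D\<close> complexifies to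
  \<open>map_prod B B\<close> on \<open>D \<times> D\<close>.\<close>

definition cscale :: "complex \<Rightarrow> 'a::real_vector \<times> 'a \<Rightarrow> 'a \<times> 'a" where
  "cscale z p = (Re z *\<^sub>R fst p - Im z *\<^sub>R snd p, Re z *\<^sub>R snd p + Im z *\<^sub>R fst p)"

definition sector :: "real \<Rightarrow> complex set" where
  "sector \<theta> = {z. z \<noteq> 0 \<and> \<bar>Arg z\<bar> < \<theta>}"

definition holomorphic_extension ::
  "(real \<Rightarrow> 'a::real_normed_vector \<Rightarrow>\<^sub>L 'a) \<Rightarrow> real \<Rightarrow>
   (complex \<Rightarrow> ('a \<times> 'a) \<Rightarrow>\<^sub>L ('a \<times> 'a)) \<Rightarrow> bool" where
  "holomorphic_extension S \<theta> E \<longleftrightarrow>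
     (\<forall>t>0. \<forall>p. E (complex_of_real t) p = map_prod (S t) (S t) p) \<and>
     (\<forall>z\<in>sector \<theta>. \<forall>a p. E z (cscale a p) = cscale a (E z p)) \<and>
     (\<forall>z\<in>sector \<theta>. \<forall>z'\<in>sector \<theta>. E (z + z') = E z o\<^sub>L E z') \<and>
     (\<forall>z\<in>sector \<theta>. \<forall>p. \<exists>d. ((\<lambda>z. E z p) has_derivative (\<lambda>h. cscale h d)) (at z)) \<and>
     (\<forall>\<theta>'. 0 < \<theta>' \<and> \<theta>' < \<theta> \<longrightarrow>
        (\<forall>p. ((\<lambda>z. E z p) \<longlongrightarrow> p) (at 0 within sector \<theta>')))"

definition analytic_semigroup :: "(real \<Rightarrow> 'a::real_normed_vector \<Rightarrow>\<^sub>L 'a) \<Rightarrow> bool" where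
  "analytic_semigroup S \<longleftrightarrow> C0_semigroup S \<and>
     (\<exists>\<theta> E. 0 < \<theta> \<and> \<theta> \<le> pi / 2 \<and> holomorphic_extension S \<theta> E)"

definition resolvent ::
  "'a::real_normed_vector set \<Rightarrow> ('a \<Rightarrow> 'a) \<Rightarrow> complex \<Rightarrow> 'a \<times> 'a \<Rightarrow> 'a \<times> 'a" where
  "resolvent D B z = the_inv_into (D \<times> D) (\<lambda>p. cscale z p - map_prod B B p)"

definition resolvent_set :: "'a::real_normed_vector set \<Rightarrow> ('a \<Rightarrow> 'a) \<Rightarrow> complex set" where
  "resolvent_set D B = {z. bij_betw (\<lambda>p. cscale z p - map_prod B B p) (D \<times> D) UNIV \<and>
                           bounded_linear (resolvent D B z)}"

text \<open>Sectorial of some angle \<open>\<omega> < \<pi>\<close>, i.e. the spectrum lies in the closed sector of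
  half-angle \<open>\<omega>\<close> around the positive axis and \<open>z R(z)\<close> is uniformly bounded outside every larger
  sector; \<open>0\<close> is required to be a regular point.\<close>

definition sectorial :: "'a::real_normed_vector set \<Rightarrow> ('a \<Rightarrow> 'a) \<Rightarrow> bool" where
  "sectorial D B \<longleftrightarrow> 0 \<in> resolvent_set D B \<and>
     (\<exists>\<omega>. 0 \<le> \<omega> \<and> \<omega> < pi \<and>
        (\<forall>z. z \<noteq> 0 \<and> \<omega> < \<bar>Arg z\<bar> \<longrightarrow> z \<in> resolvent_set D B) \<and>
        (\<forall>\<omega>'. \<omega> < \<omega>' \<and> \<omega>' < pi \<longrightarrow>
           (\<exists>K. \<forall>z. z \<noteq> 0 \<and> \<omega>' < \<bar>Arg z\<bar> \<longrightarrow> cmod z * onorm (resolvent D B z) \<le> K)))"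


subsection \<open>Fractional powers\<close>

text \<open>For \<open>\<alpha> \<ge> 0\<close>, the bounded operator \<open>B\<^sup>-\<^sup>\<alpha>\<close>: the integer part of \<open>\<alpha>\<close> is a power of
  the inverse of \<open>B\<close>, and for \<open>0 < \<alpha> < 1\<close> Balakrishnan's formula is used,
  \<open>B\<^sup>-\<^sup>\<alpha> = sin (\<pi> \<alpha>) / \<pi> * \<integral>\<^sub>0\<^sup>\<infinity> t\<^sup>-\<^sup>\<alpha> (t + B)\<^sup>-\<^sup>1 dt\<close>.\<close>

definition inv_power ::
  "'a::{banach, second_countable_topology} set \<Rightarrow> ('a \<Rightarrow> 'a) \<Rightarrow> real \<Rightarrow> 'a \<Rightarrow> 'a" where
  "inv_power D B \<alpha> \<xi> = (the_inv_into D B ^^ nat \<lfloor>\<alpha>\<rfloor>)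
     (if frac \<alpha> = 0 then \<xi>
      else (sin (pi * frac \<alpha>) / pi) *\<^sub>R
        (LINT t:{0<..}|lborel. (t powr (- frac \<alpha>)) *\<^sub>R the_inv_into D (\<lambda>u. t *\<^sub>R u + B u) \<xi>))"

text \<open>For \<open>\<eta> < 0\<close> the space \<open>D(B\<^sup>\<eta>)\<close> of the theory is the completion of the whole space in the
  norm \<open>\<xi> \<mapsto> \<parallel>B\<^sup>\<eta> \<xi>\<parallel>\<close>; here it is represented by its dense subspace \<open>UNIV\<close>. The value
  \<open>0\<close> off the domain keeps the power Borel measurable.\<close>

definition frac_dom ::
  "'a::{banach, second_countable_topology} set \<Rightarrow> ('a \<Rightarrow> 'a) \<Rightarrow> real \<Rightarrow> 'a set" where
  "frac_dom D B \<eta> = (if \<eta> \<le> 0 then UNIV else range (inv_power D B \<eta>))"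

definition frac_power ::
  "'a::{banach, second_countable_topology} set \<Rightarrow> ('a \<Rightarrow> 'a) \<Rightarrow> real \<Rightarrow> 'a \<Rightarrow> 'a" where
  "frac_power D B \<eta> \<xi> =
     (if \<eta> \<le> 0 then inv_power D B (- \<eta>) \<xi>
      else if \<xi> \<in> frac_dom D B \<eta> then the_inv (inv_power D B \<eta>) \<xi> else 0)"

abbreviation neg_gen_dom ::
  "(real \<Rightarrow> 'a::{banach, second_countable_topology} \<Rightarrow>\<^sub>L 'a) \<Rightarrow> real \<Rightarrow> 'a set" where
  "neg_gen_dom S \<equiv> frac_dom (gen_dom S) (\<lambda>u. - gen S u)"

abbreviation neg_gen_power ::
  "(real \<Rightarrow> 'a::{banach, second_countable_topology} \<Rightarrow>\<^sub>L 'a) \<Rightarrow> real \<Rightarrow> 'a \<Rightarrow> 'a" where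
  "neg_gen_power S \<equiv> frac_power (gen_dom S) (\<lambda>u. - gen S u)"


subsection \<open>Operators bounded with respect to a norm on a subspace\<close>

definition bounded_op_on ::
  "'a::real_vector set \<Rightarrow> ('a \<Rightarrow> real) \<Rightarrow> ('a \<Rightarrow> 'b::real_normed_vector) \<Rightarrow> bool" where
  "bounded_op_on D N C \<longleftrightarrow>
     (\<forall>u\<in>D. \<forall>v\<in>D. C (u + v) = C u + C v) \<and>
     (\<forall>a. \<forall>u\<in>D. C (a *\<^sub>R u) = a *\<^sub>R C u) \<and>
     (\<exists>K. \<forall>u\<in>D. norm (C u) \<le> K * N u)"

text \<open>As in \<open>onorm\<close>, the vector \<open>0\<close> contributes \<open>0 / 0 = 0\<close>.\<close>

definition op_norm_on ::
  "'a set \<Rightarrow> ('a \<Rightarrow> real) \<Rightarrow> ('a \<Rightarrow> 'b::real_normed_vector) \<Rightarrow> real" where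
  "op_norm_on D N C = (SUP u\<in>D. norm (C u) / N u)"


subsection \<open>Gaussian variables and Brownian motion\<close>

definition gaussian_real :: "'w measure \<Rightarrow> ('w \<Rightarrow> real) \<Rightarrow> real \<Rightarrow> real \<Rightarrow> bool" where
  "gaussian_real M X \<mu> v \<longleftrightarrow>
     (if v = 0 then AE \<omega> in M. X \<omega> = \<mu>
      else distributed M lborel X (\<lambda>x. ennreal (normal_density \<mu> (sqrt v) x)))"

definition gaussian ::
  "'w measure \<Rightarrow> ('w \<Rightarrow> 'a::real_inner) \<Rightarrow> 'a \<Rightarrow> ('a \<Rightarrow> 'a) \<Rightarrow> bool" where
  "gaussian M X m P \<longleftrightarrow>
     X \<in> borel_measurable M \<and> bounded_linear P \<and>
     (\<forall>h k. h \<bullet> P k = P h \<bullet> k) \<and> (\<forall>h. 0 \<le> h \<bullet> P h) \<and>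
     (\<forall>h. gaussian_real M (\<lambda>\<omega>. h \<bullet> X \<omega>) (h \<bullet> m) (h \<bullet> P h))"

definition brownian_motion ::
  "'w measure \<Rightarrow> (real \<Rightarrow> 'w \<Rightarrow> real ^ 'r) \<Rightarrow> real ^ 'r ^ 'r \<Rightarrow> bool" where
  "brownian_motion M w R \<longleftrightarrow>
     (\<forall>t\<ge>0. w t \<in> borel_measurable M) \<and>
     (AE \<omega> in M. w 0 \<omega> = 0) \<and>
     (\<forall>s t. 0 \<le> s \<and> s \<le> t \<longrightarrow>
        gaussian M (\<lambda>\<omega>. w t \<omega> - w s \<omega>) 0 (\<lambda>h. (t - s) *\<^sub>R (R *v h))) \<and>
     (\<forall>k (\<tau> :: nat \<Rightarrow> real). 0 \<le> \<tau> 0 \<and> (\<forall>i<k. \<tau> i \<le> \<tau> (Suc i)) \<longrightarrow>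
        prob_space.indep_vars M (\<lambda>_. borel) (\<lambda>i \<omega>. w (\<tau> (Suc i)) \<omega> - w (\<tau> i) \<omega>) {..<k}) \<and>
     (AE \<omega> in M. continuous_on {0..} (\<lambda>t. w t \<omega>))"

definition pos_def :: "real ^ 'r ^ 'r \<Rightarrow> bool" where
  "pos_def R \<longleftrightarrow> transpose R = R \<and> (\<forall>v. v \<noteq> 0 \<longrightarrow> 0 < v \<bullet> (R *v v))"

definition min_eig :: "real ^ 'r ^ 'r \<Rightarrow> real" where
  "min_eig R = Min {l. \<exists>v. v \<noteq> 0 \<and> R *v v = l *\<^sub>R v}"


subsection \<open>Observation and conditional expectation\<close>

definition output_process ::
  "(real \<Rightarrow> 'a::banach \<Rightarrow>\<^sub>L 'a) \<Rightarrow> ('a \<Rightarrow> real ^ 'r) \<Rightarrow> ('w \<Rightarrow> 'a) \<Rightarrow> (real \<Rightarrow> 'w \<Rightarrow> real ^ 'r) \<Rightarrow>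
   real \<Rightarrow> 'w \<Rightarrow> real ^ 'r" where
  "output_process S C x w t \<omega> = C (integral {0..t} (\<lambda>s. S s (x \<omega>))) + w t \<omega>"

definition gen_sigma ::
  "'w measure \<Rightarrow> 'i set \<Rightarrow> ('i \<Rightarrow> 'w \<Rightarrow> 'b::topological_space) \<Rightarrow> 'w measure" where
  "gen_sigma M I Y = sigma (space M) {Y i -` U \<inter> space M | i U. i \<in> I \<and> U \<in> sets borel}"

text \<open>\<open>Z\<close> is a version of the conditional expectation of \<open>X\<close> given \<open>F\<close>.\<close>

definition is_cond_exp ::
  "'w measure \<Rightarrow> 'w measure \<Rightarrow> ('w \<Rightarrow> 'a::{banach, second_countable_topology}) \<Rightarrow>
   ('w \<Rightarrow> 'a) \<Rightarrow> bool" where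
  "is_cond_exp M F X Z \<longleftrightarrow>
     Z \<in> borel_measurable F \<and> integrable M Z \<and>
     (\<forall>U\<in>sets F. (LINT \<omega>:U|M. Z \<omega>) = (LINT \<omega>:U|M. X \<omega>))"


subsection \<open>The constant of the estimate\<close>

definition M_init :: "(real \<Rightarrow> real) \<Rightarrow> real \<Rightarrow> real \<Rightarrow> real" where
  "M_init c \<nu> \<eta> =
     (if \<eta> > \<nu> then 4 * (ln 2)\<^sup>2 * (c (1 - \<eta> + \<nu>))\<^sup>2 / (1 + \<eta> - \<nu>)\<^sup>2
      else 2 powr (2 + 2 * (\<eta> - \<nu>)) * (c (\<nu> - \<eta>))\<^sup>2 / (1 + \<eta> - \<nu>)\<^sup>2)"

text \<open>\<open>normC\<close>, \<open>errn\<close>, \<open>ex\<close>, \<open>lam\<close> stand for the norm of the observation operator, the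
  mean square error of the discrete time estimate, the second moment of the initial state in the
  fractional power space, and the smallest eigenvalue of the noise covariance.\<close>

definition M_const ::
  "(real \<Rightarrow> real) \<Rightarrow> real \<Rightarrow> real \<Rightarrow> real \<Rightarrow> real \<Rightarrow> real \<Rightarrow> real \<Rightarrow> real" where
  "M_const c \<nu> \<eta> normC errn ex lam =
     2 * normC\<^sup>2 * errn * ex / ((2 powr (1 + 2 * (\<eta> - \<nu>)) - 1) * lam) *
     (M_init c \<nu> \<eta> +
      (c (1 - \<eta> + \<nu>))\<^sup>2 / 2 powr (4 - 2 * (\<eta> - \<nu>)) *
      ((2 - 2 * (\<eta> - \<nu>)) / (1 - 2 * (\<eta> - \<nu>))))"

end

theory Submission
  imports Defs
begin

text \<open>
  Everything is done for one coordinate \<open>U = \<langle>e, e\<^sup>A\<^sup>T x\<rangle>\<close> of the state at a time; the bound for a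
  coordinate is proportional to the mean square error of the discrete estimate of that
  coordinate, so that it can be summed over orthonormal systems (\<open>estimate_difference\<close>).

  The variables \<open>U\<close> and \<open>\<langle>b, y(t)\<rangle>\<close> belong to a space of jointly Gaussian variables, in which
  conditional expectations are orthogonal projections in mean square. Let \<open>p k\<close> be the projection of
  \<open>U\<close> onto the span of the constants and the observations on the grid with \<open>N = 2^k n\<close>
  intervals. Then \<open>p 0\<close> is the coordinate of the discrete estimate, and the limit of \<open>p k\<close> is the
  coordinate of the continuous one. The successive increments of \<open>p k\<close> are orthogonal, hence
  the mean square difference of the two estimates is the sum of the mean squares of the
  increments.

  For one increment (\<open>increment_bound\<close>), let \<open>h = T / (2 N)\<close> be the new step. Refining
  the grid is the same as observing the midpoint combinations
  \<open>2 y(l + h) - y(l) - y(l + 2 h)\<close> with \<open>l = 2 i h\<close>. Their noise parts are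
  uncorrelated with the old observations and with each other, with covariance \<open>2 h R\<close>; their
  signal parts are \<open>C u_i\<close>, where \<open>u_i\<close> is the negative of the second difference of the
  integrated orbit, which is small by smoothness. An observation of a small signal in a large noise cannot improve the estimate
  much (\<open>innovation_bound\<close>): the increment has mean square at most the current error times
  \<open>\<Sum>_i E |C u_i|^2 / (2 h min_eig R)\<close>.

  The signal is bounded with the identity
  \<open>(-A)^\<nu> u_i = (-A)^(-(1 + d)) (e^(A l) - 2 e^(A (l + h)) + e^(A (l + 2 h))) (-A)^\<eta> x\<close>, where
  \<open>d = \<eta> - \<nu>\<close> (\<open>neg_power_diff2\<close>). For \<open>l > 0\<close> the second derivative of \<open>(-A)^(-(1 + d)) e^(A t)\<close>
  is \<open>(-A)^(1 - d) e^(A t)\<close>, of norm at most \<open>c (1 - d) t^(d - 1)\<close>, and the second difference is at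
  most \<open>c (1 - d) l^(d - 1) h^2\<close> times the norm of \<open>(-A)^\<eta> x\<close>; the squares of these are
  summable over \<open>l = 2 i h\<close> because of \<open>d < 1/2\<close>, with sum of order \<open>h^(2 + 2 d)\<close>. For \<open>l = 0\<close> the
  singularity is integrated, which gives the same order (\<open>sum_diff2_bound\<close>). After the division by \<open>h\<close>
  the increment is of order \<open>h^(1 + 2 d)\<close>, and \<open>d > -1/2\<close> makes the sum over \<open>k\<close> a convergent
  geometric series, with sum proportional to \<open>(T / n)^(1 + 2 d) / (2^(1 + 2 d) - 1)\<close>.

  The limit of \<open>p k\<close> is identified through characteristic functions. For jointly
  Gaussian variables \<open>W\<close> of mean \<open>0\<close> and \<open>V\<close>, the number \<open>E (W e^(i V))\<close> is \<open>i E (W V) E (e^(i V))\<close>; so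
  a variable that is orthogonal to the observations is uncorrelated with all
  trigonometric functions of them (\<open>gaussian_correlation_bound\<close>), and by uniqueness of the Fourier transform its
  integrals over the generated \<open>\<sigma>\<close>-algebra vanish (\<open>fourier_unique_sigma\<close>). The error
  \<open>U - p k\<close> is orthogonal to the observations on the grid, and in the limit to all of them, as
  these depend on time continuously in mean square.

  Two analytic foundations are built from the definitions: the laws of exponents for the powers
  given by Balakrishnan's formula (\<open>P_add\<close>), and the integrability of the squared norms of \<open>x\<close> and
  \<open>(-A)^\<eta> x\<close>, a weak form of Fernique's theorem (\<open>limit_of_images\<close>).
\<close>

section \<open>The uniform boundedness principle\<close>

text \<open>A vector \<open>v\<close> of norm at most \<open>r\<close> at which the operator is large exists, and one of \<open>x + v\<close>
  and \<open>x - v\<close> inherits this because \<open>2 L v\<close> is the difference of the values there. The factor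
  \<open>2 / 3\<close> stands for any number below \<open>1\<close>.\<close>

lemma blinfun_large_on_ball:
  fixes L :: "'a::real_normed_vector \<Rightarrow>\<^sub>L 'b::real_normed_vector"
  assumes "0 < r"
  shows "\<exists>y. norm (y - x) \<le> r \<and> 2 / 3 * r * norm L \<le> norm (L y)"
proof (cases "norm L = 0")
  case True
  then show ?thesis using assms by (intro exI[of _ x]) auto
next
  case False
  have "\<exists>v. norm v \<le> r \<and> 2 / 3 * r * norm L \<le> norm (L v)"
  proof (rule ccontr)
    assume "\<not> ?thesis"
    then have small: "norm (L v) < 2 / 3 * r * norm L" if "norm v \<le> r" for v
      using that by (meson not_le)
    have "norm (L u) \<le> 2 / 3 * norm L * norm u" for u
    proof (cases "u = 0")
      case False
      have "norm (L ((r / norm u) *\<^sub>R u)) < 2 / 3 * r * norm L"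
        using assms False by (intro small) auto
      then show ?thesis
        using assms False by (simp add: blinfun.scaleR_right field_simps)
    qed simp
    then have "norm L \<le> 2 / 3 * norm L"
      by (intro norm_blinfun_bound) auto
    then show False using False by simp
  qed
  then obtain v where v: "norm v \<le> r" "2 / 3 * r * norm L \<le> norm (L v)" by blast
  have "2 *\<^sub>R L v = L (x + v) - L (x - v)"
    by (simp add: blinfun.add_right blinfun.diff_right scaleR_2)
  then have "2 * norm (L v) \<le> norm (L (x + v)) + norm (L (x - v))"
    by (metis abs_numeral norm_scaleR norm_triangle_ineq4)
  then consider "2 / 3 * r * norm L \<le> norm (L (x + v))" | "2 / 3 * r * norm L \<le> norm (L (x - v))"
    using v by linarith
  then show ?thesis
  proof cases
    case 1
    then show ?thesis using v by (intro exI[of _ "x + v"]) simp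
  next
    case 2
    then show ?thesis using v by (intro exI[of _ "x - v"]) simp
  qed
qed

text \<open>Sokal's argument: if the norms were unbounded, pick operators with norms exceeding
  \<open>4\<^sup>n\<close> and move a point by at most \<open>3\<^sup>-\<^sup>n\<close> in step \<open>n\<close> so that the \<open>n\<close>-th operator is
  large at it. The remaining steps are too short to undo this, and the orbit of the limit is
  unbounded.\<close>

lemma uniform_boundedness:
  fixes L :: "'i \<Rightarrow> 'a::banach \<Rightarrow>\<^sub>L 'b::real_normed_vector"
  assumes pw: "\<And>x. \<exists>K. \<forall>i. norm (L i x) \<le> K"
  shows "\<exists>K. \<forall>i. norm (L i) \<le> K"
proof (rule ccontr)
  assume "\<not> ?thesis"
  then have "\<forall>n. \<exists>i. 4 ^ n < norm (L i)" by (meson not_le)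
  then obtain i where i: "\<And>n. 4 ^ n < norm (L (i n))" by metis
  define T where "T n = L (i n)" for n :: nat
  have "\<forall>n x. \<exists>y. norm (y - x) \<le> (1/3) ^ n \<and> 2 / 3 * (1/3) ^ n * norm (T n) \<le> norm (T n y)"
    by (intro allI blinfun_large_on_ball) simp
  then obtain g where g: "\<And>n x. norm (g n x - x) \<le> (1/3) ^ n"
    "\<And>n x. 2 / 3 * (1/3) ^ n * norm (T n) \<le> norm (T n (g n x))" by metis
  define x where "x = rec_nat 0 g"
  have step: "\<And>n. norm (x (Suc n) - x n) \<le> (1/3) ^ n"
    and big: "\<And>n. 2 / 3 * (1/3) ^ n * norm (T n) \<le> norm (T n (x (Suc n)))"
    using g unfolding x_def by auto
  have dist: "norm (x (n + k) - x n) \<le> 3 / 2 * ((1/3) ^ n - (1/3) ^ (n + k))" for n k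
  proof (induction k)
    case (Suc k)
    have "norm (x (n + Suc k) - x n) \<le> norm (x (Suc (n + k)) - x (n + k)) + norm (x (n + k) - x n)"
      using norm_triangle_ineq[of "x (Suc (n + k)) - x (n + k)" "x (n + k) - x n"] by simp
    also have "\<dots> \<le> (1/3) ^ (n + k) + 3 / 2 * ((1/3) ^ n - (1/3) ^ (n + k))"
      using step Suc by (intro add_mono) auto
    also have "\<dots> = 3 / 2 * ((1/3) ^ n - (1/3) ^ (n + Suc k))" by (simp add: field_simps)
    finally show ?case .
  qed simp
  have dist': "norm (x (n + k) - x n) \<le> 3 / 2 * (1/3) ^ n" for n k
    using dist[of n k] by (smt (verit) zero_le_power divide_nonneg_nonneg mult_left_mono)
  have "Cauchy x"
  proof (rule CauchyI)
    fix e :: real assume "0 < e"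
    then obtain N where N: "3 * (1/3) ^ N < e"
      using real_arch_pow_inv[of "e/3" "1/3"] by (auto simp: field_simps)
    show "\<exists>M. \<forall>m\<ge>M. \<forall>n\<ge>M. norm (x m - x n) < e"
    proof (intro exI allI impI)
      fix m n assume "N \<le> m" "N \<le> n"
      then have "norm (x m - x N) \<le> 3 / 2 * (1/3) ^ N" "norm (x n - x N) \<le> 3 / 2 * (1/3) ^ N"
        using dist'[of N "m - N"] dist'[of N "n - N"] by auto
      then have "norm (x m - x n) \<le> 3 * (1/3) ^ N"
        using norm_triangle_ineq4[of "x m - x N" "x n - x N"] by simp
      then show "norm (x m - x n) < e" using N by simp
    qed
  qed
  then obtain l where l: "x \<longlonglongrightarrow> l" by (metis Cauchy_convergent convergent_def)
  obtain K where K: "\<And>j. norm (L j l) \<le> K" using pw by blast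
  have lower: "1 / 6 * (4/3) ^ n \<le> K" for n
  proof -
    have "norm (l - x (Suc n)) \<le> 3 / 2 * (1/3) ^ Suc n"
    proof (rule Lim_norm_ubound)
      show "(\<lambda>k. x (k + Suc n) - x (Suc n)) \<longlonglongrightarrow> l - x (Suc n)"
        by (intro tendsto_diff LIMSEQ_ignore_initial_segment[OF l] tendsto_const)
      show "\<forall>\<^sub>F k in sequentially. norm (x (k + Suc n) - x (Suc n)) \<le> 3 / 2 * (1/3) ^ Suc n"
        using dist'[of "Suc n"] by (simp add: add.commute)
    qed simp
    then have "norm (T n (x (Suc n) - l)) \<le> norm (T n) * (1 / 2 * (1/3) ^ n)"
      by (intro order_trans[OF norm_blinfun] mult_left_mono) (auto simp: norm_minus_commute)
    moreover have "norm (T n (x (Suc n))) \<le> norm (T n l) + norm (T n (x (Suc n) - l))"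
      using norm_triangle_ineq[of "T n l" "T n (x (Suc n) - l)"] by (simp add: blinfun.diff_right)
    ultimately have "1 / 6 * ((1/3) ^ n * norm (T n)) \<le> norm (T n l)"
      using big[of n] by (simp only: mult.assoc mult.left_commute[of "norm (T n)"] mult.commute[of "norm (T n)"])
    then have "1 / 6 * (1/3) ^ n * norm (T n) \<le> norm (T n l)" by simp
    moreover have "1 / 6 * (1/3) ^ n * 4 ^ n \<le> 1 / 6 * (1/3) ^ n * norm (T n)"
      using i[of n] unfolding T_def by (intro mult_left_mono) auto
    moreover have "(1 / 6 :: real) * (1/3) ^ n * 4 ^ n = 1 / 6 * (4/3) ^ n"
      by (simp add: power_divide)
    ultimately show ?thesis using K[of "i n"] unfolding T_def by linarith
  qed
  obtain n where "6 * K < (4/3) ^ n" using real_arch_pow[of "4/3" "6 * K"] by auto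
  then show False using lower[of n] by simp
qed

lemma bounded_linear_limit:
  fixes L :: "nat \<Rightarrow> 'a::banach \<Rightarrow>\<^sub>L 'b::real_normed_vector"
  assumes lim: "\<And>x. (\<lambda>n. L n x) \<longlonglongrightarrow> f x"
  shows "bounded_linear f"
proof -
  have "\<exists>K. \<forall>n. norm (L n x) \<le> K" for x
    using convergent_imp_bounded[OF lim[of x]] unfolding bounded_iff by auto
  then obtain K where K: "\<And>n. norm (L n) \<le> K" using uniform_boundedness[of L] by blast
  show ?thesis
  proof (rule bounded_linear_intro)
    show "f (x + y) = f x + f y" for x y
      using tendsto_add[OF lim[of x] lim[of y]] lim[of "x + y"]
      by (simp add: blinfun.add_right LIMSEQ_unique)
    show "f (r *\<^sub>R x) = r *\<^sub>R f x" for r x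
      using tendsto_scaleR[OF tendsto_const[of r] lim[of x]] lim[of "r *\<^sub>R x"]
      by (simp add: blinfun.scaleR_right LIMSEQ_unique)
    show "norm (f x) \<le> norm x * K" for x
    proof (rule Lim_norm_ubound[OF _ lim[of x]])
      show "\<forall>\<^sub>F n in sequentially. norm (L n x) \<le> norm x * K"
        using K by (intro always_eventually allI order_trans[OF norm_blinfun])
          (metis mult.commute mult_right_mono norm_ge_zero)
    qed simp
  qed
qed


section \<open>Strongly continuous and analytic semigroups\<close>

lemma right_difference_quotient:
  fixes f :: "real \<Rightarrow> 'a::real_normed_vector"
  assumes "(f has_vector_derivative d) (at a within {a..a + 1})"
  shows "((\<lambda>h. (f (a + h) - f a) /\<^sub>R h) \<longlongrightarrow> d) (at_right 0)"
proof -
  have "at a within {a..a + 1} = at_right a"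
    by (rule at_within_Icc_at_right) simp
  then have "((\<lambda>y. (1 / norm (y - a)) *\<^sub>R (f y - (f a + (y - a) *\<^sub>R d))) \<longlongrightarrow> 0) (at_right a)"
    using assms unfolding has_vector_derivative_def has_derivative_within by simp
  then have "((\<lambda>h. (1 / norm h) *\<^sub>R (f (h + a) - (f a + h *\<^sub>R d))) \<longlongrightarrow> 0) (at_right 0)"
    by (subst (asm) filterlim_at_right_to_0) simp
  moreover have "\<forall>\<^sub>F h in at_right 0. (1 / norm h) *\<^sub>R (f (h + a) - (f a + h *\<^sub>R d)) =
      (f (a + h) - f a) /\<^sub>R h - d"
    using eventually_at_right_less[of 0]
    by eventually_elim (simp add: algebra_simps divide_inverse)
  ultimately have "((\<lambda>h. (f (a + h) - f a) /\<^sub>R h - d) \<longlongrightarrow> 0) (at_right 0)"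
    by (simp cong: tendsto_cong)
  then show ?thesis by (simp add: LIM_zero_iff)
qed

locale semigroup =
  fixes S :: "real \<Rightarrow> 'a::banach \<Rightarrow>\<^sub>L 'a"
  assumes C0: "C0_semigroup S"
begin

lemma S_0 [simp]: "S 0 \<xi> = \<xi>"
  and S_add: "\<lbrakk>0 \<le> s; 0 \<le> t\<rbrakk> \<Longrightarrow> S (s + t) \<xi> = S s (S t \<xi>)"
  and S_tendsto: "((\<lambda>t. S t \<xi>) \<longlongrightarrow> \<xi>) (at_right 0)"
  using C0 unfolding C0_semigroup_def by auto

text \<open>Otherwise the operators along some sequence of times tending to \<open>0\<close> are unbounded in norm,
  although they converge at every point; this contradicts uniform boundedness.\<close>

lemma bounded_near_0: "\<exists>\<delta>>0. \<exists>K\<ge>1. \<forall>t. 0 \<le> t \<and> t \<le> \<delta> \<longrightarrow> norm (S t) \<le> K"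
proof (rule ccontr)
  assume unbounded: "\<not> ?thesis"
  have neg: "\<exists>t. 0 \<le> t \<and> t \<le> \<delta> \<and> K < norm (S t)" if "0 < \<delta>" "1 \<le> K" for \<delta> K
  proof (rule ccontr)
    assume "\<not> ?thesis"
    then have "\<forall>t. 0 \<le> t \<and> t \<le> \<delta> \<longrightarrow> norm (S t) \<le> K" by (simp add: not_less)
    then show False using unbounded that by blast
  qed
  have "\<exists>t. 0 \<le> t \<and> t \<le> 1 / real (Suc n) \<and> real (Suc n) < norm (S t)" for n
    by (rule neg) auto
  then obtain t where t: "\<And>n. 0 \<le> t n" "\<And>n. t n \<le> 1 / real (Suc n)"
    "\<And>n. real (Suc n) < norm (S (t n))" by metis
  have pos: "0 < t n" if "1 \<le> n" for n
  proof (rule ccontr)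
    assume "\<not> 0 < t n"
    then have "t n = 0" using t(1)[of n] by simp
    then have "S (t n) = id_blinfun" by (intro blinfun_eqI) simp
    then have "norm (S (t n)) \<le> 1" by (simp add: norm_blinfun_id_le)
    then show False using t(3)[of n] by simp
  qed
  have "t \<longlonglongrightarrow> 0"
  proof (rule tendsto_sandwich[OF _ _ tendsto_const])
    show "(\<lambda>n. 1 / real (Suc n)) \<longlonglongrightarrow> 0"
      using LIMSEQ_inverse_real_of_nat by (simp add: divide_inverse)
  qed (use t in auto)
  moreover have "\<forall>\<^sub>F n in sequentially. t n \<in> {0<..} \<and> t n \<noteq> 0"
    unfolding eventually_sequentially
  proof (intro exI[of _ 1] allI impI)
    show "t n \<in> {0<..} \<and> t n \<noteq> 0" if "1 \<le> n" for n using pos[OF that] by simp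
  qed
  ultimately have "filterlim t (at_right 0) sequentially"
    unfolding filterlim_at by simp
  from filterlim_compose[OF S_tendsto this]
  have "(\<lambda>n. S (t n) \<xi>) \<longlonglongrightarrow> \<xi>" for \<xi> .
  from convergent_imp_bounded[OF this]
  have "\<exists>K. \<forall>n. norm (S (t n) \<xi>) \<le> K" for \<xi>
    unfolding bounded_iff by simp
  from uniform_boundedness[of "\<lambda>n. S (t n)", OF this]
  obtain K where K: "\<And>n. norm (S (t n)) \<le> K" by blast
  obtain n where "K < real n" using reals_Archimedean2 by blast
  then show False using K[of n] t(3)[of n] by simp
qed

lemma bounded_on_interval: "\<exists>K\<ge>1. \<forall>t. 0 \<le> t \<and> t \<le> b \<longrightarrow> norm (S t) \<le> K"
proof -
  obtain \<delta> K where \<delta>: "0 < \<delta>" and K: "1 \<le> K" "\<And>t. 0 \<le> t \<Longrightarrow> t \<le> \<delta> \<Longrightarrow> norm (S t) \<le> K"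
    using bounded_near_0 by blast
  have *: "norm (S t) \<le> K ^ Suc k" if "0 \<le> t" "t \<le> real (Suc k) * \<delta>" for k t
    using that
  proof (induction k arbitrary: t)
    case 0
    then show ?case using K(2)[of t] by simp
  next
    case (Suc k)
    show ?case
    proof (cases "t \<le> \<delta>")
      case True
      then have "norm (S t) \<le> K" by (intro K(2) Suc.prems(1))
      also have "K \<le> K ^ Suc (Suc k)" using K by (intro self_le_power) auto
      finally show ?thesis .
    next
      case False
      have "S t = S (t - \<delta>) o\<^sub>L S \<delta>"
        using S_add[of "t - \<delta>" \<delta>] False \<delta> by (intro blinfun_eqI) simp
      from arg_cong[OF this, of norm] have "norm (S t) \<le> norm (S (t - \<delta>)) * norm (S \<delta>)"
        by (rule ord_eq_le_trans) (rule norm_blinfun_compose)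
      also have "\<dots> \<le> K ^ Suc k * K"
      proof (rule mult_mono)
        show "norm (S (t - \<delta>)) \<le> K ^ Suc k"
          using False Suc.prems by (intro Suc.IH) (auto simp: algebra_simps)
      qed (use K \<delta> in auto)
      finally show ?thesis by (simp add: mult.commute)
    qed
  qed
  obtain k where "b / \<delta> < real k" using reals_Archimedean2 by blast
  then have "b \<le> real (Suc k) * \<delta>" using \<delta> by (simp add: field_simps)
  then have "norm (S t) \<le> K ^ Suc k" if "0 \<le> t" "t \<le> b" for t
    using *[OF that(1), of k] that(2) by linarith
  then have "\<forall>t. 0 \<le> t \<and> t \<le> b \<longrightarrow> norm (S t) \<le> K ^ Suc k" by simp
  with one_le_power[OF K(1), of "Suc k"] show ?thesis by (intro exI[of _ "K ^ Suc k"] conjI)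
qed

lemma continuous_orbit: "continuous_on {0..} (\<lambda>t. S t \<xi>)"
  unfolding continuous_on_iff
proof (intro ballI allI impI)
  fix t0 e :: real assume t0: "t0 \<in> {0..}" and e: "0 < e"
  obtain K where K: "1 \<le> K" "\<And>t. 0 \<le> t \<Longrightarrow> t \<le> t0 + 1 \<Longrightarrow> norm (S t) \<le> K"
    using bounded_on_interval by blast
  obtain \<delta> where \<delta>: "0 < \<delta>" "\<And>h. 0 < h \<Longrightarrow> h < \<delta> \<Longrightarrow> dist (S h \<xi>) \<xi> < e / K"
    using tendstoD[OF S_tendsto[of \<xi>], of "e / K"] e K
    unfolding eventually_at_right_field by auto
  have close: "dist (S s \<xi>) (S t \<xi>) < e" if "0 \<le> s" "s < t" "t - s < \<delta>" "s \<le> t0 + 1" for s t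
  proof -
    have "S t \<xi> = S s (S (t - s) \<xi>)" using S_add[of s "t - s"] that by simp
    then have "dist (S s \<xi>) (S t \<xi>) = norm (S s (\<xi> - S (t - s) \<xi>))"
      by (simp add: dist_norm blinfun.diff_right)
    also have "\<dots> \<le> norm (S s) * norm (\<xi> - S (t - s) \<xi>)" by (rule norm_blinfun)
    also have "\<dots> \<le> K * norm (\<xi> - S (t - s) \<xi>)" using K that by (intro mult_right_mono) auto
    also have "\<dots> < e"
      using \<delta>(2)[of "t - s"] that K
      by (simp add: dist_norm norm_minus_commute pos_less_divide_eq mult.commute)
    finally show ?thesis .
  qed
  show "\<exists>d>0. \<forall>t\<in>{0..}. dist t t0 < d \<longrightarrow> dist (S t \<xi>) (S t0 \<xi>) < e"
  proof (intro exI[of _ "min \<delta> 1"] conjI ballI impI)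
    fix t assume t: "t \<in> {0..}" "dist t t0 < min \<delta> 1"
    consider "t < t0" | "t = t0" | "t0 < t" by linarith
    then show "dist (S t \<xi>) (S t0 \<xi>) < e"
    proof cases
      case 1
      then show ?thesis using close[of t t0] t by (auto simp: dist_real_def)
    next
      case 2
      then show ?thesis using e by simp
    next
      case 3
      then show ?thesis using close[of t0 t] t t0 by (auto simp: dist_real_def dist_commute)
    qed
  qed (use \<delta> in auto)
qed

lemma gen_tendsto: "\<xi> \<in> gen_dom S \<Longrightarrow> ((\<lambda>h. (S h \<xi> - \<xi>) /\<^sub>R h) \<longlongrightarrow> gen S \<xi>) (at_right 0)"
proof -
  assume "\<xi> \<in> gen_dom S"
  then obtain l where l: "((\<lambda>h. (S h \<xi> - \<xi>) /\<^sub>R h) \<longlongrightarrow> l) (at_right 0)"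
    unfolding gen_dom_def by blast
  have "gen S \<xi> = l"
    unfolding gen_def by (rule tendsto_Lim[OF trivial_limit_at_right_real l])
  with l show ?thesis by simp
qed

lemma genI:
  assumes "((\<lambda>h. (S h \<xi> - \<xi>) /\<^sub>R h) \<longlongrightarrow> l) (at_right 0)"
  shows "\<xi> \<in> gen_dom S" "gen S \<xi> = l"
proof -
  show "\<xi> \<in> gen_dom S" unfolding gen_dom_def using assms by blast
  show "gen S \<xi> = l" unfolding gen_def by (rule tendsto_Lim[OF trivial_limit_at_right_real assms])
qed

lemma gen_add: "\<lbrakk>\<xi> \<in> gen_dom S; \<zeta> \<in> gen_dom S\<rbrakk> \<Longrightarrow>
    \<xi> + \<zeta> \<in> gen_dom S \<and> gen S (\<xi> + \<zeta>) = gen S \<xi> + gen S \<zeta>"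
proof -
  assume "\<xi> \<in> gen_dom S" "\<zeta> \<in> gen_dom S"
  from tendsto_add[OF this[THEN gen_tendsto]]
  have "((\<lambda>h. (S h (\<xi> + \<zeta>) - (\<xi> + \<zeta>)) /\<^sub>R h) \<longlongrightarrow> gen S \<xi> + gen S \<zeta>) (at_right 0)"
    by (simp add: blinfun.add_right algebra_simps)
  then show ?thesis by (blast intro: genI)
qed

lemma gen_scaleR: "\<xi> \<in> gen_dom S \<Longrightarrow> r *\<^sub>R \<xi> \<in> gen_dom S \<and> gen S (r *\<^sub>R \<xi>) = r *\<^sub>R gen S \<xi>"
proof -
  assume "\<xi> \<in> gen_dom S"
  from tendsto_scaleR[OF tendsto_const[of r] gen_tendsto[OF this]]
  have "((\<lambda>h. (S h (r *\<^sub>R \<xi>) - r *\<^sub>R \<xi>) /\<^sub>R h) \<longlongrightarrow> r *\<^sub>R gen S \<xi>) (at_right 0)"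
    by (simp add: blinfun.scaleR_right algebra_simps)
  then show ?thesis by (blast intro: genI)
qed

lemma gen_diff: "\<lbrakk>\<xi> \<in> gen_dom S; \<zeta> \<in> gen_dom S\<rbrakk> \<Longrightarrow>
    \<xi> - \<zeta> \<in> gen_dom S \<and> gen S (\<xi> - \<zeta>) = gen S \<xi> - gen S \<zeta>"
  using gen_add[of \<xi> "(-1) *\<^sub>R \<zeta>"] gen_scaleR[of \<zeta> "-1"] by simp

lemma S_commute: "\<lbrakk>0 \<le> s; 0 \<le> t\<rbrakk> \<Longrightarrow> S s (S t \<xi>) = S t (S s \<xi>)"
  using S_add[of s t] S_add[of t s] by (simp add: add.commute)

lemma gen_S_commute:
  assumes "0 \<le> t" "\<xi> \<in> gen_dom S"
  shows "S t \<xi> \<in> gen_dom S" "gen S (S t \<xi>) = S t (gen S \<xi>)"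
proof -
  have "((\<lambda>h. S t ((S h \<xi> - \<xi>) /\<^sub>R h)) \<longlongrightarrow> S t (gen S \<xi>)) (at_right 0)"
    by (intro blinfun.tendsto tendsto_const gen_tendsto assms)
  moreover have "\<forall>\<^sub>F h in at_right 0. S t ((S h \<xi> - \<xi>) /\<^sub>R h) = (S h (S t \<xi>) - S t \<xi>) /\<^sub>R h"
    using eventually_at_right_less[of 0]
    by eventually_elim (simp add: blinfun.scaleR_right blinfun.diff_right S_commute assms)
  ultimately have "((\<lambda>h. (S h (S t \<xi>) - S t \<xi>) /\<^sub>R h) \<longlongrightarrow> S t (gen S \<xi>)) (at_right 0)"
    by (simp cong: tendsto_cong)
  then show "S t \<xi> \<in> gen_dom S" "gen S (S t \<xi>) = S t (gen S \<xi>)"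
    by (rule genI)+
qed

lemma integrable_orbit: "0 \<le> a \<Longrightarrow> (\<lambda>s. S s \<xi>) integrable_on {a..b}"
  by (rule integrable_continuous_real, rule continuous_on_subset[OF continuous_orbit]) auto

lemma gen_integral:
  assumes "0 \<le> t"
  shows "integral {0..t} (\<lambda>s. S s \<xi>) \<in> gen_dom S"
    "gen S (integral {0..t} (\<lambda>s. S s \<xi>)) = S t \<xi> - \<xi>"
proof -
  define I where "I t = integral {0..t} (\<lambda>s. S s \<xi>)" for t
  have right_deriv: "((\<lambda>h. (I (a + h) - I a) /\<^sub>R h) \<longlongrightarrow> S a \<xi>) (at_right 0)" if "0 \<le> a" for a
  proof -
    have "(I has_vector_derivative S a \<xi>) (at a within {0..a + 1})"
      unfolding I_def
      by (rule integral_has_vector_derivative[OF continuous_on_subset[OF continuous_orbit]])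
         (use that in auto)
    then have "(I has_vector_derivative S a \<xi>) (at a within {a..a + 1})"
      by (rule has_vector_derivative_within_subset) (use that in auto)
    then show ?thesis by (rule right_difference_quotient)
  qed
  have shift: "S h (I t) = I (t + h) - I h" if "0 \<le> h" for h
  proof -
    have "S h (I t) = integral {0..t} (\<lambda>s. S h (S s \<xi>))"
      unfolding I_def using integral_linear[OF integrable_orbit[of 0 \<xi> t] blinfun.bounded_linear_right[of "S h"]]
      by (simp add: o_def)
    also have "\<dots> = integral {0..t} (\<lambda>s. S (s + h) \<xi>)"
      using that by (intro integral_cong) (simp add: S_add S_commute)
    also have "\<dots> = integral {h..t + h} (\<lambda>s. S s \<xi>)"
      using has_integral_affinity'[OF integrable_integral[OF integrable_orbit[OF that, where \<xi> = \<xi> and b = "t + h"],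
          unfolded cbox_interval[symmetric]], of 1 h] by (simp add: integral_unique)
    also have "\<dots> = I (t + h) - I h"
      unfolding I_def using Henstock_Kurzweil_Integration.integral_combine[where a = 0 and c = h and b = "t + h" and f = "\<lambda>s. S s \<xi>"]
        integrable_orbit[where a = 0 and b = "t + h" and \<xi> = \<xi>] that assms
      by (simp add: algebra_simps)
    finally show ?thesis .
  qed
  have "I 0 = 0" by (simp add: I_def)
  have "((\<lambda>h. (I (t + h) - I t) /\<^sub>R h - (I (0 + h) - I 0) /\<^sub>R h) \<longlongrightarrow> S t \<xi> - S 0 \<xi>) (at_right 0)"
    by (intro tendsto_diff right_deriv assms order_refl)
  moreover have "\<forall>\<^sub>F h in at_right 0. (I (t + h) - I t) /\<^sub>R h - (I (0 + h) - I 0) /\<^sub>R h = (S h (I t) - I t) /\<^sub>R h"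
    using eventually_at_right_less[of 0]
    by eventually_elim (simp add: shift \<open>I 0 = 0\<close> flip: scaleR_diff_right)
  ultimately have "((\<lambda>h. (S h (I t) - I t) /\<^sub>R h) \<longlongrightarrow> S t \<xi> - S 0 \<xi>) (at_right 0)"
    by (rule Lim_transform_eventually)
  then have "((\<lambda>h. (S h (I t) - I t) /\<^sub>R h) \<longlongrightarrow> S t \<xi> - \<xi>) (at_right 0)"
    by simp
  then show "integral {0..t} (\<lambda>s. S s \<xi>) \<in> gen_dom S"
    "gen S (integral {0..t} (\<lambda>s. S s \<xi>)) = S t \<xi> - \<xi>"
    unfolding I_def by (rule genI)+
qed

end

locale analytic_sg =
  fixes S :: "real \<Rightarrow> 'a::banach \<Rightarrow>\<^sub>L 'a"
  assumes analytic: "analytic_semigroup S"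

sublocale analytic_sg \<subseteq> semigroup
  using analytic by unfold_locales (simp add: analytic_semigroup_def)

context analytic_sg
begin

lemma orbit_differentiable:
  assumes "0 < t"
  shows "\<exists>d. ((\<lambda>s. S s \<xi>) has_vector_derivative d) (at t)"
proof -
  obtain \<theta> E where \<theta>: "0 < \<theta>" and E: "holomorphic_extension S \<theta> E"
    using analytic unfolding analytic_semigroup_def by blast
  have "complex_of_real t \<in> sector \<theta>"
    using assms \<theta> unfolding sector_def by simp
  then obtain d where d: "((\<lambda>z. E z (\<xi>, 0)) has_derivative (\<lambda>h. cscale h d)) (at (complex_of_real t))"
    using E unfolding holomorphic_extension_def by blast
  have "((\<lambda>s. complex_of_real s) has_derivative complex_of_real) (at t)"
    by (rule bounded_linear_imp_has_derivative) (rule bounded_linear_of_real)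
  from has_derivative_compose[OF this d]
  have "((\<lambda>s. E (complex_of_real s) (\<xi>, 0)) has_derivative (\<lambda>h. cscale (complex_of_real h) d)) (at t)"
    by simp
  then have "((\<lambda>s. fst (E (complex_of_real s) (\<xi>, 0))) has_derivative
      (\<lambda>h. fst (cscale (complex_of_real h) d))) (at t)"
    by (rule has_derivative_fst)
  then have "((\<lambda>s. fst (E (complex_of_real s) (\<xi>, 0))) has_vector_derivative fst d) (at t)"
    by (simp add: has_vector_derivative_def cscale_def)
  moreover have "\<forall>\<^sub>F s in nhds t. fst (E (complex_of_real s) (\<xi>, 0)) = S s \<xi>"
    using E assms unfolding eventually_nhds holomorphic_extension_def
    by (intro exI[of _ "{0<..}"]) auto
  ultimately have "((\<lambda>s. S s \<xi>) has_vector_derivative fst d) (at t)"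
    using has_vector_derivative_transform_within_open[of
        "\<lambda>s. fst (E (complex_of_real s) (\<xi>, 0))" "fst d" t "{0<..}" "\<lambda>s. S s \<xi>"]
      E assms unfolding holomorphic_extension_def by auto
  then show ?thesis ..
qed

text \<open>The difference quotients at \<open>0\<close> of the orbit of \<open>S t \<xi>\<close> are difference quotients of the
  orbit of \<open>\<xi>\<close> at the time \<open>t\<close>, where the holomorphic extension is differentiable.\<close>

lemma smoothing:
  assumes "0 < t"
  shows S_in_dom: "S t \<xi> \<in> gen_dom S"
    and orbit_deriv: "((\<lambda>s. S s \<xi>) has_vector_derivative gen S (S t \<xi>)) (at t)"
proof -
  obtain d where d: "((\<lambda>s. S s \<xi>) has_vector_derivative d) (at t)"
    using orbit_differentiable[OF assms] by blast
  have "((\<lambda>h. (S (t + h) \<xi> - S t \<xi>) /\<^sub>R h) \<longlongrightarrow> d) (at_right 0)"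
    by (rule right_difference_quotient[OF has_vector_derivative_at_within[OF d]])
  moreover have "\<forall>\<^sub>F h in at_right 0. (S (t + h) \<xi> - S t \<xi>) /\<^sub>R h = (S h (S t \<xi>) - S t \<xi>) /\<^sub>R h"
    using eventually_at_right_less[of 0]
    by eventually_elim (use assms in \<open>metis S_add add.commute less_imp_le\<close>)
  ultimately have "((\<lambda>h. (S h (S t \<xi>) - S t \<xi>) /\<^sub>R h) \<longlongrightarrow> d) (at_right 0)"
    by (simp cong: tendsto_cong)
  then have *: "S t \<xi> \<in> gen_dom S" "gen S (S t \<xi>) = d"
    by (rule genI)+
  show "S t \<xi> \<in> gen_dom S" by (rule *)
  show "((\<lambda>s. S s \<xi>) has_vector_derivative gen S (S t \<xi>)) (at t)"
    unfolding *(2) by (rule d)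
qed

text \<open>A pointwise limit of bounded operators, the difference quotients, is bounded.\<close>

lemma bounded_linear_gen_S:
  assumes "0 < t"
  shows "bounded_linear (\<lambda>\<xi>. gen S (S t \<xi>))"
proof (rule bounded_linear_limit)
  fix \<xi>
  have "((\<lambda>h. (S h (S t \<xi>) - S t \<xi>) /\<^sub>R h) \<longlongrightarrow> gen S (S t \<xi>)) (at_right 0)"
    by (rule gen_tendsto[OF S_in_dom[OF assms]])
  moreover have "filterlim (\<lambda>n. 1 / real (Suc n)) (at_right 0) sequentially"
    unfolding filterlim_at using LIMSEQ_inverse_real_of_nat by (auto simp: divide_inverse)
  ultimately have "(\<lambda>n. (S (1 / real (Suc n)) (S t \<xi>) - S t \<xi>) /\<^sub>R (1 / real (Suc n)))
      \<longlonglongrightarrow> gen S (S t \<xi>)"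
    by (rule filterlim_compose)
  then show "(\<lambda>n. blinfun_apply (real (Suc n) *\<^sub>R ((S (1 / real (Suc n)) o\<^sub>L S t) - S t)) \<xi>)
      \<longlonglongrightarrow> gen S (S t \<xi>)"
    by (simp add: blinfun.diff_left blinfun.scaleR_left del: of_nat_Suc)
qed

lemma smoothing2:
  assumes "0 < t"
  shows gen_S_in_dom: "gen S (S t \<xi>) \<in> gen_dom S"
    and gen_orbit_deriv: "((\<lambda>s. gen S (S s \<xi>)) has_vector_derivative gen S (gen S (S t \<xi>))) (at t)"
    and bounded_linear_gen2_S: "bounded_linear (\<lambda>\<xi>. gen S (gen S (S t \<xi>)))"
proof -
  have split: "gen S (S s \<zeta>) = S (s - t / 2) (gen S (S (t / 2) \<zeta>))" if "t / 2 \<le> s" for s \<zeta>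
    using gen_S_commute(2)[of "s - t / 2" "S (t / 2) \<zeta>"] S_in_dom[of "t / 2"]
      S_add[of "s - t / 2" "t / 2" \<zeta>] that assms by simp
  have split_t: "gen S (S t \<zeta>) = S (t / 2) (gen S (S (t / 2) \<zeta>))" for \<zeta>
    using split[of t] assms by simp
  show "gen S (S t \<xi>) \<in> gen_dom S"
    unfolding split_t using S_in_dom assms by simp
  have "((\<lambda>s. S s (gen S (S (t / 2) \<xi>))) \<circ> (\<lambda>s. s - t / 2) has_vector_derivative
      1 *\<^sub>R gen S (S (t / 2) (gen S (S (t / 2) \<xi>)))) (at t)"
    using orbit_deriv[of "t / 2" "gen S (S (t / 2) \<xi>)"] assms
    by (intro vector_diff_chain_at) (auto intro!: derivative_eq_intros)
  then have "((\<lambda>s. S (s - t / 2) (gen S (S (t / 2) \<xi>))) has_vector_derivative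
      gen S (gen S (S t \<xi>))) (at t)"
    by (simp add: o_def split_t)
  then show "((\<lambda>s. gen S (S s \<xi>)) has_vector_derivative gen S (gen S (S t \<xi>))) (at t)"
  proof (rule has_vector_derivative_transform_within_open[of _ _ _ "{t / 2<..}"])
    show "S (s - t / 2) (gen S (S (t / 2) \<xi>)) = gen S (S s \<xi>)" if "s \<in> {t / 2<..}" for s
      using split[of s \<xi>] that by simp
  qed (use assms in auto)
  show "bounded_linear (\<lambda>\<xi>. gen S (gen S (S t \<xi>)))"
    unfolding split_t
    using bounded_linear_compose[OF bounded_linear_gen_S bounded_linear_gen_S, of "t/2" "t/2"] assms
    by simp
qed

end

section \<open>Negative fractional powers of a non-negative operator\<close>

definition wt :: "real \<Rightarrow> real \<Rightarrow> real" where
  "wt a t = (if 0 < t then t powr (- a) else 0)"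

lemma wt_nonneg [simp]: "0 \<le> wt a t"
  by (simp add: wt_def)

lemma borel_measurable_wt [measurable]: "wt a \<in> borel_measurable borel"
proof -
  have "wt a = (\<lambda>t. if 0 < t then t powr (- a) else 0)" by (simp add: wt_def fun_eq_iff)
  then show ?thesis by simp
qed

text \<open>The substitution \<open>t = u / (1 - u)\<close> turns the kernel into the Beta integral
  \<open>B(1 - a, a)\<close>, which the reflection formula evaluates.\<close>

lemma beta_kernel:
  assumes a: "0 < a" "a < 1"
  shows "has_bochner_integral lborel (\<lambda>t. wt a t / (1 + t)) (pi / sin (pi * a))"
proof -
  define f where "f t = t powr (- a) / (1 + t)" for t :: real
  define g where "g u = u / (1 - u)" for u :: real
  have g': "(g has_field_derivative (1 / (1 - u)\<^sup>2)) (at u within {0<..<1})" if "u \<in> {0<..<1}" for u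
    unfolding g_def using that
    by (auto intro!: derivative_eq_intros simp: field_simps power2_eq_square)
  have inj: "inj_on g {0<..<1}"
    unfolding g_def by (auto simp: inj_on_def field_simps)
  have img: "g ` {0<..<1} = {0<..}"
  proof (intro equalityI subsetI)
    fix t :: real assume "t \<in> {0<..}"
    then show "t \<in> g ` {0<..<1}"
      by (intro image_eqI[of _ _ "t / (1 + t)"]) (auto simp: g_def field_simps)
  qed (auto simp: g_def)
  have transformed: "\<bar>1 / (1 - u)\<^sup>2\<bar> * f (g u) = u powr ((1 - a) - 1) * (1 - u) powr (a - 1)"
    if "u \<in> {0<..<1}" for u
  proof -
    have "f (g u) = u powr (- a) * (1 - u) powr a * (1 - u)"
      using that unfolding f_def g_def
      by (simp add: powr_divide powr_minus field_simps)
    moreover have "(1 - u) powr (a - 1) = (1 - u) powr a / (1 - u)"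
      using that by (simp add: powr_diff)
    ultimately show ?thesis using that by (simp add: power2_eq_square)
  qed
  have Beta: "Beta (1 - a) a = pi / sin (pi * a)"
  proof -
    have "complex_of_real (Gamma a * Gamma (1 - a)) = complex_of_real (pi / sin (pi * a))"
      using Gamma_reflection_complex[of "of_real a"] Gamma_complex_of_real[of "1 - a"]
      by (simp add: Gamma_complex_of_real flip: sin_of_real)
    then have "Gamma a * Gamma (1 - a) = pi / sin (pi * a)" using of_real_eq_iff by blast
    then show ?thesis by (simp add: Beta_def mult.commute)
  qed
  have "((\<lambda>u. u powr ((1 - a) - 1) * (1 - u) powr (a - 1)) has_integral Beta (1 - a) a) {0<..<1}"
    using has_integral_Beta_real[of "1 - a" a] a by (simp add: has_integral_Icc_iff_Ioo)
  then have "((\<lambda>u. \<bar>1 / (1 - u)\<^sup>2\<bar> * f (g u)) has_integral Beta (1 - a) a) {0<..<1}"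
    using transformed by (subst has_integral_cong) auto
  moreover from this have "(\<lambda>u. \<bar>1 / (1 - u)\<^sup>2\<bar> * f (g u)) absolutely_integrable_on {0<..<1}"
    by (intro nonnegative_absolutely_integrable_1) (auto simp: f_def g_def has_integral_iff)
  ultimately have *: "f absolutely_integrable_on {0<..}" "integral {0<..} f = Beta (1 - a) a"
    using has_absolute_integral_change_of_variables_1'[OF _ g' inj, of f "Beta (1 - a) a"]
    by (auto simp: img has_integral_iff)
  have eq: "indicator {0<..} t *\<^sub>R f t = wt a t / (1 + t)" for t
    by (simp add: wt_def f_def indicator_def)
  have meas: "(\<lambda>t. wt a t / (1 + t)) \<in> lborel \<rightarrow>\<^sub>M borel" by simp
  have "integrable lebesgue (\<lambda>t. wt a t / (1 + t))"
    using *(1) unfolding set_integrable_def eq .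
  moreover have "integral\<^sup>L lebesgue (\<lambda>t. wt a t / (1 + t)) = Beta (1 - a) a"
    using set_lebesgue_integral_eq_integral(2)[OF *(1)] *(2)
    unfolding set_lebesgue_integral_def eq by simp
  ultimately show ?thesis
    using integrable_completion[OF meas] integral_completion[OF meas] Beta
    by (simp add: has_bochner_integral_iff)
qed

text \<open>The operators \<open>R t\<close> play the role of \<open>(t + B)\<^sup>-\<^sup>1\<close>. The powers of \<open>B\<close> with negative exponents are
  constructed from the resolvents alone, so that scalars can serve as a second instance.\<close>

locale resolvent_family =
  fixes R :: "real \<Rightarrow> 'a::{banach, second_countable_topology} \<Rightarrow>\<^sub>L 'a" and K :: real
  assumes resolvent_eq: "\<lbrakk>0 \<le> s; 0 \<le> t\<rbrakk> \<Longrightarrow> R s \<xi> - R t \<xi> = (t - s) *\<^sub>R R s (R t \<xi>)"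
    and norm_R: "0 \<le> t \<Longrightarrow> norm (R t) \<le> K / (1 + t)"
    and inj_R0: "R 0 \<xi> = 0 \<Longrightarrow> \<xi> = 0"
begin

definition L :: "real \<Rightarrow> 'a \<Rightarrow> 'a" where
  "L a \<xi> = (LINT t|lborel. wt a t *\<^sub>R R t \<xi>)"

text \<open>Balakrishnan's formula for the power with exponent \<open>- a\<close>.\<close>

definition J :: "real \<Rightarrow> 'a \<Rightarrow> 'a" where
  "J a \<xi> = (sin (pi * a) / pi) *\<^sub>R L a \<xi>"

lemma K_nonneg: "0 \<le> K"
  using order_trans[OF norm_ge_zero norm_R[of 0]] by simp

lemma norm_R_apply: "0 \<le> t \<Longrightarrow> norm (R t \<xi>) \<le> K / (1 + t) * norm \<xi>"
  by (rule order_trans[OF norm_blinfun mult_right_mono[OF norm_R]]) auto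

lemma R_commute: "\<lbrakk>0 \<le> s; 0 \<le> t\<rbrakk> \<Longrightarrow> R s (R t \<xi>) = R t (R s \<xi>)"
proof (cases "s = t")
  case False
  assume "0 \<le> s" "0 \<le> t"
  then have "(t - s) *\<^sub>R R s (R t \<xi>) = - ((s - t) *\<^sub>R R t (R s \<xi>))"
    using resolvent_eq[of s t \<xi>, symmetric] resolvent_eq[of t s \<xi>, symmetric] by simp
  then show ?thesis using False by (simp flip: scaleR_minus_left)
qed simp

lemma R_eq_R0: "0 \<le> s \<Longrightarrow> R s \<xi> = R 0 \<xi> - s *\<^sub>R R 0 (R s \<xi>)"
proof -
  assume "0 \<le> s"
  then have "R 0 \<xi> - R s \<xi> = (s - 0) *\<^sub>R R 0 (R s \<xi>)" by (intro resolvent_eq) auto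
  moreover have "y - x = (s - 0) *\<^sub>R z \<Longrightarrow> x = y - s *\<^sub>R z" for x y z :: 'a
    by (simp add: algebra_simps)
  ultimately show ?thesis by blast
qed

lemma continuous_R: "continuous_on {0..} R"
  unfolding continuous_on_iff
proof (intro ballI allI impI)
  fix s e :: real assume s: "s \<in> {0..}" and e: "0 < e"
  have bd: "norm (R t) \<le> K" if "0 \<le> t" for t
    using norm_R[OF that] that K_nonneg
    by (intro order_trans[OF norm_R[OF that]]) (auto simp: field_simps)
  show "\<exists>d>0. \<forall>t\<in>{0..}. dist t s < d \<longrightarrow> dist (R t) (R s) < e"
  proof (intro exI[of _ "e / (K * K + 1)"] conjI ballI impI)
    show "0 < e / (K * K + 1)" using e by (simp add: add_nonneg_pos)
    fix t assume t: "t \<in> {0..}" "dist t s < e / (K * K + 1)"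
    have "R t - R s = (s - t) *\<^sub>R (R t o\<^sub>L R s)"
      using resolvent_eq[of t s] s t
      by (intro blinfun_eqI) (auto simp: blinfun.diff_left blinfun.scaleR_left)
    then have "norm (R t - R s) = \<bar>s - t\<bar> * norm (R t o\<^sub>L R s)" by simp
    also have "\<dots> \<le> \<bar>s - t\<bar> * (K * K)"
      using bd[of t] bd[of s] s t K_nonneg
      by (intro mult_left_mono order_trans[OF norm_blinfun_compose] mult_mono) auto
    also have "\<dots> \<le> \<bar>s - t\<bar> * (K * K + 1)" by (intro mult_left_mono) auto
    also have "\<dots> < e"
      using t(2) by (simp add: dist_real_def pos_less_divide_eq add_nonneg_pos abs_minus_commute)
    finally show "dist (R t) (R s) < e" by (simp add: dist_norm)
  qed
qed

lemma measurable_weighted [measurable]: "(\<lambda>t. wt a t *\<^sub>R R t \<xi>) \<in> borel_measurable borel"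
proof -
  have "continuous_on {0<..} (\<lambda>t. t powr (- a) *\<^sub>R R t \<xi>)"
    by (intro continuous_intros continuous_on_subset[OF continuous_R]) auto
  then have "(\<lambda>t. indicator {0<..} t *\<^sub>R (t powr (- a) *\<^sub>R R t \<xi>)) \<in> borel_measurable borel"
    by (intro borel_measurable_continuous_on_indicator) auto
  also have "(\<lambda>t. indicator {0<..} t *\<^sub>R (t powr (- a) *\<^sub>R R t \<xi>)) = (\<lambda>t. wt a t *\<^sub>R R t \<xi>)"
    by (auto simp: wt_def fun_eq_iff)
  finally show ?thesis .
qed

lemma norm_weighted: "norm (wt a t *\<^sub>R R t \<xi>) \<le> K * norm \<xi> * (wt a t / (1 + t))"
proof (cases "0 < t")
  case True
  then show ?thesis using mult_left_mono[OF norm_R_apply[of t \<xi>] wt_nonneg[of a t]]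
    by (simp add: field_simps)
qed (simp add: wt_def)

context
  fixes a :: real
  assumes a: "0 < a" "a < 1"
begin

lemma sin_pos: "0 < sin (pi * a)"
  using a by (intro sin_gt_zero) auto

lemma kernel_integrable: "integrable lborel (\<lambda>t. wt a t / (1 + t))"
  and kernel_integral: "(LINT t|lborel. wt a t / (1 + t)) = pi / sin (pi * a)"
  using beta_kernel[OF a] by (auto simp: has_bochner_integral_iff)

lemma weighted_integrable: "integrable lborel (\<lambda>t. wt a t *\<^sub>R R t \<xi>)"
proof (rule Bochner_Integration.integrable_bound)
  show "integrable lborel (\<lambda>t. K * norm \<xi> * (wt a t / (1 + t)))"
    by (intro integrable_mult_right kernel_integrable)
  show "AE t in lborel. norm (wt a t *\<^sub>R R t \<xi>) \<le> norm (K * norm \<xi> * (wt a t / (1 + t)))"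
    using norm_weighted by (intro AE_I2) (smt (verit) real_norm_def)
qed simp

lemma norm_L: "norm (L a \<xi>) \<le> norm \<xi> * (K * (pi / sin (pi * a)))"
proof -
  have "norm (L a \<xi>) \<le> (LINT t|lborel. K * norm \<xi> * (wt a t / (1 + t)))"
    unfolding L_def
    by (intro Bochner_Integration.integral_norm_bound_integral weighted_integrable norm_weighted
        integrable_mult_right kernel_integrable)
  also have "\<dots> = K * norm \<xi> * (pi / sin (pi * a))"
    by (simp only: Bochner_Integration.integral_mult_right_zero kernel_integral)
  also have "\<dots> = norm \<xi> * (K * (pi / sin (pi * a)))" by simp
  finally show ?thesis .
qed

lemma bounded_linear_L: "bounded_linear (L a)"
proof (rule bounded_linear_intro[OF _ _ norm_L])
  show "L a (\<xi> + \<zeta>) = L a \<xi> + L a \<zeta>" for \<xi> \<zeta>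
    unfolding L_def using weighted_integrable by (simp add: blinfun.add_right scaleR_add_right)
  show "L a (r *\<^sub>R \<xi>) = r *\<^sub>R L a \<xi>" for r \<xi>
  proof -
    have "(\<lambda>t. wt a t *\<^sub>R R t (r *\<^sub>R \<xi>)) = (\<lambda>t. r *\<^sub>R (wt a t *\<^sub>R R t \<xi>))"
      by (simp add: blinfun.scaleR_right mult.commute)
    then show ?thesis unfolding L_def by (simp only: integral_scaleR_right weighted_integrable)
  qed
qed

lemma bounded_linear_J: "bounded_linear (J a)"
  unfolding J_def by (intro bounded_linear_intros bounded_linear_L)

lemma L_commute:
  assumes T: "bounded_linear T" and c: "\<And>t. 0 \<le> t \<Longrightarrow> T (R t \<xi>) = R t (T \<xi>)"
  shows "T (L a \<xi>) = L a (T \<xi>)"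
proof -
  interpret T: bounded_linear T by fact
  have "T (L a \<xi>) = (LINT t|lborel. T (wt a t *\<^sub>R R t \<xi>))"
    unfolding L_def by (rule integral_bounded_linear[OF T weighted_integrable, symmetric])
  also have "\<dots> = (LINT t|lborel. wt a t *\<^sub>R R t (T \<xi>))"
    using c by (intro Bochner_Integration.integral_cong) (auto simp: T.scaleR wt_def)
  finally show ?thesis by (simp add: L_def)
qed

lemma J_commute:
  assumes T: "bounded_linear T" and c: "\<And>t. 0 \<le> t \<Longrightarrow> T (R t \<xi>) = R t (T \<xi>)"
  shows "T (J a \<xi>) = J a (T \<xi>)"
  by (simp add: J_def linear_cmul[OF bounded_linear.linear[OF T]] L_commute[OF T c])

lemma L_scaled:
  assumes "0 < l"
  shows "has_bochner_integral lborel (\<lambda>t. wt a t *\<^sub>R R (l * t) \<xi>) (l powr (a - 1) *\<^sub>R L a \<xi>)"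
proof -
  have "has_bochner_integral lborel (\<lambda>t. wt a t *\<^sub>R R t \<xi>) (L a \<xi>)"
    using weighted_integrable by (simp add: has_bochner_integral_iff L_def)
  then have "has_bochner_integral lborel (\<lambda>t. wt a (0 + l * t) *\<^sub>R R (0 + l * t) \<xi>) (L a \<xi> /\<^sub>R \<bar>l\<bar>)"
    using assms by (subst (asm) lborel_has_bochner_integral_real_affine_iff[of l _ _ 0]) auto
  then have *: "has_bochner_integral lborel (\<lambda>t. l powr a *\<^sub>R (wt a (0 + l * t) *\<^sub>R R (0 + l * t) \<xi>))
      (l powr a *\<^sub>R (L a \<xi> /\<^sub>R \<bar>l\<bar>))"
    by (rule has_bochner_integral_scaleR_right)
  have eq1: "l powr a *\<^sub>R (wt a (0 + l * t) *\<^sub>R R (0 + l * t) \<xi>) = wt a t *\<^sub>R R (l * t) \<xi>" for t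
    using assms by (auto simp: wt_def zero_less_mult_iff powr_mult powr_minus)
  have eq2: "l powr a *\<^sub>R (L a \<xi> /\<^sub>R \<bar>l\<bar>) = l powr (a - 1) *\<^sub>R L a \<xi>"
    using assms by (simp add: powr_diff divide_inverse)
  show ?thesis using * unfolding eq1 eq2 .
qed

end

end

text \<open>Multiplication by \<open>1 / (1 + t)\<close> on the real line, the resolvents of the number \<open>1\<close>.
  Comparison with this family fixes the constants in the composition law.\<close>

definition sR :: "real \<Rightarrow> real \<Rightarrow>\<^sub>L real" where
  "sR t = (1 / (1 + t)) *\<^sub>R id_blinfun"

lemma sR_apply: "sR t \<xi> = \<xi> / (1 + t)"
  by (simp add: sR_def blinfun.scaleR_left)

interpretation scalar: resolvent_family sR 1
proof
  show "sR s \<xi> - sR t \<xi> = (t - s) *\<^sub>R sR s (sR t \<xi>)" if "0 \<le> s" "0 \<le> t" for s t \<xi>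
    using that by (simp add: sR_apply field_simps)
  show "norm (sR t) \<le> 1 / (1 + t)" if "0 \<le> t" for t
    using that by (simp add: sR_def)
  show "\<xi> = 0" if "sR 0 \<xi> = 0" for \<xi>
    using that by (simp add: sR_apply)
qed

lemma scalar_L: "\<lbrakk>0 < a; a < 1\<rbrakk> \<Longrightarrow> scalar.L a \<xi> = \<xi> * (pi / sin (pi * a))"
proof -
  assume "0 < a" "a < 1"
  moreover have "(\<lambda>t. wt a t *\<^sub>R sR t \<xi>) = (\<lambda>t. \<xi> * (wt a t / (1 + t)))"
    by (simp add: sR_apply mult.commute)
  ultimately show ?thesis
    using scalar.kernel_integral[of a] by (simp only: scalar.L_def Bochner_Integration.integral_mult_right_zero)
qed

context
  fixes a b :: real
  assumes ab: "0 < a" "a < 1" "0 < b" "b < 1"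
begin

text \<open>The integrand of the product of the powers with exponents \<open>- a\<close> and \<open>- b\<close>, after the substitution \<open>s = l t\<close> in the
  first integral. The order of integration is then exchanged: for fixed \<open>l\<close> the resolvent identity splits the product
  \<open>R (l t) R t\<close>.\<close>

definition compker :: "(real \<Rightarrow> 'a::{banach, second_countable_topology} \<Rightarrow>\<^sub>L 'a) \<Rightarrow> 'a \<Rightarrow> real \<Rightarrow> real \<Rightarrow> 'a" where
  "compker R \<xi> t l = (wt (a + b - 1) t * wt a l) *\<^sub>R R (l * t) (R t \<xi>)"

lemma compker_measurable:
  assumes "resolvent_family R K"
  shows "case_prod (compker R \<xi>) \<in> borel_measurable (lborel \<Otimes>\<^sub>M lborel)"
proof -
  interpret resolvent_family R K by fact
  let ?A = "{0<..} \<times> {0<..} :: (real \<times> real) set"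
  have "continuous_on ?A (\<lambda>p. (fst p powr (- (a + b - 1)) * snd p powr (- a)) *\<^sub>R
      R (snd p * fst p) (R (fst p) \<xi>))"
    by (intro continuous_intros continuous_on_compose2[OF continuous_R]) auto
  then have "(\<lambda>p. indicator ?A p *\<^sub>R ((fst p powr (- (a + b - 1)) * snd p powr (- a)) *\<^sub>R
      R (snd p * fst p) (R (fst p) \<xi>))) \<in> borel_measurable borel"
    by (intro borel_measurable_continuous_on_indicator borel_open open_Times) auto
  also have "(\<lambda>p. indicator ?A p *\<^sub>R ((fst p powr (- (a + b - 1)) * snd p powr (- a)) *\<^sub>R
      R (snd p * fst p) (R (fst p) \<xi>))) = case_prod (compker R \<xi>)"
    by (auto simp: compker_def wt_def fun_eq_iff)
  finally show ?thesis by (simp add: lborel_prod)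
qed

lemma compker_inner:
  assumes "resolvent_family R K"
  shows "has_bochner_integral lborel (compker R \<xi> t) (wt b t *\<^sub>R resolvent_family.L R a (R t \<xi>))"
proof (cases "0 < t")
  case True
  interpret resolvent_family R K by fact
  have "has_bochner_integral lborel (\<lambda>s. wt a s *\<^sub>R R s (R t \<xi>)) (L a (R t \<xi>))"
    using weighted_integrable ab by (simp add: has_bochner_integral_iff L_def)
  then have "has_bochner_integral lborel (\<lambda>l. wt a (0 + t * l) *\<^sub>R R (0 + t * l) (R t \<xi>))
      (L a (R t \<xi>) /\<^sub>R \<bar>t\<bar>)"
    using True by (subst (asm) lborel_has_bochner_integral_real_affine_iff[of t _ _ 0]) auto
  then have *: "has_bochner_integral lborel
      (\<lambda>l. (t powr (1 - b)) *\<^sub>R (wt a (0 + t * l) *\<^sub>R R (0 + t * l) (R t \<xi>)))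
      ((t powr (1 - b)) *\<^sub>R (L a (R t \<xi>) /\<^sub>R \<bar>t\<bar>))"
    by (rule has_bochner_integral_scaleR_right)
  have eq1: "(t powr (1 - b)) *\<^sub>R (wt a (0 + t * l) *\<^sub>R R (0 + t * l) (R t \<xi>)) = compker R \<xi> t l" for l
  proof -
    have "t powr (1 - b) * (t powr (- a) * l powr (- a)) = t powr (- (a + b - 1)) * l powr (- a)"
      by (simp add: algebra_simps flip: powr_add)
    then show ?thesis
      using True by (auto simp: compker_def wt_def zero_less_mult_iff powr_mult mult.commute[of t l])
  qed
  have eq2: "(t powr (1 - b)) *\<^sub>R (L a (R t \<xi>) /\<^sub>R \<bar>t\<bar>) = wt b t *\<^sub>R L a (R t \<xi>)"
    using True by (simp add: wt_def powr_diff powr_minus divide_inverse)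
  show ?thesis using * unfolding eq1 eq2 .
next
  case False
  then have "compker R \<xi> t = (\<lambda>_. 0)" by (simp add: compker_def wt_def fun_eq_iff)
  then show ?thesis using False by (simp add: wt_def has_bochner_integral_iff)
qed

lemma compker_scalar: "compker sR 1 t l = (wt (a + b - 1) t * wt a l) * (1 / (1 + l * t) * (1 / (1 + t)))"
  by (simp add: compker_def sR_apply)

lemma compker_scalar_nonneg: "0 \<le> compker sR 1 t l"
proof (cases "0 < t \<and> 0 < l")
  case True
  then show ?thesis unfolding compker_scalar by (intro mult_nonneg_nonneg) auto
qed (auto simp: compker_scalar wt_def)

lemma compker_scalar_integrable: "integrable (lborel \<Otimes>\<^sub>M lborel) (case_prod (compker sR 1))"
proof (rule lborel_pair.Fubini_integrable)
  show "case_prod (compker sR 1) \<in> borel_measurable (lborel \<Otimes>\<^sub>M lborel)"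
    by (rule compker_measurable) unfold_locales
  have inner: "has_bochner_integral lborel (compker sR 1 t) (wt b t *\<^sub>R scalar.L a (sR t 1))" for t
    by (rule compker_inner) unfold_locales
  have "(\<lambda>t. LINT l|lborel. norm (case (t, l) of (t, l) \<Rightarrow> compker sR 1 t l)) =
      (\<lambda>t. (wt b t / (1 + t)) * (pi / sin (pi * a)))"
    using inner ab compker_scalar_nonneg
    by (auto simp: has_bochner_integral_iff fun_eq_iff scalar_L sR_apply)
  then show "integrable lborel (\<lambda>t. LINT l|lborel. norm (case (t, l) of (t, l) \<Rightarrow> compker sR 1 t l))"
    using scalar.kernel_integrable[of b] ab by (metis integrable_mult_left)
  show "AE t in lborel. integrable lborel (\<lambda>l. case (t, l) of (t, l) \<Rightarrow> compker sR 1 t l)"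
    using inner by (auto simp: has_bochner_integral_iff)
qed

lemma compker_integrable:
  assumes "resolvent_family R K"
  shows "integrable (lborel \<Otimes>\<^sub>M lborel) (case_prod (compker R \<xi>))"
proof (rule Bochner_Integration.integrable_bound)
  interpret resolvent_family R K by fact
  show "integrable (lborel \<Otimes>\<^sub>M lborel) (\<lambda>p. K * K * norm \<xi> * (case_prod (compker sR 1)) p)"
    using compker_scalar_integrable by simp
  show "case_prod (compker R \<xi>) \<in> borel_measurable (lborel \<Otimes>\<^sub>M lborel)"
    by (rule compker_measurable[OF assms])
  have "norm (compker R \<xi> t l) \<le> K * K * norm \<xi> * compker sR 1 t l" for t l
  proof (cases "0 < t \<and> 0 < l")
    case True
    have "norm (R (l * t) (R t \<xi>)) \<le> K / (1 + l * t) * (K / (1 + t) * norm \<xi>)"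
      using True K_nonneg
      by (intro order_trans[OF norm_R_apply] mult_left_mono norm_R_apply) auto
    then have "(wt (a + b - 1) t * wt a l) * norm (R (l * t) (R t \<xi>)) \<le>
        (wt (a + b - 1) t * wt a l) * (K / (1 + l * t) * (K / (1 + t) * norm \<xi>))"
      by (rule mult_left_mono) simp
    moreover have "norm (compker R \<xi> t l) = (wt (a + b - 1) t * wt a l) * norm (R (l * t) (R t \<xi>))"
      by (simp add: compker_def abs_mult)
    ultimately have "norm (compker R \<xi> t l) \<le>
        (wt (a + b - 1) t * wt a l) * (K / (1 + l * t) * (K / (1 + t) * norm \<xi>))" by simp
    also have "\<dots> = K * K * norm \<xi> * compker sR 1 t l" by (simp add: compker_scalar)
    finally show ?thesis .
  qed (auto simp: compker_def wt_def)
  then show "AE p in lborel \<Otimes>\<^sub>M lborel. norm (case_prod (compker R \<xi>) p) \<le>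
      norm (K * K * norm \<xi> * (case_prod (compker sR 1)) p)"
    by (intro AE_I2) (auto intro: order_trans[OF _ abs_ge_self])
qed

lemma L_L_eq_double_integral:
  assumes "resolvent_family R K"
  shows "resolvent_family.L R a (resolvent_family.L R b \<xi>) =
    (LINT l|lborel. LINT t|lborel. compker R \<xi> t l)"
proof -
  interpret resolvent_family R K by fact
  have "L a (L b \<xi>) = (LINT t|lborel. L a (wt b t *\<^sub>R R t \<xi>))"
    unfolding L_def[of b]
    by (rule integral_bounded_linear[OF bounded_linear_L weighted_integrable, symmetric]) (use ab in auto)
  also have "\<dots> = (LINT t|lborel. LINT l|lborel. compker R \<xi> t l)"
    using compker_inner[OF assms, of \<xi>] bounded_linear_L[of a] ab
    by (simp add: has_bochner_integral_iff linear_cmul[OF bounded_linear.linear])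
  also have "\<dots> = (LINT l|lborel. LINT t|lborel. compker R \<xi> t l)"
    by (rule lborel_pair.Fubini_integral[OF compker_integrable[OF assms], symmetric])
  finally show ?thesis .
qed

text \<open>The resolvent identity makes the inner integral explicit. Its dependence on \<open>l\<close> is a
  scalar factor that is the same for every resolvent family.\<close>

definition compfac :: "real \<Rightarrow> real" where
  "compfac l = wt a l * ((if a + b < 1 then l powr (a + b - 1) - 1 else 1 - l powr (a + b - 1)) / (1 - l))"

lemma compker_outer:
  assumes "resolvent_family R K" and "l \<noteq> 1" and "a + b \<noteq> 1"
  shows "(LINT t|lborel. compker R \<xi> t l) =
    compfac l *\<^sub>R (if a + b < 1 then resolvent_family.L R (a + b) \<xi>
             else R 0 (resolvent_family.L R (a + b - 1) \<xi>))"
proof (cases "0 < l")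
  case True
  interpret resolvent_family R K by fact
  show ?thesis
  proof (cases "a + b < 1")
    case True
    note lt = this
    have compker_eq: "compker R \<xi> t l = (wt a l / (1 - l)) *\<^sub>R (wt (a + b) t *\<^sub>R R (l * t) \<xi> - wt (a + b) t *\<^sub>R R (1 * t) \<xi>)" for t
    proof (cases "0 < t")
      case True
      have "wt (a + b - 1) t = wt (a + b) t * t" using True by (simp add: wt_def powr_diff powr_add powr_minus divide_inverse)
      moreover have "R (l * t) \<xi> - R (1 * t) \<xi> = (t * (1 - l)) *\<^sub>R R (l * t) (R t \<xi>)"
        using resolvent_eq[of "l * t" t \<xi>] True \<open>0 < l\<close> by (simp add: algebra_simps)
      ultimately show ?thesis
        using assms(2) by (simp add: compker_def flip: scaleR_diff_right)
    qed (simp add: compker_def wt_def)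
    have "has_bochner_integral lborel (\<lambda>t. compker R \<xi> t l)
        ((wt a l / (1 - l)) *\<^sub>R (l powr (a + b - 1) *\<^sub>R L (a + b) \<xi> - 1 powr (a + b - 1) *\<^sub>R L (a + b) \<xi>))"
      unfolding compker_eq
      by (intro has_bochner_integral_scaleR_right has_bochner_integral_diff L_scaled)
         (use ab lt \<open>0 < l\<close> in auto)
    moreover have "l powr (a + b - 1) *\<^sub>R L (a + b) \<xi> - 1 powr (a + b - 1) *\<^sub>R L (a + b) \<xi> =
        (l powr (a + b - 1) - 1) *\<^sub>R L (a + b) \<xi>"
      by (simp add: scaleR_left_diff_distrib)
    ultimately show ?thesis
      using lt by (simp add: has_bochner_integral_iff compfac_def)
  next
    case False
    let ?c = "a + b - 1"
    have c: "0 < ?c" "?c < 1" using False assms(3) ab by auto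
    have compker_eq: "compker R \<xi> t l = (- wt a l / (1 - l)) *\<^sub>R
        R 0 (l *\<^sub>R (wt ?c t *\<^sub>R R (l * t) \<xi>) - wt ?c t *\<^sub>R R (1 * t) \<xi>)" for t
    proof (cases "0 < t")
      case True

      have "(t * (1 - l)) *\<^sub>R R (l * t) (R t \<xi>) = R (l * t) \<xi> - R t \<xi>"
        using resolvent_eq[of "l * t" t \<xi>] True \<open>0 < l\<close> by (simp add: algebra_simps)
      also have "\<dots> = - ((l * t) *\<^sub>R R 0 (R (l * t) \<xi>) - t *\<^sub>R R 0 (R t \<xi>))"
      proof -
        have "R (l * t) \<xi> - R t \<xi> =
            (R 0 \<xi> - (l * t) *\<^sub>R R 0 (R (l * t) \<xi>)) - (R 0 \<xi> - t *\<^sub>R R 0 (R t \<xi>))"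
          by (rule arg_cong2[where f = "(-)"]; rule R_eq_R0) (use True \<open>0 < l\<close> in auto)
        then show ?thesis by simp
      qed
      also have "\<dots> = t *\<^sub>R (- R 0 (l *\<^sub>R R (l * t) \<xi> - R t \<xi>))"
        unfolding blinfun.diff_right blinfun.scaleR_right scaleR_minus_right scaleR_diff_right
          scaleR_scaleR mult.commute[of t l] by (rule refl)
      finally have *: "(t * (1 - l)) *\<^sub>R R (l * t) (R t \<xi>) = t *\<^sub>R (- R 0 (l *\<^sub>R R (l * t) \<xi> - R t \<xi>))" .
      have cancel: "x = (1 / (1 - l)) *\<^sub>R y" if "(t * (1 - l)) *\<^sub>R x = t *\<^sub>R y" for x y :: 'a
      proof (rule scaleR_left_imp_eq)
        show "t * (1 - l) \<noteq> 0" using True assms(2) by simp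
        show "(t * (1 - l)) *\<^sub>R x = (t * (1 - l)) *\<^sub>R (1 / (1 - l)) *\<^sub>R y"
          using that assms(2) by simp
      qed
      have eq: "R (l * t) (R t \<xi>) = (1 / (1 - l)) *\<^sub>R - R 0 (l *\<^sub>R R (l * t) \<xi> - R t \<xi>)"
        by (rule cancel[OF *])
      have "l *\<^sub>R (wt ?c t *\<^sub>R R (l * t) \<xi>) - wt ?c t *\<^sub>R R (1 * t) \<xi> =
          wt ?c t *\<^sub>R (l *\<^sub>R R (l * t) \<xi> - R t \<xi>)"
        by (simp add: scaleR_diff_right mult.commute)
      then show ?thesis
        unfolding compker_def eq by (simp only: blinfun.scaleR_right) (simp add: mult.commute)
    qed (simp add: compker_def wt_def)
    have "has_bochner_integral lborel (\<lambda>t. compker R \<xi> t l)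
        ((- wt a l / (1 - l)) *\<^sub>R R 0 (l *\<^sub>R (l powr (?c - 1) *\<^sub>R L ?c \<xi>) - 1 powr (?c - 1) *\<^sub>R L ?c \<xi>))"
      unfolding compker_eq
      by (intro has_bochner_integral_scaleR_right has_bochner_integral_diff L_scaled
            has_bochner_integral_bounded_linear[OF blinfun.bounded_linear_right])
         (use c \<open>0 < l\<close> in auto)
    moreover have "l *\<^sub>R (l powr (?c - 1) *\<^sub>R L ?c \<xi>) - 1 powr (?c - 1) *\<^sub>R L ?c \<xi> = (l powr ?c - 1) *\<^sub>R L ?c \<xi>"
    proof -
      have "l * l powr (?c - 1) = l powr ?c"
      proof -
        have "1 + (?c - 1) = ?c" by simp
        then show ?thesis using powr_mult_base[of l "?c - 1"] \<open>0 < l\<close> by (simp only: less_imp_le)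
      qed
      then show ?thesis by (simp only: scaleR_scaleR powr_one_eq_one scaleR_left_diff_distrib)
    qed
    moreover have "(- w / m) * (p - 1) = w * ((1 - p) / m)" for w m p :: real
      by (cases "m = 0") (auto simp: field_simps)
    ultimately have "has_bochner_integral lborel (\<lambda>t. compker R \<xi> t l)
        ((wt a l * ((1 - l powr ?c) / (1 - l))) *\<^sub>R R 0 (L ?c \<xi>))"
      by (simp only: blinfun.scaleR_right scaleR_scaleR)
    then show ?thesis
      using False by (simp only: has_bochner_integral_iff compfac_def if_False)
  qed
qed (simp add: compker_def compfac_def wt_def)

text \<open>The composition law up to a factor that depends on \<open>a\<close> and \<open>b\<close> only. The factor is
  the same for all resolvent families, and its value can be read off from the scalar one.\<close>

lemma L_L:
  assumes R: "resolvent_family R K" and "a + b \<noteq> 1"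
  shows "resolvent_family.L R a (resolvent_family.L R b \<xi>) = (LINT l|lborel. compfac l) *\<^sub>R
     (if a + b < 1 then resolvent_family.L R (a + b) \<xi>
             else R 0 (resolvent_family.L R (a + b - 1) \<xi>))" (is "_ = _ *\<^sub>R ?X")
    and "integrable lborel compfac"
proof -
  have sc: "resolvent_family sR 1" by unfold_locales
  let ?c = "if a + b < 1 then scalar.L (a + b) 1 else sR 0 (scalar.L (a + b - 1) 1)"
  have ae: "AE l in lborel. (LINT t|lborel. compker sR 1 t l) = compfac l *\<^sub>R ?c"
    using AE_lborel_singleton[of "1::real"]
    by eventually_elim (rule compker_outer[OF sc _ assms(2)])
  have int: "integrable lborel (\<lambda>l. LINT t|lborel. compker sR 1 t l)"
    by (rule lborel_pair.integrable_snd[OF compker_scalar_integrable])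
  have hm: "compfac \<in> borel_measurable lborel"
    unfolding compfac_def by measurable
  have "(\<lambda>l. compfac l *\<^sub>R ?c) \<in> borel_measurable lborel"
    by (intro borel_measurable_scaleR hm borel_measurable_const)
  from integrable_cong_AE_imp[OF int this ae]
  have hc: "integrable lborel (\<lambda>l. compfac l * ?c)" unfolding real_scaleR_def .
  have c0: "?c \<noteq> 0"
  proof (cases "a + b < 1")
    case True
    then show ?thesis using ab scalar.sin_pos[of "a + b"] by (simp add: scalar_L)
  next
    case False
    then show ?thesis using ab assms(2) scalar.sin_pos[of "a + b - 1"]
      by (simp add: scalar_L sR_apply)
  qed
  have "integrable lborel (\<lambda>l. compfac l * ?c / ?c)" by (rule integrable_divide[OF hc])
  moreover have "(\<lambda>l. compfac l * ?c / ?c) = compfac" using nonzero_mult_div_cancel_right[OF c0] by blast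
  ultimately show hi: "integrable lborel compfac" by (simp only:)
  have "(LINT l|lborel. LINT t|lborel. compker R \<xi> t l) = (LINT l|lborel. compfac l *\<^sub>R ?X)"
  proof (rule integral_cong_AE)
    show "AE l in lborel. (LINT t|lborel. compker R \<xi> t l) = compfac l *\<^sub>R ?X"
      using AE_lborel_singleton[of "1::real"]
      by eventually_elim (rule compker_outer[OF R _ assms(2)])
    show "(\<lambda>l. LINT t|lborel. compker R \<xi> t l) \<in> borel_measurable lborel"
      by (rule borel_measurable_integrable[OF lborel_pair.integrable_snd[OF compker_integrable[OF R]]])
    show "(\<lambda>l. compfac l *\<^sub>R ?X) \<in> borel_measurable lborel"
      by (intro borel_measurable_scaleR hm borel_measurable_const)
  qed
  then show "resolvent_family.L R a (resolvent_family.L R b \<xi>) = (LINT l|lborel. compfac l) *\<^sub>R ?X"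
    by (simp only: L_L_eq_double_integral[OF R, of \<xi>] integral_scaleR_left[OF hi])
qed

end

context resolvent_family
begin

lemma J_J:
  assumes ab: "0 < a" "a < 1" "0 < b" "b < 1" and ne: "a + b \<noteq> 1"
  shows "J a (J b \<xi>) = (if a + b < 1 then J (a + b) \<xi> else R 0 (J (a + b - 1) \<xi>))"
proof -
  define c where "c = (LINT l|lborel. compfac a b l)"
  let ?s = "if a + b < 1 then a + b else a + b - 1"
  have s: "0 < ?s" "?s < 1" using ab ne by auto
  have sc: "resolvent_family sR 1" and R: "resolvent_family R K" by unfold_locales
  have "pi / sin (pi * a) * (pi / sin (pi * b)) = c * (pi / sin (pi * ?s))"
    using L_L(1)[OF ab sc ne, of 1] ab s by (auto simp: scalar_L sR_apply c_def mult.commute split: if_splits)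
  then have c: "sin (pi * a) / pi * (sin (pi * b) / pi) * c = sin (pi * ?s) / pi"
  proof -
    have "z / p = x / p * (y / p) * c" if "p / x * (p / y) = c * (p / z)"
      and "x \<noteq> 0" "y \<noteq> 0" "z \<noteq> 0" "p \<noteq> 0" for x y z p :: real
    proof -
      have "c = p / x * (p / y) * (z / p)" using that by simp
      then show ?thesis using that by simp
    qed
    from this[of pi "sin (pi * a)" "sin (pi * b)" "sin (pi * ?s)"]
    show ?thesis
      using sin_pos[of a] sin_pos[of b] sin_pos[OF s] ab
        \<open>pi / sin (pi * a) * (pi / sin (pi * b)) = c * (pi / sin (pi * ?s))\<close> by simp
  qed
  have "J a (J b \<xi>) = (sin (pi * a) / pi * (sin (pi * b) / pi)) *\<^sub>R L a (L b \<xi>)"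
    unfolding J_def using bounded_linear_L[of a] ab by (simp add: linear_cmul[OF bounded_linear.linear])
  also have "\<dots> = (sin (pi * a) / pi * (sin (pi * b) / pi) * c) *\<^sub>R
      (if a + b < 1 then L (a + b) \<xi> else R 0 (L (a + b - 1) \<xi>))"
    using L_L(1)[OF ab R ne, of \<xi>] by (simp add: c_def)
  also have "\<dots> = (if a + b < 1 then J (a + b) \<xi> else R 0 (J (a + b - 1) \<xi>))"
    unfolding c by (simp add: J_def blinfun.scaleR_right)
  finally show ?thesis .
qed

text \<open>Subtracting the scalar kernel times \<open>R 0 \<xi>\<close> leaves an integrand that also vanishes
  at \<open>0\<close>, so that its integral stays bounded as \<open>a\<close> tends to \<open>1\<close> while the factor
  \<open>sin (\<pi> a)\<close> tends to \<open>0\<close>.\<close>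

lemma J_near_1:
  assumes a: "1 / 2 \<le> a" "a < 1"
  shows "norm (J a \<xi> - R 0 \<xi>) \<le> sin (pi * a) * ((K * K + 2 * K) * norm \<xi>)"
proof -
  let ?C = "(K * K + 2 * K) * norm \<xi>"
  have a0: "0 < a" using a by simp
  have "norm (R t \<xi> - (1 / (1 + t)) *\<^sub>R R 0 \<xi>) \<le> min 1 t * ?C / (1 + t)" if t: "0 < t" for t
  proof -
    have R0: "norm (R 0 \<xi>) \<le> K * norm \<xi>" using norm_R_apply[of 0] by simp
    have "norm (R 0 (R t \<xi>)) \<le> K * (K / (1 + t) * norm \<xi>)"
      using norm_R_apply[of 0 "R t \<xi>"] mult_left_mono[OF norm_R_apply[of t \<xi>] K_nonneg] t by simp
    moreover have "R t \<xi> - (1 / (1 + t)) *\<^sub>R R 0 \<xi> = (t / (1 + t)) *\<^sub>R R 0 \<xi> - t *\<^sub>R R 0 (R t \<xi>)"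
    proof -
      have "R t \<xi> = R 0 \<xi> - t *\<^sub>R R 0 (R t \<xi>)" using t by (intro R_eq_R0) simp
      moreover have "R 0 \<xi> - (1 / (1 + t)) *\<^sub>R R 0 \<xi> = (t / (1 + t)) *\<^sub>R R 0 \<xi>"
      proof -
        have "1 - 1 / (1 + t) = t / (1 + t)" using t by (simp add: field_simps)
        then show ?thesis by (simp flip: scaleR_left_diff_distrib[of 1, simplified])
      qed
      moreover have "x - d = e - b" if "x = a - b" "a - d = e" for x a b d e :: 'a
        using that by (auto simp: algebra_simps)
      ultimately show ?thesis by blast
    qed
    ultimately have "norm (R t \<xi> - (1 / (1 + t)) *\<^sub>R R 0 \<xi>) \<le>
        t / (1 + t) * norm (R 0 \<xi>) + t * norm (R 0 (R t \<xi>))"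
      using t norm_triangle_ineq4[of "(t / (1 + t)) *\<^sub>R R 0 \<xi>" "t *\<^sub>R R 0 (R t \<xi>)"] by simp
    also have "\<dots> \<le> t / (1 + t) * (K * norm \<xi>) + t * (K * (K / (1 + t) * norm \<xi>))"
      using t R0 \<open>norm (R 0 (R t \<xi>)) \<le> K * (K / (1 + t) * norm \<xi>)\<close>
      by (intro add_mono mult_left_mono) auto
    also have "\<dots> = t * ((K * K + K) * norm \<xi>) / (1 + t)"
      by (simp add: algebra_simps add_divide_distrib)
    also have "\<dots> \<le> t * ?C / (1 + t)"
      using t K_nonneg by (intro divide_right_mono mult_left_mono mult_right_mono) auto
    finally have 1: "norm (R t \<xi> - (1 / (1 + t)) *\<^sub>R R 0 \<xi>) \<le> t * ?C / (1 + t)" .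
    have "norm (R t \<xi> - (1 / (1 + t)) *\<^sub>R R 0 \<xi>) \<le> K / (1 + t) * norm \<xi> + 1 / (1 + t) * (K * norm \<xi>)"
      using norm_R_apply[of t \<xi>] R0 t
      by (intro order_trans[OF norm_triangle_ineq4] add_mono) (auto simp: divide_right_mono)
    also have "\<dots> = 2 * K * norm \<xi> / (1 + t)" by (simp add: field_simps add_divide_distrib)
    also have "\<dots> \<le> ?C / (1 + t)"
      using t K_nonneg by (intro divide_right_mono mult_right_mono) auto
    finally show ?thesis using 1 by (auto simp: min_def)
  qed
  then have bound: "norm (wt a t *\<^sub>R R t \<xi> - (wt a t / (1 + t)) *\<^sub>R R 0 \<xi>) \<le> ?C * (wt (1/2) t / (1 + t))" for t
  proof (cases "0 < t")
    case True
    have "t powr (- a) * min 1 t \<le> t powr (- (1/2))"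
    proof (cases "t \<le> 1")
      case True
      have "t powr (- a) * t = t powr (1 - a)" using \<open>0 < t\<close> by (simp add: powr_diff powr_minus divide_inverse)
      also have "\<dots> \<le> t powr (- (1/2))" using True \<open>0 < t\<close> a by (intro powr_mono') auto
      finally show ?thesis using True by (simp add: min_def)
    next
      case False
      then show ?thesis using a by (simp add: min_def powr_mono)
    qed
    then have wle: "wt a t * min 1 t \<le> wt (1/2) t" using True by (simp add: wt_def)
    have "wt a t *\<^sub>R R t \<xi> - (wt a t / (1 + t)) *\<^sub>R R 0 \<xi> = wt a t *\<^sub>R (R t \<xi> - (1 / (1 + t)) *\<^sub>R R 0 \<xi>)"
      by (simp add: scaleR_diff_right)
    then have "norm (wt a t *\<^sub>R R t \<xi> - (wt a t / (1 + t)) *\<^sub>R R 0 \<xi>) \<le> wt a t * (min 1 t * ?C / (1 + t))"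
      using mult_left_mono[OF
          \<open>\<And>t. 0 < t \<Longrightarrow> norm (R t \<xi> - (1 / (1 + t)) *\<^sub>R R 0 \<xi>) \<le> min 1 t * ?C / (1 + t)\<close>[OF True]
          wt_nonneg[of a t]]
      by (simp only: norm_scaleR abs_of_nonneg[OF wt_nonneg])
    also have "\<dots> = (wt a t * min 1 t) * (?C / (1 + t))" by simp
    also have "\<dots> \<le> wt (1/2) t * (?C / (1 + t))"
      using wle True K_nonneg by (intro mult_right_mono) auto
    finally show ?thesis by (simp add: mult.commute)
  qed (simp add: wt_def)
  have int: "integrable lborel (\<lambda>t. wt a t *\<^sub>R R t \<xi> - (wt a t / (1 + t)) *\<^sub>R R 0 \<xi>)"
    using weighted_integrable[OF a0 a(2)] kernel_integrable[OF a0 a(2)] by simp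
  have "L a \<xi> - (pi / sin (pi * a)) *\<^sub>R R 0 \<xi> = (LINT t|lborel. wt a t *\<^sub>R R t \<xi> - (wt a t / (1 + t)) *\<^sub>R R 0 \<xi>)"
    unfolding L_def
    by (subst Bochner_Integration.integral_diff)
       (use weighted_integrable[OF a0 a(2)] kernel_integrable[OF a0 a(2)] kernel_integral[OF a0 a(2)] in auto)
  also have "norm \<dots> \<le> (LINT t|lborel. ?C * (wt (1/2) t / (1 + t)))"
    by (intro Bochner_Integration.integral_norm_bound_integral int bound)
       (intro integrable_mult_right kernel_integrable; simp)
  also have "\<dots> = ?C * pi"
  proof -
    have "(LINT t|lborel. wt (1/2) t / (1 + t)) = pi" using kernel_integral[of "1/2"] by simp
    then show ?thesis by (simp only: Bochner_Integration.integral_mult_right_zero)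
  qed
  finally have "norm (L a \<xi> - (pi / sin (pi * a)) *\<^sub>R R 0 \<xi>) \<le> ?C * pi" .
  moreover have "J a \<xi> - R 0 \<xi> = (sin (pi * a) / pi) *\<^sub>R (L a \<xi> - (pi / sin (pi * a)) *\<^sub>R R 0 \<xi>)"
    using sin_pos[OF a0 a(2)] by (simp add: J_def scaleR_diff_right)
  ultimately have "norm (J a \<xi> - R 0 \<xi>) \<le> (sin (pi * a) / pi) * (?C * pi)"
  proof -
    have "0 \<le> sin (pi * a) / pi" using sin_pos[OF a0 a(2)] by simp
    from mult_left_mono[OF \<open>norm (L a \<xi> - (pi / sin (pi * a)) *\<^sub>R R 0 \<xi>) \<le> ?C * pi\<close> this]
    show ?thesis
      unfolding \<open>J a \<xi> - R 0 \<xi> = (sin (pi * a) / pi) *\<^sub>R (L a \<xi> - (pi / sin (pi * a)) *\<^sub>R R 0 \<xi>)\<close>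
        norm_scaleR abs_of_nonneg[OF \<open>0 \<le> sin (pi * a) / pi\<close>] .
  qed
  also have "\<dots> = sin (pi * a) * ?C" by simp
  finally show ?thesis .
qed

text \<open>If one power vanishes at \<open>\<xi>\<close>, so do all with a larger exponent, and their limit \<open>R 0 \<xi>\<close> for
  exponents tending to \<open>1\<close>.\<close>

lemma J_inj:
  assumes a: "0 < a" "a < 1" and J0: "J a \<xi> = 0"
  shows "\<xi> = 0"
proof -
  have zero: "J c \<xi> = 0" if "a < c" "c < 1" for c
    using J_J[of "c - a" a \<xi>] that a J0 linear_0[OF bounded_linear.linear[OF bounded_linear_J[of "c - a"]]]
    by simp
  define c where "c n = 1 - (1 - a) / 2 * (1 / 2) ^ n" for n
  have c: "a < c n" "c n < 1" for n
  proof -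
    have "(1 / 2) ^ n \<le> (1 :: real)" by (intro power_le_one) auto
    then have "0 < (1 - a) * (1 - (1 / 2) ^ n / 2)" using a by (intro mult_pos_pos) auto
    also have "\<dots> = c n - a" by (simp add: c_def field_simps)
    finally show "a < c n" by simp
    show "c n < 1" using a by (simp add: c_def)
  qed
  have "c \<longlonglongrightarrow> 1 - (1 - a) / 2 * 0"
    unfolding c_def by (intro tendsto_intros LIMSEQ_power_zero) auto
  then have lim: "c \<longlonglongrightarrow> 1" by simp
  have "(\<lambda>n. sin (pi * c n) * ((K * K + 2 * K) * norm \<xi>)) \<longlonglongrightarrow> sin (pi * 1) * ((K * K + 2 * K) * norm \<xi>)"
    by (intro tendsto_intros lim)
  moreover have "\<forall>\<^sub>F n in sequentially. norm (R 0 \<xi>) \<le> sin (pi * c n) * ((K * K + 2 * K) * norm \<xi>)"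
  proof -
    have "\<forall>\<^sub>F n in sequentially. 1 / 2 < c n"
      using order_tendstoD(1)[OF lim, of "1/2"] by simp
    then show ?thesis
    proof eventually_elim
      case (elim n)
      then show ?case using J_near_1[of "c n" \<xi>] c[of n] zero by simp
    qed
  qed
  ultimately have "norm (R 0 \<xi>) \<le> sin (pi * 1) * ((K * K + 2 * K) * norm \<xi>)"
    by (intro tendsto_lowerbound) auto
  then have "R 0 \<xi> = 0" by simp
  then show ?thesis by (rule inj_R0)
qed

lemma J_R: "\<lbrakk>0 < a; a < 1; 0 \<le> t\<rbrakk> \<Longrightarrow> R t (J a \<xi>) = J a (R t \<xi>)"
  by (intro J_commute blinfun.bounded_linear_right R_commute) auto

text \<open>The case \<open>a + b = 1\<close>, in which the double integral is not of the form above, follows by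
  applying a further injective power.\<close>

lemma J_J_1:
  assumes a: "0 < a" "a < 1"
  shows "J a (J (1 - a) \<xi>) = R 0 \<xi>"
proof -
  define g where "g = (1 - a) / 2"
  have g: "0 < g" "g < 1" "g + a < 1" using a by (auto simp: g_def field_simps)
  have "J g (J a (J (1 - a) \<xi>)) = R 0 (J g \<xi>)"
    using J_J[of g a "J (1 - a) \<xi>"] J_J[of "g + a" "1 - a" \<xi>] g a by simp
  then have "J g (J a (J (1 - a) \<xi>) - R 0 \<xi>) = 0"
    using J_R[of g 0 \<xi>] g linear_diff[OF bounded_linear.linear[OF bounded_linear_J[of g]]] by simp
  then have "J a (J (1 - a) \<xi>) - R 0 \<xi> = 0" by (rule J_inj[OF g(1,2)])
  then show ?thesis by simp
qed

subsection \<open>Powers with arbitrary non-negative exponent\<close>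

definition P :: "real \<Rightarrow> 'a \<Rightarrow> 'a" where
  "P \<alpha> \<xi> = (blinfun_apply (R 0) ^^ nat \<lfloor>\<alpha>\<rfloor>) (if frac \<alpha> = 0 then \<xi> else J (frac \<alpha>) \<xi>)"

definition J0 :: "real \<Rightarrow> 'a \<Rightarrow> 'a" where
  "J0 f \<xi> = (if f = 0 then \<xi> else J f \<xi>)"

lemma P_eq: "P \<alpha> \<xi> = (blinfun_apply (R 0) ^^ nat \<lfloor>\<alpha>\<rfloor>) (J0 (frac \<alpha>) \<xi>)"
  by (simp add: P_def J0_def)

lemma bounded_linear_R0_pow: "bounded_linear (blinfun_apply (R 0) ^^ m)"
proof (induction m)
  case (Suc m)
  then show ?case
    using bounded_linear_compose[OF blinfun.bounded_linear_right[of "R 0"] Suc] by (simp add: o_def)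
qed (simp add: id_def)

lemma bounded_linear_J0: "\<lbrakk>0 \<le> f; f < 1\<rbrakk> \<Longrightarrow> bounded_linear (J0 f)"
  using bounded_linear_J[of f] unfolding J0_def by (cases "f = 0") auto

lemma bounded_linear_P: "bounded_linear (P \<alpha>)"
  using bounded_linear_compose[OF bounded_linear_R0_pow bounded_linear_J0[OF frac_ge_0 frac_lt_1]]
  unfolding P_eq[abs_def] by (simp add: o_def)

lemma J0_commute:
  assumes "0 \<le> f" "f < 1" "bounded_linear T" "\<And>t \<zeta>. 0 \<le> t \<Longrightarrow> T (R t \<zeta>) = R t (T \<zeta>)"
  shows "T (J0 f \<xi>) = J0 f (T \<xi>)"
  using J_commute[OF _ _ assms(3,4)] assms(1,2) by (simp add: J0_def)

lemma P_commute:
  assumes T: "bounded_linear T" and c: "\<And>t \<zeta>. 0 \<le> t \<Longrightarrow> T (R t \<zeta>) = R t (T \<zeta>)"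
  shows "T (P \<alpha> \<xi>) = P \<alpha> (T \<xi>)"
proof -
  have "T ((blinfun_apply (R 0) ^^ m) \<zeta>) = (blinfun_apply (R 0) ^^ m) (T \<zeta>)" for m \<zeta>
    by (induction m arbitrary: \<zeta>) (auto simp: c)
  then show ?thesis
    unfolding P_eq using J0_commute[OF frac_ge_0 frac_lt_1 T c] by simp
qed

lemma J0_J0:
  assumes f: "0 \<le> f" "f < 1" and g: "0 \<le> g" "g < 1"
  shows "J0 f (J0 g \<xi>) = (if f + g < 1 then J0 (f + g) \<xi> else R 0 (J0 (f + g - 1) \<xi>))"
proof (cases "f = 0 \<or> g = 0")
  case True
  then show ?thesis using f g by (auto simp: J0_def)
next
  case False
  then have pos: "0 < f" "0 < g" using f g by auto
  show ?thesis
  proof (cases "f + g = 1")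
    case True
    then have "g = 1 - f" by linarith
    then show ?thesis using J_J_1[OF pos(1) f(2)] pos by (simp add: J0_def)
  next
    case ne: False
    then show ?thesis using J_J[OF pos(1) f(2) pos(2) g(2) ne, of \<xi>] pos by (simp add: J0_def)
  qed
qed

lemma P_add:
  assumes "0 \<le> \<alpha>" "0 \<le> \<beta>"
  shows "P \<alpha> (P \<beta> \<xi>) = P (\<alpha> + \<beta>) \<xi>"
proof -
  let ?f = "frac \<alpha>" and ?g = "frac \<beta>" and ?m = "nat \<lfloor>\<alpha>\<rfloor>" and ?k = "nat \<lfloor>\<beta>\<rfloor>"
  have f: "0 \<le> ?f" "?f < 1" "0 \<le> ?g" "?g < 1" by (auto simp: frac_lt_1)
  have "J0 ?f (R 0 \<zeta>) = R 0 (J0 ?f \<zeta>)" for \<zeta>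
    using J0_commute[OF f(1,2) blinfun.bounded_linear_right R_commute, of 0 \<zeta>] by simp
  then have "J0 ?f ((blinfun_apply (R 0) ^^ k) \<zeta>) = (blinfun_apply (R 0) ^^ k) (J0 ?f \<zeta>)" for k \<zeta>
    by (induction k arbitrary: \<zeta>) auto
  then have "P \<alpha> (P \<beta> \<xi>) = (blinfun_apply (R 0) ^^ (?m + ?k)) (J0 ?f (J0 ?g \<xi>))"
    by (simp add: P_eq funpow_add)
  also have "\<dots> = P (\<alpha> + \<beta>) \<xi>"
  proof (cases "?f + ?g < 1")
    case True
    have "J0 ?f (J0 ?g \<xi>) = J0 (?f + ?g) \<xi>"
      unfolding J0_J0[OF f] using True by (rule if_P)
    moreover have "frac (\<alpha> + \<beta>) = ?f + ?g" "nat \<lfloor>\<alpha> + \<beta>\<rfloor> = ?m + ?k"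
      using True assms by (auto simp: frac_add floor_add nat_add_distrib)
    ultimately show ?thesis by (simp add: P_eq)
  next
    case False
    have "J0 ?f (J0 ?g \<xi>) = R 0 (J0 (?f + ?g - 1) \<xi>)"
      unfolding J0_J0[OF f] using False by (rule if_not_P)
    moreover have "frac (\<alpha> + \<beta>) = ?f + ?g - 1"
      using False by (simp add: frac_add)
    moreover have "nat \<lfloor>\<alpha> + \<beta>\<rfloor> = Suc (?m + ?k)"
      using False assms by (simp add: floor_add nat_add_distrib)
    ultimately show ?thesis by (simp add: P_eq funpow_swap1)
  qed
  finally show ?thesis .
qed

lemma P_0 [simp]: "P 0 \<xi> = \<xi>"
  by (simp add: P_def)

lemma P_1 [simp]: "P 1 \<xi> = R 0 \<xi>"
  by (simp add: P_def)

lemma P_eq_0: "P \<alpha> \<xi> = 0 \<Longrightarrow> \<xi> = 0"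
proof -
  have pow: "\<zeta> = 0" if "(blinfun_apply (R 0) ^^ m) \<zeta> = 0" for m \<zeta>
    using that by (induction m) (auto dest: inj_R0)
  have "\<zeta> = 0" if "J0 (frac \<alpha>) \<zeta> = 0" for \<zeta>
  proof (cases "frac \<alpha> = 0")
    case True
    then show ?thesis using that by (simp add: J0_def)
  next
    case False
    then have "0 < frac \<alpha>" using frac_ge_0[of \<alpha>] by linarith
    then show ?thesis using J_inj[of "frac \<alpha>" \<zeta>] that False frac_lt_1[of \<alpha>] unfolding J0_def by simp
  qed
  then show "P \<alpha> \<xi> = 0 \<Longrightarrow> \<xi> = 0" using pow unfolding P_eq by blast
qed

lemma P_inj: "inj (P \<alpha>)"
proof (rule injI)
  fix \<xi> \<zeta> assume "P \<alpha> \<xi> = P \<alpha> \<zeta>"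
  then have "P \<alpha> (\<xi> - \<zeta>) = 0"
    by (simp add: linear_diff[OF bounded_linear.linear[OF bounded_linear_P[of \<alpha>]]])
  then show "\<xi> = \<zeta>" using P_eq_0[of \<alpha> "\<xi> - \<zeta>"] by simp
qed

end

section \<open>Fractional powers of the negative generator\<close>

locale sectorial_semigroup = analytic_sg S
  for S :: "real \<Rightarrow> 'a::{banach, second_countable_topology} \<Rightarrow>\<^sub>L 'a" +
  assumes sect: "sectorial (gen_dom S) (\<lambda>u. - gen S u)"
begin

abbreviation "D \<equiv> gen_dom S"
abbreviation "B u \<equiv> - gen S u"

lemma gen_0: "0 \<in> D" "gen S 0 = 0"
  using gen_scaleR[OF S_in_dom[of 1 0], of 0] by auto

text \<open>The resolvent at the negative number \<open>- t\<close> respects the splitting of the complexification into real and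
  imaginary parts; up to sign it is the inverse of \<open>t + B\<close> on each of them.\<close>

lemma resolvent_properties:
  assumes t: "0 \<le> t"
  shows shift_bij: "bij_betw (\<lambda>u. t *\<^sub>R u + B u) D UNIV"
    and bounded_linear_shift_inverse: "bounded_linear (the_inv_into D (\<lambda>u. t *\<^sub>R u + B u))"
    and norm_shift_inverse: "norm (the_inv_into D (\<lambda>u. t *\<^sub>R u + B u) \<xi>) \<le>
       onorm (resolvent D (\<lambda>u. B u) (complex_of_real (- t))) * norm \<xi>"
proof -
  let ?z = "complex_of_real (- t)"
  let ?f = "\<lambda>u. t *\<^sub>R u + B u"
  let ?\<Phi> = "\<lambda>p. cscale ?z p - map_prod (\<lambda>u. B u) (\<lambda>u. B u) p"
  have "?z \<in> resolvent_set D (\<lambda>u. B u)"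
  proof (cases "t = 0")
    case True
    then show ?thesis using sect by (simp add: sectorial_def)
  next
    case False
    obtain \<omega> where \<omega>: "0 \<le> \<omega>" "\<omega> < pi"
      "\<And>z. z \<noteq> 0 \<Longrightarrow> \<omega> < \<bar>Arg z\<bar> \<Longrightarrow> z \<in> resolvent_set D (\<lambda>u. B u)"
      using sect unfolding sectorial_def by blast
    have "Arg ?z = pi" using t False by (simp add: Arg_of_real flip: of_real_minus)
    then show ?thesis using \<omega> False by auto
  qed
  then have \<Phi>: "bij_betw ?\<Phi> (D \<times> D) UNIV" and bl: "bounded_linear (resolvent D (\<lambda>u. B u) ?z)"
    by (auto simp: resolvent_set_def)
  have \<Phi>_eq: "?\<Phi> (u, v) = (- ?f u, - ?f v)" for u v
    by (simp add: cscale_def)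
  show bij: "bij_betw ?f D UNIV"
    unfolding bij_betw_def
  proof
    show "inj_on ?f D"
    proof (rule inj_onI)
      fix u v assume "u \<in> D" "v \<in> D" "?f u = ?f v"
      then have "?\<Phi> (u, u) = ?\<Phi> (v, v)" unfolding \<Phi>_eq by simp
      from inj_onD[OF bij_betw_imp_inj_on[OF \<Phi>] this] \<open>u \<in> D\<close> \<open>v \<in> D\<close>
      show "u = v" by blast
    qed
    show "?f ` D = UNIV"
    proof (rule equalityI[OF subset_UNIV], rule subsetI)
      fix y
      have "(- y, - y) \<in> ?\<Phi> ` (D \<times> D)"
        using bij_betw_imp_surj_on[OF \<Phi>] by (simp only: UNIV_I)
      then obtain u v where "u \<in> D" "(- y, - y) = ?\<Phi> (u, v)" by blast
      then have "y = ?f u" unfolding \<Phi>_eq by (metis Pair_inject minus_equation_iff)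
      then show "y \<in> ?f ` D" using \<open>u \<in> D\<close> by blast
    qed
  qed
  have eq: "the_inv_into D ?f \<xi> = fst (resolvent D (\<lambda>u. B u) ?z (- \<xi>, 0))" for \<xi>
  proof -
    let ?u = "the_inv_into D ?f \<xi>"
    have u: "?u \<in> D" "?f ?u = \<xi>"
      using the_inv_into_into[OF bij_betw_imp_inj_on[OF bij], of \<xi> D]
        f_the_inv_into_f_bij_betw[OF bij, of \<xi>] bij_betw_imp_surj_on[OF bij] by auto
    have "?\<Phi> (?u, 0) = (- \<xi>, 0)" unfolding \<Phi>_eq u(2) by (simp add: gen_0)
    then have "resolvent D (\<lambda>u. B u) ?z (- \<xi>, 0) = (?u, 0)"
      unfolding resolvent_def
      by (intro the_inv_into_f_eq bij_betw_imp_inj_on[OF \<Phi>]) (use u gen_0 in auto)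
    then show ?thesis by simp
  qed
  show "bounded_linear (the_inv_into D ?f)"
  proof -
    have "bounded_linear (\<lambda>\<xi>. fst (resolvent D (\<lambda>u. B u) ?z (- \<xi>, 0)))"
      by (intro bounded_linear_fst_comp bounded_linear_compose[OF bl] bounded_linear_Pair
          bounded_linear_minus bounded_linear_ident bounded_linear_zero)
    then show ?thesis unfolding eq[symmetric] .
  qed
  have "norm (the_inv_into D ?f \<xi>) \<le> norm (resolvent D (\<lambda>u. B u) ?z (- \<xi>, 0))"
    unfolding eq by (metis norm_fst_le prod.collapse)
  also have "\<dots> \<le> onorm (resolvent D (\<lambda>u. B u) ?z) * norm (- \<xi>, 0 :: 'a)"
    by (rule onorm[OF bl])
  finally show "norm (the_inv_into D ?f \<xi>) \<le> onorm (resolvent D (\<lambda>u. B u) ?z) * norm \<xi>"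
    by (simp add: norm_Pair)
qed

definition Rs :: "real \<Rightarrow> 'a \<Rightarrow>\<^sub>L 'a" where
  "Rs t = Blinfun (the_inv_into D (\<lambda>u. t *\<^sub>R u + B u))"

lemma Rs_apply: "0 \<le> t \<Longrightarrow> Rs t \<xi> = the_inv_into D (\<lambda>u. t *\<^sub>R u + B u) \<xi>"
  unfolding Rs_def using bounded_linear_shift_inverse bounded_linear_Blinfun_apply by metis

lemma Rs_D: "0 \<le> t \<Longrightarrow> Rs t \<xi> \<in> D"
  and Rs_eq: "0 \<le> t \<Longrightarrow> t *\<^sub>R Rs t \<xi> + B (Rs t \<xi>) = \<xi>"
  using the_inv_into_into[OF bij_betw_imp_inj_on[OF shift_bij], of t \<xi> D]
    f_the_inv_into_f_bij_betw[OF shift_bij, of t \<xi>] bij_betw_imp_surj_on[OF shift_bij, of t]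
  by (auto simp: Rs_apply)

lemma Rs_unique: "\<lbrakk>0 \<le> t; u \<in> D; t *\<^sub>R u + B u = \<xi>\<rbrakk> \<Longrightarrow> Rs t \<xi> = u"
  unfolding Rs_apply using the_inv_into_f_eq[OF bij_betw_imp_inj_on[OF shift_bij]] by simp

lemma Rs0_gen: "u \<in> D \<Longrightarrow> Rs 0 (gen S u) = - u"
  using Rs_unique[of 0 u "- gen S u"] by (simp add: blinfun.minus_right minus_equation_iff)

lemma Rs_resolvent_eq:
  assumes "0 \<le> s" "0 \<le> t"
  shows "Rs s \<xi> - Rs t \<xi> = (t - s) *\<^sub>R Rs s (Rs t \<xi>)"
proof -
  let ?v = "Rs t \<xi>"
  have "Rs s \<xi> = ?v + (t - s) *\<^sub>R Rs s ?v"
  proof (rule Rs_unique[OF assms(1)])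
    have d: "(t - s) *\<^sub>R Rs s ?v \<in> D" "gen S ((t - s) *\<^sub>R Rs s ?v) = (t - s) *\<^sub>R gen S (Rs s ?v)"
      using gen_scaleR[OF Rs_D] assms by auto
    then show "?v + (t - s) *\<^sub>R Rs s ?v \<in> D" using gen_add[OF Rs_D] assms by blast
    have "gen S (?v + (t - s) *\<^sub>R Rs s ?v) = gen S ?v + (t - s) *\<^sub>R gen S (Rs s ?v)"
      using gen_add[OF Rs_D d(1)] d(2) assms by simp
    then have "s *\<^sub>R (?v + (t - s) *\<^sub>R Rs s ?v) + B (?v + (t - s) *\<^sub>R Rs s ?v) =
        s *\<^sub>R ?v + B ?v + (t - s) *\<^sub>R (s *\<^sub>R Rs s ?v + B (Rs s ?v))"
      by (simp add: algebra_simps)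
    also have "\<dots> = t *\<^sub>R ?v + B ?v"
      unfolding Rs_eq[OF assms(1)] by (simp add: algebra_simps)
    also have "\<dots> = \<xi>" by (rule Rs_eq[OF assms(2)])
    finally show "s *\<^sub>R (?v + (t - s) *\<^sub>R Rs s ?v) + B (?v + (t - s) *\<^sub>R Rs s ?v) = \<xi>" .
  qed
  then show ?thesis by simp
qed

definition KR :: real where
  "KR = (SOME K. \<forall>t\<ge>0. norm (Rs t) \<le> K / (1 + t))"

lemma norm_Rs: "0 \<le> t \<Longrightarrow> norm (Rs t) \<le> KR / (1 + t)"
proof -
  have "\<exists>K. \<forall>t\<ge>0. norm (Rs t) \<le> K / (1 + t)"
  proof -
    obtain \<omega> where \<omega>: "0 \<le> \<omega>" "\<omega> < pi"
      "\<And>\<omega>'. \<omega> < \<omega>' \<Longrightarrow> \<omega>' < pi \<Longrightarrow>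
         \<exists>K. \<forall>z. z \<noteq> 0 \<and> \<omega>' < \<bar>Arg z\<bar> \<longrightarrow> cmod z * onorm (resolvent D (\<lambda>u. B u) z) \<le> K"
      using sect unfolding sectorial_def by blast
    obtain K1 where K1: "\<And>z. z \<noteq> 0 \<Longrightarrow> (\<omega> + pi) / 2 < \<bar>Arg z\<bar> \<Longrightarrow>
        cmod z * onorm (resolvent D (\<lambda>u. B u) z) \<le> K1"
      using \<omega>(3)[of "(\<omega> + pi) / 2"] \<omega>(1,2) by auto
    have tR: "t * norm (Rs t) \<le> \<bar>K1\<bar>" if t: "0 < t" for t
    proof -
      let ?z = "complex_of_real (- t)"
      have "Arg ?z = pi" using t by (simp add: Arg_of_real flip: of_real_minus)
      then have o: "t * onorm (resolvent D (\<lambda>u. B u) ?z) \<le> K1"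
        using K1[of ?z] t \<omega> by (simp add: field_simps)
      then have "norm (Rs t \<xi>) \<le> (\<bar>K1\<bar> / t) * norm \<xi>" for \<xi>
      proof -
        have "norm (Rs t \<xi>) \<le> onorm (resolvent D (\<lambda>u. B u) ?z) * norm \<xi>"
          using norm_shift_inverse[of t \<xi>] t by (simp add: Rs_apply)
        also have "\<dots> \<le> (\<bar>K1\<bar> / t) * norm \<xi>"
          using o t by (intro mult_right_mono) (auto simp: field_simps)
        finally show ?thesis .
      qed
      then have "norm (Rs t) \<le> \<bar>K1\<bar> / t" using t by (intro norm_blinfun_bound) auto
      then show ?thesis using t by (simp add: field_simps)
    qed
    have tR0: "t * norm (Rs t) \<le> \<bar>K1\<bar>" if "0 \<le> t" for t
      using tR[of t] that by (cases "t = 0") auto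
    have nR: "norm (Rs t) \<le> norm (Rs 0) + norm (Rs 0) * \<bar>K1\<bar>" if t: "0 \<le> t" for t
    proof -
      have "Rs t = Rs 0 - t *\<^sub>R (Rs 0 o\<^sub>L Rs t)"
      proof (rule blinfun_eqI)
        fix \<xi>
        have "y - x = (t - 0) *\<^sub>R z \<Longrightarrow> x = y - t *\<^sub>R z" for x y z :: 'a
          by (simp add: algebra_simps)
        from this[OF Rs_resolvent_eq[OF order_refl t]]
        show "Rs t \<xi> = (Rs 0 - t *\<^sub>R (Rs 0 o\<^sub>L Rs t)) \<xi>"
          by (simp only: blinfun.diff_left blinfun.scaleR_left blinfun_apply_blinfun_compose)
      qed
      then have "norm (Rs t) = norm (Rs 0 - t *\<^sub>R (Rs 0 o\<^sub>L Rs t))" by (rule arg_cong)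
      also have "\<dots> \<le> norm (Rs 0) + norm (t *\<^sub>R (Rs 0 o\<^sub>L Rs t))"
        by (rule norm_triangle_ineq4)
      also have "norm (t *\<^sub>R (Rs 0 o\<^sub>L Rs t)) = t * norm (Rs 0 o\<^sub>L Rs t)" using t by simp
      also have "\<dots> \<le> t * (norm (Rs 0) * norm (Rs t))"
        using t by (intro mult_left_mono norm_blinfun_compose)
      also have "\<dots> = norm (Rs 0) * (t * norm (Rs t))" by simp
      also have "\<dots> \<le> norm (Rs 0) * \<bar>K1\<bar>" by (intro mult_left_mono tR0 t) auto
      finally show ?thesis by simp
    qed
    have "norm (Rs t) \<le> (norm (Rs 0) + norm (Rs 0) * \<bar>K1\<bar> + \<bar>K1\<bar>) / (1 + t)" if t: "0 \<le> t" for t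
      using nR[OF t] tR0[OF t] t by (simp add: field_simps)
    then show ?thesis by blast
  qed
  then show "0 \<le> t \<Longrightarrow> norm (Rs t) \<le> KR / (1 + t)" unfolding KR_def by (rule someI2_ex) blast
qed

sublocale resolvent_family Rs KR
proof
  show "\<xi> = 0" if "Rs 0 \<xi> = 0" for \<xi>
    using Rs_eq[of 0 \<xi>] that by (simp add: gen_0)
qed (auto intro: Rs_resolvent_eq norm_Rs)

lemma inv_power_eq_P: "inv_power D (\<lambda>u. B u) \<alpha> \<xi> = P \<alpha> \<xi>"
proof -
  have "the_inv_into D (\<lambda>u. B u) = blinfun_apply (Rs 0)"
    by (simp add: Rs_apply fun_eq_iff)
  moreover have "(LINT t:{0<..}|lborel. (t powr (- frac \<alpha>)) *\<^sub>R the_inv_into D (\<lambda>u. t *\<^sub>R u + B u) \<xi>) =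
      L (frac \<alpha>) \<xi>"
    unfolding L_def set_lebesgue_integral_def
    by (intro Bochner_Integration.integral_cong) (auto simp: wt_def indicator_def Rs_apply)
  ultimately show ?thesis by (simp add: inv_power_def P_def J_def)
qed

lemma neg_power_nonpos: "\<eta> \<le> 0 \<Longrightarrow> neg_gen_power S \<eta> \<xi> = P (- \<eta>) \<xi>"
  by (simp add: frac_power_def inv_power_eq_P)

lemma neg_dom_nonpos: "\<eta> \<le> 0 \<Longrightarrow> neg_gen_dom S \<eta> = UNIV"
  by (simp add: frac_dom_def)

lemma neg_dom_pos: "0 < \<eta> \<Longrightarrow> neg_gen_dom S \<eta> = range (P \<eta>)"
  by (simp add: frac_dom_def inv_power_eq_P image_def)

lemma neg_power_P: "0 \<le> \<kappa> \<Longrightarrow> neg_gen_power S \<kappa> (P \<kappa> y) = y"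
proof (cases "\<kappa> = 0")
  case False
  assume "0 \<le> \<kappa>"
  then have k: "0 < \<kappa>" using False by simp
  have "inv_power D (\<lambda>u. B u) \<kappa> = P \<kappa>" by (simp add: fun_eq_iff inv_power_eq_P)
  then show ?thesis
    using k neg_dom_pos[OF k] the_inv_f_f[OF P_inj] by (simp add: frac_power_def)
qed (simp add: neg_power_nonpos)

lemma Rs_S_commute: "\<lbrakk>0 \<le> s; 0 \<le> t\<rbrakk> \<Longrightarrow> S t (Rs s \<xi>) = Rs s (S t \<xi>)"
proof -
  assume st: "0 \<le> s" "0 \<le> t"
  have "Rs s (S t \<xi>) = S t (Rs s \<xi>)"
  proof (rule Rs_unique[OF st(1)])
    show "S t (Rs s \<xi>) \<in> D" using gen_S_commute(1)[OF st(2) Rs_D[OF st(1)]] .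
    have "s *\<^sub>R S t (Rs s \<xi>) + B (S t (Rs s \<xi>)) = S t (s *\<^sub>R Rs s \<xi> + B (Rs s \<xi>))"
      unfolding gen_S_commute(2)[OF st(2) Rs_D[OF st(1)]]
      by (simp only: blinfun.add_right blinfun.scaleR_right blinfun.minus_right)
    then show "s *\<^sub>R S t (Rs s \<xi>) + B (S t (Rs s \<xi>)) = S t \<xi>"
      unfolding Rs_eq[OF st(1)] .
  qed
  then show ?thesis by simp
qed

lemma P_S_commute: "0 \<le> t \<Longrightarrow> S t (P \<alpha> \<xi>) = P \<alpha> (S t \<xi>)"
  by (intro P_commute blinfun.bounded_linear_right Rs_S_commute)

subsection \<open>Smoothing by the semigroup\<close>

definition Q :: "real \<Rightarrow> real \<Rightarrow> 'a \<Rightarrow> 'a" where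
  "Q \<kappa> t \<xi> = P (2 - \<kappa>) (gen S (gen S (S t \<xi>)))"

text \<open>Orbits enter the domain of every power, and \<open>(-A)\<^sup>\<kappa> e\<^sup>A\<^sup>t\<close> factors through
  \<open>A\<^sup>2 e\<^sup>A\<^sup>t\<close>, which is bounded.\<close>

lemma
  assumes \<kappa>: "0 \<le> \<kappa>" "\<kappa> < 2" and t: "0 < t"
  shows P_Q: "P \<kappa> (Q \<kappa> t \<xi>) = S t \<xi>"
    and neg_power_S: "neg_gen_power S \<kappa> (S t \<xi>) = Q \<kappa> t \<xi>"
    and bounded_linear_Q: "bounded_linear (Q \<kappa> t)"
proof -
  have "P 2 = (\<lambda>\<xi>. P 1 (P 1 \<xi>))" using P_add[of 1 1] by simp
  then have "P 2 (gen S (gen S (S t \<xi>))) = S t \<xi>"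
    by (simp add: Rs0_gen gen_S_in_dom[OF t] S_in_dom[OF t] blinfun.minus_right)
  then show PQ: "P \<kappa> (Q \<kappa> t \<xi>) = S t \<xi>"
    using P_add[of \<kappa> "2 - \<kappa>"] \<kappa> by (simp add: Q_def)
  show "neg_gen_power S \<kappa> (S t \<xi>) = Q \<kappa> t \<xi>"
    unfolding PQ[symmetric] by (rule neg_power_P[OF \<kappa>(1)])
  show "bounded_linear (Q \<kappa> t)"
    using bounded_linear_compose[OF bounded_linear_P bounded_linear_gen2_S[OF t]]
    unfolding Q_def[abs_def] .
qed

lemma norm_Q:
  assumes bound: "onorm (\<lambda>\<xi>. neg_gen_power S \<kappa> (S t \<xi>)) \<le> k" and \<kappa>: "0 \<le> \<kappa>" "\<kappa> < 2" and t: "0 < t"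
  shows "norm (Q \<kappa> t \<xi>) \<le> k * norm \<xi>"
proof -
  have "onorm (Q \<kappa> t) \<le> k" using bound unfolding neg_power_S[OF \<kappa> t] by simp
  then show ?thesis
    using onorm[OF bounded_linear_Q[OF \<kappa> t], of \<xi>] by (meson mult_right_mono norm_ge_zero order_trans)
qed

subsection \<open>Measurability of the powers\<close>

text \<open>The domain of \<open>(-A)\<^sup>\<eta>\<close> consists of the points at which the continuous maps
  \<open>(-A)\<^sup>\<eta> e\<^sup>A\<^sup>/\<^sup>n\<close> converge, and their limit is \<open>(-A)\<^sup>\<eta>\<close>; hence both are Borel.\<close>

lemma P_Q_commute:
  assumes t: "0 < t"
  shows "Q \<kappa> t (P \<alpha> y) = P \<alpha> (Q \<kappa> t y)"
proof -
  have "Rs s (gen S u) = gen S (Rs s u)" if "u \<in> D" "0 \<le> s" for s u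
  proof (rule Rs_unique[OF that(2)])
    have e: "gen S (Rs s u) = s *\<^sub>R Rs s u - u"
    proof -
      have "s *\<^sub>R Rs s u - gen S (Rs s u) = u" using Rs_eq[OF that(2), of u] by simp
      moreover have "x - y = z \<Longrightarrow> y = x - z" for x y z :: 'a by (simp add: algebra_simps)
      ultimately show ?thesis by blast
    qed
    have d: "s *\<^sub>R Rs s u \<in> D" "gen S (s *\<^sub>R Rs s u) = s *\<^sub>R gen S (Rs s u)"
      using gen_scaleR[OF Rs_D[OF that(2)]] by auto
    show "gen S (Rs s u) \<in> D" unfolding e using gen_diff[OF d(1) that(1)] by blast
    have "gen S (gen S (Rs s u)) = s *\<^sub>R gen S (Rs s u) - gen S u"
      using gen_diff[OF d(1) that(1)] d(2) e by simp
    then show "s *\<^sub>R gen S (Rs s u) + B (gen S (Rs s u)) = gen S u" by simp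
  qed
  then have "(\<lambda>\<xi>. gen S (gen S (S t \<xi>))) (Rs s \<xi>) = Rs s (gen S (gen S (S t \<xi>)))" if "0 \<le> s" for s \<xi>
    using that t by (simp add: Rs_S_commute S_in_dom gen_S_in_dom)
  from P_commute[OF bounded_linear_gen2_S[OF t] this]
  have "gen S (gen S (S t (P \<alpha> y))) = P \<alpha> (gen S (gen S (S t y)))" by blast
  then show ?thesis
    unfolding Q_def using P_commute[OF bounded_linear_P, of "2 - \<kappa>" \<alpha>]
      P_commute[OF blinfun.bounded_linear_right R_commute] by metis
qed

lemma orbit_sequence: "(\<lambda>n. S (1 / real (Suc n)) y) \<longlonglongrightarrow> y"
proof -
  have "(\<lambda>n. 1 / real (Suc n)) \<longlonglongrightarrow> 0"
    using LIMSEQ_inverse_real_of_nat by (simp add: divide_inverse)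
  from continuous_on_tendsto_compose[OF continuous_orbit this]
  show ?thesis by simp
qed

lemma neg_dom_eq: "0 \<le> \<eta> \<Longrightarrow> neg_gen_dom S \<eta> = range (P \<eta>)"
proof (cases "\<eta> = 0")
  case True
  then show ?thesis by (auto simp: neg_dom_nonpos)
qed (simp add: neg_dom_pos)

lemma neg_power_outside: "\<lbrakk>0 \<le> \<eta>; u \<notin> neg_gen_dom S \<eta>\<rbrakk> \<Longrightarrow> neg_gen_power S \<eta> u = 0"
  by (cases "\<eta> = 0") (auto simp: frac_power_def neg_dom_nonpos)

lemma neg_power_measurable_small:
  assumes \<eta>: "0 \<le> \<eta>" "\<eta> < 2"
  shows "neg_gen_dom S \<eta> \<in> sets borel" "neg_gen_power S \<eta> \<in> borel_measurable borel"
proof -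
  define f where "f n = Q \<eta> (1 / real (Suc n))" for n
  have bl: "bounded_linear (f n)" for n
    unfolding f_def by (rule bounded_linear_Q[OF \<eta>]) simp
  have [measurable]: "f n \<in> borel_measurable borel" for n
    by (intro borel_measurable_continuous_onI linear_continuous_on bl)
  have conv: "(\<lambda>n. f n (P \<eta> y)) \<longlonglongrightarrow> y" for y
  proof -
    have "f n (P \<eta> y) = S (1 / real (Suc n)) y" for n
      unfolding f_def using P_Q_commute[of "1 / real (Suc n)" \<eta> \<eta> y] P_Q[OF \<eta>, of "1 / real (Suc n)" y]
      by simp
    then show ?thesis using orbit_sequence by simp
  qed
  have dom: "u \<in> neg_gen_dom S \<eta>" if "(\<lambda>n. f n u) \<longlonglongrightarrow> v" for u v
  proof -
    have "(\<lambda>n. P \<eta> (f n u)) \<longlonglongrightarrow> P \<eta> v"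
      by (rule bounded_linear.tendsto[OF bounded_linear_P that])
    moreover have "P \<eta> (f n u) = S (1 / real (Suc n)) u" for n
      unfolding f_def using P_Q[OF \<eta>] by simp
    ultimately have "P \<eta> v = u"
      using orbit_sequence[of u] by (simp add: LIMSEQ_unique)
    then show ?thesis unfolding neg_dom_eq[OF \<eta>(1)] by blast
  qed
  have eq: "neg_gen_dom S \<eta> = {u \<in> space borel. Cauchy (\<lambda>n. f n u)}"
  proof (intro equalityI subsetI CollectI conjI)
    fix u assume "u \<in> neg_gen_dom S \<eta>"
    then obtain y where "u = P \<eta> y" unfolding neg_dom_eq[OF \<eta>(1)] by blast
    then show "Cauchy (\<lambda>n. f n u)" using conv[of y] LIMSEQ_imp_Cauchy by blast
  next
    fix u assume "u \<in> {u \<in> space borel. Cauchy (\<lambda>n. f n u)}"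
    then show "u \<in> neg_gen_dom S \<eta>" using dom Cauchy_convergent convergent_def by blast
  qed simp
  show D: "neg_gen_dom S \<eta> \<in> sets borel"
    unfolding eq by measurable
  have "neg_gen_power S \<eta> = (\<lambda>u. if u \<in> neg_gen_dom S \<eta> then lim (\<lambda>n. f n u) else 0)"
  proof (rule ext)
    fix u
    show "neg_gen_power S \<eta> u = (if u \<in> neg_gen_dom S \<eta> then lim (\<lambda>n. f n u) else 0)"
    proof (cases "u \<in> neg_gen_dom S \<eta>")
      case True
      then obtain y where y: "u = P \<eta> y" unfolding neg_dom_eq[OF \<eta>(1)] by blast
      then show ?thesis using True neg_power_P[OF \<eta>(1)] limI[OF conv[of y]] by simp
    qed (simp add: neg_power_outside[OF \<eta>(1)])
  qed
  also have "\<dots> \<in> borel_measurable borel"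
    by (rule measurable_If_set) (use D in auto)
  finally show "neg_gen_power S \<eta> \<in> borel_measurable borel" .
qed

text \<open>The larger power is the composition of two smaller ones, each of them extended by \<open>0\<close>; a point
  is in its domain if it is in the first domain and its image is in the second.\<close>

lemma neg_power_measurable_add:
  assumes ab: "0 \<le> a" "0 \<le> b"
    and a: "neg_gen_dom S a \<in> sets borel" "neg_gen_power S a \<in> borel_measurable borel"
    and b: "neg_gen_dom S b \<in> sets borel" "neg_gen_power S b \<in> borel_measurable borel"
  shows "neg_gen_dom S (a + b) \<in> sets borel" "neg_gen_power S (a + b) \<in> borel_measurable borel"
proof -
  have "0 \<le> a + b" using ab by simp
  note dom_ab = neg_dom_eq[OF this] and pow_ab = neg_power_P[OF this] and out_ab = neg_power_outside[OF this]
  have eq: "neg_gen_dom S (a + b) = neg_gen_dom S a \<inter> (neg_gen_power S a -` neg_gen_dom S b \<inter> space borel)"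
  proof (intro equalityI subsetI)
    fix u assume "u \<in> neg_gen_dom S (a + b)"
    then obtain y where "u = P a (P b y)" unfolding dom_ab using P_add[OF ab] by auto
    then show "u \<in> neg_gen_dom S a \<inter> (neg_gen_power S a -` neg_gen_dom S b \<inter> space borel)"
      using ab by (simp add: neg_dom_eq neg_power_P)
  next
    fix u assume u: "u \<in> neg_gen_dom S a \<inter> (neg_gen_power S a -` neg_gen_dom S b \<inter> space borel)"
    then obtain y where y: "u = P a y" using ab by (auto simp: neg_dom_eq)
    then have "y \<in> neg_gen_dom S b" using u neg_power_P[OF ab(1)] by simp
    then obtain z where "y = P b z" using ab by (auto simp: neg_dom_eq)
    then show "u \<in> neg_gen_dom S (a + b)" unfolding dom_ab using y P_add[OF ab] by simp
  qed
  show D: "neg_gen_dom S (a + b) \<in> sets borel"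
    unfolding eq by (intro sets.Int a(1) measurable_sets[OF a(2) b(1)])
  have "neg_gen_power S (a + b) =
      (\<lambda>u. if u \<in> neg_gen_dom S (a + b) then neg_gen_power S b (neg_gen_power S a u) else 0)"
  proof (rule ext)
    fix u
    show "neg_gen_power S (a + b) u =
        (if u \<in> neg_gen_dom S (a + b) then neg_gen_power S b (neg_gen_power S a u) else 0)"
    proof (cases "u \<in> neg_gen_dom S (a + b)")
      case True
      then obtain y where y: "u = P (a + b) y" unfolding dom_ab by blast
      then have "u = P a (P b y)" using P_add[OF ab] by simp
      then show ?thesis using True pow_ab[of y] y neg_power_P ab by simp
    qed (simp add: out_ab)
  qed
  also have "\<dots> \<in> borel_measurable borel"
  proof (rule measurable_If_set)
    show "(\<lambda>u. neg_gen_power S b (neg_gen_power S a u)) \<in> borel_measurable borel"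
      by (rule measurable_compose[OF a(2) b(2)])
  qed (use D in auto)
  finally show "neg_gen_power S (a + b) \<in> borel_measurable borel" .
qed

lemma neg_power_measurable: "neg_gen_power S \<eta> \<in> borel_measurable borel"
proof -
  have "neg_gen_dom S \<eta> \<in> sets borel \<and> neg_gen_power S \<eta> \<in> borel_measurable borel"
  proof (cases "0 < \<eta>")
    case False
    then have "neg_gen_power S \<eta> = P (- \<eta>)" by (simp add: fun_eq_iff neg_power_nonpos)
    then show ?thesis
      using False linear_continuous_on[OF bounded_linear_P]
      by (simp add: neg_dom_nonpos borel_measurable_continuous_onI)
  next
    case True
    have *: "neg_gen_dom S (real k * 1 + frac \<eta>) \<in> sets borel \<and>
        neg_gen_power S (real k * 1 + frac \<eta>) \<in> borel_measurable borel" for k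
    proof (induction k)
      case 0
      show ?case using neg_power_measurable_small[of "frac \<eta>"] frac_lt_1[of \<eta>] by simp
    next
      case (Suc k)
      have "real (Suc k) * 1 + frac \<eta> = 1 + (real k * 1 + frac \<eta>)" by simp
      then show ?case
        using neg_power_measurable_add[of 1 "real k * 1 + frac \<eta>"] Suc neg_power_measurable_small[of 1]
        by (simp only:) auto
    qed
    have "real (nat \<lfloor>\<eta>\<rfloor>) * 1 + frac \<eta> = \<eta>" using True by (simp add: frac_def)
    then show ?thesis using *[of "nat \<lfloor>\<eta>\<rfloor>"] by (simp only:)
  qed
  then show "neg_gen_power S \<eta> \<in> borel_measurable borel" by auto
qed

subsection \<open>Second differences of orbits\<close>

definition diff2 :: "real \<Rightarrow> real \<Rightarrow> 'a \<Rightarrow> 'a" where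
  "diff2 l h \<xi> = S l \<xi> - 2 *\<^sub>R S (l + h) \<xi> + S (l + 2 * h) \<xi>"

lemma bounded_linear_diff2: "bounded_linear (diff2 l h)"
  unfolding diff2_def
  by (intro bounded_linear_add bounded_linear_sub bounded_linear_scaleR_right
      bounded_linear_compose[OF bounded_linear_scaleR_right] blinfun.bounded_linear_right)

lemma diff2_P:
  assumes "0 \<le> l" "0 \<le> h"
  shows "diff2 l h (P \<alpha> \<xi>) = P \<alpha> (diff2 l h \<xi>)"
proof (rule P_commute[OF bounded_linear_diff2])
  show "diff2 l h (Rs t \<zeta>) = Rs t (diff2 l h \<zeta>)" if "0 \<le> t" for t \<zeta>
    using assms that
    by (simp add: diff2_def Rs_S_commute blinfun.diff_right blinfun.add_right blinfun.scaleR_right)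
qed

lemma diff2_integral:
  fixes \<xi> :: 'a
  assumes "0 \<le> l" "0 \<le> h"
  defines "I \<equiv> \<lambda>t. integral {0..t} (\<lambda>s. S s \<xi>)"
  shows "2 *\<^sub>R I (l + h) - I l - I (l + 2 * h) = P 1 (diff2 l h \<xi>)"
proof -
  have I: "I t \<in> D" "gen S (I t) = S t \<xi> - \<xi>" if "0 \<le> t" for t
    unfolding I_def by (rule gen_integral[OF that])+
  have P1: "P 1 (S t \<xi> - \<xi>) = - I t" if "0 \<le> t" for t
    using Rs0_gen[OF I(1)[OF that]] I(2)[OF that] by simp
  have "diff2 l h \<xi> = (S l \<xi> - \<xi>) - 2 *\<^sub>R (S (l + h) \<xi> - \<xi>) + (S (l + 2 * h) \<xi> - \<xi>)"
    by (simp add: diff2_def algebra_simps scaleR_2)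
  then have "P 1 (diff2 l h \<xi>) = P 1 (S l \<xi> - \<xi>) - 2 *\<^sub>R P 1 (S (l + h) \<xi> - \<xi>) + P 1 (S (l + 2 * h) \<xi> - \<xi>)"
    by (simp only: P_1 blinfun.diff_right blinfun.add_right blinfun.scaleR_right)
  then show ?thesis using assms(1,2) P1[of l] P1[of "l + h"] P1[of "l + 2 * h"] by simp
qed

text \<open>The second difference of the integrated orbit lies in the domain of \<open>(-A)\<^sup>\<nu>\<close>, where
  \<open>(-A)\<^sup>\<nu>\<close> maps it to the second difference of \<open>(-A)\<^sup>-\<^sup>(\<^sup>1\<^sup>+\<^sup>\<eta>\<^sup>-\<^sup>\<nu>\<^sup>) e\<^sup>A\<^sup>t (-A)\<^sup>\<eta> x\<close>,
  a bounded operator applied to \<open>(-A)\<^sup>\<eta> x\<close> whatever the signs of \<open>\<nu>\<close> and \<open>\<eta>\<close>.\<close>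

lemma neg_power_diff2:
  assumes lh: "0 \<le> l" "0 \<le> h" and d: "\<bar>\<eta> - \<nu>\<bar> < 1" and x: "x \<in> neg_gen_dom S \<eta>"
  defines "\<xi> \<equiv> neg_gen_power S \<eta> x"
  shows "P 1 (diff2 l h x) \<in> neg_gen_dom S \<nu>"
    and "neg_gen_power S \<nu> (P 1 (diff2 l h x)) = P (1 + (\<eta> - \<nu>)) (diff2 l h \<xi>)"
proof -
  let ?v = "P (1 + (\<eta> - \<nu>)) (diff2 l h \<xi>)"
  have d': "0 \<le> 1 + (\<eta> - \<nu>)" using d by linarith
  have *: "P 1 (diff2 l h x) = P \<nu> ?v" if "0 < \<nu>"
  proof (cases "0 < \<eta>")
    case True
    then obtain y where y: "x = P \<eta> y" using x by (auto simp: neg_dom_pos)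
    then have "\<xi> = y" unfolding \<xi>_def using True by (simp add: neg_power_P)
    have "P 1 (diff2 l h x) = P 1 (P \<eta> (diff2 l h y))" using y diff2_P lh by simp
    also have "\<dots> = P (1 + \<eta>) (diff2 l h y)" using True by (intro P_add) auto
    also have "\<dots> = P \<nu> ?v" using P_add[of \<nu> "1 + (\<eta> - \<nu>)"] that d' \<open>\<xi> = y\<close> by (simp add: add.commute)
    finally show ?thesis .
  next
    case False
    then have "\<xi> = P (- \<eta>) x" unfolding \<xi>_def by (simp add: neg_power_nonpos)
    then have "P \<nu> ?v = P \<nu> (P (1 + (\<eta> - \<nu>)) (P (- \<eta>) (diff2 l h x)))" using diff2_P lh by simp
    also have "\<dots> = P \<nu> (P (1 + (\<eta> - \<nu>) - \<eta>) (diff2 l h x))"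
      using P_add[OF d', of "- \<eta>"] False by simp
    also have "\<dots> = P 1 (diff2 l h x)" using P_add[of \<nu> "1 - \<nu>"] that False d by simp
    finally show ?thesis by simp
  qed
  have **: "P (- \<nu>) (P 1 (diff2 l h x)) = ?v" if "\<nu> \<le> 0"
  proof (cases "0 < \<eta>")
    case True
    then obtain y where y: "x = P \<eta> y" using x by (auto simp: neg_dom_pos)
    then have "\<xi> = y" unfolding \<xi>_def using True by (simp add: neg_power_P)
    have "P (- \<nu>) (P 1 (diff2 l h x)) = P (- \<nu>) (P (1 + \<eta>) (diff2 l h y))"
      using y diff2_P lh P_add[of 1 \<eta>] True by simp
    also have "\<dots> = ?v" using P_add[of "- \<nu>" "1 + \<eta>"] that True \<open>\<xi> = y\<close> by (simp add: algebra_simps)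
    finally show ?thesis .
  next
    case False
    then have "\<xi> = P (- \<eta>) x" unfolding \<xi>_def by (simp add: neg_power_nonpos)
    then have "?v = P (1 + (\<eta> - \<nu>)) (P (- \<eta>) (diff2 l h x))" using diff2_P lh by simp
    also have "\<dots> = P (1 - \<nu>) (diff2 l h x)" using P_add[OF d', of "- \<eta>"] False by simp
    also have "\<dots> = P (- \<nu>) (P 1 (diff2 l h x))" using P_add[of "- \<nu>" 1] that by simp
    finally show ?thesis by simp
  qed
  show "P 1 (diff2 l h x) \<in> neg_gen_dom S \<nu>"
    using * by (cases "0 < \<nu>") (auto simp: neg_dom_pos neg_dom_nonpos)
  show "neg_gen_power S \<nu> (P 1 (diff2 l h x)) = ?v"
  proof (cases "0 < \<nu>")
    case True
    then show ?thesis using * neg_power_P[of \<nu> ?v] by simp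
  next
    case False
    then show ?thesis using ** by (simp only: neg_power_nonpos not_less)
  qed
qed

end

locale smoothing_bound = sectorial_semigroup S
  for S :: "real \<Rightarrow> 'a::{banach, second_countable_topology} \<Rightarrow>\<^sub>L 'a" +
  fixes c :: "real \<Rightarrow> real" and T d :: real
  assumes d: "\<bar>d\<bar> < 1 / 2" and T: "0 < T"
    and bound: "\<lbrakk>0 \<le> \<kappa>; 0 < t; t \<le> T\<rbrakk> \<Longrightarrow>
      onorm (\<lambda>\<xi>. neg_gen_power S \<kappa> (S t \<xi>)) \<le> c \<kappa> / t powr \<kappa>"
begin

lemma norm_Q_bound:
  "\<lbrakk>0 \<le> \<kappa>; \<kappa> < 2; 0 < t; t \<le> T\<rbrakk> \<Longrightarrow> norm (Q \<kappa> t \<xi>) \<le> c \<kappa> * norm \<xi> * t powr (- \<kappa>)"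
  using norm_Q[OF bound, of \<kappa> t \<xi>] by (simp add: powr_minus divide_inverse ac_simps)

definition G :: "'a \<Rightarrow> real \<Rightarrow> 'a" where
  "G \<xi> a = P (1 + d) (S a \<xi>)"

definition G1 :: "'a \<Rightarrow> real \<Rightarrow> 'a" where
  "G1 \<xi> a = P (1 + d) (gen S (S a \<xi>))"

lemma P_diff2: "P (1 + d) (diff2 s h \<xi>) = (G \<xi> (s + 2 * h) - G \<xi> (s + h)) - (G \<xi> (s + h) - G \<xi> s)"
proof -
  interpret P: bounded_linear "P (1 + d)" by (rule bounded_linear_P)
  show ?thesis
    unfolding diff2_def G_def P.add P.diff P.scaleR by (simp add: scaleR_2 algebra_simps)
qed

lemma continuous_powr_nonneg:
  fixes f :: "real \<Rightarrow> real"
  assumes "continuous_on A f" "\<And>x. x \<in> A \<Longrightarrow> 0 \<le> f x" "0 < p"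
  shows "continuous_on A (\<lambda>x. f x powr p)"
  by (rule continuous_on_powr') (use assms in auto)

lemma continuous_G: "0 \<le> a \<Longrightarrow> continuous_on {a..b} (G \<xi>)"
  unfolding G_def
  by (intro bounded_linear.continuous_on[OF bounded_linear_P] continuous_on_subset[OF continuous_orbit]) auto

lemma deriv_G: "0 < a \<Longrightarrow> (G \<xi> has_vector_derivative G1 \<xi> a) (at a)"
  unfolding G_def[abs_def] G1_def
  by (intro bounded_linear.has_vector_derivative[OF bounded_linear_P] orbit_deriv)

lemma deriv_G1: "0 < a \<Longrightarrow> (G1 \<xi> has_vector_derivative Q (1 - d) a \<xi>) (at a)"
proof -
  assume a: "0 < a"
  have "(G1 \<xi> has_vector_derivative P (1 + d) (gen S (gen S (S a \<xi>)))) (at a)"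
    unfolding G1_def[abs_def]
    by (intro bounded_linear.has_vector_derivative[OF bounded_linear_P] gen_orbit_deriv a)
  then show ?thesis by (simp add: Q_def)
qed

lemma G1_eq: "\<lbrakk>d \<le> 0; 0 < a\<rbrakk> \<Longrightarrow> G1 \<xi> a = - Q (- d) a \<xi>"
proof -
  assume "d \<le> 0" "0 < a"
  have "Q (- d) a \<xi> = P (1 + d) (P 1 (gen S (gen S (S a \<xi>))))"
    using P_add[of "1 + d" 1] d by (simp add: Q_def add.commute)
  also have "\<dots> = - G1 \<xi> a"
    using gen_S_in_dom[OF \<open>0 < a\<close>]
    by (simp add: Rs0_gen G1_def linear_neg[OF bounded_linear.linear[OF bounded_linear_P]])
  finally show ?thesis by simp
qed

lemma continuous_G1: "0 < a \<Longrightarrow> continuous_on {a..b} (G1 \<xi>)"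
  by (intro continuous_at_imp_continuous_on ballI has_vector_derivative_continuous[OF deriv_G1]) auto

lemma G1_increment_regular:
  assumes l: "0 < l" "l \<le> s" and h: "0 < h" and lT: "s + h \<le> T"
  shows "norm (G1 \<xi> (s + h) - G1 \<xi> s) \<le> c (1 - d) * norm \<xi> * l powr (d - 1) * h"
proof -
  let ?C = "c (1 - d) * norm \<xi> * l powr (d - 1)"
  have "norm (G1 \<xi> (s + h) - G1 \<xi> s) \<le> ?C * (s + h) - ?C * s"
  proof (rule differentiable_bound_general[where f' = "\<lambda>a. Q (1 - d) a \<xi>" and \<phi>' = "\<lambda>_. ?C"])
    fix a assume a: "s < a" "a < s + h"
    show "(G1 \<xi> has_vector_derivative Q (1 - d) a \<xi>) (at a)" using a l by (intro deriv_G1) auto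
    show "((\<lambda>a. ?C * a) has_vector_derivative ?C) (at a)"
      by (auto intro!: derivative_eq_intros simp: has_real_derivative_iff_has_vector_derivative[symmetric])
    have b: "norm (Q (1 - d) a \<xi>) \<le> c (1 - d) * norm \<xi> * a powr (d - 1)"
      using norm_Q_bound[of "1 - d" a \<xi>] a l lT d by simp
    then have "0 \<le> c (1 - d) * norm \<xi> * a powr (d - 1)" by (rule order_trans[OF norm_ge_zero])
    moreover have "0 < a powr (d - 1)" using a l by simp
    ultimately have "0 \<le> c (1 - d) * norm \<xi>" by (simp add: zero_le_mult_iff)
    then have "c (1 - d) * norm \<xi> * a powr (d - 1) \<le> ?C"
      using a l d by (intro mult_left_mono powr_mono2') auto
    then show "norm (Q (1 - d) a \<xi>) \<le> ?C" using b by simp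
  qed (use l h in \<open>auto intro!: continuous_G1 continuous_intros\<close>)
  then show ?thesis by (simp add: algebra_simps)
qed

text \<open>A second difference is the increment of a first difference, so a bound of the increments of the
  derivative \<open>G1\<close> can be integrated.\<close>

lemma G_increment:
  assumes s: "0 \<le> s" and h: "0 < h"
    and bd: "\<And>a. s < a \<Longrightarrow> a < s + h \<Longrightarrow> norm (G1 \<xi> (a + h) - G1 \<xi> a) \<le> \<phi>' a"
    and \<phi>: "\<And>a. s < a \<Longrightarrow> a < s + h \<Longrightarrow> (\<phi> has_real_derivative \<phi>' a) (at a)"
    and cont: "continuous_on {s..s + h} \<phi>"
  shows "norm (P (1 + d) (diff2 s h \<xi>)) \<le> \<phi> (s + h) - \<phi> s"
proof -
  let ?F = "\<lambda>a. G \<xi> (a + h) - G \<xi> a"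
  have "norm (?F (s + h) - ?F s) \<le> \<phi> (s + h) - \<phi> s"
  proof (rule differentiable_bound_general)
    have "continuous_on {s..s + h} (\<lambda>a. G \<xi> (a + h))"
      by (rule continuous_on_compose2[OF continuous_G[of 0 "s + 2 * h"]])
         (use s h in \<open>auto intro!: continuous_intros\<close>)
    then show "continuous_on {s..s + h} ?F"
      using s by (intro continuous_on_diff continuous_G)
    fix a assume a: "s < a" "a < s + h"
    have "((G \<xi> \<circ> (\<lambda>a. a + h)) has_vector_derivative (1 *\<^sub>R G1 \<xi> (a + h))) (at a)"
      using a s h by (intro vector_diff_chain_at deriv_G) (auto intro!: derivative_eq_intros)
    then show "(?F has_vector_derivative G1 \<xi> (a + h) - G1 \<xi> a) (at a)"
      using a s by (intro has_vector_derivative_diff deriv_G) (auto simp: o_def)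
    show "(\<phi> has_vector_derivative \<phi>' a) (at a)"
      using \<phi>[OF a] by (simp add: has_real_derivative_iff_has_vector_derivative)
    show "norm (G1 \<xi> (a + h) - G1 \<xi> a) \<le> \<phi>' a" by (rule bd[OF a])
  qed (use h cont in auto)
  moreover have "P (1 + d) (diff2 s h \<xi>) = ?F (s + h) - ?F s"
    by (simp add: P_diff2 algebra_simps)
  ultimately show ?thesis by simp
qed

lemma norm_diff2_regular:
  assumes l: "0 < l" and h: "0 < h" and lT: "l + 2 * h \<le> T"
  shows "norm (P (1 + d) (diff2 l h \<xi>)) \<le> c (1 - d) * norm \<xi> * l powr (d - 1) * h\<^sup>2"
proof -
  let ?C = "c (1 - d) * norm \<xi> * l powr (d - 1) * h"
  have "norm (P (1 + d) (diff2 l h \<xi>)) \<le> ?C * (l + h) - ?C * l"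
  proof (rule G_increment[where \<phi> = "\<lambda>a. ?C * a" and \<phi>' = "\<lambda>_. ?C"])
    show "norm (G1 \<xi> (a + h) - G1 \<xi> a) \<le> ?C" if "l < a" "a < l + h" for a
      using that l h lT by (intro G1_increment_regular) auto
    show "((\<lambda>a. ?C * a) has_real_derivative ?C) (at a)" for a
      by (auto intro!: derivative_eq_intros)
  qed (use l h in \<open>auto intro!: continuous_intros\<close>)
  then show ?thesis by (simp add: algebra_simps power2_eq_square)
qed

text \<open>For \<open>d \<le> 0\<close> the first derivative is \<open>- (-A)\<^sup>-\<^sup>d e\<^sup>A\<^sup>t\<close>, bounded by \<open>c (- d) t\<^sup>d\<close>, and one integration
  reaches \<open>0\<close> because \<open>d > -1\<close>.\<close>

lemma norm_diff2_singular_nonpos: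
  assumes d0: "d \<le> 0" and h: "0 < h" and lT: "2 * h \<le> T"
  shows "norm (P (1 + d) (diff2 0 h \<xi>)) \<le> c (- d) * norm \<xi> * (2 * h) powr (1 + d) / (1 + d)"
proof -
  let ?\<phi> = "\<lambda>a. c (- d) * norm \<xi> * a powr (1 + d) / (1 + d)"
  have d1: "0 < 1 + d" using d by simp
  have incr: "norm (G \<xi> b - G \<xi> a) \<le> ?\<phi> b - ?\<phi> a" if ab: "0 \<le> a" "a < b" "b \<le> T" for a b
  proof (rule differentiable_bound_general[OF ab(2) continuous_G[OF ab(1)]])
    have "continuous_on {a..b} (\<lambda>a. a powr (1 + d))"
      using ab d1 by (intro continuous_powr_nonneg continuous_intros) auto
    from continuous_on_mult_left[OF this, of "c (- d) * norm \<xi> / (1 + d)"]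
    show "continuous_on {a..b} ?\<phi>" by simp
    fix t assume t: "a < t" "t < b"
    show "(G \<xi> has_vector_derivative G1 \<xi> t) (at t)" using t ab by (intro deriv_G) auto
    have "(?\<phi> has_real_derivative c (- d) * norm \<xi> * t powr d) (at t)"
      using t ab d1 by (auto intro!: derivative_eq_intros)
    then show "(?\<phi> has_vector_derivative c (- d) * norm \<xi> * t powr d) (at t)"
      by (simp add: has_real_derivative_iff_has_vector_derivative)
    show "norm (G1 \<xi> t) \<le> c (- d) * norm \<xi> * t powr d"
      using norm_Q_bound[of "- d" t \<xi>] t ab d d0 by (simp add: G1_eq)
  qed
  have "P (1 + d) (diff2 0 h \<xi>) = (G \<xi> (2 * h) - G \<xi> h) - (G \<xi> h - G \<xi> 0)"
    by (simp add: P_diff2)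
  then have "norm (P (1 + d) (diff2 0 h \<xi>)) \<le> norm (G \<xi> (2 * h) - G \<xi> h) + norm (G \<xi> h - G \<xi> 0)"
    by (simp only: norm_triangle_ineq4)
  also have "\<dots> \<le> (?\<phi> (2 * h) - ?\<phi> h) + (?\<phi> h - ?\<phi> 0)"
    using h lT by (intro add_mono incr) auto
  finally show ?thesis using d1 by simp
qed

text \<open>For \<open>d > 0\<close> the second derivative is integrable at \<open>0\<close>, so that the increments of \<open>G1\<close> from \<open>a\<close> to \<open>a + h\<close> are bounded by a
  difference of values of \<open>t\<^sup>d\<close>, which is integrated once more.\<close>

lemma norm_diff2_singular_pos:
  assumes d0: "0 < d" and h: "0 < h" and lT: "2 * h \<le> T"
  shows "norm (P (1 + d) (diff2 0 h \<xi>)) \<le>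
    c (1 - d) * norm \<xi> * ((2 * h) powr (1 + d) - 2 * h powr (1 + d)) / (d * (1 + d))"
proof -
  let ?k = "c (1 - d) * norm \<xi>"
  let ?\<phi> = "\<lambda>a. ?k * ((a + h) powr (1 + d) - a powr (1 + d)) / (d * (1 + d))"
  have incr: "norm (G1 \<xi> (s + h) - G1 \<xi> s) \<le> ?k * (s + h) powr d / d - ?k * s powr d / d"
    if s: "0 < s" "s < h" for s
  proof (rule differentiable_bound_general[where f' = "\<lambda>a. Q (1 - d) a \<xi>"
        and \<phi>' = "\<lambda>a. ?k * a powr (d - 1)"])
    fix a assume a: "s < a" "a < s + h"
    show "(G1 \<xi> has_vector_derivative Q (1 - d) a \<xi>) (at a)" using a s by (intro deriv_G1) auto
    have "((\<lambda>a. ?k * a powr d / d) has_real_derivative ?k * a powr (d - 1)) (at a)"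
      using a s d0 by (auto intro!: derivative_eq_intros)
    then show "((\<lambda>a. ?k * a powr d / d) has_vector_derivative ?k * a powr (d - 1)) (at a)"
      by (simp add: has_real_derivative_iff_has_vector_derivative)
    show "norm (Q (1 - d) a \<xi>) \<le> ?k * a powr (d - 1)"
      using norm_Q_bound[of "1 - d" a \<xi>] a s lT d by simp
  qed (use s h d0 in \<open>auto intro!: continuous_G1 continuous_intros\<close>)
  have "norm (P (1 + d) (diff2 0 h \<xi>)) \<le> ?\<phi> (0 + h) - ?\<phi> 0"
  proof (rule G_increment)
    show "norm (G1 \<xi> (a + h) - G1 \<xi> a) \<le> ?k * (a + h) powr d / d - ?k * a powr d / d"
      if "0 < a" "a < 0 + h" for a using incr[of a] that by simp
    show "(?\<phi> has_real_derivative ?k * (a + h) powr d / d - ?k * a powr d / d) (at a)"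
      if "0 < a" "a < 0 + h" for a
    proof -
      have "(?\<phi> has_real_derivative ?k * ((1 + d) * (a + h) powr d - (1 + d) * a powr d) / (d * (1 + d))) (at a)"
        using that d0 h by (auto intro!: derivative_eq_intros)
      moreover have "?k * ((1 + d) * (a + h) powr d - (1 + d) * a powr d) / (d * (1 + d)) =
          ?k * (a + h) powr d / d - ?k * a powr d / d"
      proof -
        have "k * ((1 + d) * x - (1 + d) * y) / (d * (1 + d)) = k * x / d - k * y / d" for k x y :: real
          using d0 by (simp add: divide_simps) (simp add: algebra_simps)
        then show ?thesis .
      qed
      ultimately show ?thesis by (simp only:)
    qed
    have 1: "continuous_on {0..0 + h} (\<lambda>a. a powr (1 + d))"
      by (rule continuous_powr_nonneg) (use d0 in \<open>auto intro!: continuous_intros\<close>)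
    have 2: "continuous_on {0..0 + h} (\<lambda>a. (a + h) powr (1 + d))"
      by (rule continuous_powr_nonneg) (use d0 h in \<open>auto intro!: continuous_intros\<close>)
    from continuous_on_mult_left[OF continuous_on_diff[OF 2 1], of "?k / (d * (1 + d))"]
    show "continuous_on {0..0 + h} ?\<phi>" by simp
  qed (use h in auto)
  also have "\<dots> = ?k * ((2 * h) powr (1 + d) - 2 * h powr (1 + d)) / (d * (1 + d))"
  proof -
    have "h + h = 2 * h" "0 powr (1 + d) = 0" by simp_all
    have "k * (x - y) / m - k * (y - 0) / m = k * (x - 2 * y) / m" for k x y m :: real
      by (simp add: divide_simps) (simp add: algebra_simps)
    from this[of ?k "(2 * h) powr (1 + d)" "h powr (1 + d)" "d * (1 + d)"]
    show ?thesis by (simp only: add_0_left \<open>h + h = 2 * h\<close> \<open>0 powr (1 + d) = 0\<close>)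
  qed
  finally show ?thesis .
qed

end

section \<open>Square integrable variables and least squares\<close>

context prob_space
begin

text \<open>Square integrable functions are not identified when they agree almost everywhere: \<open>ip\<close> is a
  semi-inner product, and projections are only unique up to null functions.\<close>

definition sq :: "('a \<Rightarrow> real) \<Rightarrow> bool" where
  "sq X \<longleftrightarrow> X \<in> borel_measurable M \<and> integrable M (\<lambda>\<omega>. (X \<omega>)\<^sup>2)"

definition ip :: "('a \<Rightarrow> real) \<Rightarrow> ('a \<Rightarrow> real) \<Rightarrow> real" where
  "ip X Y = expectation (\<lambda>\<omega>. X \<omega> * Y \<omega>)"

lemma sq_measurable: "sq X \<Longrightarrow> X \<in> borel_measurable M"
  by (simp add: sq_def)

lemma sq_integrable_mult:
  assumes "sq X" "sq Y"
  shows "integrable M (\<lambda>\<omega>. X \<omega> * Y \<omega>)"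
proof (rule Bochner_Integration.integrable_bound)
  show "integrable M (\<lambda>\<omega>. (X \<omega>)\<^sup>2 + (Y \<omega>)\<^sup>2)" using assms by (simp add: sq_def)
  have "\<bar>x * y\<bar> \<le> x\<^sup>2 + y\<^sup>2" for x y :: real
  proof -
    have "0 \<le> x\<^sup>2 + y\<^sup>2" "2 * (x * y) \<le> x\<^sup>2 + y\<^sup>2" "- 2 * (x * y) \<le> x\<^sup>2 + y\<^sup>2"
      using sum_squares_bound[of x y] sum_squares_bound[of "- x" y] by simp_all
    then show ?thesis by (intro abs_leI) linarith+
  qed
  then show "AE \<omega> in M. norm (X \<omega> * Y \<omega>) \<le> norm ((X \<omega>)\<^sup>2 + (Y \<omega>)\<^sup>2)"
    by (intro AE_I2) (auto intro: order_trans[OF _ abs_ge_self])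
qed (use assms in \<open>auto simp: sq_def\<close>)

lemma sq_const [simp, intro]: "sq (\<lambda>_. c)"
  by (simp add: sq_def)

lemma sq_integrable: "sq X \<Longrightarrow> integrable M X"
  using sq_integrable_mult[of X "\<lambda>_. 1"] by simp

lemma sq_cmult [intro]: "sq X \<Longrightarrow> sq (\<lambda>\<omega>. c * X \<omega>)"
  by (auto simp: sq_def power_mult_distrib)

lemma sq_add [intro]: "sq X \<Longrightarrow> sq Y \<Longrightarrow> sq (\<lambda>\<omega>. X \<omega> + Y \<omega>)"
  using sq_integrable_mult[of X Y] by (auto simp: sq_def power2_sum mult.assoc)

lemma sq_diff [intro]: "sq X \<Longrightarrow> sq Y \<Longrightarrow> sq (\<lambda>\<omega>. X \<omega> - Y \<omega>)"
  using sq_add[of X "\<lambda>\<omega>. (-1) * Y \<omega>"] sq_cmult[of Y "-1"] by simp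

lemma sq_sum [intro]: "(\<And>j. j \<in> F \<Longrightarrow> sq (X j)) \<Longrightarrow> sq (\<lambda>\<omega>. \<Sum>j\<in>F. X j \<omega>)"
  by (induction F rule: infinite_finite_induct) auto

lemma sq_lincomb [intro]: "(\<And>j. j \<in> F \<Longrightarrow> sq (X j)) \<Longrightarrow> sq (\<lambda>\<omega>. \<Sum>j\<in>F. a j * X j \<omega>)"
  by (intro sq_sum sq_cmult)

lemma ip_commute: "ip X Y = ip Y X"
  by (simp add: ip_def mult.commute)

lemma ip_add_left: "\<lbrakk>sq X; sq Y; sq Z\<rbrakk> \<Longrightarrow> ip (\<lambda>\<omega>. X \<omega> + Y \<omega>) Z = ip X Z + ip Y Z"
  unfolding ip_def using sq_integrable_mult by (simp add: distrib_right)

lemma ip_diff_left: "\<lbrakk>sq X; sq Y; sq Z\<rbrakk> \<Longrightarrow> ip (\<lambda>\<omega>. X \<omega> - Y \<omega>) Z = ip X Z - ip Y Z"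
  unfolding ip_def using sq_integrable_mult by (simp add: left_diff_distrib)

lemma ip_cmult_left: "ip (\<lambda>\<omega>. c * X \<omega>) Z = c * ip X Z"
  unfolding ip_def by (simp add: mult.assoc)

lemma ip_add_right: "\<lbrakk>sq X; sq Y; sq Z\<rbrakk> \<Longrightarrow> ip Z (\<lambda>\<omega>. X \<omega> + Y \<omega>) = ip Z X + ip Z Y"
  using ip_add_left[of X Y Z] by (simp add: ip_commute[of Z])

lemma ip_diff_right: "\<lbrakk>sq X; sq Y; sq Z\<rbrakk> \<Longrightarrow> ip Z (\<lambda>\<omega>. X \<omega> - Y \<omega>) = ip Z X - ip Z Y"
  using ip_diff_left[of X Y Z] by (simp add: ip_commute[of Z])

lemma ip_cmult_right: "ip Z (\<lambda>\<omega>. c * X \<omega>) = c * ip Z X"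
  using ip_cmult_left[of c X Z] by (simp add: ip_commute[of Z])

lemma ip_lincomb_left:
  assumes "\<And>j. j \<in> F \<Longrightarrow> sq (X j)" "sq Z"
  shows "ip (\<lambda>\<omega>. \<Sum>j\<in>F. a j * X j \<omega>) Z = (\<Sum>j\<in>F. a j * ip (X j) Z)"
  using assms(1)
proof (induction F rule: infinite_finite_induct)
  case (insert x F)
  then have "ip (\<lambda>\<omega>. a x * X x \<omega> + (\<Sum>j\<in>F. a j * X j \<omega>)) Z =
      ip (\<lambda>\<omega>. a x * X x \<omega>) Z + ip (\<lambda>\<omega>. \<Sum>j\<in>F. a j * X j \<omega>) Z"
    using assms(2) by (intro ip_add_left sq_cmult sq_lincomb) auto
  then show ?case using insert by (simp add: ip_cmult_left)
qed (auto simp: ip_def)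

lemma ip_lincomb_right:
  assumes "\<And>j. j \<in> F \<Longrightarrow> sq (X j)" "sq Z"
  shows "ip Z (\<lambda>\<omega>. \<Sum>j\<in>F. a j * X j \<omega>) = (\<Sum>j\<in>F. a j * ip Z (X j))"
  using ip_lincomb_left[OF assms] by (simp add: ip_commute[of Z])

lemma ip_self_nonneg [simp]: "0 \<le> ip X X"
  unfolding ip_def by (intro Bochner_Integration.integral_nonneg) simp

lemma ip_self: "ip X X = expectation (\<lambda>\<omega>. (X \<omega>)\<^sup>2)"
  by (simp add: ip_def power2_eq_square)

lemma ip_Cauchy_Schwarz:
  assumes "sq X" "sq Y"
  shows "(ip X Y)\<^sup>2 \<le> ip X X * ip Y Y"
proof -
  have *: "0 \<le> ip X X + 2 * t * ip X Y + t\<^sup>2 * ip Y Y" for t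
  proof -
    have "0 \<le> ip (\<lambda>\<omega>. X \<omega> + t * Y \<omega>) (\<lambda>\<omega>. X \<omega> + t * Y \<omega>)" by simp
    also have "\<dots> = ip X X + 2 * t * ip X Y + t\<^sup>2 * ip Y Y"
      using assms sq_cmult[OF assms(2), of t]
      by (simp add: ip_add_left ip_add_right ip_cmult_left ip_cmult_right sq_add ip_commute[of Y X]
          power2_eq_square algebra_simps)
    finally show ?thesis .
  qed
  show ?thesis
  proof (cases "ip Y Y = 0")
    case True
    have "ip X Y = 0"
    proof (rule ccontr)
      assume ne: "ip X Y \<noteq> 0"
      have "0 \<le> ip X X + 2 * (- (ip X X + 1) / (2 * ip X Y)) * ip X Y"
        using *[of "- (ip X X + 1) / (2 * ip X Y)"] True by simp
      also have "\<dots> = - 1" using ne by (simp add: field_simps)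
      finally show False by simp
    qed
    then show ?thesis by simp
  next
    case False
    then have pos: "0 < ip Y Y" using ip_self_nonneg[of Y] by linarith
    have "0 \<le> ip X X + 2 * (- ip X Y / ip Y Y) * ip X Y + (- ip X Y / ip Y Y)\<^sup>2 * ip Y Y" by (rule *)
    also have "\<dots> = ip X X - (ip X Y)\<^sup>2 / ip Y Y"
      using pos by (simp add: power2_eq_square divide_simps)
    finally show ?thesis using pos by (simp add: field_simps)
  qed
qed

lemma ip_null: "\<lbrakk>sq X; sq Y; ip X X = 0\<rbrakk> \<Longrightarrow> ip X Y = 0"
  using ip_Cauchy_Schwarz[of X Y] by simp

text \<open>Least squares: orthogonalise the last generator against the others. If nothing is left
  of it, it is irrelevant, otherwise its coefficient is determined.\<close>

lemma projection_exists:
  assumes "finite F" and "\<And>j. j \<in> F \<Longrightarrow> sq (Y j)" and "sq U"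
  shows "\<exists>a. \<forall>k\<in>F. ip (\<lambda>\<omega>. U \<omega> - (\<Sum>j\<in>F. a j * Y j \<omega>)) (Y k) = 0"
  using assms
proof (induction F arbitrary: U rule: finite_induct)
  case (insert i F)
  note Y = insert.prems(1)
  have YF: "\<And>j. j \<in> F \<Longrightarrow> sq (Y j)" using Y by simp
  obtain a where a: "\<And>k. k \<in> F \<Longrightarrow> ip (\<lambda>\<omega>. U \<omega> - (\<Sum>j\<in>F. a j * Y j \<omega>)) (Y k) = 0"
    using insert.IH[OF YF insert.prems(2)] by blast
  obtain b where b: "\<And>k. k \<in> F \<Longrightarrow> ip (\<lambda>\<omega>. Y i \<omega> - (\<Sum>j\<in>F. b j * Y j \<omega>)) (Y k) = 0"
    using insert.IH[OF YF, of "Y i"] Y by auto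
  define V where "V = (\<lambda>\<omega>. U \<omega> - (\<Sum>j\<in>F. a j * Y j \<omega>))"
  define Z where "Z = (\<lambda>\<omega>. Y i \<omega> - (\<Sum>j\<in>F. b j * Y j \<omega>))"
  have sqV: "sq V" unfolding V_def by (intro sq_diff sq_lincomb insert.prems(2) YF)
  have sqZ: "sq Z" unfolding Z_def by (intro sq_diff sq_lincomb YF Y) simp_all
  define c where "c = (if ip Z Z = 0 then 0 else ip V Z / ip Z Z)"
  have cZ: "ip V Z = c * ip Z Z"
    using ip_null[OF sqZ sqV] by (auto simp: c_def ip_commute)
  define W where "W = (\<lambda>\<omega>. V \<omega> - c * Z \<omega>)"
  have sqW: "sq W" unfolding W_def using sqV sqZ by auto
  have WF: "ip W (Y k) = 0" if "k \<in> F" for k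
    using a[OF that] b[OF that] Y that sqV sqZ
    unfolding W_def by (subst ip_diff_left) (auto simp: ip_cmult_left V_def Z_def)
  have "ip W Z = 0"
    using cZ sqV sqZ unfolding W_def by (subst ip_diff_left) (auto simp: ip_cmult_left)
  moreover have "Y i = (\<lambda>\<omega>. Z \<omega> + (\<Sum>j\<in>F. b j * Y j \<omega>))" unfolding Z_def by simp
  ultimately have Wi: "ip W (Y i) = 0"
    using ip_add_right[OF sqZ sq_lincomb[where F = F and X = Y and a = b] sqW]
      ip_lincomb_right[where F = F and X = Y and Z = W and a = b] YF sqW WF by simp
  define a' where "a' j = (if j = i then c else a j - c * b j)" for j
  have "(\<lambda>\<omega>. U \<omega> - (\<Sum>j\<in>insert i F. a' j * Y j \<omega>)) = W"
  proof
    fix \<omega>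
    have "(\<Sum>j\<in>F. a' j * Y j \<omega>) = (\<Sum>j\<in>F. a j * Y j \<omega>) - c * (\<Sum>j\<in>F. b j * Y j \<omega>)"
    proof -
      have "(\<Sum>j\<in>F. a' j * Y j \<omega>) = (\<Sum>j\<in>F. a j * Y j \<omega> - c * (b j * Y j \<omega>))"
        using insert.hyps by (intro sum.cong) (auto simp: a'_def algebra_simps)
      then show ?thesis by (simp add: sum_subtractf sum_distrib_left)
    qed
    then show "U \<omega> - (\<Sum>j\<in>insert i F. a' j * Y j \<omega>) = W \<omega>"
      using insert.hyps by (simp add: W_def V_def Z_def a'_def algebra_simps)
  qed
  then show ?case using WF Wi by (intro exI[of _ a']) auto
qed simp

text \<open>The gain from additional observations \<open>s q + v q\<close>, each of which consists of a signal
  \<open>s q\<close> and a noise \<open>v q\<close> that is uncorrelated with everything else. The increment of the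
  estimate is a combination of the innovations of these observations, with coefficients that are
  controlled from below through the noise and from above through the signal.\<close>

lemma innovation_bound:
  assumes fin: "finite F" "finite K"
    and sqY: "\<And>j. j \<in> F \<Longrightarrow> sq (Y j)" and sqs: "\<And>q. q \<in> K \<Longrightarrow> sq (s q)"
    and sqv: "\<And>q. q \<in> K \<Longrightarrow> sq (v q)" and sqU: "sq U"
    and vY: "\<And>q j. \<lbrakk>q \<in> K; j \<in> F\<rbrakk> \<Longrightarrow> ip (v q) (Y j) = 0"
    and vU: "\<And>q. q \<in> K \<Longrightarrow> ip (v q) U = 0"
    and vs: "\<And>q q'. \<lbrakk>q \<in> K; q' \<in> K\<rbrakk> \<Longrightarrow> ip (v q) (s q') = 0"
    and \<mu>: "0 < \<mu>"
    and coercive: "\<And>a. \<mu> * (\<Sum>q\<in>K. (a q)\<^sup>2) \<le>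
      ip (\<lambda>\<omega>. \<Sum>q\<in>K. a q * v q \<omega>) (\<lambda>\<omega>. \<Sum>q\<in>K. a q * v q \<omega>)"
    and p: "p = (\<lambda>\<omega>. \<Sum>j\<in>F. b j * Y j \<omega>)" "\<And>j. j \<in> F \<Longrightarrow> ip (\<lambda>\<omega>. U \<omega> - p \<omega>) (Y j) = 0"
    and p': "p' = (\<lambda>\<omega>. (\<Sum>j\<in>F. b' j * Y j \<omega>) + (\<Sum>q\<in>K. a q * (s q \<omega> + v q \<omega>)))"
      "\<And>j. j \<in> F \<Longrightarrow> ip (\<lambda>\<omega>. U \<omega> - p' \<omega>) (Y j) = 0"
      "\<And>q. q \<in> K \<Longrightarrow> ip (\<lambda>\<omega>. U \<omega> - p' \<omega>) (\<lambda>\<omega>. s q \<omega> + v q \<omega>) = 0"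
  shows "ip (\<lambda>\<omega>. p' \<omega> - p \<omega>) (\<lambda>\<omega>. p' \<omega> - p \<omega>) \<le>
    ip (\<lambda>\<omega>. U \<omega> - p \<omega>) (\<lambda>\<omega>. U \<omega> - p \<omega>) * (\<Sum>q\<in>K. ip (s q) (s q)) / \<mu>"
proof -
  define Up where "Up = (\<lambda>\<omega>. U \<omega> - p \<omega>)"
  define Up' where "Up' = (\<lambda>\<omega>. U \<omega> - p' \<omega>)"
  define D where "D = (\<lambda>\<omega>. p' \<omega> - p \<omega>)"
  have sqp: "sq p" and sqp': "sq p'"
    unfolding p(1) p'(1) using sqY sqs sqv by (auto intro!: sq_add sq_lincomb)
  have sqUp: "sq Up" and sqUp': "sq Up'" and sqD: "sq D"
    unfolding Up_def Up'_def D_def using sqp sqp' sqU by auto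
  have "\<forall>q\<in>K. \<exists>g. \<forall>k\<in>F. ip (\<lambda>\<omega>. s q \<omega> - (\<Sum>j\<in>F. g j * Y j \<omega>)) (Y k) = 0"
  proof
    fix q assume "q \<in> K"
    then show "\<exists>g. \<forall>k\<in>F. ip (\<lambda>\<omega>. s q \<omega> - (\<Sum>j\<in>F. g j * Y j \<omega>)) (Y k) = 0"
      by (intro projection_exists[OF fin(1)] sqY sqs)
  qed
  from bchoice[OF this]
  obtain g where g: "\<And>q k. \<lbrakk>q \<in> K; k \<in> F\<rbrakk> \<Longrightarrow> ip (\<lambda>\<omega>. s q \<omega> - (\<Sum>j\<in>F. g q j * Y j \<omega>)) (Y k) = 0"
    by blast
  \<comment> \<open>Split each signal into the part \<open>\<pi> q\<close> that is predictable from the old observations and an orthogonal rest \<open>t q\<close>;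
    the innovation is \<open>t q + v q\<close>.\<close>
  define \<pi> where "\<pi> q = (\<lambda>\<omega>. \<Sum>j\<in>F. g q j * Y j \<omega>)" for q
  define t where "t q = (\<lambda>\<omega>. s q \<omega> - \<pi> q \<omega>)" for q
  have sq\<pi>: "sq (\<pi> q)" for q unfolding \<pi>_def using sqY by auto
  have sqt: "sq (t q)" if "q \<in> K" for q unfolding t_def using sqs[OF that] sq\<pi> by auto
  have tY: "ip (t q) (Y k) = 0" if "q \<in> K" "k \<in> F" for q k
    using g[OF that] by (simp add: t_def \<pi>_def)
  have linR: "ip Z (\<lambda>\<omega>. \<Sum>j\<in>F. e j * Y j \<omega>) = (\<Sum>j\<in>F. e j * ip Z (Y j))" if "sq Z" for Z e
    by (rule ip_lincomb_right[where F = F and X = Y and Z = Z and a = e]) (use sqY that in auto)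
  have tspan: "ip (t q) (\<lambda>\<omega>. \<Sum>j\<in>F. e j * Y j \<omega>) = 0" if "q \<in> K" for q e
    using linR[OF sqt[OF that]] tY[OF that] by simp
  have vspan: "ip (v q) (\<lambda>\<omega>. \<Sum>j\<in>F. e j * Y j \<omega>) = 0" if "q \<in> K" for q e
    using linR[OF sqv[OF that]] vY[OF that] by simp
  have vt: "ip (v q) (t q') = 0" if "q \<in> K" "q' \<in> K" for q q'
  proof -
    have "ip (v q) (t q') = ip (v q) (s q') - ip (v q) (\<pi> q')"
      unfolding t_def using sqs sq\<pi> sqv that by (intro ip_diff_right) auto
    then show ?thesis using vs[OF that] vspan[OF that(1)] by (simp add: \<pi>_def)
  qed
  define T where "T = (\<lambda>\<omega>. \<Sum>q\<in>K. a q * t q \<omega>)"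
  define V where "V = (\<lambda>\<omega>. \<Sum>q\<in>K. a q * v q \<omega>)"
  define E where "E = (\<lambda>\<omega>. T \<omega> + V \<omega>)"
  have sqT: "sq T" and sqV: "sq V" unfolding T_def V_def using sqt sqv by auto
  then have sqE: "sq E" unfolding E_def by auto
  have TV: "ip V T = 0"
  proof -
    have "ip V T = (\<Sum>q\<in>K. a q * ip (v q) T)"
      unfolding V_def by (rule ip_lincomb_left[OF _ sqT]) (rule sqv)
    moreover have "ip (v q) T = (\<Sum>q'\<in>K. a q' * ip (v q) (t q'))" if "q \<in> K" for q
      unfolding T_def by (rule ip_lincomb_right[OF _ sqv[OF that]]) (rule sqt)
    ultimately show ?thesis by (simp add: vt)
  qed
  \<comment> \<open>\<open>N\<close> is both in the span of the old observations and orthogonal to it.\<close>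
  define N where "N = (\<lambda>\<omega>. D \<omega> - E \<omega>)"
  have sqN: "sq N" unfolding N_def using sqD sqE by auto
  define e where "e j = b' j - b j + (\<Sum>q\<in>K. a q * g q j)" for j
  have N_span: "N = (\<lambda>\<omega>. \<Sum>j\<in>F. e j * Y j \<omega>)"
  proof
    fix \<omega>
    have "N \<omega> = (\<Sum>j\<in>F. b' j * Y j \<omega>) - (\<Sum>j\<in>F. b j * Y j \<omega>) + (\<Sum>q\<in>K. a q * \<pi> q \<omega>)"
      unfolding N_def D_def E_def T_def V_def p(1) p'(1) t_def
      by (simp add: algebra_simps sum.distrib sum_subtractf)
    also have "(\<Sum>q\<in>K. a q * \<pi> q \<omega>) = (\<Sum>j\<in>F. (\<Sum>q\<in>K. a q * g q j) * Y j \<omega>)"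
      unfolding \<pi>_def sum_distrib_left sum_distrib_right
      by (subst sum.swap) (simp add: mult.assoc)
    finally show "N \<omega> = (\<Sum>j\<in>F. e j * Y j \<omega>)"
      by (simp add: e_def algebra_simps sum.distrib sum_subtractf)
  qed
  have D_eq: "D = (\<lambda>\<omega>. Up \<omega> - Up' \<omega>)" by (simp add: D_def Up_def Up'_def)
  have DY: "ip D (Y j) = 0" if "j \<in> F" for j
    using p(2)[OF that] p'(2)[OF that] sqUp sqUp' sqY[OF that]
    unfolding D_eq by (simp add: ip_diff_left Up_def[symmetric] Up'_def[symmetric])
  have EY: "ip E (Y j) = 0" if "j \<in> F" for j
  proof -
    have "ip T (Y j) = (\<Sum>q\<in>K. a q * ip (t q) (Y j))"
      unfolding T_def by (rule ip_lincomb_left[OF _ sqY[OF that]]) (rule sqt)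
    moreover have "ip V (Y j) = (\<Sum>q\<in>K. a q * ip (v q) (Y j))"
      unfolding V_def by (rule ip_lincomb_left[OF _ sqY[OF that]]) (rule sqv)
    ultimately have "ip T (Y j) = 0" "ip V (Y j) = 0" using tY vY that by simp_all
    then
    show ?thesis unfolding E_def using sqT sqV sqY[OF that] by (simp add: ip_add_left)
  qed
  have "ip N (Y j) = 0" if "j \<in> F" for j
    unfolding N_def using DY EY that sqD sqE sqY by (simp add: ip_diff_left)
  then have "ip N N = 0"
    using linR[OF sqN, of e] by (simp add: N_span[symmetric])
  then have Nnull: "ip N X = 0" if "sq X" for X using ip_null sqN that by blast
  have DN: "D = (\<lambda>\<omega>. N \<omega> + E \<omega>)" by (simp add: N_def)
  have ipDE: "ip D X = ip E X" if "sq X" for X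
    using ip_add_left[OF sqN sqE that] Nnull[OF that] by (subst DN) simp
  then have DD: "ip D D = ip E E" and DE: "ip D E = ip D D"
    using ipDE[OF sqD] ipDE[OF sqE] ip_commute[of D E] by simp_all
  \<comment> \<open>The noise does not enter \<open>\<beta> q\<close>, the inner product of the old error with the innovation.\<close>
  define \<beta> where "\<beta> q = ip Up (t q)" for q
  have "ip D (\<lambda>\<omega>. t q \<omega> + v q \<omega>) = \<beta> q" if q: "q \<in> K" for q
  proof -
    have sqtv: "sq (\<lambda>\<omega>. t q \<omega> + v q \<omega>)" using sqt sqv q by auto
    have sqsv: "sq (\<lambda>\<omega>. s q \<omega> + v q \<omega>)" using sqs sqv q by auto
    have "ip Up' (\<pi> q) = 0"
      unfolding \<pi>_def using linR[OF sqUp'] p'(2) by (simp add: Up'_def)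
    moreover have "(\<lambda>\<omega>. t q \<omega> + v q \<omega>) = (\<lambda>\<omega>. (s q \<omega> + v q \<omega>) - \<pi> q \<omega>)" by (auto simp: t_def)
    ultimately have "ip Up' (\<lambda>\<omega>. t q \<omega> + v q \<omega>) = 0"
      using ip_diff_right[OF sqsv sq\<pi> sqUp'] p'(3)[OF q] by (simp add: Up'_def)
    moreover have "ip Up (v q) = 0"
    proof -
      have "ip (v q) Up = ip (v q) U - ip (v q) p"
        unfolding Up_def using sqU sqp sqv[OF q] by (rule ip_diff_right)
      then show ?thesis using vU[OF q] vspan[OF q] by (simp add: p(1) ip_commute[of Up])
    qed
    ultimately show ?thesis
      unfolding D_eq using ip_diff_left[OF sqUp sqUp' sqtv] ip_add_right[OF sqt[OF q] sqv[OF q] sqUp]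
      by (simp add: \<beta>_def)
  qed
  moreover have "E = (\<lambda>\<omega>. \<Sum>q\<in>K. a q * (t q \<omega> + v q \<omega>))"
    by (simp add: E_def T_def V_def sum.distrib algebra_simps)
  ultimately have DE_sum: "ip D D = (\<Sum>q\<in>K. a q * \<beta> q)"
    using ip_lincomb_right[where F = K and X = "\<lambda>q \<omega>. t q \<omega> + v q \<omega>" and Z = D and a = a] sqt sqv sqD DE
    by (simp add: sq_add)
  have "ip E E = ip T T + ip V V"
    unfolding E_def using sqT sqV TV by (simp add: ip_add_left ip_add_right sq_add ip_commute[of T V])
  then have lower: "\<mu> * (\<Sum>q\<in>K. (a q)\<^sup>2) \<le> ip D D"
    using coercive[of a] DD ip_self_nonneg[of T] unfolding V_def by linarith
  define S2 where "S2 = (\<Sum>q\<in>K. ip (s q) (s q))"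
  have "(\<beta> q)\<^sup>2 \<le> ip Up Up * ip (s q) (s q)" if q: "q \<in> K" for q
  proof -
    have "s q = (\<lambda>\<omega>. t q \<omega> + \<pi> q \<omega>)" by (simp add: t_def)
    moreover have "ip (t q) (\<pi> q) = 0" "ip (\<pi> q) (t q) = 0"
      using tspan[OF q, of "g q"] ip_commute[of "\<pi> q" "t q"] by (simp_all add: \<pi>_def)
    ultimately have "ip (s q) (s q) = ip (t q) (t q) + ip (\<pi> q) (\<pi> q)"
      using sqt[OF q] sq\<pi>[of q] by (simp add: ip_add_left ip_add_right sq_add)
    then have "ip (t q) (t q) \<le> ip (s q) (s q)" by simp
    then show ?thesis
      using ip_Cauchy_Schwarz[OF sqUp sqt[OF q]] unfolding \<beta>_def
      by (meson ip_self_nonneg mult_left_mono order_trans)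
  qed
  then have "(\<Sum>q\<in>K. (\<beta> q)\<^sup>2) \<le> ip Up Up * S2"
    unfolding S2_def sum_distrib_left by (intro sum_mono)
  moreover have "(ip D D)\<^sup>2 \<le> (\<Sum>q\<in>K. (a q)\<^sup>2) * (\<Sum>q\<in>K. (\<beta> q)\<^sup>2)"
    unfolding DE_sum by (rule Cauchy_Schwarz_ineq_sum)
  ultimately have "(ip D D)\<^sup>2 \<le> (\<Sum>q\<in>K. (a q)\<^sup>2) * (ip Up Up * S2)"
    by (meson mult_left_mono order_trans sum_nonneg zero_le_power2)
  also have "\<dots> \<le> ip D D / \<mu> * (ip Up Up * S2)"
  proof (rule mult_right_mono)
    show "(\<Sum>q\<in>K. (a q)\<^sup>2) \<le> ip D D / \<mu>" using lower \<mu> by (simp add: field_simps)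
    show "0 \<le> ip Up Up * S2" by (simp add: S2_def sum_nonneg)
  qed
  finally have "ip D D * ip D D \<le> ip D D * (ip Up Up * S2 / \<mu>)" by (simp add: power2_eq_square)
  moreover have "0 \<le> ip Up Up * S2 / \<mu>" using \<mu> by (simp add: S2_def sum_nonneg)
  ultimately have "ip D D \<le> ip Up Up * S2 / \<mu>"
  proof (cases "ip D D = 0")
    case False
    then have "0 < ip D D" using ip_self_nonneg[of D] by linarith
    then show ?thesis
      using \<open>ip D D * ip D D \<le> ip D D * (ip Up Up * S2 / \<mu>)\<close> by (simp only: mult_le_cancel_left_pos)
  qed simp
  then show ?thesis by (simp add: D_def Up_def S2_def)
qed

end

section \<open>Gaussian spaces and conditional expectations\<close>

context prob_space
begin

text \<open>Uniqueness of the Fourier transform for the signed law of \<open>Y\<close> weighted by \<open>W\<close>: the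
  normalised positive and negative parts of the weight give two probability laws with the same
  characteristic function.\<close>

lemma fourier_unique_1:
  fixes W Y :: "'a \<Rightarrow> real"
  assumes W: "integrable M W" and Y [measurable]: "Y \<in> borel_measurable M"
    and c: "\<And>t. expectation (\<lambda>\<omega>. W \<omega> * cos (t * Y \<omega>)) = 0"
    and s: "\<And>t. expectation (\<lambda>\<omega>. W \<omega> * sin (t * Y \<omega>)) = 0"
    and A [measurable]: "A \<in> sets borel"
  shows "expectation (\<lambda>\<omega>. W \<omega> * indicator A (Y \<omega>)) = 0"
proof -
  have Wm [measurable]: "W \<in> borel_measurable M" using W by auto
  define W1 where "W1 \<omega> = max (W \<omega>) 0" for \<omega>
  define W2 where "W2 \<omega> = max (- W \<omega>) 0" for \<omega>
  have W_eq: "W \<omega> = W1 \<omega> - W2 \<omega>" for \<omega> by (simp add: W1_def W2_def)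
  have nonneg: "0 \<le> W1 \<omega>" "0 \<le> W2 \<omega>" for \<omega> by (auto simp: W1_def W2_def)
  have int: "integrable M W1" "integrable M W2"
    unfolding W1_def W2_def using W by auto
  have [measurable]: "W1 \<in> borel_measurable M" "W2 \<in> borel_measurable M" using int by auto
  define k where "k = expectation W1"
  have k2: "k = expectation W2"
    using c[of 0] int by (simp add: W_eq k_def)
  have bounded_mult: "integrable M (\<lambda>\<omega>. V \<omega> * f (Y \<omega>))"
    if "integrable M V" "f \<in> borel_measurable borel" "\<And>y. \<bar>f y\<bar> \<le> 1" for V :: "'a \<Rightarrow> real" and f :: "real \<Rightarrow> real"
  proof (rule Bochner_Integration.integrable_bound[OF that(1)])
    have [measurable]: "f \<in> borel_measurable borel" "V \<in> borel_measurable M" using that by auto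
    show "(\<lambda>\<omega>. V \<omega> * f (Y \<omega>)) \<in> borel_measurable M" by measurable
    show "AE \<omega> in M. norm (V \<omega> * f (Y \<omega>)) \<le> norm (V \<omega>)"
      using that(3) by (intro AE_I2) (simp add: abs_mult mult_left_le)
  qed
  have diff: "expectation (\<lambda>\<omega>. W \<omega> * f (Y \<omega>)) = expectation (\<lambda>\<omega>. W1 \<omega> * f (Y \<omega>)) - expectation (\<lambda>\<omega>. W2 \<omega> * f (Y \<omega>))"
    if "f \<in> borel_measurable borel" "\<And>y. \<bar>f y\<bar> \<le> 1" for f :: "real \<Rightarrow> real"
    unfolding W_eq left_diff_distrib
    by (intro Bochner_Integration.integral_diff bounded_mult int that)
  show ?thesis
  proof (cases "k = 0")
    case True
    then have "expectation W1 = 0" "expectation W2 = 0" using k2 by (auto simp: k_def)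
    then have "AE \<omega> in M. W1 \<omega> = 0" "AE \<omega> in M. W2 \<omega> = 0"
      using integral_nonneg_eq_0_iff_AE[OF int(1)] integral_nonneg_eq_0_iff_AE[OF int(2)] nonneg by simp_all
    then have "AE \<omega> in M. W \<omega> * indicator A (Y \<omega>) = 0"
      by eventually_elim (simp add: W_eq)
    then have "expectation (\<lambda>\<omega>. W \<omega> * indicator A (Y \<omega>)) = expectation (\<lambda>\<omega>. 0)"
      by (intro integral_cong_AE) auto
    then show ?thesis by simp
  next
    case False
    have "0 \<le> k" unfolding k_def using nonneg by (intro Bochner_Integration.integral_nonneg) auto
    then have k: "0 < k" using False by simp
    define N where "N V = distr (density M (\<lambda>\<omega>. ennreal (V \<omega> / k))) borel Y" for V :: "'a \<Rightarrow> real"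
    have N: "real_distribution (N V)"
      and N_char: "char (N V) t = complex_of_real (expectation (\<lambda>\<omega>. V \<omega> * cos (t * Y \<omega>)) / k) +
          \<i> * complex_of_real (expectation (\<lambda>\<omega>. V \<omega> * sin (t * Y \<omega>)) / k)"
      and N_meas: "measure (N V) A = expectation (\<lambda>\<omega>. V \<omega> * indicator A (Y \<omega>)) / k"
      if V: "integrable M V" "\<And>\<omega>. 0 \<le> V \<omega>" "expectation V = k" for V t
    proof -
      have [measurable]: "V \<in> borel_measurable M" using V by auto
      have nn: "(\<integral>\<^sup>+\<omega>. ennreal (V \<omega> / k) \<partial>M) = 1"
        using V k by (subst nn_integral_eq_integral) auto
      have ps: "prob_space (density M (\<lambda>\<omega>. ennreal (V \<omega> / k)))"
        by (rule prob_spaceI) (simp add: emeasure_density nn cong: nn_integral_cong)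
      show "real_distribution (N V)"
        unfolding N_def by (rule prob_space.real_distribution_distr[OF ps]) simp
      have dens: "integral\<^sup>L (density M (\<lambda>\<omega>. ennreal (V \<omega> / k))) f = (LINT \<omega>|M. (V \<omega> / k) *\<^sub>R f \<omega>)"
        if "f \<in> borel_measurable M" for f :: "'a \<Rightarrow> 'b::{banach, second_countable_topology}"
        using that V k by (intro integral_density) auto
      have "char (N V) t = (CLINT \<omega>|density M (\<lambda>\<omega>. ennreal (V \<omega> / k)). iexp (t * Y \<omega>))"
        unfolding char_def N_def by (subst integral_distr) auto
      also have "\<dots> = (CLINT \<omega>|M. (V \<omega> / k) *\<^sub>R iexp (t * Y \<omega>))"
        by (rule dens) simp
      also have "\<dots> = (CLINT \<omega>|M. complex_of_real (V \<omega> * cos (t * Y \<omega>) / k) + \<i> * complex_of_real (V \<omega> * sin (t * Y \<omega>) / k))"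
        by (intro Bochner_Integration.integral_cong) (auto simp: exp_Euler scaleR_conv_of_real field_simps add_divide_distrib simp flip: cos_of_real sin_of_real)
      also have "\<dots> = complex_of_real (expectation (\<lambda>\<omega>. V \<omega> * cos (t * Y \<omega>)) / k) +
          \<i> * complex_of_real (expectation (\<lambda>\<omega>. V \<omega> * sin (t * Y \<omega>)) / k)"
      proof -
        have "integrable M (\<lambda>\<omega>. complex_of_real (V \<omega> * cos (t * Y \<omega>) / k))"
          "integrable M (\<lambda>\<omega>. complex_of_real (V \<omega> * sin (t * Y \<omega>) / k))"
          using bounded_mult[OF V(1), of "\<lambda>y. cos (t * y)"] bounded_mult[OF V(1), of "\<lambda>y. sin (t * y)"]
          by (intro integrable_of_real integrable_divide; simp)+
        then show ?thesis by (simp del: of_real_mult of_real_divide)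
      qed
      finally show "char (N V) t = complex_of_real (expectation (\<lambda>\<omega>. V \<omega> * cos (t * Y \<omega>)) / k) +
          \<i> * complex_of_real (expectation (\<lambda>\<omega>. V \<omega> * sin (t * Y \<omega>)) / k)" .
      interpret N: prob_space "N V"
        using \<open>real_distribution (N V)\<close> by (simp add: real_distribution_def)
      have "measure (N V) A = (LINT y|N V. indicator A y)" by (simp add: N_def)
      also have "\<dots> = (LINT \<omega>|density M (\<lambda>\<omega>. ennreal (V \<omega> / k)). indicator A (Y \<omega>))"
        unfolding N_def by (subst integral_distr) auto
      also have "\<dots> = (LINT \<omega>|M. (V \<omega> / k) *\<^sub>R indicator A (Y \<omega>))"
        by (rule dens) simp
      also have "\<dots> = expectation (\<lambda>\<omega>. V \<omega> * indicator A (Y \<omega>)) / k" by simp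
      finally show "measure (N V) A = expectation (\<lambda>\<omega>. V \<omega> * indicator A (Y \<omega>)) / k" .
    qed
    have "char (N W1) = char (N W2)"
    proof
      fix t
      have "expectation (\<lambda>\<omega>. W1 \<omega> * cos (t * Y \<omega>)) = expectation (\<lambda>\<omega>. W2 \<omega> * cos (t * Y \<omega>))"
        using diff[of "\<lambda>y. cos (t * y)"] c[of t] by simp
      moreover have "expectation (\<lambda>\<omega>. W1 \<omega> * sin (t * Y \<omega>)) = expectation (\<lambda>\<omega>. W2 \<omega> * sin (t * Y \<omega>))"
        using diff[of "\<lambda>y. sin (t * y)"] s[of t] by simp
      ultimately show "char (N W1) t = char (N W2) t"
        by (simp only: N_char[OF int(1) nonneg(1) k_def[symmetric]] N_char[OF int(2) nonneg(2) k2[symmetric]])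
    qed
    then have "N W1 = N W2"
      by (intro Levy_uniqueness N int nonneg k_def[symmetric] k2[symmetric])
    from arg_cong[OF this, of "\<lambda>\<mu>. measure \<mu> A"]
    have "expectation (\<lambda>\<omega>. W1 \<omega> * indicator A (Y \<omega>)) / k = expectation (\<lambda>\<omega>. W2 \<omega> * indicator A (Y \<omega>)) / k"
      unfolding N_meas[OF int(1) nonneg(1) k_def[symmetric]] N_meas[OF int(2) nonneg(2) k2[symmetric]] .
    then show ?thesis
      using k diff[of "indicator A"] by (simp add: indicator_def)
  qed
qed

text \<open>Several coordinates are treated one after the other, the remaining ones staying on the
  Fourier side.\<close>

lemma fourier_unique_finite:
  fixes W :: "'a \<Rightarrow> real" and Z :: "'i \<Rightarrow> 'a \<Rightarrow> real"
  assumes "finite F" and "integrable M W" and "\<And>j. j \<in> F \<Longrightarrow> Z j \<in> borel_measurable M"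
    and "\<And>\<theta>. expectation (\<lambda>\<omega>. W \<omega> * cos (\<Sum>j\<in>F. \<theta> j * Z j \<omega>)) = 0"
    and "\<And>\<theta>. expectation (\<lambda>\<omega>. W \<omega> * sin (\<Sum>j\<in>F. \<theta> j * Z j \<omega>)) = 0"
    and "\<And>j. j \<in> F \<Longrightarrow> A j \<in> sets borel"
  shows "expectation (\<lambda>\<omega>. W \<omega> * (\<Prod>j\<in>F. indicator (A j) (Z j \<omega>))) = 0"
  using assms
proof (induction F arbitrary: W rule: finite_induct)
  case empty
  then show ?case by simp
next
  case (insert i F)
  note W = insert.prems(1)
  have Wm [measurable]: "W \<in> borel_measurable M" using W by auto
  have Zi [measurable]: "Z i \<in> borel_measurable M" and ZF: "\<And>j. j \<in> F \<Longrightarrow> Z j \<in> borel_measurable M"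
    using insert.prems(2) by auto
  have Ai [measurable]: "A i \<in> sets borel" using insert.prems(5) by auto
  have bdd: "integrable M (\<lambda>\<omega>. V \<omega> * f \<omega>)"
    if "integrable M V" "f \<in> borel_measurable M" "\<And>\<omega>. \<bar>f \<omega>\<bar> \<le> 1" for V f :: "'a \<Rightarrow> real"
  proof (rule Bochner_Integration.integrable_bound[OF that(1)])
    show "(\<lambda>\<omega>. V \<omega> * f \<omega>) \<in> borel_measurable M" using that by auto
    show "AE \<omega> in M. norm (V \<omega> * f \<omega>) \<le> norm (V \<omega>)"
      using that(3) by (intro AE_I2) (simp add: abs_mult mult_left_le)
  qed
  define W' where "W' \<omega> = W \<omega> * indicator (A i) (Z i \<omega>)" for \<omega>
  have W': "integrable M W'"
    unfolding W'_def by (rule bdd[OF W]) (auto simp: indicator_def)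
  have key: "expectation (\<lambda>\<omega>. W' \<omega> * cos (\<Sum>j\<in>F. \<theta> j * Z j \<omega>)) = 0 \<and>
      expectation (\<lambda>\<omega>. W' \<omega> * sin (\<Sum>j\<in>F. \<theta> j * Z j \<omega>)) = 0" for \<theta>
  proof -
    let ?S = "\<lambda>\<omega>. \<Sum>j\<in>F. \<theta> j * Z j \<omega>"
    have [measurable]: "?S \<in> borel_measurable M" using ZF by auto
    have upd: "(\<Sum>j\<in>insert i F. (\<theta>(i := t)) j * Z j \<omega>) = ?S \<omega> + t * Z i \<omega>" for t \<omega>
    proof -
      have "(\<Sum>j\<in>F. (\<theta>(i := t)) j * Z j \<omega>) = ?S \<omega>"
        using insert.hyps by (intro sum.cong) auto
      then show ?thesis using insert.hyps by simp
    qed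
    have C: "expectation (\<lambda>\<omega>. W \<omega> * cos (?S \<omega> + t * Z i \<omega>)) = 0" for t
      using insert.prems(3)[of "\<theta>(i := t)"] unfolding upd .
    have Si: "expectation (\<lambda>\<omega>. W \<omega> * sin (?S \<omega> + t * Z i \<omega>)) = 0" for t
      using insert.prems(4)[of "\<theta>(i := t)"] unfolding upd .
    have ic: "integrable M (\<lambda>\<omega>. W \<omega> * cos (?S \<omega> + t * Z i \<omega>))"
      and isn: "integrable M (\<lambda>\<omega>. W \<omega> * sin (?S \<omega> + t * Z i \<omega>))" for t
      by (intro bdd W; simp)+
    have Sm: "?S \<in> borel_measurable M" by measurable
    have "W x * cos a * cos b = (W x * cos (a + b) + W x * cos (a + (- b))) / 2"
      "W x * sin a * cos b = (W x * sin (a + b) + W x * sin (a + (- b))) / 2"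
      "W x * cos a * sin b = (W x * sin (a + b) - W x * sin (a + (- b))) / 2"
      "W x * sin a * sin b = (W x * cos (a + (- b)) - W x * cos (a + b)) / 2" for x a b
      by (simp_all add: cos_add sin_add cos_diff sin_diff algebra_simps)
    note trig = this
    have "expectation (\<lambda>\<omega>. (W \<omega> * cos (?S \<omega>)) * indicator (A i) (Z i \<omega>)) = 0"
    proof (rule fourier_unique_1)
      show "integrable M (\<lambda>\<omega>. W \<omega> * cos (?S \<omega>))" by (intro bdd W) auto
      show "expectation (\<lambda>\<omega>. W \<omega> * cos (?S \<omega>) * cos (t * Z i \<omega>)) = 0" for t
        using ic[of t] ic[of "- t"] C[of t] C[of "- t"] unfolding trig by simp
      show "expectation (\<lambda>\<omega>. W \<omega> * cos (?S \<omega>) * sin (t * Z i \<omega>)) = 0" for t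
        using isn[of t] isn[of "- t"] Si[of t] Si[of "- t"] unfolding trig by simp
    qed auto
    moreover have "expectation (\<lambda>\<omega>. (W \<omega> * sin (?S \<omega>)) * indicator (A i) (Z i \<omega>)) = 0"
    proof (rule fourier_unique_1)
      show "integrable M (\<lambda>\<omega>. W \<omega> * sin (?S \<omega>))" by (intro bdd W) auto
      show "expectation (\<lambda>\<omega>. W \<omega> * sin (?S \<omega>) * cos (t * Z i \<omega>)) = 0" for t
        using isn[of t] isn[of "- t"] Si[of t] Si[of "- t"] unfolding trig by simp
      show "expectation (\<lambda>\<omega>. W \<omega> * sin (?S \<omega>) * sin (t * Z i \<omega>)) = 0" for t
        using ic[of t] ic[of "- t"] C[of t] C[of "- t"] unfolding trig by simp
    qed auto
    ultimately show ?thesis by (simp add: W'_def ac_simps)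
  qed
  have "expectation (\<lambda>\<omega>. W' \<omega> * (\<Prod>j\<in>F. indicator (A j) (Z j \<omega>))) = 0"
    by (rule insert.IH[OF W']) (use key insert.prems in auto)
  then show ?case using insert.hyps by (simp add: W'_def mult.assoc)
qed

text \<open>By a monotone class argument this determines the weight on the generated \<open>\<sigma>\<close>-algebra.\<close>

lemma fourier_unique_sigma:
  fixes W :: "'a \<Rightarrow> real" and y :: "'i \<Rightarrow> 'a \<Rightarrow> 'b::euclidean_space"
  assumes W: "integrable M W" and y: "\<And>i. i \<in> I \<Longrightarrow> y i \<in> borel_measurable M"
    and C: "\<And>F \<theta>. \<lbrakk>finite F; F \<subseteq> I \<times> Basis\<rbrakk> \<Longrightarrow>
      expectation (\<lambda>\<omega>. W \<omega> * cos (\<Sum>j\<in>F. \<theta> j * (y (fst j) \<omega> \<bullet> snd j))) = 0"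
    and Si: "\<And>F \<theta>. \<lbrakk>finite F; F \<subseteq> I \<times> Basis\<rbrakk> \<Longrightarrow>
      expectation (\<lambda>\<omega>. W \<omega> * sin (\<Sum>j\<in>F. \<theta> j * (y (fst j) \<omega> \<bullet> snd j))) = 0"
    and A: "A \<in> sets (gen_sigma M I y)"
  shows "(LINT \<omega>:A|M. W \<omega>) = 0"
proof -
  define Z where "Z j \<omega> = y (fst j) \<omega> \<bullet> snd j" for j \<omega>
  have Zm: "Z j \<in> borel_measurable M" if "j \<in> I \<times> Basis" for j
  proof -
    have "y (fst j) \<in> borel_measurable M" using y that by auto
    then show ?thesis unfolding Z_def[abs_def] by (intro borel_measurable_inner) auto
  qed
  define \<P> where "\<P> = {{\<omega>\<in>space M. \<forall>j\<in>F. Z j \<omega> \<in> B j} | F B.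
      finite F \<and> F \<subseteq> I \<times> Basis \<and> (\<forall>j\<in>F. B j \<in> sets (borel :: real measure))}"
  define N where "N = sigma (space M) \<P>"
  have \<P>_sub: "\<P> \<subseteq> Pow (space M)" unfolding \<P>_def by blast
  have setsN: "sets N = sigma_sets (space M) \<P>" and spaceN: "space N = space M"
    using \<P>_sub by (auto simp: N_def)
  have ZN: "Z j \<in> borel_measurable N" if "j \<in> I \<times> Basis" for j
  proof (rule measurableI)
    fix B :: "real set" assume B: "B \<in> sets borel"
    have "Z j -` B \<inter> space N = {\<omega>\<in>space M. \<forall>j\<in>{j}. Z j \<omega> \<in> (\<lambda>_. B) j}" by (auto simp: spaceN)
    also have "\<dots> \<in> \<P>"
      unfolding \<P>_def using that B by (intro CollectI exI[of _ "{j}"] exI[of _ "\<lambda>_. B"]) auto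
    finally show "Z j -` B \<inter> space N \<in> sets N" unfolding setsN by (rule sigma_sets.Basic)
  qed simp
  have yN: "y i \<in> borel_measurable N" if "i \<in> I" for i
    unfolding borel_measurable_euclidean_space[of "y i"]
  proof
    fix b :: 'b assume "b \<in> Basis"
    then show "(\<lambda>\<omega>. y i \<omega> \<bullet> b) \<in> borel_measurable N" using ZN[of "(i, b)"] that by (simp add: Z_def[abs_def])
  qed
  have "A \<in> sets N"
  proof -
    have "{y i -` U \<inter> space M | i U. i \<in> I \<and> U \<in> sets borel} \<subseteq> sets N"
      using measurable_sets[OF yN] by (auto simp: spaceN)
    then have "sigma_sets (space M) {y i -` U \<inter> space M | i U. i \<in> I \<and> U \<in> sets borel} \<subseteq> sets N"
      using sets.sigma_sets_subset[of _ N] by (simp add: spaceN)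
    moreover have "A \<in> sigma_sets (space M) {y i -` U \<inter> space M | i U. i \<in> I \<and> U \<in> sets borel}"
      using A unfolding gen_sigma_def by (subst (asm) sets_measure_of) auto
    ultimately show ?thesis by blast
  qed
  then have "A \<in> sigma_sets (space M) \<P>" unfolding setsN .
  have "Int_stable \<P>"
  proof (rule Int_stableI)
    fix a b assume "a \<in> \<P>" "b \<in> \<P>"
    then obtain F1 B1 F2 B2 where *: "a = {\<omega>\<in>space M. \<forall>j\<in>F1. Z j \<omega> \<in> B1 j}" "b = {\<omega>\<in>space M. \<forall>j\<in>F2. Z j \<omega> \<in> B2 j}"
      "finite F1" "F1 \<subseteq> I \<times> Basis" "finite F2" "F2 \<subseteq> I \<times> Basis"
      "\<forall>j\<in>F1. B1 j \<in> sets (borel :: real measure)" "\<forall>j\<in>F2. B2 j \<in> sets (borel :: real measure)"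
      unfolding \<P>_def by blast
    define B where "B j = (if j \<in> F1 then B1 j else UNIV) \<inter> (if j \<in> F2 then B2 j else UNIV)" for j
    have "a \<inter> b = {\<omega>\<in>space M. \<forall>j\<in>F1 \<union> F2. Z j \<omega> \<in> B j}"
      unfolding * B_def by (auto split: if_splits)
    moreover have "\<forall>j\<in>F1 \<union> F2. B j \<in> sets borel" using * by (auto simp: B_def)
    ultimately show "a \<inter> b \<in> \<P>"
      unfolding \<P>_def using * by (intro CollectI exI[of _ "F1 \<union> F2"] exI[of _ B]) auto
  qed
  have \<P>_M: "\<P> \<subseteq> sets M"
  proof
    fix a assume "a \<in> \<P>"
    then obtain F B where *: "a = {\<omega>\<in>space M. \<forall>j\<in>F. Z j \<omega> \<in> B j}" "finite F" "F \<subseteq> I \<times> Basis"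
      "\<forall>j\<in>F. B j \<in> sets (borel :: real measure)"
      unfolding \<P>_def by blast
    show "a \<in> sets M" unfolding *(1)
    proof (rule sets.sets_Collect_finite_All[OF _ *(2)])
      fix j assume j: "j \<in> F"
      have "Z j -` B j \<inter> space M \<in> sets M"
        using Zm[of j] j * by (intro measurable_sets) auto
      then show "{\<omega>\<in>space M. Z j \<omega> \<in> B j} \<in> sets M" by (simp add: vimage_def Int_def conj_commute)
    qed
  qed
  have A_M: "a \<in> sets M" if "a \<in> sigma_sets (space M) \<P>" for a
    using sets.sigma_sets_subset[OF \<P>_M] that by blast
  have set_int: "set_integrable M a W" if "a \<in> sets M" for a
    using integrable_mult_indicator[OF that W] by (simp add: set_integrable_def)
  have E0: "expectation W = 0"
    using C[of "{}" undefined] by simp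
  from \<open>Int_stable \<P>\<close> \<P>_sub \<open>A \<in> sigma_sets (space M) \<P>\<close> show ?thesis
  proof (induction rule: sigma_sets_induct_disjoint)
    case (basic a)
    then obtain F B where *: "a = {\<omega>\<in>space M. \<forall>j\<in>F. Z j \<omega> \<in> B j}" "finite F" "F \<subseteq> I \<times> Basis"
      "\<forall>j\<in>F. B j \<in> sets (borel :: real measure)"
      unfolding \<P>_def by blast
    have "expectation (\<lambda>\<omega>. W \<omega> * (\<Prod>j\<in>F. indicator (B j) (Z j \<omega>))) = 0"
    proof (rule fourier_unique_finite[OF *(2) W])
      show "expectation (\<lambda>\<omega>. W \<omega> * cos (\<Sum>j\<in>F. \<theta> j * Z j \<omega>)) = 0" for \<theta>
        unfolding Z_def by (rule C[OF *(2,3)])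
      show "expectation (\<lambda>\<omega>. W \<omega> * sin (\<Sum>j\<in>F. \<theta> j * Z j \<omega>)) = 0" for \<theta>
        unfolding Z_def by (rule Si[OF *(2,3)])
    qed (use * Zm in auto)
    moreover have "(\<Prod>j\<in>F. indicator (B j) (Z j \<omega>) :: real) = indicator a \<omega>" if "\<omega> \<in> space M" for \<omega>
      using that *(2) unfolding *(1) by (auto simp: indicator_def prod_zero_iff)
    ultimately show ?case
      unfolding set_lebesgue_integral_def
      by (subst (asm) Bochner_Integration.integral_cong[OF refl, of _ _ "\<lambda>\<omega>. indicator a \<omega> *\<^sub>R W \<omega>"])
         (auto simp: mult.commute)
  next
    case empty
    then show ?case by (simp add: set_lebesgue_integral_def)
  next
    case (compl a)
    have "indicator (space M - a) \<omega> *\<^sub>R W \<omega> = W \<omega> - indicator a \<omega> *\<^sub>R W \<omega>" if "\<omega> \<in> space M" for \<omega>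
      using that by (simp add: indicator_def)
    then have "(LINT \<omega>:space M - a|M. W \<omega>) = (LINT \<omega>|M. W \<omega> - indicator a \<omega> *\<^sub>R W \<omega>)"
      unfolding set_lebesgue_integral_def by (rule Bochner_Integration.integral_cong[OF refl])
    also have "\<dots> = expectation W - (LINT \<omega>:a|M. W \<omega>)"
      using set_int[OF A_M[OF compl(1)]] W unfolding set_lebesgue_integral_def set_integrable_def by simp
    finally show ?case using compl E0 by simp
  next
    case (union a)
    have "(LINT \<omega>:(\<Union>i. a i)|M. W \<omega>) = (\<Sum>i. LINT \<omega>:a i|M. W \<omega>)"
    proof (rule lebesgue_integral_countable_add)
      show "a i \<in> sets M" for i using union(2) A_M by blast
      show "a i \<inter> a j = {}" if "i \<noteq> j" for i j
        using union(1) that by (auto simp: disjoint_family_on_def)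
      show "set_integrable M (\<Union>i. a i) W"
        using union(2) A_M by (intro set_int sets.countable_UN) auto
    qed
    then show ?case using union by simp
  qed
qed

end

text \<open>A Gaussian space is described by characteristic functions, which also covers degenerate
  variables.\<close>

locale gaussian_space = prob_space +
  fixes \<G> :: "('a \<Rightarrow> real) set"
  assumes lincomb: "\<lbrakk>X \<in> \<G>; Y \<in> \<G>\<rbrakk> \<Longrightarrow> (\<lambda>\<omega>. a * X \<omega> + b * Y \<omega>) \<in> \<G>"
    and sq\<G>: "X \<in> \<G> \<Longrightarrow> sq X"
    and gauss: "X \<in> \<G> \<Longrightarrow> (CLINT \<omega>|M. iexp (X \<omega>)) =
      iexp (expectation X) * exp (- complex_of_real (ip X X - (expectation X)\<^sup>2) / 2)"
begin

text \<open>The derivative at \<open>s = 0\<close> of the characteristic function of \<open>V + s U\<close>, computed in two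
  ways.\<close>

lemma gaussian_correlation:
  assumes U: "U \<in> \<G>" "expectation U = 0" and V: "V \<in> \<G>"
  shows "(CLINT \<omega>|M. U \<omega> * iexp (V \<omega>)) = \<i> * ip U V * (CLINT \<omega>|M. iexp (V \<omega>))"
proof -
  have sU: "sq U" and sV: "sq V" using U V sq\<G> by auto
  note [measurable] = sq_measurable[OF sU] sq_measurable[OF sV]
  define f where "f s = (CLINT \<omega>|M. iexp (V \<omega> + s * U \<omega>))" for s :: real
  define u where "u = ip U U"
  define q where "q = ip U V"
  have f_eq: "f s = f 0 * exp (- complex_of_real (s\<^sup>2 * u + 2 * s * q) / 2)" for s
  proof -
    let ?X = "\<lambda>s \<omega>. 1 * V \<omega> + s * U \<omega>"
    have "ip (?X s) (?X s) = ip V V + (s\<^sup>2 * u + 2 * s * q)" for s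
      using sU sV sq_cmult[OF sU, of s]
      by (simp add: ip_add_left ip_add_right ip_cmult_left ip_cmult_right sq_add u_def q_def
          ip_commute[of V U] power2_eq_square algebra_simps)
    moreover have "expectation (?X s) = expectation V" for s
      using U sq_integrable[OF sU] sq_integrable[OF sV] by simp
    ultimately have F: "f s = iexp (expectation V) * exp (- complex_of_real
        (ip V V + (s\<^sup>2 * u + 2 * s * q) - (expectation V)\<^sup>2) / 2)" for s
      using gauss[OF lincomb[OF V U(1), of 1 s]] by (simp add: f_def)
    show ?thesis
      unfolding F[of s] F[of 0] mult.assoc exp_add[symmetric]
      by (simp add: algebra_simps add_divide_distrib diff_divide_distrib)
  qed
  have intUV: "integrable M (\<lambda>\<omega>. U \<omega> * iexp (V \<omega>))"
    by (rule Bochner_Integration.integrable_bound[OF sq_integrable[OF sU]]) (auto simp: norm_mult)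
  have int_iexp: "integrable M (\<lambda>\<omega>. iexp (X \<omega>))" if "X \<in> borel_measurable M" for X :: "'a \<Rightarrow> real"
    by (rule integrable_const_bound[of _ 1]) (use that in auto)
  have approx: "cmod (complex_of_real (real n) * (f (1 / real n) - f 0) - (CLINT \<omega>|M. \<i> * (U \<omega> * iexp (V \<omega>)))) \<le> u / real n"
    if n: "0 < n" for n :: nat
  proof -
    let ?g = "\<lambda>\<omega>. complex_of_real (real n) * (iexp (V \<omega> + 1 / real n * U \<omega>) - iexp (V \<omega>)) - \<i> * (U \<omega> * iexp (V \<omega>))"
    have "cmod (?g \<omega>) \<le> (U \<omega>)\<^sup>2 / real n" for \<omega>
    proof -
      let ?x = "1 / real n * U \<omega>"
      have "?g \<omega> = complex_of_real (real n) * iexp (V \<omega>) * (iexp ?x - (1 + \<i> * ?x))"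
        using n by (simp add: exp_add algebra_simps)
      then have "cmod (?g \<omega>) = real n * cmod (iexp ?x - (1 + \<i> * ?x))"
        by (simp add: norm_mult)
      also have "\<dots> \<le> real n * (\<bar>?x\<bar>\<^sup>2 / 2)"
        using iexp_approx1[of ?x 1] by (intro mult_left_mono) (auto simp: numeral_2_eq_2)
      also have "\<dots> \<le> real n * \<bar>?x\<bar>\<^sup>2" by (intro mult_left_mono) auto
      also have "\<dots> = (U \<omega>)\<^sup>2 / real n"
        using n by (simp add: power2_eq_square field_simps)
      finally show ?thesis .
    qed
    note pointwise = this
    have i1: "integrable M (\<lambda>\<omega>. iexp (V \<omega> + 1 / real n * U \<omega>))" and i2: "integrable M (\<lambda>\<omega>. iexp (V \<omega>))"
      by (rule int_iexp, simp)+
    have ig: "integrable M ?g"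
      by (rule Bochner_Integration.integrable_diff[OF integrable_mult_right[OF Bochner_Integration.integrable_diff[OF i1 i2]]
            integrable_mult_right[OF intUV]])
    have b: "cmod (integral\<^sup>L M ?g) \<le> expectation (\<lambda>\<omega>. (U \<omega>)\<^sup>2 / real n)"
    proof (rule order_trans[OF integral_norm_bound integral_mono[OF _ _ pointwise]])
      show "integrable M (\<lambda>\<omega>. cmod (?g \<omega>))"
        by (rule integrable_norm[OF ig])
      show "integrable M (\<lambda>\<omega>. (U \<omega>)\<^sup>2 / real n)" using sU by (simp add: sq_def)
    qed
    have "integral\<^sup>L M ?g = complex_of_real (real n) * (f (1 / real n) - f 0) - (CLINT \<omega>|M. \<i> * (U \<omega> * iexp (V \<omega>)))"
    proof -
      have "integral\<^sup>L M ?g = (CLINT \<omega>|M. complex_of_real (real n) * (iexp (V \<omega> + 1 / real n * U \<omega>) - iexp (V \<omega>))) -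
          (CLINT \<omega>|M. \<i> * (U \<omega> * iexp (V \<omega>)))"
        by (rule Bochner_Integration.integral_diff[OF integrable_mult_right[OF Bochner_Integration.integrable_diff[OF i1 i2]]
              integrable_mult_right[OF intUV]])
      also have "(CLINT \<omega>|M. complex_of_real (real n) * (iexp (V \<omega> + 1 / real n * U \<omega>) - iexp (V \<omega>))) =
          complex_of_real (real n) * (f (1 / real n) - f 0)"
        unfolding Bochner_Integration.integral_mult_right_zero Bochner_Integration.integral_diff[OF i1 i2]
        by (simp add: f_def)
      finally show ?thesis .
    qed
    then show ?thesis using b by (simp add: u_def ip_self)
  qed
  have lim1: "(\<lambda>n. complex_of_real (real n) * (f (1 / real n) - f 0)) \<longlonglongrightarrow> (CLINT \<omega>|M. \<i> * (U \<omega> * iexp (V \<omega>)))"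
  proof (rule LIM_zero_cancel, rule Lim_null_comparison)
    show "\<forall>\<^sub>F n in sequentially. norm (complex_of_real (real n) * (f (1 / real n) - f 0) -
        (CLINT \<omega>|M. \<i> * (U \<omega> * iexp (V \<omega>)))) \<le> u / real n"
      using eventually_gt_at_top[of 0] by eventually_elim (rule approx)
    show "(\<lambda>n. u / real n) \<longlonglongrightarrow> 0" by (rule lim_const_over_n)
  qed
  have lim2: "(\<lambda>n. complex_of_real (real n) * (f (1 / real n) - f 0)) \<longlonglongrightarrow> f 0 * complex_of_real (- q)"
  proof -
    have "((\<lambda>s. exp (- (s\<^sup>2 * u + 2 * s * q) / 2)) has_real_derivative (- q)) (at 0)"
      by (auto intro!: derivative_eq_intros)
    then have "(\<lambda>s. (exp (- (s\<^sup>2 * u + 2 * s * q) / 2) - 1) / s) \<midarrow>0\<rightarrow> - q"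
      by (simp add: DERIV_def)
    moreover have "filterlim (\<lambda>n. 1 / real n) (at 0) sequentially"
      unfolding filterlim_at using lim_1_over_n
      by (auto simp: eventually_sequentially intro!: exI[of _ 1])
    ultimately have "(\<lambda>n. (exp (- ((1 / real n)\<^sup>2 * u + 2 * (1 / real n) * q) / 2) - 1) / (1 / real n)) \<longlonglongrightarrow> - q"
      by (rule filterlim_compose)
    then have *: "(\<lambda>n. f 0 * complex_of_real ((exp (- ((1 / real n)\<^sup>2 * u + 2 * (1 / real n) * q) / 2) - 1) / (1 / real n)))
        \<longlonglongrightarrow> f 0 * complex_of_real (- q)"
      by (intro tendsto_intros)
    have eq: "f 0 * complex_of_real ((exp (- ((1 / real n)\<^sup>2 * u + 2 * (1 / real n) * q) / 2) - 1) / (1 / real n)) =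
        complex_of_real (real n) * (f (1 / real n) - f 0)" for n
      unfolding f_eq[of "1 / real n"]
      by (simp add: algebra_simps exp_of_real[symmetric])
    show ?thesis using * unfolding eq .
  qed
  have "\<i> * (CLINT \<omega>|M. U \<omega> * iexp (V \<omega>)) = f 0 * complex_of_real (- q)"
    using LIMSEQ_unique[OF lim1 lim2] by simp
  then have "\<i> * (\<i> * (CLINT \<omega>|M. U \<omega> * iexp (V \<omega>))) = \<i> * (f 0 * complex_of_real (- q))" by simp
  then have "(CLINT \<omega>|M. U \<omega> * iexp (V \<omega>)) = \<i> * (f 0 * complex_of_real q)"
    by (simp add: mult.assoc[symmetric])
  then show ?thesis by (simp add: f_def q_def mult.commute mult.left_commute)
qed

text \<open>In particular, a variable orthogonal to \<open>V\<close> is uncorrelated with the trigonometric functions of \<open>V\<close>, and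
  approximate orthogonality is stable.\<close>

lemma gaussian_correlation_bound:
  assumes U: "U \<in> \<G>" "expectation U = 0" and V: "V \<in> \<G>"
  shows "\<bar>expectation (\<lambda>\<omega>. U \<omega> * cos (V \<omega>))\<bar> \<le> \<bar>ip U V\<bar>"
    and "\<bar>expectation (\<lambda>\<omega>. U \<omega> * sin (V \<omega>))\<bar> \<le> \<bar>ip U V\<bar>"
proof -
  have sU: "sq U" and sV: "sq V" using U V sq\<G> by auto
  note [measurable] = sq_measurable[OF sU] sq_measurable[OF sV]
  have int: "integrable M (\<lambda>\<omega>. U \<omega> * iexp (V \<omega>))"
    by (rule Bochner_Integration.integrable_bound[OF sq_integrable[OF sU]]) (auto simp: norm_mult)
  let ?I = "CLINT \<omega>|M. U \<omega> * iexp (V \<omega>)"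
  have "cmod (CLINT \<omega>|M. iexp (V \<omega>)) \<le> 1"
    using integral_norm_bound[of M "\<lambda>\<omega>. iexp (V \<omega>)"] by (simp add: prob_space)
  then have "cmod ?I \<le> \<bar>ip U V\<bar> * 1"
    unfolding gaussian_correlation[OF U V] norm_mult by (simp add: mult_left_le)
  then have I: "cmod ?I \<le> \<bar>ip U V\<bar>" by simp
  have re: "Re (U \<omega> * iexp (V \<omega>)) = U \<omega> * cos (V \<omega>)" and im: "Im (U \<omega> * iexp (V \<omega>)) = U \<omega> * sin (V \<omega>)" for \<omega>
    by (simp_all add: Re_exp Im_exp)
  show "\<bar>expectation (\<lambda>\<omega>. U \<omega> * cos (V \<omega>))\<bar> \<le> \<bar>ip U V\<bar>"
    using order_trans[OF abs_Re_le_cmod I] unfolding integral_Re[OF int, symmetric] re .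
  show "\<bar>expectation (\<lambda>\<omega>. U \<omega> * sin (V \<omega>))\<bar> \<le> \<bar>ip U V\<bar>"
    using order_trans[OF abs_Im_le_cmod I] unfolding integral_Im[OF int, symmetric] im .
qed

end

section \<open>Gaussian variables with values in a Hilbert space\<close>

text \<open>Orthonormalising the first \<open>n\<close> points of a dense sequence gives finite orthonormal sets whose
  projections converge strongly to the identity.\<close>

lemma finite_projections:
  "\<exists>E :: nat \<Rightarrow> 'a::{real_inner, second_countable_topology} set. \<forall>n. finite (E n) \<and>
     (\<forall>v. (\<Sum>e\<in>E n. (e \<bullet> v)\<^sup>2) = (norm (\<Sum>e\<in>E n. (e \<bullet> v) *\<^sub>R e))\<^sup>2 \<and> (\<Sum>e\<in>E n. (e \<bullet> v)\<^sup>2) \<le> (norm v)\<^sup>2) \<and>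
     (\<forall>v. (\<lambda>n. \<Sum>e\<in>E n. (e \<bullet> v) *\<^sub>R e) \<longlonglongrightarrow> v)"
proof -
  obtain D :: "'a set" where D: "countable D" "D \<noteq> {}" "\<And>X. open X \<Longrightarrow> X \<noteq> {} \<Longrightarrow> \<exists>d\<in>D. d \<in> X"
    using countable_dense_exists[where 'a = 'a]
    by (metis UNIV_I ex_in_conv open_UNIV UNIV_not_empty)
  define d where "d = from_nat_into D"
  have dense: "\<exists>k. dist (d k) v < e" if "0 < e" for v e
  proof -
    have "v \<in> ball v e" using that by simp
    then obtain y where "y \<in> D" "y \<in> ball v e" using D(3)[OF open_ball, of v e] by blast
    then show ?thesis
      using from_nat_into_surj[OF D(1) \<open>y \<in> D\<close>] unfolding d_def by (auto simp: dist_commute)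
  qed
  have "\<exists>C. finite C \<and> span C = span (d ` {..n}) \<and> pairwise orthogonal C" for n
    using basis_orthogonal[of "d ` {..n}"] by auto
  then obtain C where C: "\<And>n. finite (C n)" "\<And>n. span (C n) = span (d ` {..n})" "\<And>n. pairwise orthogonal (C n)"
    by metis
  define E where "E n = (\<lambda>c. c /\<^sub>R norm c) ` (C n - {0})" for n
  define Pr where "Pr n v = (\<Sum>e\<in>E n. (e \<bullet> v) *\<^sub>R e)" for n v
  have finE: "finite (E n)" for n using C(1) by (simp add: E_def)
  have norm1: "norm e = 1" if "e \<in> E n" for e n
  proof -
    obtain c where "e = c /\<^sub>R norm c" "c \<noteq> 0" using \<open>e \<in> E n\<close> unfolding E_def by blast
    then show ?thesis by simp
  qed
  have orth: "e \<bullet> f = 0" if "e \<in> E n" "f \<in> E n" "e \<noteq> f" for e f n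
  proof -
    obtain c c' where c: "e = c /\<^sub>R norm c" "f = c' /\<^sub>R norm c'" "c \<in> C n" "c' \<in> C n"
      using \<open>e \<in> E n\<close> \<open>f \<in> E n\<close> unfolding E_def by blast
    then have "c \<noteq> c'" using that by auto
    then have "orthogonal c c'" using C(3)[of n] c unfolding pairwise_def by blast
    then show ?thesis by (simp add: c orthogonal_def)
  qed
  have in_e: "f \<bullet> Pr n v = f \<bullet> v" if "f \<in> E n" for f n v
  proof -
    have "f \<bullet> Pr n v = (\<Sum>e\<in>E n. (e \<bullet> v) * (f \<bullet> e))" by (simp add: Pr_def inner_sum_right)
    also have "\<dots> = (\<Sum>e\<in>E n. if e = f then f \<bullet> v else 0)"
      using orth[OF that] norm1[OF that] by (intro sum.cong) (auto simp: dot_square_norm)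
    finally show ?thesis using finE that by simp
  qed
  have normPr: "(norm (Pr n v))\<^sup>2 = (\<Sum>e\<in>E n. (e \<bullet> v)\<^sup>2)" for n v
  proof -
    have "(norm (Pr n v))\<^sup>2 = Pr n v \<bullet> Pr n v" by (simp add: dot_square_norm)
    also have "\<dots> = (\<Sum>e\<in>E n. (e \<bullet> v) * (e \<bullet> Pr n v))"
      by (subst (1) Pr_def) (simp add: inner_sum_left)
    also have "\<dots> = (\<Sum>e\<in>E n. (e \<bullet> v)\<^sup>2)" using in_e by (intro sum.cong) (auto simp: power2_eq_square)
    finally show ?thesis .
  qed
  have perp: "(v - Pr n v) \<bullet> y = 0" if "y \<in> span (C n)" for v n y
  proof -
    have "orthogonal (v - Pr n v) y"
    proof (rule orthogonal_to_span[OF that])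
      fix c assume "c \<in> C n"
      show "orthogonal (v - Pr n v) c"
      proof (cases "c = 0")
        case False
        then have e: "c /\<^sub>R norm c \<in> E n" using \<open>c \<in> C n\<close> by (auto simp: E_def)
        have "(v - Pr n v) \<bullet> (c /\<^sub>R norm c) = 0"
          by (simp only: inner_commute[of _ "c /\<^sub>R norm c"] inner_diff_right in_e[OF e, of v] diff_self)
        then show ?thesis using False by (simp add: orthogonal_def)
      qed (simp add: orthogonal_def)
    qed
    then show ?thesis by (simp add: orthogonal_def)
  qed
  have Pr_span: "Pr n v \<in> span (C n)" for n v
    unfolding Pr_def E_def
    by (intro span_sum span_scale) (auto intro: span_scale[OF span_base])
  have best: "norm (v - Pr n v) \<le> norm (v - y)" if "y \<in> span (C n)" for v n y
  proof -
    have "Pr n v - y \<in> span (C n)" using Pr_span that by (rule span_diff)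
    then have "(v - Pr n v) \<bullet> (Pr n v - y) = 0" by (rule perp)
    then have "(norm ((v - Pr n v) + (Pr n v - y)))\<^sup>2 = (norm (v - Pr n v))\<^sup>2 + (norm (Pr n v - y))\<^sup>2"
      by (simp only: dot_square_norm[symmetric] inner_add_left inner_add_right) (simp add: inner_commute)
    then have "(norm (v - Pr n v))\<^sup>2 \<le> (norm (v - y))\<^sup>2" by simp
    then show ?thesis by (rule power2_le_imp_le) simp
  qed
  have lim: "(\<lambda>n. Pr n v) \<longlonglongrightarrow> v" for v
  proof (rule LIMSEQ_I)
    fix e :: real assume "0 < e"
    then obtain k where k: "dist (d k) v < e" using dense by blast
    show "\<exists>N. \<forall>n\<ge>N. norm (Pr n v - v) < e"
    proof (intro exI[of _ k] allI impI)
      fix n assume "k \<le> n"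
      then have "d k \<in> span (C n)" unfolding C(2) by (intro span_base) auto
      from best[OF this, of v] show "norm (Pr n v - v) < e"
        using k by (simp add: dist_norm norm_minus_commute)
    qed
  qed
  have bessel: "(norm (Pr n v))\<^sup>2 \<le> (norm v)\<^sup>2" for n v
  proof -
    have "(v - Pr n v) \<bullet> Pr n v = 0" by (rule perp[OF Pr_span])
    then have "(norm ((v - Pr n v) + Pr n v))\<^sup>2 = (norm (v - Pr n v))\<^sup>2 + (norm (Pr n v))\<^sup>2"
      by (simp only: dot_square_norm[symmetric] inner_add_left inner_add_right) (simp add: inner_commute)
    then show ?thesis by simp
  qed
  show ?thesis
    using finE normPr bessel lim unfolding Pr_def by (intro exI[of _ E]) auto
qed

definition projecting :: "(nat \<Rightarrow> 'a::real_inner set) \<Rightarrow> bool" where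
  "projecting E \<longleftrightarrow> (\<forall>n. finite (E n)) \<and>
     (\<forall>n v. (\<Sum>e\<in>E n. (e \<bullet> v)\<^sup>2) = (norm (\<Sum>e\<in>E n. (e \<bullet> v) *\<^sub>R e))\<^sup>2) \<and>
     (\<forall>n v. (\<Sum>e\<in>E n. (e \<bullet> v)\<^sup>2) \<le> (norm v)\<^sup>2) \<and>
     (\<forall>v. (\<lambda>n. \<Sum>e\<in>E n. (e \<bullet> v) *\<^sub>R e) \<longlonglongrightarrow> v)"

lemma projectingD:
  assumes "projecting E"
  shows "finite (E n)"
    "(\<Sum>e\<in>E n. (e \<bullet> v)\<^sup>2) = (norm (\<Sum>e\<in>E n. (e \<bullet> v) *\<^sub>R e))\<^sup>2"
    "(\<Sum>e\<in>E n. (e \<bullet> v)\<^sup>2) \<le> (norm v)\<^sup>2"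
    "(\<lambda>n. \<Sum>e\<in>E n. (e \<bullet> v) *\<^sub>R e) \<longlonglongrightarrow> v"
  using assms unfolding projecting_def by blast+

lemma projecting_exists: "\<exists>E :: nat \<Rightarrow> 'a::{real_inner, second_countable_topology} set. projecting E"
  using finite_projections unfolding projecting_def by blast

context prob_space
begin

text \<open>Fourth moments are controlled by second moments, as they are for Gaussian variables.\<close>

definition tame :: "('a \<Rightarrow> real) \<Rightarrow> bool" where
  "tame X \<longleftrightarrow> sq X \<and> sq (\<lambda>\<omega>. (X \<omega>)\<^sup>2) \<and> ip (\<lambda>\<omega>. (X \<omega>)\<^sup>2) (\<lambda>\<omega>. (X \<omega>)\<^sup>2) \<le> 3 * (ip X X)\<^sup>2"

definition gch :: "('a \<Rightarrow> real) \<Rightarrow> bool" where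
  "gch X \<longleftrightarrow> sq X \<and> (CLINT \<omega>|M. iexp (X \<omega>)) =
     iexp (expectation X) * exp (- complex_of_real (ip X X - (expectation X)\<^sup>2) / 2)"

lemma gaussian_real_facts:
  assumes X: "X \<in> borel_measurable M" and g: "gaussian_real M X \<mu> v" and v: "0 \<le> v"
  shows "tame X" "gch X" "expectation X = \<mu>" "ip X X = \<mu>\<^sup>2 + v"
proof -
  have "tame X \<and> gch X \<and> expectation X = \<mu> \<and> ip X X = \<mu>\<^sup>2 + v"
  proof (cases "v = 0")
    case True
    then have ae: "AE \<omega> in M. X \<omega> = \<mu>" using g by (simp add: gaussian_real_def)
    have [measurable]: "X \<in> borel_measurable M" by fact
    have cong: "integral\<^sup>L M (\<lambda>\<omega>. f (X \<omega>)) = f \<mu>" if [measurable]: "f \<in> borel_measurable borel"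
      for f :: "real \<Rightarrow> 'b::{banach, second_countable_topology}"
    proof -
      have "integral\<^sup>L M (\<lambda>\<omega>. f (X \<omega>)) = integral\<^sup>L M (\<lambda>\<omega>. f \<mu>)"
        by (rule integral_cong_AE) (use ae in auto)
      then show ?thesis by (simp add: prob_space)
    qed
    have int: "integrable M (\<lambda>\<omega>. f (X \<omega>))" if [measurable]: "f \<in> borel_measurable borel" for f :: "real \<Rightarrow> real"
    proof -
      have "integrable M (\<lambda>\<omega>. f \<mu>)" by simp
      then show ?thesis by (rule integrable_cong_AE_imp) (use ae in auto)
    qed
    have 1: "expectation X = \<mu>" using cong[of "\<lambda>x. x"] by simp
    have 2: "ip X X = \<mu>\<^sup>2" using cong[of "\<lambda>x. x * x"] by (simp add: ip_def power2_eq_square)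
    have 4: "ip (\<lambda>\<omega>. (X \<omega>)\<^sup>2) (\<lambda>\<omega>. (X \<omega>)\<^sup>2) = (\<mu>\<^sup>2)\<^sup>2"
      using cong[of "\<lambda>x. x\<^sup>2 * x\<^sup>2"] by (simp add: ip_def power2_eq_square)
    have s: "sq X" "sq (\<lambda>\<omega>. (X \<omega>)\<^sup>2)"
      using int[of "\<lambda>x. x\<^sup>2"] int[of "\<lambda>x. (x\<^sup>2)\<^sup>2"] by (auto simp: sq_def)
    show ?thesis
      using 1 2 4 s True cong[of "\<lambda>x. iexp x"] by (simp add: tame_def gch_def)
  next
    case False
    then have v: "0 < v" using v by simp
    define \<sigma> where "\<sigma> = sqrt v"
    have \<sigma>: "0 < \<sigma>" "\<sigma>\<^sup>2 = v" using v by (auto simp: \<sigma>_def)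
    define Z where "Z \<omega> = (X \<omega> - \<mu>) / \<sigma>" for \<omega>
    have dZ: "distributed M lborel Z std_normal_density"
      using g False normal_standard_normal_convert[OF \<sigma>(1), of X \<mu>]
      by (simp add: gaussian_real_def \<sigma>_def[symmetric] Z_def[abs_def])
    have [measurable]: "X \<in> borel_measurable M" "Z \<in> borel_measurable M"
      using X unfolding Z_def[abs_def] by auto
    have X_eq: "X \<omega> = \<mu> + \<sigma> * Z \<omega>" for \<omega> using \<sigma> by (simp add: Z_def)
    have mom: "has_bochner_integral M (\<lambda>\<omega>. Z \<omega> ^ k) m"
      if "has_bochner_integral lborel (\<lambda>x. std_normal_density x * x ^ k) m" for k m
      using that distributed_integrable[OF dZ, of "\<lambda>x. x ^ k"] distributed_integral[OF dZ, of "\<lambda>x. x ^ k"]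
      by (simp add: has_bochner_integral_iff)
    have m1: "has_bochner_integral M (\<lambda>\<omega>. Z \<omega>) 0" using mom[OF std_normal_moment_odd[of 0]] by simp
    have m2: "has_bochner_integral M (\<lambda>\<omega>. Z \<omega> ^ 2) 1" using mom[OF std_normal_moment_even[of 1]] by simp
    have m3: "has_bochner_integral M (\<lambda>\<omega>. Z \<omega> ^ 3) 0"
      using mom[OF std_normal_moment_odd[of 1]] by (simp add: numeral_3_eq_3)
    have m4: "has_bochner_integral M (\<lambda>\<omega>. Z \<omega> ^ 4) 3"
      using mom[OF std_normal_moment_even[of 2]] by (simp add: fact_numeral)
    have "has_bochner_integral M (\<lambda>\<omega>. \<mu> + \<sigma> * Z \<omega>) (\<mu> * 1 + \<sigma> * 0)"
      using m1 prob_space by (simp add: has_bochner_integral_iff)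
    then have E1: "expectation X = \<mu>" by (simp add: has_bochner_integral_iff X_eq[abs_def])
    have "has_bochner_integral M (\<lambda>\<omega>. \<mu>\<^sup>2 + (2 * \<mu> * \<sigma>) * Z \<omega> + \<sigma>\<^sup>2 * Z \<omega> ^ 2) (\<mu>\<^sup>2 + (2 * \<mu> * \<sigma>) * 0 + \<sigma>\<^sup>2 * 1)"
      using m1 m2 prob_space by (simp add: has_bochner_integral_iff)
    moreover have "\<mu>\<^sup>2 + (2 * \<mu> * \<sigma>) * Z \<omega> + \<sigma>\<^sup>2 * Z \<omega> ^ 2 = (X \<omega>)\<^sup>2" for \<omega>
      by (simp add: X_eq power2_eq_square algebra_simps)
    ultimately have "has_bochner_integral M (\<lambda>\<omega>. (X \<omega>)\<^sup>2) (\<mu>\<^sup>2 + v)" using \<sigma> by simp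
    then have E2: "ip X X = \<mu>\<^sup>2 + v" and sX: "sq X" by (auto simp: has_bochner_integral_iff ip_self sq_def)
    have "has_bochner_integral M (\<lambda>\<omega>. \<mu> ^ 4 + (4 * \<mu> ^ 3 * \<sigma>) * Z \<omega> + (6 * \<mu>\<^sup>2 * \<sigma>\<^sup>2) * Z \<omega> ^ 2 +
        (4 * \<mu> * \<sigma> ^ 3) * Z \<omega> ^ 3 + \<sigma> ^ 4 * Z \<omega> ^ 4)
       (\<mu> ^ 4 + (4 * \<mu> ^ 3 * \<sigma>) * 0 + (6 * \<mu>\<^sup>2 * \<sigma>\<^sup>2) * 1 + (4 * \<mu> * \<sigma> ^ 3) * 0 + \<sigma> ^ 4 * 3)"
      using m1 m2 m3 m4 prob_space by (simp add: has_bochner_integral_iff)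
    moreover have "\<mu> ^ 4 + (4 * \<mu> ^ 3 * \<sigma>) * Z \<omega> + (6 * \<mu>\<^sup>2 * \<sigma>\<^sup>2) * Z \<omega> ^ 2 +
        (4 * \<mu> * \<sigma> ^ 3) * Z \<omega> ^ 3 + \<sigma> ^ 4 * Z \<omega> ^ 4 = ((X \<omega>)\<^sup>2)\<^sup>2" for \<omega>
      by (simp add: X_eq power2_eq_square power3_eq_cube power4_eq_xxxx algebra_simps)
    moreover have "\<sigma> ^ 4 = v\<^sup>2" using \<sigma>(2) by (metis numeral_Bit0 power2_eq_square power_add)
    ultimately have "has_bochner_integral M (\<lambda>\<omega>. ((X \<omega>)\<^sup>2)\<^sup>2) (\<mu> ^ 4 + 6 * \<mu>\<^sup>2 * v + 3 * v\<^sup>2)"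
      using \<sigma> by (simp add: mult.commute[of _ 3])
    then have E4: "ip (\<lambda>\<omega>. (X \<omega>)\<^sup>2) (\<lambda>\<omega>. (X \<omega>)\<^sup>2) = \<mu> ^ 4 + 6 * \<mu>\<^sup>2 * v + 3 * v\<^sup>2"
      and sX2: "sq (\<lambda>\<omega>. (X \<omega>)\<^sup>2)" by (auto simp: has_bochner_integral_iff ip_self sq_def)
    have "\<mu> ^ 4 + 6 * \<mu>\<^sup>2 * v + 3 * v\<^sup>2 \<le> 3 * (\<mu>\<^sup>2 + v)\<^sup>2"
    proof -
      have "3 * (\<mu>\<^sup>2 + v)\<^sup>2 - (\<mu> ^ 4 + 6 * \<mu>\<^sup>2 * v + 3 * v\<^sup>2) = 2 * (\<mu>\<^sup>2)\<^sup>2"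
        by (simp add: power2_eq_square power4_eq_xxxx algebra_simps)
      then show ?thesis by (metis diff_ge_0_iff_ge mult_nonneg_nonneg zero_le_numeral zero_le_power2)
    qed
    then have "tame X" using sX sX2 E2 E4 by (simp add: tame_def)
    moreover have "gch X"
    proof -
      have "(CLINT \<omega>|M. iexp (\<sigma> * Z \<omega>)) = char (distr M borel Z) \<sigma>"
        unfolding char_def by (subst integral_distr) auto
      also have "distr M borel Z = std_normal_distribution"
        using distributed_distr_eq_density[OF dZ] by (simp cong: distr_cong)
      finally have "(CLINT \<omega>|M. iexp (\<sigma> * Z \<omega>)) = complex_of_real (exp (- v / 2))"
        unfolding char_std_normal_distribution \<sigma>(2) .
      moreover have "exp (- complex_of_real v / 2) = complex_of_real (exp (- v / 2))"
        by (simp add: exp_of_real[symmetric])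
      ultimately have Zc: "(CLINT \<omega>|M. iexp (\<sigma> * Z \<omega>)) = exp (- complex_of_real v / 2)" by simp
      have "(CLINT \<omega>|M. iexp (X \<omega>)) = (CLINT \<omega>|M. iexp \<mu> * iexp (\<sigma> * Z \<omega>))"
        by (intro Bochner_Integration.integral_cong) (auto simp: X_eq exp_add[symmetric] algebra_simps)
      also have "\<dots> = iexp \<mu> * exp (- complex_of_real v / 2)"
        unfolding Bochner_Integration.integral_mult_right_zero Zc ..
      finally show ?thesis using sX E1 E2 by (simp add: gch_def)
    qed
    ultimately show ?thesis using E1 E2 by simp
  qed
  then show "tame X" "gch X" "expectation X = \<mu>" "ip X X = \<mu>\<^sup>2 + v" by auto
qed

text \<open>Fatou's lemma.\<close>

lemma integrable_limit:
  fixes Q :: "nat \<Rightarrow> 'a \<Rightarrow> real"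
  assumes Q: "\<And>n. integrable M (Q n)" "\<And>n \<omega>. 0 \<le> Q n \<omega>" "\<And>n. expectation (Q n) \<le> B"
    and L: "L \<in> borel_measurable M" "AE \<omega> in M. (\<lambda>n. Q n \<omega>) \<longlonglongrightarrow> L \<omega>"
  shows "integrable M L" "expectation L \<le> B"
proof -
  have nonneg: "AE \<omega> in M. 0 \<le> L \<omega>"
    using L(2) by eventually_elim (use Q(2) in \<open>auto intro: LIMSEQ_le_const\<close>)
  have "(\<integral>\<^sup>+\<omega>. ennreal (L \<omega>) \<partial>M) = (\<integral>\<^sup>+\<omega>. liminf (\<lambda>n. ennreal (Q n \<omega>)) \<partial>M)"
  proof (rule nn_integral_cong_AE)
    show "AE \<omega> in M. ennreal (L \<omega>) = liminf (\<lambda>n. ennreal (Q n \<omega>))"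
      using L(2)
    proof eventually_elim
      case (elim \<omega>)
      then have "(\<lambda>n. ennreal (Q n \<omega>)) \<longlonglongrightarrow> ennreal (L \<omega>)" by (rule tendsto_ennrealI)
      from lim_imp_Liminf[OF _ this] show ?case by simp
    qed
  qed
  also have "\<dots> \<le> liminf (\<lambda>n. \<integral>\<^sup>+\<omega>. ennreal (Q n \<omega>) \<partial>M)"
    using Q(1) by (intro nn_integral_liminf) auto
  also have "\<dots> \<le> liminf (\<lambda>n. ennreal B)"
    using Q by (intro Liminf_mono always_eventually allI) (auto simp: nn_integral_eq_integral intro: ennreal_leI)
  also have "\<dots> = ennreal B" by (simp add: Liminf_const)
  finally have le: "(\<integral>\<^sup>+\<omega>. ennreal (L \<omega>) \<partial>M) \<le> ennreal B" .
  show int: "integrable M L"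
    using le_less_trans[OF le ennreal_less_top] by (intro integrableI_nonneg[OF L(1) nonneg]) simp
  have B: "0 \<le> B" using Q(3)[of 0] Bochner_Integration.integral_nonneg[of M "Q 0"] Q(2) by (meson order_trans)
  show "expectation L \<le> B"
    using le nonneg int B by (subst (asm) nn_integral_eq_integral) (auto simp: ennreal_le_iff)
qed

text \<open>A family of non-negative variables that is bounded at almost every point has bounded
  expectations if its second moments are comparable to the squared first moments: outside of an
  event of probability at most \<open>1 / 12\<close> the family is bounded by a constant, and the event
  contributes at most half of an expectation by the Cauchy-Schwarz inequality.\<close>

lemma bounded_expectations:
  fixes Q :: "nat \<Rightarrow> 'a \<Rightarrow> real"
  assumes Q: "\<And>n. sq (Q n)" "\<And>n \<omega>. 0 \<le> Q n \<omega>" "\<And>n. ip (Q n) (Q n) \<le> 3 * (expectation (Q n))\<^sup>2"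
    and bounded: "AE \<omega> in M. \<exists>K. \<forall>n. Q n \<omega> \<le> K"
  shows "\<exists>B. \<forall>n. expectation (Q n) \<le> B"
proof -
  have [measurable]: "Q n \<in> borel_measurable M" for n using Q(1) by (rule sq_measurable)
  define A where "A k = {\<omega>\<in>space M. \<forall>n. Q n \<omega> \<le> real k}" for k :: nat
  have A [measurable]: "A k \<in> sets M" for k unfolding A_def by measurable
  have "(\<lambda>k. prob (A k)) \<longlonglongrightarrow> prob (\<Union>k. A k)"
    by (rule finite_Lim_measure_incseq) (auto simp: A_def incseq_def intro: order_trans)
  moreover have "prob (\<Union>k. A k) = 1"
  proof -
    have "AE \<omega> in M. \<omega> \<in> (\<Union>k. A k)"
      using bounded AE_space
    proof eventually_elim
      case (elim \<omega>)
      then obtain K where K: "\<And>n. Q n \<omega> \<le> K" by blast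
      obtain k where "K \<le> real k" using real_arch_simple by blast
      then have "\<omega> \<in> A k" using K elim unfolding A_def by (auto intro: order_trans)
      then show ?case by blast
    qed
    then show ?thesis by (subst (asm) prob_Collect_eq_1[symmetric]) (auto simp: prob_eq_1)
  qed
  ultimately have "(\<lambda>k. prob (A k)) \<longlonglongrightarrow> 1" by simp
  then have "\<forall>\<^sub>F k in sequentially. 11 / 12 < prob (A k)" by (rule order_tendstoD) simp
  then obtain k where k: "11 / 12 < prob (A k)" by (meson eventually_sequentially order_refl)
  define B where "B = space M - A k"
  have [measurable]: "B \<in> sets M" by (simp add: B_def)
  have pB: "prob B \<le> 1 / 12" using prob_compl[OF A, of k] k by (simp add: B_def)
  have ind: "(\<lambda>\<omega>. indicator B \<omega> * indicator B \<omega> :: real) = indicator B" by (auto simp: indicator_def)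
  have sqB: "sq (indicator B)" unfolding sq_def power2_eq_square ind by (auto intro!: integrable_const_bound[where B = 1])
  have iB: "ip (indicator B) (indicator B) = prob B" unfolding ip_def ind by simp
  have "expectation (Q n) \<le> 2 * real k" for n
  proof -
    let ?q = "expectation (Q n)"
    have q0: "0 \<le> ?q" using Q(2) by (intro Bochner_Integration.integral_nonneg) auto
    have "(ip (Q n) (indicator B))\<^sup>2 \<le> ip (Q n) (Q n) * prob B"
      using ip_Cauchy_Schwarz[OF Q(1) sqB] iB by simp
    also have "\<dots> \<le> (3 * ?q\<^sup>2) * (1 / 12)" by (intro mult_mono Q(3) pB) auto
    also have "\<dots> = (?q / 2)\<^sup>2" by (simp add: power2_eq_square)
    finally have "ip (Q n) (indicator B) \<le> ?q / 2" by (rule power2_le_imp_le) (use q0 in simp)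
    moreover have "?q \<le> expectation (\<lambda>\<omega>. real k + Q n \<omega> * indicator B \<omega>)"
    proof (rule integral_mono)
      show "integrable M (Q n)" by (rule sq_integrable[OF Q(1)])
      show "integrable M (\<lambda>\<omega>. real k + Q n \<omega> * indicator B \<omega>)"
        using sq_integrable_mult[OF Q(1) sqB] by simp
      show "Q n \<omega> \<le> real k + Q n \<omega> * indicator B \<omega>" if "\<omega> \<in> space M" for \<omega>
        using that Q(2)[of n \<omega>] by (auto simp: B_def A_def indicator_def)
    qed
    then have "?q \<le> real k + ip (Q n) (indicator B)"
      using sq_integrable_mult[OF Q(1) sqB] by (simp add: ip_def prob_space)
    ultimately show ?thesis by simp
  qed
  then show ?thesis by blast
qed

text \<open>The covariances between the summands are estimated by Cauchy-Schwarz, whatever the dependence,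
  and the constant \<open>3\<close> survives.\<close>

lemma tame_sum_squares:
  assumes "finite F" "\<And>j. j \<in> F \<Longrightarrow> tame (X j)"
  defines "Q \<equiv> \<lambda>\<omega>. \<Sum>j\<in>F. (X j \<omega>)\<^sup>2"
  shows "sq Q" "ip Q Q \<le> 3 * (expectation Q)\<^sup>2"
proof -
  have s: "sq (X j)" "sq (\<lambda>\<omega>. (X j \<omega>)\<^sup>2)" if "j \<in> F" for j using assms(2)[OF that] by (auto simp: tame_def)
  show sqQ: "sq Q" unfolding Q_def using s by auto
  have pair: "ip (\<lambda>\<omega>. (X i \<omega>)\<^sup>2) (\<lambda>\<omega>. (X j \<omega>)\<^sup>2) \<le> 3 * (ip (X i) (X i) * ip (X j) (X j))"
    if "i \<in> F" "j \<in> F" for i j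
  proof (rule power2_le_imp_le)
    have "(ip (\<lambda>\<omega>. (X i \<omega>)\<^sup>2) (\<lambda>\<omega>. (X j \<omega>)\<^sup>2))\<^sup>2 \<le>
        ip (\<lambda>\<omega>. (X i \<omega>)\<^sup>2) (\<lambda>\<omega>. (X i \<omega>)\<^sup>2) * ip (\<lambda>\<omega>. (X j \<omega>)\<^sup>2) (\<lambda>\<omega>. (X j \<omega>)\<^sup>2)"
      using s that by (intro ip_Cauchy_Schwarz)
    also have "\<dots> \<le> (3 * (ip (X i) (X i))\<^sup>2) * (3 * (ip (X j) (X j))\<^sup>2)"
      using assms(2) that by (intro mult_mono) (auto simp: tame_def)
    also have "\<dots> = (3 * (ip (X i) (X i) * ip (X j) (X j)))\<^sup>2" by (simp add: power2_eq_square)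
    finally show "(ip (\<lambda>\<omega>. (X i \<omega>)\<^sup>2) (\<lambda>\<omega>. (X j \<omega>)\<^sup>2))\<^sup>2 \<le> (3 * (ip (X i) (X i) * ip (X j) (X j)))\<^sup>2" .
  qed (simp add: mult_nonneg_nonneg)
  have lin: "ip Q Z = (\<Sum>j\<in>F. ip (\<lambda>\<omega>. (X j \<omega>)\<^sup>2) Z)" if "sq Z" for Z
    using ip_lincomb_left[where F = F and X = "\<lambda>j \<omega>. (X j \<omega>)\<^sup>2" and a = "\<lambda>_. 1" and Z = Z] s that
    by (simp add: Q_def)
  have "ip Q Q = (\<Sum>i\<in>F. ip (\<lambda>\<omega>. (X i \<omega>)\<^sup>2) Q)" by (rule lin[OF sqQ])
  also have "\<dots> = (\<Sum>i\<in>F. \<Sum>j\<in>F. ip (\<lambda>\<omega>. (X j \<omega>)\<^sup>2) (\<lambda>\<omega>. (X i \<omega>)\<^sup>2))"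
  proof (rule sum.cong[OF refl])
    fix i assume "i \<in> F"
    have "ip (\<lambda>\<omega>. (X i \<omega>)\<^sup>2) Q = ip Q (\<lambda>\<omega>. (X i \<omega>)\<^sup>2)" by (rule ip_commute)
    also have "\<dots> = (\<Sum>j\<in>F. ip (\<lambda>\<omega>. (X j \<omega>)\<^sup>2) (\<lambda>\<omega>. (X i \<omega>)\<^sup>2))" by (rule lin[OF s(2)[OF \<open>i \<in> F\<close>]])
    finally show "ip (\<lambda>\<omega>. (X i \<omega>)\<^sup>2) Q = (\<Sum>j\<in>F. ip (\<lambda>\<omega>. (X j \<omega>)\<^sup>2) (\<lambda>\<omega>. (X i \<omega>)\<^sup>2))" .
  qed
  also have "\<dots> \<le> (\<Sum>i\<in>F. \<Sum>j\<in>F. 3 * (ip (X j) (X j) * ip (X i) (X i)))"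
    by (intro sum_mono pair)
  also have "\<dots> = 3 * (\<Sum>j\<in>F. ip (X j) (X j))\<^sup>2"
    by (simp add: power2_eq_square sum_product sum_distrib_left mult.commute)
  also have "(\<Sum>j\<in>F. ip (X j) (X j)) = expectation Q"
    using s unfolding Q_def by (subst Bochner_Integration.integral_sum) (auto simp: ip_self sq_def)
  finally show "ip Q Q \<le> 3 * (expectation Q)\<^sup>2" .
qed

lemma gch_limit:
  assumes X: "\<And>n. gch (X n)" and L: "L \<in> borel_measurable M" "AE \<omega> in M. (\<lambda>n. X n \<omega>) \<longlonglongrightarrow> L \<omega>"
    and Z: "sq Z" "\<And>n. AE \<omega> in M. \<bar>X n \<omega>\<bar> \<le> Z \<omega>"
  shows "gch L"
proof -
  have [measurable]: "X n \<in> borel_measurable M" for n using X[of n] by (auto simp: gch_def sq_def)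
  note [measurable] = L(1)
  have Zi: "integrable M Z" "integrable M (\<lambda>\<omega>. (Z \<omega>)\<^sup>2)" using Z by (auto intro: sq_integrable simp: sq_def)
  have b2: "AE \<omega> in M. norm ((X n \<omega>)\<^sup>2) \<le> (Z \<omega>)\<^sup>2" for n
    using Z(2)[of n] by eventually_elim (metis abs_ge_zero power2_abs power_mono real_norm_def abs_power2)
  have lim2: "AE \<omega> in M. (\<lambda>n. (X n \<omega>)\<^sup>2) \<longlonglongrightarrow> (L \<omega>)\<^sup>2"
    using L(2) by eventually_elim (rule tendsto_power)
  have "integrable M (\<lambda>\<omega>. (L \<omega>)\<^sup>2)"
    by (rule integrable_dominated_convergence[OF _ _ Zi(2) lim2 b2]) auto
  then have sL: "sq L" by (simp add: sq_def)
  have E1: "(\<lambda>n. expectation (X n)) \<longlonglongrightarrow> expectation L"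
    by (rule integral_dominated_convergence[OF _ _ Zi(1) L(2)]) (use Z(2) in auto)
  have E2: "(\<lambda>n. ip (X n) (X n)) \<longlonglongrightarrow> ip L L"
    unfolding ip_self by (rule integral_dominated_convergence[OF _ _ Zi(2) lim2 b2]) auto
  have "(\<lambda>n. CLINT \<omega>|M. iexp (X n \<omega>)) \<longlonglongrightarrow> (CLINT \<omega>|M. iexp (L \<omega>))"
  proof (rule integral_dominated_convergence[where w = "\<lambda>_. 1"])
    show "AE \<omega> in M. (\<lambda>n. iexp (X n \<omega>)) \<longlonglongrightarrow> iexp (L \<omega>)"
      using L(2) by eventually_elim (intro tendsto_intros)
  qed auto
  moreover have "(\<lambda>n. CLINT \<omega>|M. iexp (X n \<omega>)) \<longlonglongrightarrow>
      iexp (expectation L) * exp (- complex_of_real (ip L L - (expectation L)\<^sup>2) / 2)"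
    using X unfolding gch_def by (simp only:) (intro tendsto_intros E1 E2; simp)
  ultimately show ?thesis using sL LIMSEQ_unique unfolding gch_def by blast
qed

lemma tame_limit:
  assumes X: "\<And>n. tame (X n)" and L: "L \<in> borel_measurable M" "AE \<omega> in M. (\<lambda>n. X n \<omega>) \<longlonglongrightarrow> L \<omega>"
    and Z: "sq Z" "sq (\<lambda>\<omega>. (Z \<omega>)\<^sup>2)" "\<And>n. AE \<omega> in M. \<bar>X n \<omega>\<bar> \<le> Z \<omega>"
  shows "tame L"
proof -
  have [measurable]: "X n \<in> borel_measurable M" for n using X[of n] by (auto simp: tame_def sq_def)
  note [measurable] = L(1)
  have Zi: "integrable M (\<lambda>\<omega>. (Z \<omega>)\<^sup>2)" "integrable M (\<lambda>\<omega>. ((Z \<omega>)\<^sup>2)\<^sup>2)" using Z by (auto simp: sq_def)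
  have b2: "AE \<omega> in M. norm ((X n \<omega>)\<^sup>2) \<le> (Z \<omega>)\<^sup>2" for n
    using Z(3)[of n] by eventually_elim (metis abs_ge_zero power2_abs power_mono real_norm_def abs_power2)
  have b4: "AE \<omega> in M. norm (((X n \<omega>)\<^sup>2)\<^sup>2) \<le> ((Z \<omega>)\<^sup>2)\<^sup>2" for n
    using b2[of n] by eventually_elim (metis norm_ge_zero norm_power power_mono)
  have lim2: "AE \<omega> in M. (\<lambda>n. (X n \<omega>)\<^sup>2) \<longlonglongrightarrow> (L \<omega>)\<^sup>2"
    using L(2) by eventually_elim (rule tendsto_power)
  have lim4: "AE \<omega> in M. (\<lambda>n. ((X n \<omega>)\<^sup>2)\<^sup>2) \<longlonglongrightarrow> ((L \<omega>)\<^sup>2)\<^sup>2"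
    using lim2 by eventually_elim (rule tendsto_power)
  have i2: "integrable M (\<lambda>\<omega>. (L \<omega>)\<^sup>2)"
    by (rule integrable_dominated_convergence[OF _ _ Zi(1) lim2 b2]) auto
  have i4: "integrable M (\<lambda>\<omega>. ((L \<omega>)\<^sup>2)\<^sup>2)"
    by (rule integrable_dominated_convergence[OF _ _ Zi(2) lim4 b4]) auto
  have E2: "(\<lambda>n. ip (X n) (X n)) \<longlonglongrightarrow> ip L L"
    unfolding ip_self by (rule integral_dominated_convergence[OF _ _ Zi(1) lim2 b2]) auto
  have E4: "(\<lambda>n. ip (\<lambda>\<omega>. (X n \<omega>)\<^sup>2) (\<lambda>\<omega>. (X n \<omega>)\<^sup>2)) \<longlonglongrightarrow> ip (\<lambda>\<omega>. (L \<omega>)\<^sup>2) (\<lambda>\<omega>. (L \<omega>)\<^sup>2)"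
    unfolding ip_self by (rule integral_dominated_convergence[OF _ _ Zi(2) lim4 b4]) auto
  have "ip (\<lambda>\<omega>. (L \<omega>)\<^sup>2) (\<lambda>\<omega>. (L \<omega>)\<^sup>2) \<le> 3 * (ip L L)\<^sup>2"
    by (rule LIMSEQ_le[OF E4 tendsto_mult[OF tendsto_const tendsto_power[OF E2]]])
       (use X in \<open>auto simp: tame_def\<close>)
  then show ?thesis using i2 i4 by (simp add: tame_def sq_def)
qed

end

locale hilbert_gaussian = prob_space +
  fixes x :: "'a \<Rightarrow> 'x::{real_inner, banach, second_countable_topology}" and m :: 'x and P0 :: "'x \<Rightarrow> 'x"
  assumes gauss_x: "gaussian M x m P0"
begin

lemma x_measurable [measurable]: "x \<in> borel_measurable M"
  using gauss_x by (simp add: gaussian_def)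

lemma inner_x: "tame (\<lambda>\<omega>. h \<bullet> x \<omega>)" "gch (\<lambda>\<omega>. h \<bullet> x \<omega>)"
proof -
  have "gaussian_real M (\<lambda>\<omega>. h \<bullet> x \<omega>) (h \<bullet> m) (h \<bullet> P0 h)" "0 \<le> h \<bullet> P0 h"
    using gauss_x by (auto simp: gaussian_def)
  then show "tame (\<lambda>\<omega>. h \<bullet> x \<omega>)" "gch (\<lambda>\<omega>. h \<bullet> x \<omega>)"
    using gaussian_real_facts(1,2)[of "\<lambda>\<omega>. h \<bullet> x \<omega>"] by (auto intro: borel_measurable_inner)
qed

text \<open>The squared norms of the finite dimensional projections have comparable first and second moments
  and are bounded by the finite number \<open>\<parallel>x \<omega>\<parallel>\<^sup>2\<close> at every point.\<close>

lemma norm_x: "sq (\<lambda>\<omega>. norm (x \<omega>))" "sq (\<lambda>\<omega>. (norm (x \<omega>))\<^sup>2)"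
proof -
  obtain E :: "nat \<Rightarrow> 'x set" where "projecting E" using projecting_exists by blast
  note E = projectingD[OF this]
  define Q where "Q n \<omega> = (\<Sum>e\<in>E n. (e \<bullet> x \<omega>)\<^sup>2)" for n \<omega>
  have Q: "sq (Q n)" "ip (Q n) (Q n) \<le> 3 * (expectation (Q n))\<^sup>2" "0 \<le> Q n \<omega>" "Q n \<omega> \<le> (norm (x \<omega>))\<^sup>2" for n \<omega>
    using tame_sum_squares[where F = "E n" and X = "\<lambda>e \<omega>. e \<bullet> x \<omega>", OF E(1) inner_x(1)] E(3)[where n = n and v = "x \<omega>"]
    by (auto simp: Q_def[abs_def] sum_nonneg)
  have Qlim: "(\<lambda>n. Q n \<omega>) \<longlonglongrightarrow> (norm (x \<omega>))\<^sup>2" for \<omega>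
    unfolding Q_def E(2) by (intro tendsto_intros E(4))
  have "AE \<omega> in M. \<exists>K. \<forall>n. Q n \<omega> \<le> K"
    by (rule AE_I2) (use Q(4) in blast)
  then have "\<exists>B. \<forall>n. expectation (Q n) \<le> B"
    using Q by (intro bounded_expectations) auto
  then obtain B where B: "\<And>n. expectation (Q n) \<le> B" by blast
  have "integrable M (\<lambda>\<omega>. (norm (x \<omega>))\<^sup>2)"
    by (rule integrable_limit(1)[where Q = Q and B = B]) (use Q B Qlim sq_integrable in auto)
  then show "sq (\<lambda>\<omega>. norm (x \<omega>))" by (simp add: sq_def)
  have "integrable M (\<lambda>\<omega>. ((norm (x \<omega>))\<^sup>2)\<^sup>2)"
  proof (rule integrable_limit(1)[where Q = "\<lambda>n \<omega>. (Q n \<omega>)\<^sup>2" and B = "3 * B\<^sup>2"])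
    fix n
    show "integrable M (\<lambda>\<omega>. (Q n \<omega>)\<^sup>2)" using Q by (simp add: sq_def)
    have "0 \<le> expectation (Q n)" using Q by (intro Bochner_Integration.integral_nonneg) auto
    then have "(expectation (Q n))\<^sup>2 \<le> B\<^sup>2" using B by (intro power_mono)
    then show "expectation (\<lambda>\<omega>. (Q n \<omega>)\<^sup>2) \<le> 3 * B\<^sup>2" using Q(2)[of n] by (simp add: ip_self)
    show "AE \<omega> in M. (\<lambda>n. (Q n \<omega>)\<^sup>2) \<longlonglongrightarrow> ((norm (x \<omega>))\<^sup>2)\<^sup>2"
      by (rule AE_I2) (rule tendsto_power[OF Qlim])
  qed auto
  then show "sq (\<lambda>\<omega>. (norm (x \<omega>))\<^sup>2)" unfolding sq_def by simp
qed

text \<open>A functional is a limit of inner products: apply it to the projections of \<open>x\<close>.\<close>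

lemma functional_x:
  assumes \<phi>: "bounded_linear \<phi>"
  shows "tame (\<lambda>\<omega>. \<phi> (x \<omega>))" "gch (\<lambda>\<omega>. \<phi> (x \<omega>))"
proof -
  interpret \<phi>: bounded_linear \<phi> by fact
  obtain K where K: "0 \<le> K" "\<And>v. norm (\<phi> v) \<le> norm v * K" using \<phi>.nonneg_bounded by blast
  obtain E :: "nat \<Rightarrow> 'x set" where "projecting E" using projecting_exists by blast
  note E = projectingD[OF this]
  define X where "X n \<omega> = \<phi> (\<Sum>e\<in>E n. (e \<bullet> x \<omega>) *\<^sub>R e)" for n \<omega>
  have X_eq: "X n = (\<lambda>\<omega>. (\<Sum>e\<in>E n. \<phi> e *\<^sub>R e) \<bullet> x \<omega>)" for n
    by (auto simp: X_def \<phi>.sum \<phi>.scaleR inner_sum_left mult.commute)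
  have b: "\<bar>X n \<omega>\<bar> \<le> K * norm (x \<omega>)" for n \<omega>
  proof -
    have "norm (\<Sum>e\<in>E n. (e \<bullet> x \<omega>) *\<^sub>R e) \<le> norm (x \<omega>)"
      using E(2,3)[where n = n and v = "x \<omega>"] by (intro power2_le_imp_le[of "norm (\<Sum>e\<in>E n. (e \<bullet> x \<omega>) *\<^sub>R e)"]) auto
    from order_trans[OF K(2) mult_right_mono[OF this K(1)]] show ?thesis
      by (simp add: X_def mult.commute)
  qed
  have lim: "(\<lambda>n. X n \<omega>) \<longlonglongrightarrow> \<phi> (x \<omega>)" for \<omega>
    unfolding X_def by (rule \<phi>.tendsto[OF E(4)])
  have "\<phi> \<in> borel_measurable borel"
    by (intro borel_measurable_continuous_onI linear_continuous_on \<phi>)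
  then have m: "(\<lambda>\<omega>. \<phi> (x \<omega>)) \<in> borel_measurable M" by (rule measurable_compose[OF x_measurable])
  have Z: "sq (\<lambda>\<omega>. K * norm (x \<omega>))" "sq (\<lambda>\<omega>. (K * norm (x \<omega>))\<^sup>2)"
    using norm_x sq_cmult[OF norm_x(2), of "K\<^sup>2"] by (auto simp: power_mult_distrib)
  show "tame (\<lambda>\<omega>. \<phi> (x \<omega>))"
    by (rule tame_limit[where X = X, OF _ m _ Z]) (use inner_x b lim X_eq in auto)
  show "gch (\<lambda>\<omega>. \<phi> (x \<omega>))"
    by (rule gch_limit[where X = X, OF _ m _ Z(1)]) (use inner_x b lim X_eq in auto)
qed

text \<open>A limit of bounded images of \<open>x\<close> is square integrable.\<close>

lemma limit_of_images:
  assumes f: "\<And>k. bounded_linear (f k :: 'x \<Rightarrow> 'x)"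
    and V: "V \<in> borel_measurable M" "AE \<omega> in M. (\<lambda>k. f k (x \<omega>)) \<longlonglongrightarrow> V \<omega>"
  shows "integrable M (\<lambda>\<omega>. (norm (V \<omega>))\<^sup>2)"
proof -
  obtain E :: "nat \<Rightarrow> 'x set" where "projecting E" using projecting_exists by blast
  note E = projectingD[OF this]
  define Q where "Q k \<omega> = (norm (f k (x \<omega>)))\<^sup>2" for k \<omega>
  have fm [measurable]: "(\<lambda>\<omega>. f k (x \<omega>)) \<in> borel_measurable M" for k
    by (rule measurable_compose[OF x_measurable])
       (intro borel_measurable_continuous_onI linear_continuous_on f)
  have Q: "sq (Q k) \<and> ip (Q k) (Q k) \<le> 3 * (expectation (Q k))\<^sup>2" for k
  proof -
    define q where "q n \<omega> = (\<Sum>e\<in>E n. (e \<bullet> f k (x \<omega>))\<^sup>2)" for n \<omega>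
    have "tame (\<lambda>\<omega>. e \<bullet> f k (x \<omega>))" for e
      by (rule functional_x(1)[OF bounded_linear_compose[OF bounded_linear_inner_right f]])
    from tame_sum_squares[where X = "\<lambda>e \<omega>. e \<bullet> f k (x \<omega>)", OF E(1) this]
    have q: "sq (q n)" "ip (q n) (q n) \<le> 3 * (expectation (q n))\<^sup>2" for n
      by (auto simp: q_def[abs_def])
    have qlim: "(\<lambda>n. q n \<omega>) \<longlonglongrightarrow> Q k \<omega>" for \<omega>
      unfolding q_def Q_def E(2) by (intro tendsto_intros E(4))
    obtain K where K: "0 \<le> K" "\<And>v. norm (f k v) \<le> norm v * K"
      using bounded_linear.nonneg_bounded[OF f] by blast
    have qb: "0 \<le> q n \<omega>" "q n \<omega> \<le> K\<^sup>2 * (norm (x \<omega>))\<^sup>2" for n \<omega>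
    proof -
      show "0 \<le> q n \<omega>" by (simp add: q_def sum_nonneg)
      have "q n \<omega> \<le> (norm (f k (x \<omega>)))\<^sup>2" unfolding q_def by (rule E(3))
      also have "\<dots> \<le> (norm (x \<omega>) * K)\<^sup>2" by (intro power_mono K) auto
      finally show "q n \<omega> \<le> K\<^sup>2 * (norm (x \<omega>))\<^sup>2" by (simp add: power_mult_distrib mult.commute)
    qed
    have [measurable]: "Q k \<in> borel_measurable M" "q n \<in> borel_measurable M" for n
      unfolding Q_def[abs_def] q_def[abs_def] by measurable
    have Z: "sq (\<lambda>\<omega>. K\<^sup>2 * (norm (x \<omega>))\<^sup>2)" by (intro sq_cmult norm_x)
    have Zi: "integrable M (\<lambda>\<omega>. K\<^sup>2 * (norm (x \<omega>))\<^sup>2)" "integrable M (\<lambda>\<omega>. (K\<^sup>2 * (norm (x \<omega>))\<^sup>2)\<^sup>2)"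
      using sq_integrable[OF Z] conjunct2[OF Z[unfolded sq_def]] by blast+
    have b2: "AE \<omega> in M. norm ((q n \<omega>)\<^sup>2) \<le> (K\<^sup>2 * (norm (x \<omega>))\<^sup>2)\<^sup>2" for n
      using qb by (intro AE_I2) (simp add: power_mono)
    have b1: "AE \<omega> in M. norm (q n \<omega>) \<le> K\<^sup>2 * (norm (x \<omega>))\<^sup>2" for n
      using qb by (intro AE_I2) simp
    have l2: "AE \<omega> in M. (\<lambda>n. (q n \<omega>)\<^sup>2) \<longlonglongrightarrow> (Q k \<omega>)\<^sup>2" by (intro AE_I2 tendsto_power qlim)
    have l1: "AE \<omega> in M. (\<lambda>n. q n \<omega>) \<longlonglongrightarrow> Q k \<omega>" by (intro AE_I2 qlim)
    have i: "integrable M (\<lambda>\<omega>. (Q k \<omega>)\<^sup>2)"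
      by (rule integrable_dominated_convergence[OF _ _ Zi(2) l2 b2]) auto
    have c2: "(\<lambda>n. ip (q n) (q n)) \<longlonglongrightarrow> ip (Q k) (Q k)"
      unfolding ip_self by (rule integral_dominated_convergence[OF _ _ Zi(2) l2 b2]) auto
    have c1: "(\<lambda>n. expectation (q n)) \<longlonglongrightarrow> expectation (Q k)"
      by (rule integral_dominated_convergence[OF _ _ Zi(1) l1 b1]) auto
    have "ip (Q k) (Q k) \<le> 3 * (expectation (Q k))\<^sup>2"
      by (rule LIMSEQ_le[OF c2 tendsto_mult[OF tendsto_const tendsto_power[OF c1]]]) (use q in auto)
    then show ?thesis using i by (simp add: sq_def)
  qed
  have Qlim: "AE \<omega> in M. (\<lambda>k. Q k \<omega>) \<longlonglongrightarrow> (norm (V \<omega>))\<^sup>2"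
    using V(2) by eventually_elim (auto simp: Q_def intro!: tendsto_intros)
  have "AE \<omega> in M. \<exists>K. \<forall>k. Q k \<omega> \<le> K"
    using Qlim
  proof eventually_elim
    case (elim \<omega>)
    from convergent_imp_bounded[OF this] show ?case
      unfolding bounded_iff by (auto simp: Q_def intro: order_trans[OF abs_ge_self])
  qed
  then have "\<exists>B. \<forall>k. expectation (Q k) \<le> B"
    using Q by (intro bounded_expectations) (auto simp: Q_def)
  then obtain B where B: "\<And>k. expectation (Q k) \<le> B" by blast
  show ?thesis
    by (rule integrable_limit(1)[where Q = Q and B = B, OF _ _ B _ Qlim])
       (use Q V(1) sq_integrable in \<open>auto simp: Q_def\<close>)
qed

end

section \<open>Brownian motion and the Gaussian space of the system\<close>

context prob_space
begin

lemma ip_cong_AE: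
  assumes "AE \<omega> in M. X \<omega> = X' \<omega>" "AE \<omega> in M. Y \<omega> = Y' \<omega>"
    and [measurable]: "X \<in> borel_measurable M" "X' \<in> borel_measurable M"
      "Y \<in> borel_measurable M" "Y' \<in> borel_measurable M"
  shows "ip X Y = ip X' Y'"
  unfolding ip_def by (rule integral_cong_AE) (use assms(1,2) in auto)

lemma sq_cong_AE:
  assumes "sq X" "AE \<omega> in M. X \<omega> = Y \<omega>" and [measurable]: "Y \<in> borel_measurable M"
  shows "sq Y"
proof -
  have "integrable M (\<lambda>\<omega>. (X \<omega>)\<^sup>2)" using assms(1) by (simp add: sq_def)
  then have "integrable M (\<lambda>\<omega>. (Y \<omega>)\<^sup>2)"
    by (rule integrable_cong_AE_imp) (use assms(2) in auto)
  then show ?thesis by (simp add: sq_def)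
qed

lemma gch_cong_AE:
  assumes X: "gch X" and ae: "AE \<omega> in M. X \<omega> = Y \<omega>" and [measurable]: "Y \<in> borel_measurable M"
  shows "gch Y"
proof -
  have sqX: "sq X" using X by (simp add: gch_def)
  note [measurable] = sq_measurable[OF sqX]
  have "(CLINT \<omega>|M. iexp (X \<omega>)) = (CLINT \<omega>|M. iexp (Y \<omega>))"
    by (rule integral_cong_AE) (use ae in auto)
  moreover have "expectation X = expectation Y" by (rule integral_cong_AE) (use ae in auto)
  moreover have "ip X X = ip Y Y" by (rule ip_cong_AE) (use ae in auto)
  ultimately show ?thesis using X sq_cong_AE[OF sqX ae] by (simp add: gch_def)
qed

text \<open>Characteristic functions of independent variables multiply, and their variances add.\<close>

lemma gch_add:
  assumes ind: "indep_var borel X borel Y" and X: "gch X" and Y: "gch Y"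
  shows "gch (\<lambda>\<omega>. X \<omega> + Y \<omega>)"
proof -
  have s: "sq X" "sq Y" using X Y by (auto simp: gch_def)
  note [measurable] = s[THEN sq_measurable]
  have "char (distr M borel Z) 1 = (CLINT \<omega>|M. iexp (Z \<omega>))" if [measurable]: "Z \<in> borel_measurable M" for Z
    unfolding char_def by (subst integral_distr) auto
  then have c: "(CLINT \<omega>|M. iexp (X \<omega> + Y \<omega>)) = (CLINT \<omega>|M. iexp (X \<omega>)) * (CLINT \<omega>|M. iexp (Y \<omega>))"
    using char_distr_add[OF ind, of 1] by simp
  have E: "expectation (\<lambda>\<omega>. X \<omega> + Y \<omega>) = expectation X + expectation Y"
    using s by (intro Bochner_Integration.integral_add sq_integrable)
  have XY: "ip X Y = expectation X * expectation Y"
    unfolding ip_def by (rule indep_var_lebesgue_integral[OF ind]) (use s sq_integrable in auto)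
  have v: "ip (\<lambda>\<omega>. X \<omega> + Y \<omega>) (\<lambda>\<omega>. X \<omega> + Y \<omega>) =
      ip X X + ip Y Y + 2 * (expectation X * expectation Y)"
    using s XY by (simp add: ip_add_left ip_add_right sq_add ip_commute[of Y X])
  have "(CLINT \<omega>|M. iexp (X \<omega> + Y \<omega>)) =
      iexp (expectation X + expectation Y) *
      exp (- complex_of_real (ip X X + ip Y Y + 2 * (expectation X * expectation Y) -
          (expectation X + expectation Y)\<^sup>2) / 2)"
    using X Y unfolding c gch_def
    by (simp add: exp_add[symmetric] power2_sum algebra_simps add_divide_distrib diff_divide_distrib)
  then show ?thesis using s unfolding gch_def E v by (simp add: sq_add)
qed

lemma gch_const [simp]: "gch (\<lambda>_. c)"
  by (simp add: gch_def ip_self prob_space)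

lemma gch_add_const:
  assumes X: "gch X"
  shows "gch (\<lambda>\<omega>. c + X \<omega>)"
proof -
  have s: "sq X" using X by (simp add: gch_def)
  have E: "expectation (\<lambda>\<omega>. c + X \<omega>) = c + expectation X"
    using sq_integrable[OF s] by (simp add: prob_space)
  have "ip (\<lambda>\<omega>. c + X \<omega>) (\<lambda>\<omega>. c + X \<omega>) = c\<^sup>2 + 2 * c * expectation X + ip X X"
    using s sq_const[of c] by (simp add: ip_add_left ip_add_right sq_add)
      (simp add: ip_def prob_space power2_eq_square)
  moreover have "(CLINT \<omega>|M. iexp (c + X \<omega>)) = iexp c * (CLINT \<omega>|M. iexp (X \<omega>))"
    by (simp add: exp_add distrib_left flip: Bochner_Integration.integral_mult_right_zero)
  ultimately show ?thesis
    using X s unfolding gch_def E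
    by (simp add: sq_add exp_add[symmetric] power2_eq_square algebra_simps)
qed

lemma gch_sum:
  assumes "finite I" "indep_vars (\<lambda>_. borel) X I" "\<And>i. i \<in> I \<Longrightarrow> gch (X i)"
  shows "gch (\<lambda>\<omega>. \<Sum>i\<in>I. X i \<omega>)"
  using assms
proof (induction I rule: finite_induct)
  case (insert i I)
  have "indep_var borel (X i) borel (\<lambda>\<omega>. \<Sum>i\<in>I. X i \<omega>)"
    using insert.hyps insert.prems(1) by (intro indep_vars_sum) auto
  moreover have "gch (\<lambda>\<omega>. \<Sum>i\<in>I. X i \<omega>)"
    using insert.IH indep_vars_subset[OF insert.prems(1)] insert.prems(2) by auto
  ultimately show ?case using insert.hyps insert.prems(2) by (simp add: gch_add)
qed simp

end

locale observed = hilbert_gaussian M x m P0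
  for M :: "'w measure" and x :: "'w \<Rightarrow> 'x::{real_inner, banach, second_countable_topology}" and m P0 +
  fixes w :: "real \<Rightarrow> 'w \<Rightarrow> real ^ 'r" and R :: "real ^ 'r ^ 'r"
  assumes bm: "brownian_motion M w R" and pd: "pos_def R"
    and indep_x_w: "indep_set (sets (vimage_algebra (space M) x borel)) (sets (gen_sigma M {0..} w))"
begin

abbreviation wf :: "real ^ 'r \<Rightarrow> real \<Rightarrow> 'w \<Rightarrow> real" where
  "wf \<theta> t \<equiv> \<lambda>\<omega>. \<theta> \<bullet> w t \<omega>"

abbreviation RR :: "real ^ 'r \<Rightarrow> real ^ 'r \<Rightarrow> real" where
  "RR \<theta> \<theta>' \<equiv> \<theta> \<bullet> (R *v \<theta>')"

lemma RR_sym: "RR \<theta> \<theta>' = RR \<theta>' \<theta>"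
proof -
  have "(\<theta> v* R) \<bullet> \<theta>' = RR \<theta> \<theta>'" by (rule dot_lmul_matrix)
  moreover have "\<theta> v* R = R *v \<theta>"
    using pd transpose_matrix_vector[of R \<theta>] by (simp add: pos_def_def)
  ultimately show ?thesis by (simp add: inner_commute)
qed

lemma RR_nonneg: "0 \<le> RR \<theta> \<theta>"
  using pd by (cases "\<theta> = 0") (auto simp: pos_def_def less_imp_le)

lemma w_measurable: "0 \<le> t \<Longrightarrow> w t \<in> borel_measurable M"
  using bm by (simp add: brownian_motion_def)

lemma wf_measurable: "0 \<le> t \<Longrightarrow> wf \<theta> t \<in> borel_measurable M"
  by (intro borel_measurable_inner w_measurable) auto

lemma increment:
  assumes "0 \<le> s" "s \<le> t"
  shows "gch (\<lambda>\<omega>. \<theta> \<bullet> (w t \<omega> - w s \<omega>))" "expectation (\<lambda>\<omega>. \<theta> \<bullet> (w t \<omega> - w s \<omega>)) = 0"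
    "ip (\<lambda>\<omega>. \<theta> \<bullet> (w t \<omega> - w s \<omega>)) (\<lambda>\<omega>. \<theta> \<bullet> (w t \<omega> - w s \<omega>)) = (t - s) * RR \<theta> \<theta>"
    "sq (\<lambda>\<omega>. \<theta> \<bullet> (w t \<omega> - w s \<omega>))"
proof -
  have "gaussian M (\<lambda>\<omega>. w t \<omega> - w s \<omega>) 0 (\<lambda>h. (t - s) *\<^sub>R (R *v h))"
    using bm assms by (simp add: brownian_motion_def)
  then have "gaussian_real M (\<lambda>\<omega>. \<theta> \<bullet> (w t \<omega> - w s \<omega>)) (\<theta> \<bullet> 0) (\<theta> \<bullet> ((t - s) *\<^sub>R (R *v \<theta>)))"
    unfolding gaussian_def by blast
  then have g: "gaussian_real M (\<lambda>\<omega>. \<theta> \<bullet> (w t \<omega> - w s \<omega>)) 0 ((t - s) * RR \<theta> \<theta>)" by simp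
  have m: "(\<lambda>\<omega>. \<theta> \<bullet> (w t \<omega> - w s \<omega>)) \<in> borel_measurable M"
    using assms by (intro borel_measurable_inner borel_measurable_diff w_measurable) auto
  have "0 \<le> (t - s) * RR \<theta> \<theta>" using assms RR_nonneg by simp
  from gaussian_real_facts[OF m g this]
  show "gch (\<lambda>\<omega>. \<theta> \<bullet> (w t \<omega> - w s \<omega>))" "expectation (\<lambda>\<omega>. \<theta> \<bullet> (w t \<omega> - w s \<omega>)) = 0"
    "ip (\<lambda>\<omega>. \<theta> \<bullet> (w t \<omega> - w s \<omega>)) (\<lambda>\<omega>. \<theta> \<bullet> (w t \<omega> - w s \<omega>)) = (t - s) * RR \<theta> \<theta>"
    "sq (\<lambda>\<omega>. \<theta> \<bullet> (w t \<omega> - w s \<omega>))"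
    by (simp_all add: gch_def)
qed

lemma w_0: "AE \<omega> in M. w 0 \<omega> = 0"
  using bm by (simp add: brownian_motion_def)

lemma wf_increment_AE: "AE \<omega> in M. \<theta> \<bullet> (w t \<omega> - w 0 \<omega>) = wf \<theta> t \<omega>"
  using w_0 by eventually_elim simp

lemma wf_facts:
  assumes t: "0 \<le> t"
  shows "sq (wf \<theta> t)" "expectation (wf \<theta> t) = 0" "ip (wf \<theta> t) (wf \<theta> t) = t * RR \<theta> \<theta>"
proof -
  note i = increment[OF order_refl t, of \<theta>]
  note ae = wf_increment_AE[of \<theta> t] and m = wf_measurable[OF t, of \<theta>]
  have m': "(\<lambda>\<omega>. \<theta> \<bullet> (w t \<omega> - w 0 \<omega>)) \<in> borel_measurable M" by (rule sq_measurable[OF i(4)])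
  show "sq (wf \<theta> t)" by (rule sq_cong_AE[OF i(4) ae m])
  show "expectation (wf \<theta> t) = 0" using integral_cong_AE[OF m' m ae] i(2) by simp
  show "ip (wf \<theta> t) (wf \<theta> t) = t * RR \<theta> \<theta>" using ip_cong_AE[OF ae ae m' m m' m] i(3) by simp
qed

lemma ip_wf_same:
  assumes t: "0 \<le> t"
  shows "ip (wf \<theta> t) (wf \<theta>' t) = t * RR \<theta> \<theta>'"
proof -
  have "ip (wf (\<theta> + \<theta>') t) (wf (\<theta> + \<theta>') t) = ip (wf \<theta> t) (wf \<theta> t) + 2 * ip (wf \<theta> t) (wf \<theta>' t) + ip (wf \<theta>' t) (wf \<theta>' t)"
    unfolding inner_add_left
    by (simp add: ip_add_left ip_add_right sq_add wf_facts(1)[OF t] ip_commute[of "wf \<theta>' t" "wf \<theta> t"])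
  moreover have "RR (\<theta> + \<theta>') (\<theta> + \<theta>') = RR \<theta> \<theta> + 2 * RR \<theta> \<theta>' + RR \<theta>' \<theta>'"
    by (simp add: matrix_vector_right_distrib inner_add_left inner_add_right RR_sym[of \<theta>' \<theta>])
  ultimately have "t * (RR \<theta> \<theta> + 2 * RR \<theta> \<theta>' + RR \<theta>' \<theta>') = t * RR \<theta> \<theta> + 2 * ip (wf \<theta> t) (wf \<theta>' t) + t * RR \<theta>' \<theta>'"
    unfolding wf_facts(3)[OF t] by (simp only:)
  then show ?thesis by (simp add: algebra_simps)
qed

lemma ip_increment_past:
  assumes st: "0 \<le> s" "s \<le> t"
  shows "ip (\<lambda>\<omega>. \<theta> \<bullet> (w s \<omega> - w 0 \<omega>)) (\<lambda>\<omega>. \<theta>' \<bullet> (w t \<omega> - w s \<omega>)) = 0"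
proof -
  define \<tau> where "\<tau> i = (if i = 0 then 0 else if i = 1 then s else t)" for i :: nat
  define V where "V i = (if i = 0 then \<theta> else \<theta>')" for i :: nat
  have "0 \<le> \<tau> 0 \<and> (\<forall>i<2. \<tau> i \<le> \<tau> (Suc i))" using st by (auto simp: \<tau>_def)
  then have "indep_vars (\<lambda>_. borel) (\<lambda>i \<omega>. w (\<tau> (Suc i)) \<omega> - w (\<tau> i) \<omega>) {..<2}"
    using bm unfolding brownian_motion_def by blast
  then have ind: "indep_vars (\<lambda>_. borel) (\<lambda>i \<omega>. V i \<bullet> (w (\<tau> (Suc i)) \<omega> - w (\<tau> i) \<omega>)) {..<2}"
    by (rule indep_vars_compose2) auto
  have two: "{..<2} = {0, 1 :: nat}" by auto
  have int: "integrable M (\<lambda>\<omega>. V i \<bullet> (w (\<tau> (Suc i)) \<omega> - w (\<tau> i) \<omega>))" if "i \<in> {..<2}" for i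
    using that st increment(4)[of 0 s] increment(4)[of s t] sq_integrable unfolding two
    by (auto simp: \<tau>_def V_def)
  have "expectation (\<lambda>\<omega>. \<Prod>i\<in>{..<2}. V i \<bullet> (w (\<tau> (Suc i)) \<omega> - w (\<tau> i) \<omega>)) =
      (\<Prod>i\<in>{..<2}. expectation (\<lambda>\<omega>. V i \<bullet> (w (\<tau> (Suc i)) \<omega> - w (\<tau> i) \<omega>)))"
    by (rule indep_vars_lebesgue_integral[OF _ ind int]) auto
  then show ?thesis
    unfolding two ip_def using increment(2)[of 0 s \<theta>] st by (simp add: \<tau>_def V_def)
qed

lemma ip_wf_le:
  assumes st: "0 \<le> s" "s \<le> t"
  shows "ip (wf \<theta> s) (wf \<theta>' t) = s * RR \<theta> \<theta>'"
proof -
  have t: "0 \<le> t" using st by simp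
  have "ip (wf \<theta> s) (\<lambda>\<omega>. \<theta>' \<bullet> (w t \<omega> - w s \<omega>)) = 0"
    using ip_cong_AE[OF wf_increment_AE[of \<theta> s] AE_I2[of M "\<lambda>\<omega>. \<theta>' \<bullet> (w t \<omega> - w s \<omega>) = \<theta>' \<bullet> (w t \<omega> - w s \<omega>)"]
        sq_measurable[OF increment(4)[OF order_refl st(1)]] wf_measurable[OF st(1)]
        sq_measurable[OF increment(4)[OF st]] sq_measurable[OF increment(4)[OF st]]]
      ip_increment_past[OF st, of \<theta> \<theta>'] by simp
  moreover have "wf \<theta>' t = (\<lambda>\<omega>. wf \<theta>' s \<omega> + \<theta>' \<bullet> (w t \<omega> - w s \<omega>))" by (simp add: inner_diff_right)
  moreover have "ip (wf \<theta> s) (\<lambda>\<omega>. wf \<theta>' s \<omega> + \<theta>' \<bullet> (w t \<omega> - w s \<omega>)) =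
      ip (wf \<theta> s) (wf \<theta>' s) + ip (wf \<theta> s) (\<lambda>\<omega>. \<theta>' \<bullet> (w t \<omega> - w s \<omega>))"
    by (rule ip_add_right) (intro wf_facts(1)[OF st(1)] increment(4)[OF st])+
  ultimately show ?thesis using ip_wf_same[OF st(1)] by simp
qed

lemma ip_wf: "\<lbrakk>0 \<le> s; 0 \<le> t\<rbrakk> \<Longrightarrow> ip (wf \<theta> s) (wf \<theta>' t) = min s t * RR \<theta> \<theta>'"
  using ip_wf_le[of s t \<theta> \<theta>'] ip_wf_le[of t s \<theta>' \<theta>]
  by (cases "s \<le> t") (auto simp: ip_commute[of "wf \<theta> s"] RR_sym[of \<theta>'] min_def)

text \<open>After sorting the times and summing by parts, a combination of values of \<open>w\<close> is a sum
  over independent increments.\<close>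

lemma gch_w:
  assumes J: "finite J" "J \<subseteq> {0..}"
  shows "gch (\<lambda>\<omega>. \<Sum>t\<in>J. \<theta> t \<bullet> w t \<omega>)"
proof -
  define J' where "J' = insert 0 J"
  have J': "finite J'" "J' \<subseteq> {0..}" "0 \<in> J'" using J by (auto simp: J'_def)
  define l where "l = sorted_list_of_set J'"
  have l: "sorted l" "distinct l" "set l = J'" using J' by (auto simp: l_def)
  define k where "k = length l - 1"
  have len: "length l = Suc k" using l(3) J'(3) unfolding k_def by (cases l) auto
  define \<tau> where "\<tau> i = l ! min i k" for i
  have \<tau>_in: "\<tau> i \<in> J'" for i unfolding \<tau>_def using len l(3) by (metis le_imp_less_Suc min.cobounded2 nth_mem)
  have \<tau>_mono: "\<tau> i \<le> \<tau> (Suc i)" for i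
    unfolding \<tau>_def using l(1) len by (intro sorted_nth_mono) auto
  have \<tau>0: "\<tau> 0 = 0"
  proof -
    obtain i where "i < length l" "l ! i = 0" using J'(3) l(3) by (metis in_set_conv_nth)
    then have "\<tau> 0 \<le> 0" unfolding \<tau>_def using sorted_nth_mono[OF l(1), of 0 i] by simp
    then show ?thesis using \<tau>_in[of 0] J'(2) by force
  qed
  have bij: "bij_betw \<tau> {..k} J'"
  proof -
    have "bij_betw ((!) l) {..<length l} (set l)" by (rule bij_betw_nth[OF l(2)]) auto
    moreover have "{..<length l} = {..k}" using len by auto
    ultimately have "bij_betw ((!) l) {..k} J'" using l(3) by simp
    then show ?thesis by (rule bij_betw_cong[THEN iffD1, rotated]) (simp add: \<tau>_def min_def)
  qed
  define \<theta>' where "\<theta>' t = (if t \<in> J then \<theta> t else 0)" for t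
  define D where "D i \<omega> = w (\<tau> (Suc i)) \<omega> - w (\<tau> i) \<omega>" for i \<omega>
  define \<psi> where "\<psi> i = (\<Sum>j\<in>{i<..k}. \<theta>' (\<tau> j))" for i
  have "0 \<le> \<tau> 0 \<and> (\<forall>i<k. \<tau> i \<le> \<tau> (Suc i))" using \<tau>_mono \<tau>0 by simp
  then have "indep_vars (\<lambda>_. borel) D {..<k}"
    using bm unfolding brownian_motion_def D_def[abs_def] by blast
  then have ind: "indep_vars (\<lambda>_. borel) (\<lambda>i \<omega>. \<psi> i \<bullet> D i \<omega>) {..<k}"
    by (rule indep_vars_compose2) auto
  have g: "gch (\<lambda>\<omega>. \<Sum>i\<in>{..<k}. \<psi> i \<bullet> D i \<omega>)"
  proof (rule gch_sum[OF _ ind])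
    show "gch (\<lambda>\<omega>. \<psi> i \<bullet> D i \<omega>)" for i
      unfolding D_def using \<tau>_in[of i] J'(2) \<tau>_mono by (intro increment) auto
  qed simp
  have eq: "(\<Sum>t\<in>J. \<theta> t \<bullet> w t \<omega>) = (\<Sum>i\<in>{..<k}. \<psi> i \<bullet> D i \<omega>)" if w0: "w 0 \<omega> = 0" for \<omega>
  proof -
    have tel: "w (\<tau> j) \<omega> = (\<Sum>i<j. D i \<omega>)" for j
    proof (induction j)
      case (Suc j)
      then show ?case by (simp add: D_def)
    qed (simp add: \<tau>0 w0)
    have "(\<Sum>t\<in>J. \<theta> t \<bullet> w t \<omega>) = (\<Sum>t\<in>J'. \<theta>' t \<bullet> w t \<omega>)"
      using J' by (intro sum.mono_neutral_cong_left) (auto simp: J'_def \<theta>'_def)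
    also have "\<dots> = (\<Sum>j\<le>k. \<theta>' (\<tau> j) \<bullet> w (\<tau> j) \<omega>)"
      by (rule sum.reindex_bij_betw[OF bij, symmetric])
    also have "\<dots> = (\<Sum>j\<le>k. \<Sum>i<j. \<theta>' (\<tau> j) \<bullet> D i \<omega>)"
      by (simp add: tel inner_sum_right)
    also have "\<dots> = (\<Sum>i<k. \<Sum>j\<in>{i<..k}. \<theta>' (\<tau> j) \<bullet> D i \<omega>)"
      by (subst (1 2) sum.Sigma)
        (auto intro!: sum.reindex_bij_witness[of _ "\<lambda>(i, j). (j, i)" "\<lambda>(j, i). (i, j)"])
    also have "\<dots> = (\<Sum>i\<in>{..<k}. \<psi> i \<bullet> D i \<omega>)" by (simp add: \<psi>_def inner_sum_left)
    finally show ?thesis .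
  qed
  have "AE \<omega> in M. (\<Sum>i\<in>{..<k}. \<psi> i \<bullet> D i \<omega>) = (\<Sum>t\<in>J. \<theta> t \<bullet> w t \<omega>)"
    using w_0 by eventually_elim (simp add: eq)
  then show ?thesis
    by (rule gch_cong_AE[OF g]) (use J in \<open>auto intro!: borel_measurable_sum wf_measurable\<close>)
qed

lemma indep_functional_w:
  assumes \<phi>: "bounded_linear (\<phi> :: 'x \<Rightarrow> real)" and J: "J \<subseteq> {0..}"
  shows "indep_var borel (\<lambda>\<omega>. \<phi> (x \<omega>)) borel (\<lambda>\<omega>. \<Sum>t\<in>J. \<theta> t \<bullet> w t \<omega>)"
proof -
  let ?X = "\<lambda>\<omega>. \<phi> (x \<omega>)" and ?W = "\<lambda>\<omega>. \<Sum>t\<in>J. \<theta> t \<bullet> w t \<omega>"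
  let ?A = "vimage_algebra (space M) x borel" and ?B = "gen_sigma M {0..} w"
  have \<phi>m: "\<phi> \<in> borel_measurable borel"
    by (intro borel_measurable_continuous_onI linear_continuous_on \<phi>)
  have XA: "?X \<in> borel_measurable ?A"
    by (rule measurable_compose[OF measurable_vimage_algebra1 \<phi>m]) auto
  have wB: "w t \<in> borel_measurable ?B" if "0 \<le> t" for t
  proof (rule measurableI)
    fix U :: "(real ^ 'r) set" assume "U \<in> sets borel"
    then show "w t -` U \<inter> space ?B \<in> sets ?B"
      unfolding gen_sigma_def using that
      by (subst sets_measure_of) (auto simp: space_measure_of_conv intro!: sigma_sets.Basic)
  qed simp
  have WB: "?W \<in> borel_measurable ?B"
    using J by (intro borel_measurable_sum borel_measurable_inner wB) auto
  have sub: "sigma_sets (space M) {X -` A \<inter> space M | A. A \<in> sets borel} \<subseteq> sets N"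
    if "X \<in> borel_measurable N" "space N = space M" for X :: "'w \<Rightarrow> real" and N
    unfolding that(2)[symmetric]
    by (intro sets.sigma_sets_subset subsetI) (use measurable_sets[OF that(1)] in \<open>elim CollectE exE conjE, simp\<close>)
  have spB: "space ?B = space M" by (simp add: gen_sigma_def space_measure_of_conv)
  have "indep_set (sigma_sets (space M) {?X -` A \<inter> space M | A. A \<in> sets borel})
      (sigma_sets (space M) {?W -` A \<inter> space M | A. A \<in> sets borel})"
    using indep_x_w sub[OF XA] sub[OF WB spB] unfolding indep_set_def
    by (elim indep_sets_mono_sets) (auto split: bool.split)
  moreover have "?X \<in> borel_measurable M" by (rule measurable_compose[OF x_measurable \<phi>m])
  moreover have "?W \<in> borel_measurable M" using J by (intro borel_measurable_sum wf_measurable) auto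
  ultimately show ?thesis unfolding indep_var_eq by blast
qed

lemma ip_functional_wf:
  assumes \<phi>: "bounded_linear (\<phi> :: 'x \<Rightarrow> real)" and t: "0 \<le> t"
  shows "ip (\<lambda>\<omega>. \<phi> (x \<omega>)) (wf \<theta> t) = 0"
proof -
  have "indep_var borel (\<lambda>\<omega>. \<phi> (x \<omega>)) borel (wf \<theta> t)"
    using indep_functional_w[OF \<phi>, of "{t}" "\<lambda>_. \<theta>"] t by simp
  moreover have "integrable M (\<lambda>\<omega>. \<phi> (x \<omega>))"
    using functional_x(1)[OF \<phi>] by (auto simp: tame_def intro: sq_integrable)
  ultimately have "ip (\<lambda>\<omega>. \<phi> (x \<omega>)) (wf \<theta> t) = expectation (\<lambda>\<omega>. \<phi> (x \<omega>)) * expectation (wf \<theta> t)"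
    unfolding ip_def using sq_integrable[OF wf_facts(1)[OF t]] by (rule indep_var_lebesgue_integral)
  then show ?thesis using wf_facts(2)[OF t] by simp
qed

text \<open>The Gaussian space that contains all coordinates of the state and of the observations.\<close>

definition \<G> :: "('w \<Rightarrow> real) set" where
  "\<G> = {X. \<exists>c \<phi> J \<theta>. bounded_linear \<phi> \<and> finite J \<and> J \<subseteq> {0..} \<and>
     X = (\<lambda>\<omega>. c + (\<phi> (x \<omega>) + (\<Sum>t\<in>J. \<theta> t \<bullet> w t \<omega>)))}"

lemma \<G>_gch: "X \<in> \<G> \<Longrightarrow> gch X"
  unfolding \<G>_def by (auto intro!: gch_add_const gch_add indep_functional_w functional_x gch_w)

sublocale gaussian_space M \<G>
proof
  fix X Y a b assume "X \<in> \<G>" "Y \<in> \<G>"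
  then obtain c \<phi> J \<theta> c' \<phi>' J' \<theta>' where
    X: "bounded_linear \<phi>" "finite J" "J \<subseteq> {0..}" "X = (\<lambda>\<omega>. c + (\<phi> (x \<omega>) + (\<Sum>t\<in>J. \<theta> t \<bullet> w t \<omega>)))"
    and Y: "bounded_linear \<phi>'" "finite J'" "J' \<subseteq> {0..}" "Y = (\<lambda>\<omega>. c' + (\<phi>' (x \<omega>) + (\<Sum>t\<in>J'. \<theta>' t \<bullet> w t \<omega>)))"
    unfolding \<G>_def by blast
  define \<zeta> where "\<zeta> t = (if t \<in> J then a *\<^sub>R \<theta> t else 0) + (if t \<in> J' then b *\<^sub>R \<theta>' t else 0)" for t
  have "a * X \<omega> + b * Y \<omega> = (a * c + b * c') + ((a * \<phi> (x \<omega>) + b * \<phi>' (x \<omega>)) + (\<Sum>t\<in>J \<union> J'. \<zeta> t \<bullet> w t \<omega>))" for \<omega>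
  proof -
    have "(\<Sum>t\<in>J \<union> J'. \<zeta> t \<bullet> w t \<omega>) =
        (\<Sum>t\<in>J \<union> J'. (if t \<in> J then a *\<^sub>R \<theta> t else 0) \<bullet> w t \<omega>) + (\<Sum>t\<in>J \<union> J'. (if t \<in> J' then b *\<^sub>R \<theta>' t else 0) \<bullet> w t \<omega>)"
      by (simp add: \<zeta>_def inner_add_left sum.distrib)
    also have "(\<Sum>t\<in>J \<union> J'. (if t \<in> J then a *\<^sub>R \<theta> t else 0) \<bullet> w t \<omega>) = a * (\<Sum>t\<in>J. \<theta> t \<bullet> w t \<omega>)"
      unfolding sum_distrib_left using X(2) Y(2) by (intro sum.mono_neutral_cong_right) auto
    also have "(\<Sum>t\<in>J \<union> J'. (if t \<in> J' then b *\<^sub>R \<theta>' t else 0) \<bullet> w t \<omega>) = b * (\<Sum>t\<in>J'. \<theta>' t \<bullet> w t \<omega>)"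
      unfolding sum_distrib_left using X(2) Y(2) by (intro sum.mono_neutral_cong_right) auto
    finally show ?thesis by (simp add: X(4) Y(4) algebra_simps)
  qed
  moreover have "bounded_linear (\<lambda>v. a * \<phi> v + b * \<phi>' v)"
    using X(1) Y(1) by (intro bounded_linear_add bounded_linear_compose[OF bounded_linear_mult_right])
  ultimately show "(\<lambda>\<omega>. a * X \<omega> + b * Y \<omega>) \<in> \<G>"
    unfolding \<G>_def using X(2,3) Y(2,3)
    by (intro CollectI exI[of _ "a * c + b * c'"] exI[of _ "\<lambda>v. a * \<phi> v + b * \<phi>' v"] exI[of _ "J \<union> J'"] exI[of _ \<zeta>]) auto
next
  show "sq X" if "X \<in> \<G>" for X using \<G>_gch[OF that] by (simp add: gch_def)
  show "(CLINT \<omega>|M. iexp (X \<omega>)) = iexp (expectation X) * exp (- complex_of_real (ip X X - (expectation X)\<^sup>2) / 2)"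
    if "X \<in> \<G>" for X using \<G>_gch[OF that] by (simp add: gch_def)
qed

lemma \<G>_functional: "bounded_linear \<phi> \<Longrightarrow> (\<lambda>\<omega>. \<phi> (x \<omega>)) \<in> \<G>"
  unfolding \<G>_def by (intro CollectI exI[of _ 0] exI[of _ \<phi>] exI[of _ "{}"]) auto

lemma \<G>_wf: "0 \<le> t \<Longrightarrow> wf \<theta> t \<in> \<G>"
  unfolding \<G>_def by (intro CollectI exI[of _ 0] exI[of _ "\<lambda>_. 0"] exI[of _ "{t}"] exI[of _ "\<lambda>_. \<theta>"]) auto

lemma \<G>_const: "(\<lambda>_. c) \<in> \<G>"
  unfolding \<G>_def by (intro CollectI exI[of _ c] exI[of _ "\<lambda>_. 0"] exI[of _ "{}"]) auto

lemma \<G>_sum: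
  assumes "\<And>j. j \<in> F \<Longrightarrow> X j \<in> \<G>"
  shows "(\<lambda>\<omega>. \<Sum>j\<in>F. a j * X j \<omega>) \<in> \<G>"
  using assms
proof (induction F rule: infinite_finite_induct)
  case (insert i F)
  then have "(\<lambda>\<omega>. a i * X i \<omega> + 1 * (\<Sum>j\<in>F. a j * X j \<omega>)) \<in> \<G>" by (intro lincomb) auto
  then show ?case using insert by simp
qed (auto simp: \<G>_const)

subsection \<open>The noise of a midpoint observation\<close>

text \<open>The increment of \<open>w\<close> over the first half of the interval minus the one over the second half.
  For this reason it is orthogonal to the values of \<open>w\<close> outside of the interval.\<close>

definition noise :: "real \<Rightarrow> real \<Rightarrow> real ^ 'r \<Rightarrow> 'w \<Rightarrow> real" where
  "noise l h b \<omega> = 2 * wf b (l + h) \<omega> - wf b l \<omega> - wf b (l + 2 * h) \<omega>"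

lemma sq_noise: "\<lbrakk>0 \<le> l; 0 \<le> h\<rbrakk> \<Longrightarrow> sq (noise l h b)"
  unfolding noise_def[abs_def] by (intro sq_diff sq_cmult wf_facts) auto

lemma ip_noise_wf:
  assumes "0 \<le> l" "0 \<le> h" "0 \<le> t"
  shows "ip (noise l h b) (wf \<theta> t) = (2 * min (l + h) t - min l t - min (l + 2 * h) t) * RR b \<theta>"
proof -
  have s: "sq (wf b (l + h))" "sq (wf b l)" "sq (wf b (l + 2 * h))" "sq (wf \<theta> t)"
    using assms by (auto intro: wf_facts)
  have "ip (noise l h b) (wf \<theta> t) = 2 * ip (wf b (l + h)) (wf \<theta> t) - ip (wf b l) (wf \<theta> t) - ip (wf b (l + 2 * h)) (wf \<theta> t)"
    unfolding noise_def[abs_def] using s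
    by (simp add: ip_diff_left ip_cmult_left sq_diff sq_cmult)
  then show ?thesis using assms by (simp add: ip_wf algebra_simps)
qed

lemma ip_noise_wf_outside:
  "\<lbrakk>0 \<le> l; 0 \<le> h; 0 \<le> t; t \<le> l \<or> l + 2 * h \<le> t\<rbrakk> \<Longrightarrow> ip (noise l h b) (wf \<theta> t) = 0"
  by (auto simp: ip_noise_wf min_def)

lemma ip_noise_same:
  assumes "0 \<le> l" "0 \<le> h"
  shows "ip (noise l h b) (noise l h b') = 2 * h * RR b b'"
proof -
  have s: "sq (wf b' (l + h))" "sq (wf b' l)" "sq (wf b' (l + 2 * h))" "sq (noise l h b)"
    using assms by (auto intro: wf_facts sq_noise)
  have "ip (noise l h b) (noise l h b') = 2 * ip (noise l h b) (wf b' (l + h)) - ip (noise l h b) (wf b' l) -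
      ip (noise l h b) (wf b' (l + 2 * h))"
    unfolding noise_def[of l h b', abs_def] using s
    by (simp add: ip_diff_right ip_cmult_right sq_diff sq_cmult)
  then show ?thesis
    using assms by (cases "h = 0") (simp_all add: ip_noise_wf min_def algebra_simps)
qed

lemma ip_noise_disjoint:
  assumes "0 \<le> l" "0 \<le> h" "0 \<le> l'" "l + 2 * h \<le> l' \<or> l' + 2 * h \<le> l"
  shows "ip (noise l h b) (noise l' h b') = 0"
proof -
  have s: "sq (wf b' (l' + h))" "sq (wf b' l')" "sq (wf b' (l' + 2 * h))" "sq (noise l h b)"
    using assms by (auto intro: wf_facts sq_noise)
  have "ip (noise l h b) (noise l' h b') = 2 * ip (noise l h b) (wf b' (l' + h)) - ip (noise l h b) (wf b' l') -
      ip (noise l h b) (wf b' (l' + 2 * h))"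
    unfolding noise_def[of l' h b', abs_def] using s
    by (simp add: ip_diff_right ip_cmult_right sq_diff sq_cmult)
  then show ?thesis using assms ip_noise_wf_outside by auto
qed

text \<open>The noises over disjoint intervals are orthogonal, and within one interval the covariance is
  \<open>2 h R\<close>.\<close>

lemma noise_coercive:
  assumes h: "0 \<le> h" and lam: "\<And>v. lam * (norm v)\<^sup>2 \<le> RR v v"
  shows "2 * h * lam * (\<Sum>q\<in>{..<N} \<times> Basis. (a q)\<^sup>2) \<le>
    ip (\<lambda>\<omega>. \<Sum>q\<in>{..<N} \<times> Basis. a q * noise (2 * real (fst q) * h) h (snd q) \<omega>)
       (\<lambda>\<omega>. \<Sum>q\<in>{..<N} \<times> Basis. a q * noise (2 * real (fst q) * h) h (snd q) \<omega>)"
proof -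
  define A where "A i = (\<Sum>b\<in>Basis. a (i, b) *\<^sub>R b)" for i
  have lin: "(\<Sum>b\<in>Basis. a (i, b) * noise l h b \<omega>) = noise l h (A i) \<omega>" for i l \<omega>
    unfolding noise_def A_def inner_sum_left
    by (simp add: sum_distrib_left sum_subtractf[symmetric] algebra_simps)
  have eq: "(\<lambda>\<omega>. \<Sum>q\<in>{..<N} \<times> Basis. a q * noise (2 * real (fst q) * h) h (snd q) \<omega>) =
      (\<lambda>\<omega>. \<Sum>i\<in>{..<N}. 1 * noise (2 * real i * h) h (A i) \<omega>)"
    by (simp add: lin[symmetric] sum.cartesian_product case_prod_unfold)
  have s: "sq (noise (2 * real i * h) h b)" for i b using h by (intro sq_noise) auto
  have off: "ip (noise (2 * real i * h) h b) (noise (2 * real j * h) h b') = 0" if "i \<noteq> j" for i j b b'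
  proof (rule ip_noise_disjoint)
    have "real i + 1 \<le> real j \<or> real j + 1 \<le> real i" using that by linarith
    then have "(real i + 1) * h \<le> real j * h \<or> (real j + 1) * h \<le> real i * h"
      using h by (auto intro: mult_right_mono)
    then show "2 * real i * h + 2 * h \<le> 2 * real j * h \<or> 2 * real j * h + 2 * h \<le> 2 * real i * h"
      by (auto simp: algebra_simps)
  qed (use h in auto)
  let ?n = "\<lambda>i. noise (2 * real i * h) h (A i)"
  have "ip (\<lambda>\<omega>. \<Sum>i\<in>{..<N}. 1 * ?n i \<omega>) (\<lambda>\<omega>. \<Sum>i\<in>{..<N}. 1 * ?n i \<omega>) =
      (\<Sum>i\<in>{..<N}. \<Sum>j\<in>{..<N}. ip (?n i) (?n j))"
  proof -
    have "ip (\<lambda>\<omega>. \<Sum>i\<in>{..<N}. 1 * ?n i \<omega>) Z = (\<Sum>i\<in>{..<N}. 1 * ip (?n i) Z)" if "sq Z" for Z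
      by (rule ip_lincomb_left[OF _ that]) (rule s)
    moreover have "ip (?n i) (\<lambda>\<omega>. \<Sum>i\<in>{..<N}. 1 * ?n i \<omega>) = (\<Sum>j\<in>{..<N}. 1 * ip (?n i) (?n j))" for i
      by (rule ip_lincomb_right[OF _ s]) (rule s)
    moreover have "sq (\<lambda>\<omega>. \<Sum>i\<in>{..<N}. 1 * ?n i \<omega>)" by (intro sq_lincomb s)
    ultimately show ?thesis by simp
  qed
  also have "\<dots> = (\<Sum>i\<in>{..<N}. ip (?n i) (?n i))"
  proof (rule sum.cong[OF refl])
    fix i assume i: "i \<in> {..<N}"
    have "(\<Sum>j\<in>{..<N}. ip (?n i) (?n j)) = (\<Sum>j\<in>{..<N}. if j = i then ip (?n i) (?n i) else 0)"
      using off by (intro sum.cong) auto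
    then show "(\<Sum>j\<in>{..<N}. ip (?n i) (?n j)) = ip (?n i) (?n i)" using i by simp
  qed
  also have "\<dots> = (\<Sum>i\<in>{..<N}. 2 * h * RR (A i) (A i))"
    using h by (intro sum.cong ip_noise_same) auto
  finally have ip_eq: "ip (\<lambda>\<omega>. \<Sum>i\<in>{..<N}. 1 * ?n i \<omega>) (\<lambda>\<omega>. \<Sum>i\<in>{..<N}. 1 * ?n i \<omega>) =
      (\<Sum>i\<in>{..<N}. 2 * h * RR (A i) (A i))" .
  have normA: "(norm (A i))\<^sup>2 = (\<Sum>b\<in>Basis. (a (i, b))\<^sup>2)" for i
  proof -
    have "A i \<bullet> b = a (i, b)" if "b \<in> Basis" for b
      unfolding A_def using that by (rule inner_sum_left_Basis)
    then have "(\<Sum>b\<in>Basis. (A i \<bullet> b) * (A i \<bullet> b)) = (\<Sum>b\<in>Basis. (a (i, b))\<^sup>2)"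
      by (intro sum.cong) (auto simp: power2_eq_square)
    then show ?thesis unfolding power2_norm_eq_inner by (subst euclidean_inner)
  qed
  have "2 * h * lam * (\<Sum>q\<in>{..<N} \<times> Basis. (a q)\<^sup>2) = (\<Sum>i\<in>{..<N}. 2 * h * (lam * (norm (A i))\<^sup>2))"
    by (simp add: normA sum.cartesian_product sum_distrib_left case_prod_unfold mult.assoc)
  also have "\<dots> \<le> (\<Sum>i\<in>{..<N}. 2 * h * RR (A i) (A i))"
    using h by (intro sum_mono mult_left_mono lam) auto
  finally show ?thesis unfolding eq ip_eq .
qed

end

section \<open>The smallest eigenvalue\<close>

text \<open>Eigenvectors of a symmetric matrix for different eigenvalues are orthogonal, so that there
  are finitely many eigenvalues. The minimum of the quadratic form on the unit sphere is one of
  them, because the form minus \<open>\<mu> \<parallel>v\<parallel>\<^sup>2\<close> is non-negative and vanishes at the minimiser.\<close>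

lemma min_eig_coercive:
  fixes R :: "real ^ 'r ^ 'r"
  assumes "pos_def R"
  shows "0 < min_eig R" "min_eig R * (norm v)\<^sup>2 \<le> v \<bullet> (R *v v)"
proof -
  have pos: "0 < v \<bullet> (R *v v)" if "v \<noteq> 0" for v using assms that by (simp add: pos_def_def)
  have sym: "u \<bullet> (R *v v) = v \<bullet> (R *v u)" for u v
  proof -
    have "(u v* R) \<bullet> v = u \<bullet> (R *v v)" by (rule dot_lmul_matrix)
    moreover have "u v* R = R *v u"
      using assms transpose_matrix_vector[of R u] by (simp add: pos_def_def)
    ultimately show ?thesis by (simp add: inner_commute)
  qed
  define EV where "EV = {l. \<exists>v. v \<noteq> 0 \<and> R *v v = l *\<^sub>R v}"
  have "\<forall>l\<in>EV. \<exists>v. v \<noteq> 0 \<and> R *v v = l *\<^sub>R v" by (simp add: EV_def)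
  then obtain g where g: "\<forall>l\<in>EV. g l \<noteq> 0 \<and> R *v g l = l *\<^sub>R g l" using bchoice by meson
  have orth: "g l \<bullet> g k = 0" if "l \<in> EV" "k \<in> EV" "l \<noteq> k" for l k
  proof -
    have "k * (g l \<bullet> g k) = l * (g l \<bullet> g k)"
      using sym[of "g l" "g k"] g that by (simp add: inner_commute)
    then show ?thesis using that(3) by simp
  qed
  have inj: "inj_on g EV"
  proof (rule inj_onI, rule ccontr)
    fix l k assume "l \<in> EV" "k \<in> EV" "g l = g k" "l \<noteq> k"
    then show False using orth[of l k] g by auto
  qed
  have "independent (g ` EV)"
    by (rule pairwise_orthogonal_independent)
       (use orth g in \<open>auto simp: pairwise_def orthogonal_def\<close>)
  then have fin: "finite EV" using finite_imageD[OF _ inj] independent_bound by blast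
  define f where "f v = v \<bullet> (R *v v)" for v
  have "continuous_on (sphere 0 1) f" unfolding f_def
    by (intro continuous_intros linear_continuous_on matrix_vector_mul_bounded_linear)
  moreover have "sphere (0 :: real ^ 'r) 1 \<noteq> {}" by simp
  ultimately obtain u where u: "u \<in> sphere 0 1" "\<And>v. v \<in> sphere 0 1 \<Longrightarrow> f u \<le> f v"
    using continuous_attains_inf[OF compact_sphere] by blast
  define \<mu> where "\<mu> = f u"
  have nu: "norm u = 1" using u(1) by simp
  have low: "\<mu> * (norm v)\<^sup>2 \<le> f v" for v
  proof (cases "v = 0")
    case False
    have "\<mu> \<le> f (v /\<^sub>R norm v)" unfolding \<mu>_def using False by (intro u(2)) simp
    also have "\<dots> = f v / (norm v)\<^sup>2"
      by (simp add: f_def matrix_vector_mult_scaleR power2_eq_square divide_inverse)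
    finally show ?thesis using False by (simp add: field_simps)
  qed (simp add: f_def)
  define z where "z = R *v u - \<mu> *\<^sub>R u"
  define a where "a = z \<bullet> z"
  define b where "b = f z - \<mu> * (norm z)\<^sup>2"
  have quad: "0 \<le> b * t\<^sup>2 - 2 * a * t" for t
  proof -
    have "f (u - t *\<^sub>R z) = f u - 2 * t * (z \<bullet> (R *v u)) + t\<^sup>2 * f z"
      unfolding f_def using sym[of u z]
      by (simp add: matrix_vector_mult_diff_distrib matrix_vector_mult_scaleR inner_diff_left inner_diff_right
          power2_eq_square algebra_simps)
    moreover have "(norm (u - t *\<^sub>R z))\<^sup>2 = (norm u)\<^sup>2 - 2 * t * (z \<bullet> u) + t\<^sup>2 * (norm z)\<^sup>2"
      unfolding power2_norm_eq_inner
      by (simp add: inner_diff_left inner_diff_right inner_commute power2_eq_square algebra_simps)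
    moreover have "a = z \<bullet> (R *v u) - \<mu> * (z \<bullet> u)"
      unfolding a_def by (subst (2) z_def) (simp add: inner_diff_right)
    ultimately have "\<mu> * (1 - 2 * t * (z \<bullet> u) + t\<^sup>2 * (norm z)\<^sup>2) \<le> \<mu> - 2 * t * (z \<bullet> (R *v u)) + t\<^sup>2 * f z"
      and "z \<bullet> (R *v u) = a + \<mu> * (z \<bullet> u)"
      using low[of "u - t *\<^sub>R z"] by (simp_all add: nu \<mu>_def[symmetric])
    then show ?thesis unfolding b_def by (simp only:) (simp add: algebra_simps)
  qed
  have "a = 0"
  proof (rule ccontr)
    assume "a \<noteq> 0"
    then have a: "0 < a" using inner_ge_zero[of z] by (simp add: a_def)
    define t where "t = a / (\<bar>b\<bar> + 1)"
    have t: "0 < t" using a by (simp add: t_def)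
    have "2 * a * t \<le> b * t * t" using quad[of t] by (simp add: power2_eq_square)
    then have "2 * a \<le> b * t" using t by simp
    also have "\<dots> \<le> \<bar>b\<bar> * t" using t by (intro mult_right_mono) auto
    also have "\<dots> \<le> a" using a by (simp add: t_def field_simps)
    finally show False using a by simp
  qed
  then have "R *v u = \<mu> *\<^sub>R u" by (simp add: a_def z_def)
  then have "\<mu> \<in> EV" using nu unfolding EV_def by (intro CollectI exI[of _ u]) auto
  moreover from this have "EV \<noteq> {}" by blast
  ultimately have le: "min_eig R \<le> \<mu>" and mem: "min_eig R \<in> EV"
    using Min_le[OF fin] Min_in[OF fin] unfolding min_eig_def EV_def[symmetric] by blast+
  obtain v where v: "v \<noteq> 0" "R *v v = min_eig R *\<^sub>R v" using mem unfolding EV_def by blast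
  have "0 < min_eig R * (v \<bullet> v)" using pos[OF v(1)] v(2) by simp
  then show "0 < min_eig R" by (rule zero_less_mult_pos2) (use v(1) in simp)
  show "min_eig R * (norm v)\<^sup>2 \<le> v \<bullet> (R *v v)" for v
    using low[of v] mult_right_mono[OF le, of "(norm v)\<^sup>2"] by (simp add: f_def)
qed

section \<open>Summation of the second differences\<close>

text \<open>Comparison with the integral of \<open>t\<^sup>-\<^sup>a\<close>, as a telescoping sum.\<close>

lemma sum_powr_le:
  assumes a: "1 < a"
  shows "(\<Sum>i\<in>{1..<N}. real i powr (- a)) \<le> a / (a - 1)"
proof -
  have *: "(\<Sum>i\<in>{1..<Suc (Suc k)}. real i powr (- a)) \<le> 1 + (1 - real (Suc k) powr (1 - a)) / (a - 1)" for k
  proof (induction k)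
    case (Suc k)
    let ?m = "real (Suc k)"
    have m: "0 < ?m" by simp
    have "\<exists>z>?m. z < ?m + 1 \<and> (?m + 1) powr (1 - a) - ?m powr (1 - a) = (?m + 1 - ?m) * ((1 - a) * z powr (- a))"
    proof (rule MVT2)
      fix y assume "?m \<le> y"
      then have "0 < y" using m by linarith
      from has_real_derivative_powr[OF this, of "1 - a"]
      show "((\<lambda>y. y powr (1 - a)) has_real_derivative (1 - a) * y powr (- a)) (at y)" by simp
    qed simp
    then obtain z where z: "?m < z" "z < ?m + 1"
      "(?m + 1) powr (1 - a) - ?m powr (1 - a) = (1 - a) * z powr (- a)" by auto
    have "(?m + 1) powr (- a) \<le> z powr (- a)" using z m a by (intro powr_mono2') auto
    then have "(a - 1) * (?m + 1) powr (- a) \<le> (a - 1) * z powr (- a)" using a by (intro mult_left_mono) auto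
    also have "\<dots> = ?m powr (1 - a) - (?m + 1) powr (1 - a)" using z(3) by (simp add: algebra_simps)
    finally have "(?m + 1) powr (- a) \<le> (?m powr (1 - a) - (?m + 1) powr (1 - a)) / (a - 1)"
      using a by (simp add: field_simps)
    moreover have "(\<Sum>i\<in>{1..<Suc (Suc (Suc k))}. real i powr (- a)) =
        (\<Sum>i\<in>{1..<Suc (Suc k)}. real i powr (- a)) + (?m + 1) powr (- a)"
      by (simp add: add.commute)
    ultimately show ?case using Suc.IH by (simp add: add.commute diff_divide_distrib)
  qed simp
  have "(\<Sum>i\<in>{1..<N}. real i powr (- a)) \<le> (\<Sum>i\<in>{1..<Suc (Suc N)}. real i powr (- a))"
    by (intro sum_mono2) auto
  also have "\<dots> \<le> 1 + (1 - real (Suc N) powr (1 - a)) / (a - 1)" by (rule *)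
  also have "\<dots> \<le> 1 + 1 / (a - 1)" using a by (intro add_left_mono divide_right_mono) auto
  also have "\<dots> = a / (a - 1)" using a by (simp add: field_simps)
  finally show ?thesis .
qed

lemma two_powr_diff_quotient:
  assumes d: "0 < (d :: real)"
  shows "(2 powr d - 1) / d \<le> ln 2 * 2 powr d"
proof -
  have "1 - d * ln 2 \<le> 2 powr (- d)" using exp_ge_add_one_self[of "- d * ln 2"] by (simp add: powr_def)
  then have "(1 - d * ln 2) * 2 powr d \<le> 2 powr (- d) * 2 powr d" by (intro mult_right_mono) auto
  then have "2 powr d - 1 \<le> d * (ln 2 * 2 powr d)" by (simp add: powr_add[symmetric] algebra_simps)
  then show ?thesis using d by (simp add: field_simps)
qed

text \<open>The two parts of the constant: the term \<open>i = 0\<close>, where the smoothing bound is singular,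
  and a sum \<open>\<Sum> i\<^sup>2\<^sup>d\<^sup>-\<^sup>2\<close> over the remaining ones. For \<open>d > 0\<close> the difference
  quotient of \<open>2\<^sup>d\<close> replaces the division by \<open>d\<close>, at the cost of a factor
  \<open>2\<^sup>2\<^sup>d\<close>; the bound has room for a factor \<open>4\<close>.\<close>

lemma sum_diff2_bound:
  fixes c :: "real \<Rightarrow> real" and \<nu> \<eta> :: real and b :: "nat \<Rightarrow> real"
  defines "d \<equiv> \<eta> - \<nu>"
  assumes d: "\<bar>d\<bar> < 1 / 2" and h: "0 < h" and b: "\<And>i. 0 \<le> b i" and N: "0 < N"
    and reg: "\<And>i. \<lbrakk>0 < i; i < N\<rbrakk> \<Longrightarrow> b i \<le> c (1 - d) * g * (2 * real i * h) powr (d - 1) * h\<^sup>2"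
    and nonpos: "d \<le> 0 \<Longrightarrow> b 0 \<le> c (- d) * g * (2 * h) powr (1 + d) / (1 + d)"
    and pos: "0 < d \<Longrightarrow> b 0 \<le> c (1 - d) * g * ((2 * h) powr (1 + d) - 2 * h powr (1 + d)) / (d * (1 + d))"
  shows "(\<Sum>i<N. (b i)\<^sup>2) \<le> 4 * g\<^sup>2 * (M_init c \<nu> \<eta> +
     (c (1 - \<eta> + \<nu>))\<^sup>2 / 2 powr (4 - 2 * (\<eta> - \<nu>)) * ((2 - 2 * (\<eta> - \<nu>)) / (1 - 2 * (\<eta> - \<nu>)))) * h powr (2 + 2 * d)"
proof -
  have e1: "1 - \<eta> + \<nu> = 1 - d" "\<nu> - \<eta> = - d" "1 + \<eta> - \<nu> = 1 + d" "\<eta> - \<nu> = d" by (auto simp: d_def)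
  define k where "k = (c (1 - d))\<^sup>2"
  have h2: "(h powr (1 + d))\<^sup>2 = h powr (2 + 2 * d)"
    by (simp add: power2_eq_square powr_add[symmetric])
  have first: "(b 0)\<^sup>2 \<le> 4 * g\<^sup>2 * M_init c \<nu> \<eta> * h powr (2 + 2 * d)"
  proof (cases "d \<le> 0")
    case True
    have "(b 0)\<^sup>2 \<le> (c (- d) * g * (2 * h) powr (1 + d) / (1 + d))\<^sup>2"
      by (intro power_mono nonpos True b)
    also have "\<dots> = (c (- d))\<^sup>2 * g\<^sup>2 * ((2 * h) powr (1 + d))\<^sup>2 / (1 + d)\<^sup>2"
      by (simp only: power_mult_distrib power_divide)
    also have "((2 * h) powr (1 + d))\<^sup>2 = (2 * h) powr ((1 + d) + (1 + d))"
      by (simp only: powr_add power2_eq_square)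
    also have "\<dots> = 2 powr (2 + 2 * d) * h powr (2 + 2 * d)"
      using h by (simp add: powr_mult)
    also have "(c (- d))\<^sup>2 * g\<^sup>2 * (2 powr (2 + 2 * d) * h powr (2 + 2 * d)) / (1 + d)\<^sup>2 =
        2 powr (2 + 2 * d) * (c (- d))\<^sup>2 / (1 + d)\<^sup>2 * g\<^sup>2 * h powr (2 + 2 * d)"
      by simp
    also have "\<dots> = g\<^sup>2 * M_init c \<nu> \<eta> * h powr (2 + 2 * d)"
      using True by (simp add: M_init_def e1 d_def[symmetric]) (simp add: d_def)
    also have "\<dots> \<le> 4 * (g\<^sup>2 * M_init c \<nu> \<eta> * h powr (2 + 2 * d))"
      using True by (simp add: M_init_def)
    finally show ?thesis by (simp add: mult.assoc)
  next
    case False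
    then have d0: "0 < d" by simp
    let ?q = "(2 powr d - 1) / d"
    have q0: "0 \<le> ?q" using d0 ge_one_powr_ge_zero[of 2 d] by simp
    have "(2 * h) powr (1 + d) - 2 * h powr (1 + d) = 2 * h powr (1 + d) * (2 powr d - 1)"
      using h by (simp add: powr_mult powr_add algebra_simps)
    then have "b 0 \<le> c (1 - d) * g * (2 * h powr (1 + d) * (2 powr d - 1)) / (d * (1 + d))"
      using pos[OF d0] by simp
    also have "\<dots> = c (1 - d) * g * (2 * h powr (1 + d) * ?q) / (1 + d)"
      by simp
    finally have "(b 0)\<^sup>2 \<le> (c (1 - d) * g * (2 * h powr (1 + d) * ?q) / (1 + d))\<^sup>2"
      by (intro power_mono b)
    also have "\<dots> = 4 * (k * g\<^sup>2 / (1 + d)\<^sup>2 * h powr (2 + 2 * d)) * ?q\<^sup>2"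
      by (simp only: power_mult_distrib power_divide h2 k_def) (simp add: mult_ac)
    finally have b0: "(b 0)\<^sup>2 \<le> 4 * (k * g\<^sup>2 / (1 + d)\<^sup>2 * h powr (2 + 2 * d)) * ?q\<^sup>2" .
    have "?q\<^sup>2 \<le> (ln 2 * 2 powr d)\<^sup>2"
      by (intro power_mono two_powr_diff_quotient d0 q0)
    also have "(ln 2 * 2 powr d)\<^sup>2 = (ln 2)\<^sup>2 * 2 powr (2 * d)"
      by (simp add: power_mult_distrib power2_eq_square powr_add[symmetric])
    also have "\<dots> \<le> (ln 2)\<^sup>2 * 4"
    proof -
      have "2 powr (2 * d) \<le> 2 powr (2 :: real)" using d by (intro powr_mono) auto
      then show ?thesis by (intro mult_left_mono) auto
    qed
    finally have "?q\<^sup>2 \<le> (ln 2)\<^sup>2 * 4" .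
    from order_trans[OF b0 mult_left_mono[OF this]]
    have "(b 0)\<^sup>2 \<le> 4 * (k * g\<^sup>2 / (1 + d)\<^sup>2 * h powr (2 + 2 * d)) * ((ln 2)\<^sup>2 * 4)"
      by (simp add: k_def)
    also have "\<dots> = 4 * g\<^sup>2 * M_init c \<nu> \<eta> * h powr (2 + 2 * d)"
      using d0 unfolding M_init_def e1 k_def by (simp add: d_def)
    finally show ?thesis .
  qed
  have rest: "(b i)\<^sup>2 \<le> k * g\<^sup>2 * 2 powr (2 * d - 2) * h powr (2 + 2 * d) * real i powr (- (2 - 2 * d))"
    if i: "i \<in> {1..<N}" for i
  proof -
    have "(b i)\<^sup>2 \<le> (c (1 - d) * g * (2 * real i * h) powr (d - 1) * h\<^sup>2)\<^sup>2"
      using i by (intro power_mono reg b) auto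
    also have "\<dots> = k * g\<^sup>2 * ((2 * real i * h) powr (d - 1))\<^sup>2 * h ^ 4"
      by (simp add: power_mult_distrib k_def)
    also have "((2 * real i * h) powr (d - 1))\<^sup>2 = (2 * real i * h) powr ((d - 1) + (d - 1))"
      by (simp only: powr_add power2_eq_square)
    also have "\<dots> = 2 powr (2 * d - 2) * real i powr (2 * d - 2) * h powr (2 * d - 2)"
      using h by (simp add: powr_mult)
    also have "h ^ 4 = h powr 4" using h by (simp add: powr_numeral)
    also have "k * g\<^sup>2 * (2 powr (2 * d - 2) * real i powr (2 * d - 2) * h powr (2 * d - 2)) * h powr 4 =
        k * g\<^sup>2 * 2 powr (2 * d - 2) * (h powr (2 * d - 2) * h powr 4) * real i powr (2 * d - 2)"
      by (simp add: mult_ac)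
    also have "h powr (2 * d - 2) * h powr 4 = h powr (2 + 2 * d)" by (simp add: powr_add[symmetric] add.commute)
    finally show ?thesis by simp
  qed
  have "{..<N} = insert 0 {1..<N}" using N by auto
  then have "(\<Sum>i<N. (b i)\<^sup>2) = (b 0)\<^sup>2 + (\<Sum>i\<in>{1..<N}. (b i)\<^sup>2)" by simp
  also have "(\<Sum>i\<in>{1..<N}. (b i)\<^sup>2) \<le>
      (\<Sum>i\<in>{1..<N}. k * g\<^sup>2 * 2 powr (2 * d - 2) * h powr (2 + 2 * d) * real i powr (- (2 - 2 * d)))"
    by (intro sum_mono rest)
  also have "\<dots> = k * g\<^sup>2 * 2 powr (2 * d - 2) * h powr (2 + 2 * d) * (\<Sum>i\<in>{1..<N}. real i powr (- (2 - 2 * d)))"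
    by (simp add: sum_distrib_left)
  also have "\<dots> \<le> k * g\<^sup>2 * 2 powr (2 * d - 2) * h powr (2 + 2 * d) * ((2 - 2 * d) / (2 - 2 * d - 1))"
    using d by (intro mult_left_mono sum_powr_le) (auto simp: k_def)
  also have "2 powr (2 * d - 2) = 4 / 2 powr (4 - 2 * d)"
  proof -
    have "2 powr (2 * d - 2) * 2 powr (4 - 2 * d) = (2 powr 2 :: real)" by (simp add: powr_add[symmetric])
    then have "2 powr (2 * d - 2) * 2 powr (4 - 2 * d) = (4 :: real)" by simp
    then show ?thesis by (simp add: field_simps)
  qed
  finally have "(\<Sum>i<N. (b i)\<^sup>2) \<le> (b 0)\<^sup>2 + k * g\<^sup>2 * (4 / 2 powr (4 - 2 * d)) * h powr (2 + 2 * d) * ((2 - 2 * d) / (2 - 2 * d - 1))"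
    by simp
  also have "\<dots> \<le> 4 * g\<^sup>2 * M_init c \<nu> \<eta> * h powr (2 + 2 * d) +
      k * g\<^sup>2 * (4 / 2 powr (4 - 2 * d)) * h powr (2 + 2 * d) * ((2 - 2 * d) / (2 - 2 * d - 1))"
    by (intro add_right_mono first)
  finally show ?thesis unfolding e1 k_def by (simp add: algebra_simps)
qed

section \<open>Bounded approximations of the powers\<close>

context sectorial_semigroup
begin

text \<open>A large exponent is split into equal parts below \<open>2\<close>, and each factor uses up a piece of the
  semigroup.\<close>

lemma semigroup_through_power:
  assumes a: "0 \<le> a" "a < 2" and t: "0 < t"
  shows "\<exists>g. bounded_linear g \<and> (\<forall>y. g (P (real j * a) y) = S (real j * t) y)"
proof (induction j)
  case 0
  then show ?case
    by (intro exI[of _ "\<lambda>y. y"]) (simp add: P_0 S_0)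
next
  case (Suc j)
  then obtain g where g: "bounded_linear g" "\<And>y. g (P (real j * a) y) = S (real j * t) y" by blast
  have "Q a t (g (P (real (Suc j) * a) y)) = S (real (Suc j) * t) y" for y
  proof -
    have "P (real (Suc j) * a) y = P (real j * a) (P a y)"
      using a P_add[of "real j * a" a y] by (simp add: algebra_simps)
    then have "Q a t (g (P (real (Suc j) * a) y)) = Q a t (S (real j * t) (P a y))" using g(2) by simp
    also have "S (real j * t) (P a y) = P a (S (real j * t) y)" using t by (intro P_S_commute) simp
    also have "Q a t (P a (S (real j * t) y)) = S t (S (real j * t) y)"
      by (simp add: P_Q_commute[OF t] P_Q[OF a t])
    also have "\<dots> = S (t + real j * t) y" using S_add[of t "real j * t"] t by simp
    finally show ?thesis by (simp add: algebra_simps)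
  qed
  then show ?case
    using bounded_linear_compose[OF bounded_linear_Q[OF a t] g(1)] by (auto intro: exI[of _ "\<lambda>u. Q a t (g u)"])
qed

text \<open>A power is a pointwise limit of bounded operators on its domain: \<open>(-A)\<^sup>\<eta> e\<^sup>A\<^sup>t\<close> is
  bounded for \<open>t > 0\<close>.\<close>

lemma neg_power_approximation:
  "\<exists>f. (\<forall>k. bounded_linear (f k)) \<and>
     (\<forall>u\<in>neg_gen_dom S \<eta>. (\<lambda>k :: nat. f k u) \<longlonglongrightarrow> neg_gen_power S \<eta> u)"
proof (cases "\<eta> \<le> 0")
  case True
  then show ?thesis
    by (intro exI[of _ "\<lambda>k. P (- \<eta>)"]) (simp add: neg_power_nonpos bounded_linear_P)
next
  case False
  define j where "j = Suc (nat \<lceil>\<eta>\<rceil>)"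
  define a where "a = \<eta> / real j"
  have j: "0 < real j" "\<eta> < real j"
  proof -
    show "0 < real j" by (simp add: j_def)
    show "\<eta> < real j" using real_nat_ceiling_ge[of \<eta>] unfolding j_def of_nat_Suc by linarith
  qed
  have a: "0 \<le> a" "a < 2" "real j * a = \<eta>" using j False by (auto simp: a_def field_simps)
  have "\<forall>k. \<exists>g. bounded_linear g \<and> (\<forall>y. g (P \<eta> y) = S (1 / real (Suc k)) y)"
    using semigroup_through_power[OF a(1,2), of "1 / real (Suc k) / real j" j for k] j a(3) by simp
  then obtain f where f: "\<And>k. bounded_linear (f k)" "\<And>k y. f k (P \<eta> y) = S (1 / real (Suc k)) y" by metis
  show ?thesis
  proof (intro exI[of _ f] conjI allI ballI f)
    fix u assume "u \<in> neg_gen_dom S \<eta>"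
    then obtain y where u: "u = P \<eta> y" using False by (auto simp: neg_dom_pos)
    show "(\<lambda>k. f k u) \<longlonglongrightarrow> neg_gen_power S \<eta> u"
      using False orbit_sequence by (simp only: u f neg_power_P)
  qed
qed

end

section \<open>Successive projections\<close>

context prob_space
begin

text \<open>The bound of the increment does not depend on the choice of the spanning families: the
  family \<open>Y\<close> over \<open>F'\<close> and the old observations together with \<open>s + v\<close> have the same orthogonal
  complement, and both projections agree almost everywhere.\<close>

lemma projection_increment:
  assumes fin: "finite F" "finite F'" "finite K"
    and sqY: "\<And>j. j \<in> F' \<Longrightarrow> sq (Y j)" and FF: "F \<subseteq> F'"
    and sqs: "\<And>q. q \<in> K \<Longrightarrow> sq (s q)"
    and sqv: "\<And>q. q \<in> K \<Longrightarrow> sq (v q)" and sqU: "sq U"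
    and vY: "\<And>q j. \<lbrakk>q \<in> K; j \<in> F\<rbrakk> \<Longrightarrow> ip (v q) (Y j) = 0"
    and vU: "\<And>q. q \<in> K \<Longrightarrow> ip (v q) U = 0"
    and vs: "\<And>q q'. \<lbrakk>q \<in> K; q' \<in> K\<rbrakk> \<Longrightarrow> ip (v q) (s q') = 0"
    and \<mu>: "0 < \<mu>"
    and coercive: "\<And>a. \<mu> * (\<Sum>q\<in>K. (a q)\<^sup>2) \<le>
      ip (\<lambda>\<omega>. \<Sum>q\<in>K. a q * v q \<omega>) (\<lambda>\<omega>. \<Sum>q\<in>K. a q * v q \<omega>)"
    and p: "p = (\<lambda>\<omega>. \<Sum>j\<in>F. b j * Y j \<omega>)" "\<And>j. j \<in> F \<Longrightarrow> ip (\<lambda>\<omega>. U \<omega> - p \<omega>) (Y j) = 0"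
    and p': "p' = (\<lambda>\<omega>. \<Sum>j\<in>F'. b' j * Y j \<omega>)" "\<And>j. j \<in> F' \<Longrightarrow> ip (\<lambda>\<omega>. U \<omega> - p' \<omega>) (Y j) = 0"
    and refine: "\<And>Z j. \<lbrakk>sq Z; \<And>j. j \<in> F \<Longrightarrow> ip Z (Y j) = 0;
        \<And>q. q \<in> K \<Longrightarrow> ip Z (\<lambda>\<omega>. s q \<omega> + v q \<omega>) = 0; j \<in> F'\<rbrakk> \<Longrightarrow> ip Z (Y j) = 0"
    and coarsen: "\<And>Z q. \<lbrakk>sq Z; \<And>j. j \<in> F' \<Longrightarrow> ip Z (Y j) = 0; q \<in> K\<rbrakk> \<Longrightarrow> ip Z (\<lambda>\<omega>. s q \<omega> + v q \<omega>) = 0"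
  shows "ip (\<lambda>\<omega>. p' \<omega> - p \<omega>) (\<lambda>\<omega>. p' \<omega> - p \<omega>) \<le>
    ip (\<lambda>\<omega>. U \<omega> - p \<omega>) (\<lambda>\<omega>. U \<omega> - p \<omega>) * (\<Sum>q\<in>K. ip (s q) (s q)) / \<mu>"
proof -
  define Z where "Z = case_sum Y (\<lambda>q \<omega>. s q \<omega> + v q \<omega>)"
  have sqZ: "sq (Z i)" if "i \<in> F <+> K" for i
    using that sqY FF sqs sqv by (auto simp: Z_def intro!: sq_add)
  have "finite (F <+> K)" using fin by (simp add: finite_Plus)
  from projection_exists[OF this sqZ sqU]
  obtain a where a: "\<forall>k\<in>F <+> K. ip (\<lambda>\<omega>. U \<omega> - (\<Sum>i\<in>F <+> K. a i * Z i \<omega>)) (Z k) = 0" ..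
  define r where "r = (\<lambda>\<omega>. \<Sum>i\<in>F <+> K. a i * Z i \<omega>)"
  have r: "r = (\<lambda>\<omega>. (\<Sum>j\<in>F. a (Inl j) * Y j \<omega>) + (\<Sum>q\<in>K. a (Inr q) * (s q \<omega> + v q \<omega>)))"
    unfolding r_def using fin by (subst sum.Plus) (simp_all add: Z_def)
  have rY: "ip (\<lambda>\<omega>. U \<omega> - r \<omega>) (Y j) = 0" if "j \<in> F" for j
    using a InlI[OF that, of K] unfolding r_def by (force simp: Z_def)
  have rs: "ip (\<lambda>\<omega>. U \<omega> - r \<omega>) (\<lambda>\<omega>. s q \<omega> + v q \<omega>) = 0" if "q \<in> K" for q
    using a InrI[OF that, of F] unfolding r_def by (force simp: Z_def)
  have sqr: "sq r" unfolding r_def by (intro sq_lincomb sqZ)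
  have sqp: "sq p" unfolding p(1) using sqY FF by (intro sq_lincomb) auto
  have sqp': "sq p'" unfolding p'(1) using sqY by (intro sq_lincomb) auto
  have sqUr: "sq (\<lambda>\<omega>. U \<omega> - r \<omega>)" and sqUp': "sq (\<lambda>\<omega>. U \<omega> - p' \<omega>)"
    using sqU sqr sqp' by auto
  have rY': "ip (\<lambda>\<omega>. U \<omega> - r \<omega>) (Y j) = 0" if "j \<in> F'" for j
    by (rule refine[OF sqUr rY rs that])
  have p's: "ip (\<lambda>\<omega>. U \<omega> - p' \<omega>) (\<lambda>\<omega>. s q \<omega> + v q \<omega>) = 0" if "q \<in> K" for q
    by (rule coarsen[OF sqUp' p'(2) that])
  have against_p': "ip X p' = 0" if "sq X" "\<And>j. j \<in> F' \<Longrightarrow> ip X (Y j) = 0" for X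
    unfolding p'(1) using that sqY by (subst ip_lincomb_right) auto
  have against_r: "ip X r = 0" if "sq X" "\<And>j. j \<in> F \<Longrightarrow> ip X (Y j) = 0"
    "\<And>q. q \<in> K \<Longrightarrow> ip X (\<lambda>\<omega>. s q \<omega> + v q \<omega>) = 0" for X
    unfolding r_def using that sqZ by (subst ip_lincomb_right) (auto simp: Z_def intro!: sum.neutral)
  define D where "D = (\<lambda>\<omega>. r \<omega> - p' \<omega>)"
  have sqD: "sq D" unfolding D_def using sqr sqp' by (rule sq_diff)
  have orth: "ip (\<lambda>\<omega>. U \<omega> - r \<omega>) D = 0" "ip (\<lambda>\<omega>. U \<omega> - p' \<omega>) D = 0"
    unfolding D_def using rY rY' rs p's p'(2) FF sqr sqp' sqUr sqUp'
    by (auto simp: ip_diff_right against_p' against_r subset_iff)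
  have "D = (\<lambda>\<omega>. (U \<omega> - p' \<omega>) - (U \<omega> - r \<omega>))" by (simp add: D_def)
  then have "ip D D = ip (\<lambda>\<omega>. (U \<omega> - p' \<omega>) - (U \<omega> - r \<omega>)) D" by simp
  also have "\<dots> = ip (\<lambda>\<omega>. U \<omega> - p' \<omega>) D - ip (\<lambda>\<omega>. U \<omega> - r \<omega>) D"
    by (rule ip_diff_left[OF sqUp' sqUr sqD])
  finally have DD: "ip D D = 0" using orth by simp
  let ?E = "\<lambda>\<omega>. p' \<omega> - p \<omega>"
  have sqE: "sq ?E" using sqp' sqp by (rule sq_diff)
  have null: "ip D X = 0" "ip X D = 0" if "sq X" for X
    using ip_null[OF sqD that DD] ip_commute[of X D] by auto
  have "ip (\<lambda>\<omega>. r \<omega> - p \<omega>) (\<lambda>\<omega>. r \<omega> - p \<omega>) = ip (\<lambda>\<omega>. D \<omega> + ?E \<omega>) (\<lambda>\<omega>. D \<omega> + ?E \<omega>)"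
    by (simp add: D_def)
  also have "\<dots> = ip ?E ?E"
    using sqD sqE by (simp add: ip_add_left ip_add_right sq_add null)
  finally have "ip ?E ?E = ip (\<lambda>\<omega>. r \<omega> - p \<omega>) (\<lambda>\<omega>. r \<omega> - p \<omega>)" by simp
  also have "\<dots> \<le> ip (\<lambda>\<omega>. U \<omega> - p \<omega>) (\<lambda>\<omega>. U \<omega> - p \<omega>) * (\<Sum>q\<in>K. ip (s q) (s q)) / \<mu>"
    using sqY FF
    by (intro innovation_bound[OF fin(1,3) _ sqs sqv sqU vY vU vs \<mu> coercive p r rY rs]) auto
  finally show ?thesis .
qed

section \<open>Limits in mean square\<close>

text \<open>The expectations of the absolute increments are summable, so that the sequence converges almost
  surely; Fatou's lemma transfers the bounds to the limit. The function \<open>lim\<close> has an arbitrary value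
  on the exceptional null set, and it is measurable for every \<open>\<sigma>\<close>-algebra for which the
  sequence is.\<close>

lemma geometric_L2_limit:
  assumes X: "\<And>k. sq (X k)" and r: "0 < r" "r < 1"
    and cauchy: "\<And>k j. k \<le> j \<Longrightarrow> ip (\<lambda>\<omega>. X j \<omega> - X k \<omega>) (\<lambda>\<omega>. X j \<omega> - X k \<omega>) \<le> B * r ^ k"
  defines "L \<equiv> \<lambda>\<omega>. lim (\<lambda>k. X k \<omega>)"
  shows "sq L" "ip (\<lambda>\<omega>. L \<omega> - X k \<omega>) (\<lambda>\<omega>. L \<omega> - X k \<omega>) \<le> B * r ^ k"
proof -
  note [measurable] = sq_measurable[OF X]
  have L [measurable]: "L \<in> borel_measurable M" unfolding L_def by measurable
  have "0 \<le> B * r ^ 0" using cauchy[of 0 0] by (simp add: ip_def)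
  then have B: "0 \<le> B" by simp
  define q where "q = sqrt r"
  have q: "0 < q" "q < 1" "q\<^sup>2 = r" using r by (auto simp: q_def)
  define I where "I k \<omega> = \<bar>X (Suc k) \<omega> - X k \<omega>\<bar>" for k \<omega>
  have sqI: "sq (I k)" for k
  proof -
    have "sq (\<lambda>\<omega>. X (Suc k) \<omega> - X k \<omega>)" using X by auto
    then show ?thesis unfolding I_def[abs_def] sq_def by simp
  qed
  have EI: "expectation (I k) \<le> sqrt B * q ^ k" for k
  proof (rule power2_le_imp_le)
    have "(expectation (I k))\<^sup>2 = (ip (I k) (\<lambda>_. 1))\<^sup>2" by (simp add: ip_def)
    also have "\<dots> \<le> ip (I k) (I k) * ip (\<lambda>_. 1) (\<lambda>_. 1)" by (intro ip_Cauchy_Schwarz sqI sq_const)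
    also have "\<dots> = ip (\<lambda>\<omega>. X (Suc k) \<omega> - X k \<omega>) (\<lambda>\<omega>. X (Suc k) \<omega> - X k \<omega>)"
      by (simp add: ip_def I_def prob_space abs_mult_self_eq)
    also have "\<dots> \<le> B * r ^ k" by (rule cauchy) simp
    also have "\<dots> = (sqrt B * q ^ k)\<^sup>2"
      using B q by (simp add: power_mult_distrib power_mult[symmetric] mult.commute[of k]) (simp add: power_mult)
    finally show "(expectation (I k))\<^sup>2 \<le> (sqrt B * q ^ k)\<^sup>2" .
  qed (use B q in auto)
  have "(\<integral>\<^sup>+\<omega>. (\<Sum>k. ennreal (I k \<omega>)) \<partial>M) = (\<Sum>k. \<integral>\<^sup>+\<omega>. ennreal (I k \<omega>) \<partial>M)"
    by (rule nn_integral_suminf) (simp add: I_def)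
  also have "\<dots> = (\<Sum>k. ennreal (expectation (I k)))"
    by (intro suminf_cong nn_integral_eq_integral sq_integrable sqI) (simp add: I_def)
  also have "\<dots> \<le> (\<Sum>k. ennreal (sqrt B * q ^ k))"
    by (intro suminf_le ennreal_leI EI) auto
  also have "\<dots> < \<top>"
  proof -
    have "summable (\<lambda>k. sqrt B * q ^ k)" using q by (intro summable_mult summable_geometric) auto
    then show ?thesis using B q by (subst suminf_ennreal2) auto
  qed
  finally have "AE \<omega> in M. (\<Sum>k. ennreal (I k \<omega>)) \<noteq> \<infinity>"
    by (intro nn_integral_PInf_AE) (auto simp: I_def)
  then have lim: "AE \<omega> in M. (\<lambda>k. X k \<omega>) \<longlonglongrightarrow> L \<omega>"
  proof eventually_elim
    case (elim \<omega>)
    then have "summable (\<lambda>k. I k \<omega>)" by (intro summable_suminf_not_top) (auto simp: I_def)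
    then have "summable (\<lambda>k. X (Suc k) \<omega> - X k \<omega>)"
      unfolding I_def by (rule summable_rabs_cancel)
    then have "convergent (\<lambda>n. \<Sum>k<n. X (Suc k) \<omega> - X k \<omega>)" by (simp add: summable_iff_convergent)
    then have "convergent (\<lambda>n. X n \<omega> - X 0 \<omega>)"
      by (simp only: sum_lessThan_telescope[where f = "\<lambda>n. X n \<omega>"])
    then have "convergent (\<lambda>n. X 0 \<omega> + (X n \<omega> - X 0 \<omega>))" by (intro convergent_add convergent_const)
    then show ?case unfolding L_def by (simp add: convergent_LIMSEQ_iff)
  qed
  have sqd: "sq (\<lambda>\<omega>. X j \<omega> - X k \<omega>)" for j k using X by auto
  have main: "integrable M (\<lambda>\<omega>. (L \<omega> - X k \<omega>)\<^sup>2) \<and> expectation (\<lambda>\<omega>. (L \<omega> - X k \<omega>)\<^sup>2) \<le> B * r ^ k" for k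
  proof -
    have ae: "AE \<omega> in M. (\<lambda>j. (X (k + j) \<omega> - X k \<omega>)\<^sup>2) \<longlonglongrightarrow> (L \<omega> - X k \<omega>)\<^sup>2"
      using lim
    proof eventually_elim
      case (elim \<omega>)
      from LIMSEQ_ignore_initial_segment[OF this, of k] show ?case
        by (intro tendsto_intros) (simp add: add.commute)
    qed
    note il = integrable_limit[where Q = "\<lambda>j \<omega>. (X (k + j) \<omega> - X k \<omega>)\<^sup>2", OF _ _ _ _ ae, of "B * r ^ k"]
    show ?thesis
      by (intro conjI il) (use sqd cauchy[of k] in \<open>auto simp: sq_def ip_self\<close>)
  qed
  have "sq (\<lambda>\<omega>. (L \<omega> - X 0 \<omega>) + X 0 \<omega>)"
    using main[of 0] X by (intro sq_add) (auto simp: sq_def)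
  then show "sq L" by simp
  show "ip (\<lambda>\<omega>. L \<omega> - X k \<omega>) (\<lambda>\<omega>. L \<omega> - X k \<omega>) \<le> B * r ^ k" using main[of k] by (simp add: ip_self)
qed

section \<open>Uniqueness of conditional expectations\<close>

text \<open>The event that one version exceeds the other belongs to \<open>F\<close>, and the difference is
  non-negative there with vanishing integral.\<close>

lemma cond_exp_unique:
  fixes Z Z' :: "'a \<Rightarrow> real"
  assumes F: "sets F \<subseteq> sets M" "space F = space M"
    and Z: "Z \<in> borel_measurable F" "integrable M Z" and Z': "Z' \<in> borel_measurable F" "integrable M Z'"
    and eq: "\<And>A. A \<in> sets F \<Longrightarrow> (LINT \<omega>:A|M. Z \<omega>) = (LINT \<omega>:A|M. Z' \<omega>)"
  shows "AE \<omega> in M. Z \<omega> = Z' \<omega>"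
proof -
  have half: "AE \<omega> in M. V \<omega> \<le> W \<omega>"
    if V: "V \<in> borel_measurable F" "integrable M V" and W: "W \<in> borel_measurable F" "integrable M W"
      and eq: "\<And>A. A \<in> sets F \<Longrightarrow> (LINT \<omega>:A|M. V \<omega>) = (LINT \<omega>:A|M. W \<omega>)" for V W :: "'a \<Rightarrow> real"
  proof -
    define A where "A = {\<omega> \<in> space F. W \<omega> < V \<omega>}"
    have A: "A \<in> sets F" unfolding A_def using V(1) W(1) by measurable
    then have AM: "A \<in> sets M" using F by auto
    have i: "integrable M (\<lambda>\<omega>. indicator A \<omega> * (V \<omega> - W \<omega>))"
      using integrable_mult_indicator[OF AM, of "\<lambda>\<omega>. V \<omega> - W \<omega>"] V W by simp
    have "expectation (\<lambda>\<omega>. indicator A \<omega> * (V \<omega> - W \<omega>)) = 0"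
      using eq[OF A] integrable_mult_indicator[OF AM V(2)] integrable_mult_indicator[OF AM W(2)]
      by (simp add: set_lebesgue_integral_def right_diff_distrib)
    moreover have "AE \<omega> in M. 0 \<le> indicator A \<omega> * (V \<omega> - W \<omega>)"
      by (intro AE_I2) (auto simp: A_def indicator_def)
    ultimately have "AE \<omega> in M. indicator A \<omega> * (V \<omega> - W \<omega>) = 0"
      using integral_nonneg_eq_0_iff_AE[OF i] by simp
    then show ?thesis
      using AE_space
    proof eventually_elim
      case (elim \<omega>)
      then show ?case using F(2) by (cases "\<omega> \<in> A") (auto simp: A_def)
    qed
  qed
  have "AE \<omega> in M. Z \<omega> \<le> Z' \<omega>" by (rule half[OF Z Z']) (rule eq)
  moreover have "AE \<omega> in M. Z' \<omega> \<le> Z \<omega>" by (rule half[OF Z' Z]) (rule eq[symmetric])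
  ultimately show ?thesis by eventually_elim simp
qed

end

lemma space_gen_sigma [simp]: "space (gen_sigma M I Y) = space M"
  by (simp add: gen_sigma_def space_measure_of_conv)

lemma measurable_gen_sigma:
  fixes Y :: "'i \<Rightarrow> 'w \<Rightarrow> 'b::topological_space"
  assumes "i \<in> I"
  shows "Y i \<in> borel_measurable (gen_sigma M I Y)"
proof (rule measurableI)
  fix U :: "'b set" assume "U \<in> sets borel"
  then show "Y i -` U \<inter> space (gen_sigma M I Y) \<in> sets (gen_sigma M I Y)"
    unfolding gen_sigma_def using assms
    by (subst sets_measure_of) (auto simp: space_measure_of_conv intro!: sigma_sets.Basic)
qed simp

lemma sets_gen_sigma_le:
  assumes "\<And>i. i \<in> I \<Longrightarrow> Y i \<in> borel_measurable M"
  shows "sets (gen_sigma M I Y) \<subseteq> sets M"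
  unfolding gen_sigma_def
  by (subst sets_measure_of)
     (use assms in \<open>auto intro!: sets.sigma_sets_subset intro: measurable_sets\<close>)

section \<open>The observed process\<close>

locale observation_problem = smoothing_bound S c T "\<eta> - \<nu>" + observed M x m P0 w R
  for S :: "real \<Rightarrow> 'x::{real_inner, banach, second_countable_topology} \<Rightarrow>\<^sub>L 'x"
    and c :: "real \<Rightarrow> real" and T \<eta> \<nu> :: real
    and M :: "'w measure" and x :: "'w \<Rightarrow> 'x" and m :: 'x and P0 :: "'x \<Rightarrow> 'x"
    and w :: "real \<Rightarrow> 'w \<Rightarrow> real ^ 'r" and R :: "real ^ 'r ^ 'r" +
  fixes C :: "'x \<Rightarrow> real ^ 'r" and n :: nat
  assumes C_graph: "bounded_op_on (gen_dom S) (\<lambda>u. norm u + norm (gen S u)) C"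
    and C_frac: "bounded_op_on (neg_gen_dom S \<nu>) (\<lambda>u. norm (neg_gen_power S \<nu> u)) C"
    and x_dom: "AE \<omega> in M. x \<omega> \<in> neg_gen_dom S \<eta>"
    and n: "0 < n"
begin

abbreviation "\<delta> \<equiv> \<eta> - \<nu>"
abbreviation "y \<equiv> output_process S C x w"
abbreviation "normC \<equiv> op_norm_on (neg_gen_dom S \<nu>) (\<lambda>u. norm (neg_gen_power S \<nu> u)) C"

text \<open>The supremum defining the norm is finite by the boundedness assumption; where the denominator
  vanishes, \<open>C u\<close> vanishes as well.\<close>

lemma norm_C: 
  assumes u: "u \<in> neg_gen_dom S \<nu>"
  shows "norm (C u) \<le> normC * norm (neg_gen_power S \<nu> u)"
proof -
  obtain K where K: "\<And>u. u \<in> neg_gen_dom S \<nu> \<Longrightarrow> norm (C u) \<le> K * norm (neg_gen_power S \<nu> u)"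
    using C_frac unfolding bounded_op_on_def by blast
  have "bdd_above ((\<lambda>u. norm (C u) / norm (neg_gen_power S \<nu> u)) ` neg_gen_dom S \<nu>)"
  proof (rule bdd_aboveI2)
    fix u assume "u \<in> neg_gen_dom S \<nu>"
    from K[OF this] show "norm (C u) / norm (neg_gen_power S \<nu> u) \<le> max K 0"
      by (cases "neg_gen_power S \<nu> u = 0") (auto simp: divide_le_eq intro: order_trans mult_right_mono)
  qed
  from cSUP_upper[OF u this] have "norm (C u) / norm (neg_gen_power S \<nu> u) \<le> normC"
    unfolding op_norm_on_def .
  then show ?thesis
    using K[OF u] by (cases "neg_gen_power S \<nu> u = 0") (auto simp: divide_le_eq)
qed

definition I :: "real \<Rightarrow> 'x \<Rightarrow> 'x" where
  "I t \<xi> = integral {0..t} (\<lambda>s. S s \<xi>)"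

lemma C_add: "\<lbrakk>u \<in> gen_dom S; v \<in> gen_dom S\<rbrakk> \<Longrightarrow> C (u + v) = C u + C v"
  and C_scaleR: "u \<in> gen_dom S \<Longrightarrow> C (a *\<^sub>R u) = a *\<^sub>R C u"
  using C_graph unfolding bounded_op_on_def by blast+

lemma C_diff: "\<lbrakk>u \<in> gen_dom S; v \<in> gen_dom S\<rbrakk> \<Longrightarrow> C (u - v) = C u - C v"
  using C_add[of u "(-1) *\<^sub>R v"] C_scaleR[of v "-1"] gen_scaleR[of v "-1"] by simp

lemma I_dom: "0 \<le> t \<Longrightarrow> I t \<xi> \<in> gen_dom S"
  and gen_I: "0 \<le> t \<Longrightarrow> gen S (I t \<xi>) = S t \<xi> - \<xi>"
  unfolding I_def by (rule gen_integral; assumption)+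

lemma I_add: "0 \<le> t \<Longrightarrow> I t (\<xi> + \<zeta>) = I t \<xi> + I t \<zeta>"
  unfolding I_def by (simp add: blinfun.add_right Henstock_Kurzweil_Integration.integral_add integrable_orbit)

lemma I_scaleR: "I t (a *\<^sub>R \<xi>) = a *\<^sub>R I t \<xi>"
  unfolding I_def by (simp add: blinfun.scaleR_right)

lemma I_bound: "\<exists>K\<ge>0. \<forall>t\<in>{0..T}. \<forall>\<xi>. norm (C (I t \<xi>)) \<le> K * norm \<xi>"
proof -
  obtain K where K: "1 \<le> K" "\<And>t. 0 \<le> t \<Longrightarrow> t \<le> T \<Longrightarrow> norm (S t) \<le> K" using bounded_on_interval by blast
  have S: "norm (S t \<xi>) \<le> K * norm \<xi>" if "0 \<le> t" "t \<le> T" for t \<xi>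
    by (rule order_trans[OF norm_blinfun mult_right_mono[OF K(2)[OF that]]]) simp
  obtain Kc where Kc: "\<And>u. u \<in> gen_dom S \<Longrightarrow> norm (C u) \<le> Kc * (norm u + norm (gen S u))"
    using C_graph unfolding bounded_op_on_def by blast
  have "norm (C (I t \<xi>)) \<le> (\<bar>Kc\<bar> * (T * K + (K + 1))) * norm \<xi>" if t: "t \<in> {0..T}" for t \<xi>
  proof -
    have "norm (I t \<xi>) \<le> integral {0..t} (\<lambda>s. K * norm \<xi>)"
      unfolding I_def using t S by (intro integral_norm_bound_integral integrable_orbit) auto
    also have "\<dots> \<le> T * (K * norm \<xi>)" using t K(1) by (simp add: mult_right_mono)
    finally have 1: "norm (I t \<xi>) \<le> T * K * norm \<xi>" by simp
    have "norm (S t \<xi> - \<xi>) \<le> K * norm \<xi> + norm \<xi>"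
      using norm_triangle_ineq4[of "S t \<xi>" \<xi>] S[of t \<xi>] t by simp
    then have 2: "norm (gen S (I t \<xi>)) \<le> (K + 1) * norm \<xi>" using t by (simp add: gen_I distrib_right)
    have "norm (C (I t \<xi>)) \<le> Kc * (norm (I t \<xi>) + norm (gen S (I t \<xi>)))" using t by (intro Kc I_dom) simp
    also have "\<dots> \<le> \<bar>Kc\<bar> * (norm (I t \<xi>) + norm (gen S (I t \<xi>)))" by (intro mult_right_mono) auto
    also have "\<dots> \<le> \<bar>Kc\<bar> * (T * K * norm \<xi> + (K + 1) * norm \<xi>)" using 1 2 by (intro mult_left_mono add_mono) auto
    finally show ?thesis by (simp add: algebra_simps)
  qed
  moreover have "0 \<le> \<bar>Kc\<bar> * (T * K + (K + 1))" using K(1) T by simp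
  ultimately show ?thesis by blast
qed

lemma continuous_CI: "continuous_on {0..T} (\<lambda>t. C (I t \<xi>))"
  unfolding continuous_on_def
proof
  fix t assume t: "t \<in> {0..T}"
  obtain Kc where Kc: "\<And>u. u \<in> gen_dom S \<Longrightarrow> norm (C u) \<le> Kc * (norm u + norm (gen S u))"
    using C_graph unfolding bounded_op_on_def by blast
  have "continuous_on {0..T} (\<lambda>t. I t \<xi>)"
    unfolding I_def by (intro indefinite_integral_continuous_1 integrable_orbit) simp
  then have l1: "((\<lambda>s. I s \<xi>) \<longlongrightarrow> I t \<xi>) (at t within {0..T})" using t unfolding continuous_on_def by blast
  have "continuous_on {0..T} (\<lambda>t. S t \<xi>)" by (rule continuous_on_subset[OF continuous_orbit]) auto
  then have l2: "((\<lambda>s. S s \<xi>) \<longlongrightarrow> S t \<xi>) (at t within {0..T})" using t unfolding continuous_on_def by blast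
  have "((\<lambda>s. Kc * (norm (I s \<xi> - I t \<xi>) + norm ((S s \<xi> - \<xi>) - (S t \<xi> - \<xi>)))) \<longlongrightarrow>
      Kc * (norm (I t \<xi> - I t \<xi>) + norm ((S t \<xi> - \<xi>) - (S t \<xi> - \<xi>)))) (at t within {0..T})"
    by (intro tendsto_intros l1 l2)
  then have lim: "((\<lambda>s. Kc * (norm (I s \<xi> - I t \<xi>) + norm ((S s \<xi> - \<xi>) - (S t \<xi> - \<xi>)))) \<longlongrightarrow> 0) (at t within {0..T})"
    by simp
  have "\<forall>\<^sub>F s in at t within {0..T}. norm (C (I s \<xi>) - C (I t \<xi>)) \<le>
      Kc * (norm (I s \<xi> - I t \<xi>) + norm ((S s \<xi> - \<xi>) - (S t \<xi> - \<xi>)))"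
    unfolding eventually_at_filter
  proof (intro always_eventually allI impI)
    fix s assume s: "s \<in> {0..T}"
    then have d: "I s \<xi> \<in> gen_dom S" "I t \<xi> \<in> gen_dom S" using t by (auto intro: I_dom)
    have "norm (C (I s \<xi> - I t \<xi>)) \<le> Kc * (norm (I s \<xi> - I t \<xi>) + norm (gen S (I s \<xi> - I t \<xi>)))"
      using gen_diff[OF d] by (intro Kc) simp
    then show "norm (C (I s \<xi>) - C (I t \<xi>)) \<le> Kc * (norm (I s \<xi> - I t \<xi>) + norm ((S s \<xi> - \<xi>) - (S t \<xi> - \<xi>)))"
      using gen_diff[OF d] s t by (simp add: C_diff[OF d] gen_I)
  qed
  from Lim_null_comparison[OF this lim] show "((\<lambda>s. C (I s \<xi>)) \<longlongrightarrow> C (I t \<xi>)) (at t within {0..T})"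
    by (simp add: LIM_zero_iff)
qed

text \<open>The integral of the orbit is in the domain of \<open>A\<close> and depends on \<open>\<xi>\<close> continuously in the graph
  norm, because \<open>A\<close> maps it to \<open>S t \<xi> - \<xi>\<close>.\<close>

lemma bounded_linear_CI:
  assumes t: "t \<in> {0..T}"
  shows "bounded_linear (\<lambda>\<xi>. C (I t \<xi>))"
proof -
  obtain K where "\<forall>t\<in>{0..T}. \<forall>\<xi>. norm (C (I t \<xi>)) \<le> K * norm \<xi>" using I_bound by blast
  then show ?thesis
    using t by (intro bounded_linear_intro[of _ K])
      (simp_all add: I_add I_scaleR C_add C_scaleR I_dom mult.commute)
qed

lemma bounded_linear_obs:
  assumes t: "t \<in> {0..T}"
  shows "bounded_linear (\<lambda>\<xi>. b \<bullet> C (I t \<xi>))"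
  by (rule bounded_linear_compose[OF bounded_linear_inner_right bounded_linear_CI[OF t]])

lemma y_eq: "y t \<omega> = C (I t (x \<omega>)) + w t \<omega>"
  by (simp add: output_process_def I_def)

lemma y_measurable:
  assumes t: "t \<in> {0..T}"
  shows "y t \<in> borel_measurable M"
proof -
  have "(\<lambda>\<xi>. C (I t \<xi>)) \<in> borel_measurable borel"
    by (intro borel_measurable_continuous_onI linear_continuous_on bounded_linear_CI t)
  from measurable_compose[OF x_measurable this]
  show ?thesis unfolding y_eq[abs_def] using t by (intro borel_measurable_add w_measurable) auto
qed

text \<open>The constant variable is part of the observations, under an index with a negative time: the
  estimates are affine.\<close>

definition Y :: "real \<times> (real ^ 'r) \<Rightarrow> 'w \<Rightarrow> real" where
  "Y j \<omega> = (if fst j < 0 then 1 else y (fst j) \<omega> \<bullet> snd j)"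

lemma Y_const: "t < 0 \<Longrightarrow> Y (t, b) = (\<lambda>_. 1)"
  by (simp add: Y_def fun_eq_iff)

lemma Y_obs: "0 \<le> t \<Longrightarrow> Y (t, b) = (\<lambda>\<omega>. b \<bullet> C (I t (x \<omega>)) + wf b t \<omega>)"
  by (auto simp: Y_def y_eq fun_eq_iff inner_commute[of _ b] inner_add_right)

lemma Y_\<G>: "fst j \<le> T \<Longrightarrow> Y j \<in> \<G>"
proof (cases j)
  case (Pair t b)
  assume "fst j \<le> T"
  show ?thesis
  proof (cases "t < 0")
    case False
    then have "(\<lambda>\<omega>. 1 * (b \<bullet> C (I t (x \<omega>))) + 1 * wf b t \<omega>) \<in> \<G>"
      using \<open>fst j \<le> T\<close> Pair by (intro lincomb \<G>_functional bounded_linear_obs \<G>_wf) auto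
    then show ?thesis using False by (simp add: Pair Y_obs)
  qed (simp add: Pair Y_const \<G>_const)
qed

definition U :: "'x \<Rightarrow> 'w \<Rightarrow> real" where
  "U e \<omega> = e \<bullet> S T (x \<omega>)"

lemma bounded_linear_U: "bounded_linear (\<lambda>\<xi>. e \<bullet> S T \<xi>)"
  by (rule bounded_linear_compose[OF bounded_linear_inner_right blinfun.bounded_linear_right])

lemma U_\<G>: "U e \<in> \<G>"
  unfolding U_def[abs_def] by (rule \<G>_functional[OF bounded_linear_U])

section \<open>One refinement of the grid\<close>

definition N :: "nat \<Rightarrow> nat" where "N k = 2 ^ k * n"

definition time :: "nat \<Rightarrow> nat \<Rightarrow> real" where "time k j = real j * T / real (N k)"

definition grid :: "nat \<Rightarrow> (real \<times> (real ^ 'r)) set" where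
  "grid k = insert (- 1, 0) (time k ` {..N k} \<times> Basis)"

lemma N_pos: "0 < N k" and N_Suc: "N (Suc k) = 2 * N k"
  using n by (auto simp: N_def)

lemma time_bounds: "j \<le> N k \<Longrightarrow> 0 \<le> time k j \<and> time k j \<le> T"
  using N_pos[of k] T by (auto simp: time_def field_simps)

lemma finite_grid: "finite (grid k)"
  by (simp add: grid_def)

lemma grid_le: "j \<in> grid k \<Longrightarrow> fst j \<le> T"
  using time_bounds T by (auto simp: grid_def)

lemma time_refine: "time k j = time (Suc k) (2 * j)"
  using N_pos[of k] by (simp add: time_def N_Suc)

lemma grid_mono: "grid k \<subseteq> grid (Suc k)"
proof -
  have "time k ` {..N k} \<subseteq> time (Suc k) ` {..N (Suc k)}"
    unfolding time_refine[of k, abs_def] by (auto simp: N_Suc)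
  then show ?thesis unfolding grid_def by blast
qed

lemma sq_Y: "j \<in> grid k \<Longrightarrow> sq (Y j)"
  by (intro sq\<G> Y_\<G> grid_le)

lemma projection_coefficients:
  "\<exists>a. \<forall>j\<in>grid k. ip (\<lambda>\<omega>. U e \<omega> - (\<Sum>j\<in>grid k. a j * Y j \<omega>)) (Y j) = 0"
  by (rule projection_exists[OF finite_grid sq_Y sq\<G>[OF U_\<G>]])

definition coef :: "'x \<Rightarrow> nat \<Rightarrow> real \<times> (real ^ 'r) \<Rightarrow> real" where
  "coef e k = (SOME a. \<forall>j\<in>grid k. ip (\<lambda>\<omega>. U e \<omega> - (\<Sum>j\<in>grid k. a j * Y j \<omega>)) (Y j) = 0)"

text \<open>The least squares estimate of \<open>U e\<close> from the observations on the grid.\<close>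

definition p :: "'x \<Rightarrow> nat \<Rightarrow> 'w \<Rightarrow> real" where
  "p e k = (\<lambda>\<omega>. \<Sum>j\<in>grid k. coef e k j * Y j \<omega>)"

lemma p_orth: "j \<in> grid k \<Longrightarrow> ip (\<lambda>\<omega>. U e \<omega> - p e k \<omega>) (Y j) = 0"
  using someI_ex[OF projection_coefficients[of k e]] unfolding p_def coef_def by blast

lemma p_\<G>: "p e k \<in> \<G>"
  unfolding p_def by (intro \<G>_sum Y_\<G> grid_le)

lemma Up_\<G>: "(\<lambda>\<omega>. U e \<omega> - p e k \<omega>) \<in> \<G>"
  using lincomb[OF U_\<G>[of e] p_\<G>[of e k], of 1 "- 1"] by simp

lemmas sq_p = sq\<G>[OF p_\<G>] and sq_U = sq\<G>[OF U_\<G>] and sq_Up = sq\<G>[OF Up_\<G>]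

lemma Up_mean: "expectation (\<lambda>\<omega>. U e \<omega> - p e k \<omega>) = 0"
  using p_orth[of "(- 1, 0)" k e] by (simp add: ip_def Y_const grid_def)

lemma orth_p:
  assumes "sq Z" "\<And>j. j \<in> grid k \<Longrightarrow> ip Z (Y j) = 0"
  shows "ip Z (p e k) = 0"
  unfolding p_def using assms sq_Y by (subst ip_lincomb_right) auto

lemma grid_mono_le: "k \<le> l \<Longrightarrow> grid k \<subseteq> grid l"
  using grid_mono by (rule lift_Suc_mono_le)

lemma Up_orth_p: "k \<le> l \<Longrightarrow> ip (\<lambda>\<omega>. U e \<omega> - p e l \<omega>) (p e k) = 0"
  using grid_mono_le by (intro orth_p sq_Up p_orth) blast

text \<open>Pythagoras for the errors of nested projections.\<close>

lemma ip_increment: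
  assumes "k \<le> l"
  shows "ip (\<lambda>\<omega>. p e l \<omega> - p e k \<omega>) (\<lambda>\<omega>. p e l \<omega> - p e k \<omega>) =
    ip (\<lambda>\<omega>. U e \<omega> - p e k \<omega>) (\<lambda>\<omega>. U e \<omega> - p e k \<omega>) - ip (\<lambda>\<omega>. U e \<omega> - p e l \<omega>) (\<lambda>\<omega>. U e \<omega> - p e l \<omega>)"
proof -
  let ?a = "\<lambda>\<omega>. U e \<omega> - p e l \<omega>" and ?b = "\<lambda>\<omega>. p e l \<omega> - p e k \<omega>"
  have sb: "sq ?b" using sq_p sq_p by (rule sq_diff)
  have ab: "ip ?a ?b = 0"
    using Up_orth_p[OF assms, of e] Up_orth_p[of l l e] by (simp add: ip_diff_right sq_p sq_Up)
  have "(\<lambda>\<omega>. U e \<omega> - p e k \<omega>) = (\<lambda>\<omega>. ?a \<omega> + ?b \<omega>)" by simp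
  then have "ip (\<lambda>\<omega>. U e \<omega> - p e k \<omega>) (\<lambda>\<omega>. U e \<omega> - p e k \<omega>) = ip (\<lambda>\<omega>. ?a \<omega> + ?b \<omega>) (\<lambda>\<omega>. ?a \<omega> + ?b \<omega>)" by simp
  also have "\<dots> = ip (\<lambda>\<omega>. ?a \<omega> + ?b \<omega>) ?a + ip (\<lambda>\<omega>. ?a \<omega> + ?b \<omega>) ?b"
    by (rule ip_add_right[OF sq_Up sb sq_add[OF sq_Up sb]])
  also have "\<dots> = (ip ?a ?a + ip ?b ?a) + (ip ?a ?b + ip ?b ?b)"
    by (simp only: ip_add_left[OF sq_Up sb sq_Up] ip_add_left[OF sq_Up sb sb])
  finally show ?thesis using ab ip_commute[of ?b ?a] by simp
qed

end

lemma one_plus_double_pos: "\<bar>a\<bar> < 1 / 2 \<Longrightarrow> 0 < 1 + 2 * (a :: real)"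
  by linarith

context observation_problem
begin

definition ex :: real where "ex = expectation (\<lambda>\<omega>. (norm (neg_gen_power S \<eta> (x \<omega>)))\<^sup>2)"

definition lam :: real where "lam = min_eig R"

text \<open>The bracket of the constant of the estimate.\<close>

definition Kc :: real where
  "Kc = M_init c \<nu> \<eta> + (c (1 - \<eta> + \<nu>))\<^sup>2 / 2 powr (4 - 2 * (\<eta> - \<nu>)) * ((2 - 2 * (\<eta> - \<nu>)) / (1 - 2 * (\<eta> - \<nu>)))"

lemma lam: "0 < lam" "lam * (norm v)\<^sup>2 \<le> RR v v"
  unfolding lam_def by (rule min_eig_coercive[OF pd])+

lemma Kc_nonneg: "0 \<le> Kc"
  using d by (auto simp: Kc_def M_init_def)

lemma integrable_x_power: "integrable M (\<lambda>\<omega>. (norm (neg_gen_power S \<eta> (x \<omega>)))\<^sup>2)"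
proof -
  obtain f where f: "\<And>k. bounded_linear (f k)"
    "\<And>u. u \<in> neg_gen_dom S \<eta> \<Longrightarrow> (\<lambda>k :: nat. f k u) \<longlonglongrightarrow> neg_gen_power S \<eta> u"
    using neg_power_approximation[of \<eta>] by blast
  show ?thesis
  proof (rule limit_of_images[OF f(1)])
    show "(\<lambda>\<omega>. neg_gen_power S \<eta> (x \<omega>)) \<in> borel_measurable M"
      by (rule measurable_compose[OF x_measurable neg_power_measurable])
    show "AE \<omega> in M. (\<lambda>k. f k (x \<omega>)) \<longlonglongrightarrow> neg_gen_power S \<eta> (x \<omega>)"
      using x_dom by eventually_elim (rule f(2))
  qed
qed

lemma ex_nonneg: "0 \<le> ex"
  unfolding ex_def by (intro Bochner_Integration.integral_nonneg) simp

text \<open>Half a grid interval, the step of the refined grid.\<close>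

definition hk :: "nat \<Rightarrow> real" where "hk k = T / (2 * real (N k))"

abbreviation lk :: "nat \<Rightarrow> nat \<Rightarrow> real" where "lk k i \<equiv> 2 * real i * hk k"

lemma hk_pos: "0 < hk k"
  using T N_pos[of k] by (simp add: hk_def)

lemma lk_time: "lk k i = time k i" "lk k i + hk k = time (Suc k) (Suc (2 * i))" "lk k i + 2 * hk k = time k (Suc i)"
  using N_pos[of k] by (auto simp: hk_def time_def N_Suc field_simps)

definition diff_I :: "nat \<Rightarrow> nat \<Rightarrow> 'x \<Rightarrow> 'x" where
  "diff_I k i \<xi> = 2 *\<^sub>R I (lk k i + hk k) \<xi> - I (lk k i) \<xi> - I (lk k i + 2 * hk k) \<xi>"

text \<open>The signal part of the innovations of the refined grid.\<close>

lemma signal_bound: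
  assumes \<xi>: "\<xi> \<in> neg_gen_dom S \<eta>"
  shows "(\<Sum>i<N k. (norm (C (diff_I k i \<xi>)))\<^sup>2) \<le>
    normC\<^sup>2 * (4 * (norm (neg_gen_power S \<eta> \<xi>))\<^sup>2 * Kc * hk k powr (2 + 2 * \<delta>))"
proof -
  let ?\<zeta> = "neg_gen_power S \<eta> \<xi>" and ?h = "hk k"
  define b where "b i = norm (P (1 + \<delta>) (diff2 (lk k i) ?h ?\<zeta>))" for i
  have d1: "\<bar>\<delta>\<bar> < 1" using d by simp
  have l0: "0 \<le> lk k i" for i using hk_pos[of k] by simp
  have lT: "lk k i + 2 * ?h \<le> T" if "i < N k" for i
    unfolding lk_time(3) using time_bounds[of "Suc i" k] that by simp
  have C_le: "norm (C (diff_I k i \<xi>)) \<le> normC * b i" for i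
  proof -
    have eq: "diff_I k i \<xi> = P 1 (diff2 (lk k i) ?h \<xi>)"
      unfolding diff_I_def I_def by (rule diff2_integral[OF l0]) (use hk_pos[of k] in simp)
    note nd = neg_power_diff2[OF l0 less_imp_le[OF hk_pos] d1 \<xi>, of i k]
    show ?thesis unfolding eq b_def using norm_C[OF nd(1)] by (simp only: nd(2))
  qed
  have "(\<Sum>i<N k. (norm (C (diff_I k i \<xi>)))\<^sup>2) \<le> (\<Sum>i<N k. normC\<^sup>2 * (b i)\<^sup>2)"
    by (intro sum_mono) (simp only: power_mult_distrib[symmetric], intro power_mono C_le norm_ge_zero)
  also have "\<dots> = normC\<^sup>2 * (\<Sum>i<N k. (b i)\<^sup>2)" by (simp add: sum_distrib_left)
  also have "\<dots> \<le> normC\<^sup>2 * (4 * (norm ?\<zeta>)\<^sup>2 * Kc * ?h powr (2 + 2 * \<delta>))"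
    unfolding Kc_def
  proof (intro mult_left_mono sum_diff2_bound)
    show "\<bar>\<delta>\<bar> < 1 / 2" by (rule d)
    show "b i \<le> c (1 - \<delta>) * norm ?\<zeta> * (2 * real i * ?h) powr (\<delta> - 1) * ?h\<^sup>2" if "0 < i" "i < N k" for i
      unfolding b_def using that hk_pos[of k] lT by (intro norm_diff2_regular) auto
    show "b 0 \<le> c (- \<delta>) * norm ?\<zeta> * (2 * ?h) powr (1 + \<delta>) / (1 + \<delta>)" if "\<delta> \<le> 0"
      unfolding b_def using norm_diff2_singular_nonpos[OF that hk_pos, of k ?\<zeta>] lT[of 0] N_pos[of k] by simp
    show "b 0 \<le> c (1 - \<delta>) * norm ?\<zeta> * ((2 * ?h) powr (1 + \<delta>) - 2 * ?h powr (1 + \<delta>)) / (\<delta> * (1 + \<delta>))" if "0 < \<delta>"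
      unfolding b_def using norm_diff2_singular_pos[OF that hk_pos, of k ?\<zeta>] lT[of 0] N_pos[of k] by simp
  qed (auto simp: hk_pos N_pos b_def)
  finally show ?thesis .
qed

definition sig :: "nat \<Rightarrow> nat \<times> (real ^ 'r) \<Rightarrow> 'w \<Rightarrow> real" where
  "sig k q \<omega> = snd q \<bullet> C (diff_I k (fst q) (x \<omega>))"

definition noi :: "nat \<Rightarrow> nat \<times> (real ^ 'r) \<Rightarrow> 'w \<Rightarrow> real" where
  "noi k q = noise (lk k (fst q)) (hk k) (snd q)"

lemma lk_range:
  assumes "i < N k"
  shows "lk k i \<in> {0..T}" "lk k i + hk k \<in> {0..T}" "lk k i + 2 * hk k \<in> {0..T}"
proof -
  show "lk k i \<in> {0..T}" unfolding lk_time(1) using time_bounds[of i k] assms by simp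
  show "lk k i + hk k \<in> {0..T}" unfolding lk_time(2) using time_bounds[of "Suc (2 * i)" "Suc k"] assms by (simp add: N_Suc)
  show "lk k i + 2 * hk k \<in> {0..T}" unfolding lk_time(3) using time_bounds[of "Suc i" k] assms by simp
qed

lemma C_diff_I:
  assumes "i < N k"
  shows "C (diff_I k i \<xi>) = 2 *\<^sub>R C (I (lk k i + hk k) \<xi>) - C (I (lk k i) \<xi>) - C (I (lk k i + 2 * hk k) \<xi>)"
proof -
  have dom: "I (lk k i) \<xi> \<in> gen_dom S" "I (lk k i + hk k) \<xi> \<in> gen_dom S" "I (lk k i + 2 * hk k) \<xi> \<in> gen_dom S"
    using lk_range[OF assms] by (auto intro!: I_dom)
  have "2 *\<^sub>R I (lk k i + hk k) \<xi> \<in> gen_dom S" using gen_scaleR[OF dom(2), of 2] by blast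
  moreover from this have "2 *\<^sub>R I (lk k i + hk k) \<xi> - I (lk k i) \<xi> \<in> gen_dom S"
    using gen_diff[OF _ dom(1)] by blast
  ultimately show ?thesis using dom unfolding diff_I_def by (simp add: C_diff C_scaleR)
qed

lemma bounded_linear_sig:
  assumes "q \<in> {..<N k} \<times> Basis"
  shows "bounded_linear (\<lambda>\<xi>. snd q \<bullet> C (diff_I k (fst q) \<xi>))"
proof -
  have i: "fst q < N k" using assms by auto
  note r = lk_range[OF i]
  show ?thesis
    unfolding C_diff_I[OF i]
    by (intro bounded_linear_compose[OF bounded_linear_inner_right] bounded_linear_sub
        bounded_linear_compose[OF bounded_linear_scaleR_right] bounded_linear_CI r)
qed

lemma sq_functional: "bounded_linear \<phi> \<Longrightarrow> sq (\<lambda>\<omega>. \<phi> (x \<omega>))"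
  by (rule sq\<G>[OF \<G>_functional])

lemma sq_sig: "q \<in> {..<N k} \<times> Basis \<Longrightarrow> sq (sig k q)"
  unfolding sig_def[abs_def] by (rule sq_functional[OF bounded_linear_sig])

lemma sq_noi: "sq (noi k q)"
  unfolding noi_def using hk_pos[of k] by (intro sq_noise) auto

lemma ip_noi_functional:
  assumes \<phi>: "bounded_linear \<phi>"
  shows "ip (noi k q) (\<lambda>\<omega>. \<phi> (x \<omega>)) = 0"
proof -
  have h: "0 \<le> lk k (fst q)" "0 \<le> hk k" using hk_pos[of k] by auto
  have s: "sq (\<lambda>\<omega>. \<phi> (x \<omega>))" by (rule sq_functional[OF \<phi>])
  have 0: "ip (wf b t) (\<lambda>\<omega>. \<phi> (x \<omega>)) = 0" if "0 \<le> t" for b t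
    using ip_functional_wf[OF \<phi> that] by (simp add: ip_commute)
  show ?thesis
    unfolding noi_def noise_def[abs_def]
    using h s by (simp add: ip_diff_left ip_cmult_left sq_diff sq_cmult wf_facts 0)
qed

lemma ip_noi_Y:
  assumes "j \<in> grid k" "q \<in> {..<N k} \<times> Basis"
  shows "ip (noi k q) (Y j) = 0"
proof (cases "fst j < 0")
  case True
  have "expectation (noi k q) = 0"
    unfolding noi_def noise_def using hk_pos[of k] wf_facts[of "lk k (fst q)"] wf_facts[of "lk k (fst q) + hk k"]
      wf_facts[of "lk k (fst q) + 2 * hk k"]
    by (simp add: Bochner_Integration.integral_diff sq_integrable)
  then show ?thesis using True by (cases j) (simp add: Y_const ip_def)
next
  case False
  then obtain i b where j: "j = (time k i, b)" "i \<le> N k" using assms(1) by (auto simp: grid_def)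
  have t: "time k i \<in> {0..T}" using time_bounds[OF j(2)] by simp
  have s: "sq (\<lambda>\<omega>. b \<bullet> C (I (time k i) (x \<omega>)))" by (rule sq_functional[OF bounded_linear_obs[OF t]])
  have "i \<le> fst q \<or> Suc (fst q) \<le> i" by linarith
  then have "time k i \<le> time k (fst q) \<or> time k (Suc (fst q)) \<le> time k i"
    unfolding time_def using T by (auto intro!: divide_right_mono mult_right_mono)
  then have out: "time k i \<le> lk k (fst q) \<or> lk k (fst q) + 2 * hk k \<le> time k i"
    unfolding lk_time(3) unfolding lk_time(1) .
  have "ip (noi k q) (wf b (time k i)) = 0"
    unfolding noi_def by (rule ip_noise_wf_outside[OF _ _ _ out]) (use hk_pos[of k] t in auto)
  moreover have "ip (noi k q) (\<lambda>\<omega>. b \<bullet> C (I (time k i) (x \<omega>))) = 0"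
    by (rule ip_noi_functional[OF bounded_linear_obs[OF t]])
  ultimately show ?thesis
    using t s by (simp add: j Y_obs ip_add_right sq_noi wf_facts)
qed

lemma innovation_eq:
  assumes "i < N k"
  shows "(\<lambda>\<omega>. sig k (i, b) \<omega> + noi k (i, b) \<omega>) =
    (\<lambda>\<omega>. 2 * Y (time (Suc k) (Suc (2 * i)), b) \<omega> - Y (time k i, b) \<omega> - Y (time k (Suc i), b) \<omega>)"
proof -
  note r = lk_range[OF assms]
  have Y: "Y (time (Suc k) (Suc (2 * i)), b) = (\<lambda>\<omega>. b \<bullet> C (I (lk k i + hk k) (x \<omega>)) + wf b (lk k i + hk k) \<omega>)"
    "Y (time k i, b) = (\<lambda>\<omega>. b \<bullet> C (I (lk k i) (x \<omega>)) + wf b (lk k i) \<omega>)"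
    "Y (time k (Suc i), b) = (\<lambda>\<omega>. b \<bullet> C (I (lk k i + 2 * hk k) (x \<omega>)) + wf b (lk k i + 2 * hk k) \<omega>)"
  proof -
    have r': "0 \<le> lk k i" "0 \<le> lk k i + hk k" "0 \<le> lk k i + 2 * hk k" using r by auto
    show "Y (time (Suc k) (Suc (2 * i)), b) = (\<lambda>\<omega>. b \<bullet> C (I (lk k i + hk k) (x \<omega>)) + wf b (lk k i + hk k) \<omega>)"
      unfolding lk_time(2)[symmetric] by (rule Y_obs[OF r'(2)])
    show "Y (time k i, b) = (\<lambda>\<omega>. b \<bullet> C (I (lk k i) (x \<omega>)) + wf b (lk k i) \<omega>)"
      unfolding lk_time(1)[symmetric] by (rule Y_obs[OF r'(1)])
    show "Y (time k (Suc i), b) = (\<lambda>\<omega>. b \<bullet> C (I (lk k i + 2 * hk k) (x \<omega>)) + wf b (lk k i + 2 * hk k) \<omega>)"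
      unfolding lk_time(3)[symmetric] by (rule Y_obs[OF r'(3)])
  qed
  show ?thesis
    unfolding Y by (simp add: fun_eq_iff sig_def noi_def C_diff_I[OF assms] noise_def inner_diff_right)
qed

text \<open>The midpoint combinations together with the old observations span the same space as the
  observations on the refined grid, and the error before the refinement is at most the error on the first grid.\<close>

lemma increment_bound:
  "ip (\<lambda>\<omega>. p e (Suc k) \<omega> - p e k \<omega>) (\<lambda>\<omega>. p e (Suc k) \<omega> - p e k \<omega>) \<le>
    ip (\<lambda>\<omega>. U e \<omega> - p e 0 \<omega>) (\<lambda>\<omega>. U e \<omega> - p e 0 \<omega>) * (2 * normC\<^sup>2 * ex * Kc / lam) * hk k powr (1 + 2 * \<delta>)"
proof -
  let ?K = "{..<N k} \<times> (Basis :: (real ^ 'r) set)"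
  have in_grid: "(time k i, b) \<in> grid k" if "i \<le> N k" "b \<in> Basis" for i b
    using that by (auto simp: grid_def)
  have in_grid': "(time (Suc k) i, b) \<in> grid (Suc k)" if "i \<le> 2 * N k" "b \<in> Basis" for i b
    using that by (auto simp: grid_def N_Suc)
  \<comment> \<open>The innovation is the observation at the midpoint, up to old observations and the factor \<open>2\<close>.\<close>
  have innov: "ip Z (\<lambda>\<omega>. sig k (i, b) \<omega> + noi k (i, b) \<omega>) =
      2 * ip Z (Y (time (Suc k) (Suc (2 * i)), b)) - ip Z (Y (time k i, b)) - ip Z (Y (time k (Suc i), b))"
    if Z: "sq Z" and i: "i < N k" and b: "b \<in> Basis" for Z i b
  proof -
    have "sq (Y (time (Suc k) (Suc (2 * i)), b))" "sq (Y (time k i, b))" "sq (Y (time k (Suc i), b))"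
      using i b by (auto intro!: sq_Y in_grid in_grid')
    then show ?thesis using Z by (simp add: innovation_eq[OF i] ip_diff_right ip_cmult_right sq_diff sq_cmult)
  qed
  have coercive: "2 * hk k * lam * (\<Sum>q\<in>?K. (a q)\<^sup>2) \<le>
      ip (\<lambda>\<omega>. \<Sum>q\<in>?K. a q * noi k q \<omega>) (\<lambda>\<omega>. \<Sum>q\<in>?K. a q * noi k q \<omega>)" for a
    unfolding noi_def by (rule noise_coercive[OF less_imp_le[OF hk_pos] lam(2)])
  have "ip (\<lambda>\<omega>. p e (Suc k) \<omega> - p e k \<omega>) (\<lambda>\<omega>. p e (Suc k) \<omega> - p e k \<omega>) \<le>
      ip (\<lambda>\<omega>. U e \<omega> - p e k \<omega>) (\<lambda>\<omega>. U e \<omega> - p e k \<omega>) * (\<Sum>q\<in>?K. ip (sig k q) (sig k q)) / (2 * hk k * lam)"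
  proof (rule projection_increment[where F = "grid k" and F' = "grid (Suc k)" and Y = Y and v = "noi k" and b = "coef e k" and b' = "coef e (Suc k)"])
    show "ip (noi k q) (Y j) = 0" if "q \<in> ?K" "j \<in> grid k" for q j using ip_noi_Y that by blast
    show "ip (noi k q) (U e) = 0" for q
      unfolding U_def[abs_def] by (rule ip_noi_functional[OF bounded_linear_U])
    show "ip (noi k q) (sig k q') = 0" if "q' \<in> ?K" for q q'
      unfolding sig_def[abs_def] by (rule ip_noi_functional[OF bounded_linear_sig[OF that]])
    show "ip Z (Y j) = 0"
      if Z: "sq Z" "\<And>j. j \<in> grid k \<Longrightarrow> ip Z (Y j) = 0"
        "\<And>q. q \<in> ?K \<Longrightarrow> ip Z (\<lambda>\<omega>. sig k q \<omega> + noi k q \<omega>) = 0" and j: "j \<in> grid (Suc k)" for Z j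
    proof (cases "j = (- 1, 0)")
      case True
      then show ?thesis using Z(2) by (simp add: grid_def)
    next
      case False
      then obtain l b where l: "j = (time (Suc k) l, b)" "l \<le> 2 * N k" "b \<in> Basis"
        using j by (auto simp: grid_def N_Suc)
      show ?thesis
      proof (cases "even l")
        case True
        then obtain i where "l = 2 * i" by blast
        then have "j = (time k i, b)" "i \<le> N k" using l(1,2) time_refine[of k i] by auto
        then show ?thesis using Z(2) in_grid l(3) by simp
      next
        case False
        then obtain i where i: "l = Suc (2 * i)" by (auto elim!: oddE)
        then have iN: "i < N k" using l(2) by simp
        show ?thesis
          using innov[OF Z(1) iN l(3)] Z(3)[of "(i, b)"] Z(2)[OF in_grid[of i b]] Z(2)[OF in_grid[of "Suc i" b]] iN l
          by (simp add: i)
      qed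
    qed
    show "ip Z (\<lambda>\<omega>. sig k q \<omega> + noi k q \<omega>) = 0"
      if Z: "sq Z" "\<And>j. j \<in> grid (Suc k) \<Longrightarrow> ip Z (Y j) = 0" and q: "q \<in> ?K" for Z q
    proof -
      obtain i b where ib: "q = (i, b)" "i < N k" "b \<in> Basis" using q by auto
      show ?thesis
        using innov[OF Z(1) ib(2,3)] Z(2)[OF in_grid'[of "Suc (2 * i)" b]] ib
          Z(2)[OF subsetD[OF grid_mono in_grid[of i b]]] Z(2)[OF subsetD[OF grid_mono in_grid[of "Suc i" b]]]
        by simp
    qed
    show "0 < 2 * hk k * lam" using hk_pos lam(1) by simp
    show "p e k = (\<lambda>\<omega>. \<Sum>j\<in>grid k. coef e k j * Y j \<omega>)"
      "p e (Suc k) = (\<lambda>\<omega>. \<Sum>j\<in>grid (Suc k). coef e (Suc k) j * Y j \<omega>)" by (rule p_def)+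
  qed (simp_all add: finite_grid sq_Y grid_mono sq_sig sq_noi sq_U coercive p_orth)
  also have "(\<Sum>q\<in>?K. ip (sig k q) (sig k q)) \<le> normC\<^sup>2 * (4 * ex * Kc * hk k powr (2 + 2 * \<delta>))"
  proof -
    have int: "integrable M (\<lambda>\<omega>. (sig k q \<omega>)\<^sup>2)" if "q \<in> ?K" for q
      using sq_sig[OF that] by (simp add: sq_def)
    have "(\<Sum>q\<in>?K. ip (sig k q) (sig k q)) = expectation (\<lambda>\<omega>. \<Sum>q\<in>?K. (sig k q \<omega>)\<^sup>2)"
      unfolding ip_self by (rule Bochner_Integration.integral_sum[symmetric, OF int])
    also have "\<dots> \<le> expectation (\<lambda>\<omega>. normC\<^sup>2 * (4 * (norm (neg_gen_power S \<eta> (x \<omega>)))\<^sup>2 * Kc * hk k powr (2 + 2 * \<delta>)))"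
    proof (rule integral_mono_AE)
      show "AE \<omega> in M. (\<Sum>q\<in>?K. (sig k q \<omega>)\<^sup>2) \<le>
          normC\<^sup>2 * (4 * (norm (neg_gen_power S \<eta> (x \<omega>)))\<^sup>2 * Kc * hk k powr (2 + 2 * \<delta>))"
        using x_dom
      proof eventually_elim
        case (elim \<omega>)
        have "(\<Sum>q\<in>?K. (sig k q \<omega>)\<^sup>2) = (\<Sum>i<N k. \<Sum>b\<in>Basis. (b \<bullet> C (diff_I k i (x \<omega>)))\<^sup>2)"
          by (simp add: sum.cartesian_product sig_def case_prod_unfold)
        also have "\<dots> = (\<Sum>i<N k. (norm (C (diff_I k i (x \<omega>))))\<^sup>2)"
          unfolding power2_norm_eq_inner
          by (subst (2) euclidean_inner) (simp add: power2_eq_square inner_commute)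
        also have "\<dots> \<le> normC\<^sup>2 * (4 * (norm (neg_gen_power S \<eta> (x \<omega>)))\<^sup>2 * Kc * hk k powr (2 + 2 * \<delta>))"
          by (rule signal_bound[OF elim])
        finally show ?case .
      qed
      show "integrable M (\<lambda>\<omega>. \<Sum>q\<in>?K. (sig k q \<omega>)\<^sup>2)" by (rule Bochner_Integration.integrable_sum[OF int])
    qed (intro integrable_mult_right integrable_mult_left integrable_x_power)
    also have "\<dots> = normC\<^sup>2 * (4 * ex * Kc * hk k powr (2 + 2 * \<delta>))" by (simp add: ex_def)
    finally show ?thesis .
  qed
  finally have 1: "ip (\<lambda>\<omega>. p e (Suc k) \<omega> - p e k \<omega>) (\<lambda>\<omega>. p e (Suc k) \<omega> - p e k \<omega>) \<le>
      ip (\<lambda>\<omega>. U e \<omega> - p e k \<omega>) (\<lambda>\<omega>. U e \<omega> - p e k \<omega>) * (normC\<^sup>2 * (4 * ex * Kc * hk k powr (2 + 2 * \<delta>))) / (2 * hk k * lam)"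
    using hk_pos[of k] lam(1) by (auto simp: mult_left_mono divide_right_mono)
  have "hk k powr (2 + 2 * \<delta>) = hk k powr 1 * hk k powr (1 + 2 * \<delta>)"
    by (simp only: powr_add[symmetric]) (simp add: algebra_simps)
  also have "hk k powr 1 = hk k" using hk_pos[of k] by simp
  finally have h: "hk k powr (2 + 2 * \<delta>) = hk k * hk k powr (1 + 2 * \<delta>)" .
  have 2: "ip (\<lambda>\<omega>. U e \<omega> - p e k \<omega>) (\<lambda>\<omega>. U e \<omega> - p e k \<omega>) * (normC\<^sup>2 * (4 * ex * Kc * hk k powr (2 + 2 * \<delta>))) / (2 * hk k * lam) =
      ip (\<lambda>\<omega>. U e \<omega> - p e k \<omega>) (\<lambda>\<omega>. U e \<omega> - p e k \<omega>) * (2 * normC\<^sup>2 * ex * Kc / lam * hk k powr (1 + 2 * \<delta>))"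
    unfolding h using hk_pos[of k] lam(1) by (simp add: field_simps)
  have "ip (\<lambda>\<omega>. U e \<omega> - p e k \<omega>) (\<lambda>\<omega>. U e \<omega> - p e k \<omega>) \<le> ip (\<lambda>\<omega>. U e \<omega> - p e 0 \<omega>) (\<lambda>\<omega>. U e \<omega> - p e 0 \<omega>)"
    using ip_increment[of 0 k e] ip_self_nonneg[of "\<lambda>\<omega>. p e k \<omega> - p e 0 \<omega>"] by linarith
  from order_trans[OF 1[unfolded 2] mult_right_mono[OF this]] show ?thesis
    using ex_nonneg Kc_nonneg lam(1) by (simp add: mult.assoc)
qed

text \<open>Halving the step multiplies the bound of the increment by \<open>2\<^sup>-\<^sup>(\<^sup>1\<^sup>+\<^sup>2\<^sup>d\<^sup>)\<close>; the increments
  are orthogonal, so that their squares add up to a geometric series.\<close>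

definition pw :: real where "pw = 1 + 2 * \<delta>"

definition ratio :: real where "ratio = 2 powr (- pw)"

text \<open>The ratio between the bound and the mean square error of the discrete estimate.\<close>

definition factor :: real where
  "factor = 2 * normC\<^sup>2 * ex * Kc / lam * (T / real n) powr pw / (2 powr pw - 1)"

definition err :: "'x \<Rightarrow> real" where
  "err e = ip (\<lambda>\<omega>. U e \<omega> - p e 0 \<omega>) (\<lambda>\<omega>. U e \<omega> - p e 0 \<omega>)"

lemma pw_pos: "0 < pw"
  unfolding pw_def by (rule one_plus_double_pos[OF d])

lemma two_pw: "1 < 2 powr pw" using pw_pos by simp

lemma ratio: "0 < ratio" "ratio < 1" "ratio = 1 / 2 powr pw"
  using two_pw by (auto simp: ratio_def powr_minus_divide)

lemma factor_nonneg: "0 \<le> factor"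
  unfolding factor_def using ex_nonneg Kc_nonneg lam(1) two_pw by simp

lemma err_nonneg: "0 \<le> err e"
  by (simp add: err_def)

lemma hk_powr: "hk k powr pw = (T / real n) powr pw * ratio ^ Suc k"
proof -
  have "hk k = (T / real n) * (1 / 2) ^ Suc k" by (simp add: hk_def N_def power_one_over field_simps)
  then have "hk k powr pw = ((T / real n) * (1 / 2) ^ Suc k) powr pw" by (simp only:)
  also have "\<dots> = (T / real n) powr pw * ((1 / 2) ^ Suc k) powr pw"
    using T by (simp add: powr_mult del: power_Suc times_divide_eq_left)
  also have "((1 / 2 :: real) ^ Suc k) powr pw = ((1 / 2) powr pw) ^ Suc k"
    by (simp add: powr_realpow[symmetric] powr_powr mult.commute del: power_Suc)
  also have "(1 / 2 :: real) powr pw = ratio" by (simp add: ratio(3) powr_divide)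
  finally show ?thesis .
qed

lemma increments_bound:
  "k \<le> j \<Longrightarrow> ip (\<lambda>\<omega>. p e j \<omega> - p e k \<omega>) (\<lambda>\<omega>. p e j \<omega> - p e k \<omega>) \<le> err e * factor * (ratio ^ k - ratio ^ j)"
proof (induction j rule: dec_induct)
  case base
  then show ?case by (simp add: ip_def)
next
  case (step j)
  have split: "ip (\<lambda>\<omega>. p e (Suc j) \<omega> - p e k \<omega>) (\<lambda>\<omega>. p e (Suc j) \<omega> - p e k \<omega>) =
      ip (\<lambda>\<omega>. p e j \<omega> - p e k \<omega>) (\<lambda>\<omega>. p e j \<omega> - p e k \<omega>) +
      ip (\<lambda>\<omega>. p e (Suc j) \<omega> - p e j \<omega>) (\<lambda>\<omega>. p e (Suc j) \<omega> - p e j \<omega>)"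
    using ip_increment[of k "Suc j" e] ip_increment[of k j e] ip_increment[of j "Suc j" e] step.hyps by simp

  have rj: "ratio ^ Suc j = (ratio ^ j - ratio ^ Suc j) / (2 powr pw - 1)"
    using two_pw pw_pos by (simp add: ratio(3) field_simps)
  have "ip (\<lambda>\<omega>. p e (Suc j) \<omega> - p e j \<omega>) (\<lambda>\<omega>. p e (Suc j) \<omega> - p e j \<omega>) \<le>
      err e * (2 * normC\<^sup>2 * ex * Kc / lam) * ((T / real n) powr pw * ratio ^ Suc j)"
    using increment_bound[of e j] unfolding err_def pw_def[symmetric] hk_powr by simp
  also have "\<dots> = err e * factor * (ratio ^ j - ratio ^ Suc j)"
    unfolding factor_def by (subst rj) (simp add: mult_ac)
  finally show ?case using step.IH split by (simp add: algebra_simps)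
qed

definition est :: "'x \<Rightarrow> 'w \<Rightarrow> real" where "est e = (\<lambda>\<omega>. lim (\<lambda>k. p e k \<omega>))"

lemma sq_est: "sq (est e)"
  and est_error: "ip (\<lambda>\<omega>. est e \<omega> - p e k \<omega>) (\<lambda>\<omega>. est e \<omega> - p e k \<omega>) \<le> err e * factor * ratio ^ k"
proof -
  have "ip (\<lambda>\<omega>. p e j \<omega> - p e k \<omega>) (\<lambda>\<omega>. p e j \<omega> - p e k \<omega>) \<le> err e * factor * ratio ^ k" if "k \<le> j" for k j
  proof -
    have "0 \<le> err e * factor * ratio ^ j" using err_nonneg factor_nonneg ratio(1) by simp
    then show ?thesis using increments_bound[OF that, of e] by (simp add: right_diff_distrib)
  qed
  from geometric_L2_limit[OF sq_p ratio(1,2) this]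
  show "sq (est e)" "ip (\<lambda>\<omega>. est e \<omega> - p e k \<omega>) (\<lambda>\<omega>. est e \<omega> - p e k \<omega>) \<le> err e * factor * ratio ^ k"
    unfolding est_def by blast+
qed

end

section \<open>Identification of the conditional expectations\<close>

context observation_problem
begin

text \<open>The observations are continuous in mean square, so that an error orthogonal to the values on
  a fine grid is almost orthogonal to all of them.\<close>

lemma Y_continuous:
  assumes s: "s \<in> {0..T}" and t: "\<And>k. t k \<in> {0..T}" and lim: "t \<longlonglongrightarrow> s"
  shows "(\<lambda>k. ip (\<lambda>\<omega>. Y (s, b) \<omega> - Y (t k, b) \<omega>) (\<lambda>\<omega>. Y (s, b) \<omega> - Y (t k, b) \<omega>)) \<longlonglongrightarrow> 0"
proof -
  define Ob where "Ob t = (\<lambda>\<omega>. b \<bullet> C (I t (x \<omega>)))" for t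
  define A where "A k = (\<lambda>\<omega>. Ob s \<omega> - Ob (t k) \<omega>)" for k
  define V where "V k = (\<lambda>\<omega>. wf b s \<omega> - wf b (t k) \<omega>)" for k
  have s0: "0 \<le> s" and t0: "\<And>k. 0 \<le> t k" using s t by auto
  have sqOb: "sq (Ob r)" if "r \<in> {0..T}" for r
    unfolding Ob_def by (rule sq_functional[OF bounded_linear_obs[OF that]])
  have sqA: "sq (A k)" for k unfolding A_def using sqOb[OF s] sqOb[OF t] by (rule sq_diff)
  have sqw: "sq (wf b s)" "sq (wf b (t k))" for k using wf_facts(1) s0 t0 by auto
  have sqV: "sq (V k)" for k unfolding V_def using sqw by (rule sq_diff)
  have cross0: "ip (Ob r) (wf b r') = 0" if "r \<in> {0..T}" "0 \<le> r'" for r r'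
    unfolding Ob_def by (rule ip_functional_wf[OF bounded_linear_obs[OF that(1)] that(2)])
  have cross: "ip (A k) (V k) = 0" for k
    unfolding A_def V_def using sqOb[OF s] sqOb[OF t] sqw
    by (simp add: ip_diff_left ip_diff_right sq_diff cross0[OF s s0] cross0[OF s t0] cross0[OF t s0] cross0[OF t t0])
  have split: "ip (\<lambda>\<omega>. Y (s, b) \<omega> - Y (t k, b) \<omega>) (\<lambda>\<omega>. Y (s, b) \<omega> - Y (t k, b) \<omega>) = ip (A k) (A k) + ip (V k) (V k)" for k
  proof -
    have "(\<lambda>\<omega>. Y (s, b) \<omega> - Y (t k, b) \<omega>) = (\<lambda>\<omega>. A k \<omega> + V k \<omega>)"
      by (simp add: fun_eq_iff A_def V_def Ob_def Y_obs s0 t0)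
    then show ?thesis using sqA[of k] sqV[of k] cross[of k] ip_commute[of "V k" "A k"]
      by (simp add: ip_add_left ip_add_right sq_add)
  qed
  have VV: "ip (V k) (V k) = (s + t k - 2 * min s (t k)) * RR b b" for k
    unfolding V_def using sqw s0 t0
    by (simp add: ip_diff_left ip_diff_right sq_diff ip_wf min.commute[of "t k"] algebra_simps)
  have "(\<lambda>k. (s + t k - 2 * min s (t k)) * RR b b) \<longlonglongrightarrow> (s + s - 2 * min s s) * RR b b"
    by (intro tendsto_intros lim)
  then have V0: "(\<lambda>k. ip (V k) (V k)) \<longlonglongrightarrow> 0" unfolding VV by simp
  obtain K where K: "0 \<le> K" "\<And>t \<xi>. t \<in> {0..T} \<Longrightarrow> norm (C (I t \<xi>)) \<le> K * norm \<xi>" using I_bound by blast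
  have Ob_le: "\<bar>Ob r \<omega>\<bar> \<le> norm b * K * norm (x \<omega>)" if "r \<in> {0..T}" for r \<omega>
    using Cauchy_Schwarz_ineq2[of b "C (I r (x \<omega>))"] mult_left_mono[OF K(2)[OF that, of "x \<omega>"], of "norm b"]
    unfolding Ob_def by (simp add: mult.assoc)
  have A0: "(\<lambda>k. ip (A k) (A k)) \<longlonglongrightarrow> expectation (\<lambda>\<omega>. 0)"
    unfolding ip_self
  proof (rule integral_dominated_convergence)
    show "integrable M (\<lambda>\<omega>. (2 * norm b * K * norm (x \<omega>))\<^sup>2)"
      using sq_cmult[OF norm_x(1), of "2 * norm b * K"] by (simp add: sq_def)
    show "(\<lambda>\<omega>. (A k \<omega>)\<^sup>2) \<in> borel_measurable M" for k using sq_measurable[OF sqA] by measurable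
    show "AE \<omega> in M. norm ((A k \<omega>)\<^sup>2) \<le> (2 * norm b * K * norm (x \<omega>))\<^sup>2" for k
    proof (rule AE_I2)
      fix \<omega>
      have "\<bar>A k \<omega>\<bar> \<le> 2 * norm b * K * norm (x \<omega>)"
        using Ob_le[OF s, of \<omega>] Ob_le[OF t, of k \<omega>] unfolding A_def by linarith
      from power_mono[OF this, of 2] show "norm ((A k \<omega>)\<^sup>2) \<le> (2 * norm b * K * norm (x \<omega>))\<^sup>2" by simp
    qed
    show "AE \<omega> in M. (\<lambda>k. (A k \<omega>)\<^sup>2) \<longlonglongrightarrow> 0"
    proof (rule AE_I2)
      fix \<omega>
      have "(\<lambda>k. C (I (t k) (x \<omega>))) \<longlonglongrightarrow> C (I s (x \<omega>))"
        by (rule continuous_on_tendsto_compose[OF continuous_CI lim s]) (rule always_eventually, use t in blast)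
      then have "(\<lambda>k. (A k \<omega>)\<^sup>2) \<longlonglongrightarrow> (b \<bullet> C (I s (x \<omega>)) - b \<bullet> C (I s (x \<omega>)))\<^sup>2"
        unfolding A_def Ob_def by (intro tendsto_intros)
      then show "(\<lambda>k. (A k \<omega>)\<^sup>2) \<longlonglongrightarrow> 0" by simp
    qed
  qed simp
  show ?thesis unfolding split using tendsto_add[OF A0 V0] by simp
qed

lemma grid_dense:
  assumes s: "s \<in> {0..T}"
  shows "\<exists>j. (\<forall>k. j k \<le> N k) \<and> (\<lambda>k. time k (j k)) \<longlonglongrightarrow> s"
proof -
  define j where "j k = nat \<lfloor>s * real (N k) / T\<rfloor>" for k
  have q: "0 \<le> s * real (N k) / T" "s * real (N k) / T \<le> real (N k)" for k
  proof -
    have "s * real (N k) \<le> T * real (N k)" using s by (intro mult_right_mono) auto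
    then show "s * real (N k) / T \<le> real (N k)" using T by (simp add: divide_le_eq mult.commute)
    show "0 \<le> s * real (N k) / T" using s T by simp
  qed
  have j: "real (j k) \<le> s * real (N k) / T" "s * real (N k) / T < real (j k) + 1" for k
    unfolding j_def using q[of k] by (auto simp: of_nat_nat)
  have le: "j k \<le> N k" for k using order_trans[OF j(1) q(2), of k] by simp
  have dist: "\<bar>time k (j k) - s\<bar> \<le> T * (1 / 2) ^ k" for k
  proof -
    have Np: "0 < real (N k)" using N_pos by simp
    have up: "time k (j k) \<le> s" using j(1)[of k] T Np by (simp add: time_def field_simps)
    have "s * real (N k) < (real (j k) + 1) * T" using j(2)[of k] T by (simp add: divide_less_eq)
    then have "s < time k (j k) + T / real (N k)" using Np by (simp add: time_def field_simps)
    moreover have "T / real (N k) \<le> T * (1 / 2) ^ k"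
    proof -
      have "2 ^ k \<le> real (N k)" using n by (simp add: N_def)
      then have "T / real (N k) \<le> T / 2 ^ k"
        by (rule divide_left_mono) (use T N_pos[of k] in simp_all)
      then show ?thesis by (simp add: power_one_over)
    qed
    ultimately show ?thesis using up by simp
  qed
  have "(\<lambda>k. T * (1 / 2) ^ k) \<longlonglongrightarrow> T * 0"
    by (rule tendsto_mult[OF tendsto_const LIMSEQ_power_zero]) simp
  then have "(\<lambda>k. T * (1 / 2) ^ k) \<longlonglongrightarrow> 0" by simp
  from Lim_null_comparison[OF always_eventually this, of "\<lambda>k. time k (j k) - s"]
  have "(\<lambda>k. time k (j k) - s) \<longlonglongrightarrow> 0" using dist by simp
  then have "(\<lambda>k. time k (j k)) \<longlonglongrightarrow> s" by (rule LIM_zero_cancel)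
  then show ?thesis using le by (intro exI[of _ j] conjI allI)
qed

lemma Up_asymptotically_orth:
  assumes s: "s \<in> {0..T}" and b: "b \<in> Basis"
  shows "(\<lambda>k. ip (\<lambda>\<omega>. U e \<omega> - p e k \<omega>) (Y (s, b))) \<longlonglongrightarrow> 0"
proof -
  obtain j where j: "\<And>k. j k \<le> N k" "(\<lambda>k. time k (j k)) \<longlonglongrightarrow> s" using grid_dense[OF s] by blast
  let ?t = "\<lambda>k. time k (j k)" and ?Up = "\<lambda>k \<omega>. U e \<omega> - p e k \<omega>"
  have t: "?t k \<in> {0..T}" for k using time_bounds[OF j(1)] by simp
  have sY: "sq (Y (r, b))" if "r \<in> {0..T}" for r using that by (intro sq\<G> Y_\<G>) simp
  let ?D = "\<lambda>k. ip (\<lambda>\<omega>. Y (s, b) \<omega> - Y (?t k, b) \<omega>) (\<lambda>\<omega>. Y (s, b) \<omega> - Y (?t k, b) \<omega>)"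
  have le: "(ip (?Up k) (Y (s, b)))\<^sup>2 \<le> err e * ?D k" for k
  proof -
    have "(?t k, b) \<in> grid k" using j(1) b by (auto simp: grid_def)
    then have "ip (?Up k) (Y (?t k, b)) = 0" by (rule p_orth)
    then have "ip (?Up k) (Y (s, b)) = ip (?Up k) (\<lambda>\<omega>. Y (s, b) \<omega> - Y (?t k, b) \<omega>)"
      using sY[OF s] sY[OF t] by (simp add: ip_diff_right sq_Up)
    then have "(ip (?Up k) (Y (s, b)))\<^sup>2 \<le> ip (?Up k) (?Up k) * ?D k"
      using ip_Cauchy_Schwarz[OF sq_Up sq_diff[OF sY[OF s] sY[OF t]], of e k k] by simp
    also have "\<dots> \<le> err e * ?D k"
      unfolding err_def using ip_increment[of 0 k e] ip_self_nonneg[of "\<lambda>\<omega>. p e k \<omega> - p e 0 \<omega>"]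
      by (intro mult_right_mono) (linarith | simp)+
    finally show ?thesis .
  qed
  have "(\<lambda>k. err e * ?D k) \<longlonglongrightarrow> err e * 0" by (intro tendsto_mult tendsto_const Y_continuous s t j(2))
  then have "(\<lambda>k. err e * ?D k) \<longlonglongrightarrow> 0" by simp
  from Lim_null_comparison[OF always_eventually this, of "\<lambda>k. (ip (?Up k) (Y (s, b)))\<^sup>2"]
  have "(\<lambda>k. (ip (?Up k) (Y (s, b)))\<^sup>2) \<longlonglongrightarrow> 0" using le by simp
  then show ?thesis by (simp add: power_tendsto_0_iff)
qed

lemma inner_y_eq: "fst j \<in> {0..T} \<Longrightarrow> y (fst j) \<omega> \<bullet> snd j = Y j \<omega>"
  by (simp add: Y_def)

lemma Y_comb_\<G>:
  assumes "F \<subseteq> {0..T} \<times> Basis"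
  shows "(\<lambda>\<omega>. \<Sum>j\<in>F. \<theta> j * Y j \<omega>) \<in> \<G>"
  using assms by (intro \<G>_sum Y_\<G>) auto

lemma ip_Y_comb:
  assumes "F \<subseteq> {0..T} \<times> Basis" "sq Z"
  shows "ip Z (\<lambda>\<omega>. \<Sum>j\<in>F. \<theta> j * Y j \<omega>) = (\<Sum>j\<in>F. \<theta> j * ip Z (Y j))"
  by (rule ip_lincomb_right[OF sq\<G>[OF Y_\<G>] assms(2)]) (use assms(1) in auto)

text \<open>The error of the limit is uncorrelated with all trigonometric functions of the
  observations.\<close>

lemma est_error_trig:
  assumes F: "F \<subseteq> {0..T} \<times> Basis" and g: "g = (cos :: real \<Rightarrow> real) \<or> g = sin"
  shows "expectation (\<lambda>\<omega>. (U e \<omega> - est e \<omega>) * g (\<Sum>j\<in>F. \<theta> j * Y j \<omega>)) = 0"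
proof -
  let ?V = "\<lambda>\<omega>. \<Sum>j\<in>F. \<theta> j * Y j \<omega>" and ?Up = "\<lambda>k \<omega>. U e \<omega> - p e k \<omega>"
  let ?E = "\<lambda>k \<omega>. est e \<omega> - p e k \<omega>"
  let ?G = "\<lambda>\<omega>. g (?V \<omega>)"
  have V: "?V \<in> \<G>" by (rule Y_comb_\<G>[OF F])
  have Vm: "?V \<in> borel_measurable M" by (rule sq_measurable[OF sq\<G>[OF V]])
  have gm: "g \<in> borel_measurable borel" using g by auto
  have Gm: "?G \<in> borel_measurable M" by (rule measurable_compose[OF Vm gm])
  have sqG: "sq ?G" unfolding sq_def
  proof
    show "integrable M (\<lambda>\<omega>. (?G \<omega>)\<^sup>2)"
      by (rule integrable_const_bound[of _ 1]) (use g Gm in \<open>auto simp: abs_square_le_1\<close>)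
  qed (rule Gm)
  have sE: "sq (?E k)" for k using sq_est sq_p by (rule sq_diff)
  have UL: "sq (\<lambda>\<omega>. U e \<omega> - est e \<omega>)" using sq_U sq_est by (rule sq_diff)
  have const: "ip (\<lambda>\<omega>. U e \<omega> - est e \<omega>) ?G = ip (?Up k) ?G - ip (?E k) ?G" for k
  proof -
    have "(\<lambda>\<omega>. U e \<omega> - est e \<omega>) = (\<lambda>\<omega>. ?Up k \<omega> - ?E k \<omega>)" by simp
    then show ?thesis using ip_diff_left[OF sq_Up sE sqG, of e k k] by simp
  qed
  have "(\<lambda>k. \<Sum>j\<in>F. \<theta> j * ip (?Up k) (Y j)) \<longlonglongrightarrow> (\<Sum>j\<in>F. \<theta> j * 0)"
  proof (intro tendsto_sum tendsto_mult tendsto_const)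
    fix j assume "j \<in> F"
    then show "(\<lambda>k. ip (?Up k) (Y j)) \<longlonglongrightarrow> 0"
      using F Up_asymptotically_orth[of "fst j" "snd j" e] by auto
  qed
  then have V0: "(\<lambda>k. ip (?Up k) ?V) \<longlonglongrightarrow> 0" by (simp add: ip_Y_comb[OF F sq_Up])
  have lim1: "(\<lambda>k. ip (?Up k) ?G) \<longlonglongrightarrow> 0"
  proof (rule Lim_null_comparison[OF always_eventually tendsto_rabs_zero[OF V0]], rule allI)
    fix k
    show "norm (ip (?Up k) ?G) \<le> \<bar>ip (?Up k) ?V\<bar>"
      using gaussian_correlation_bound[OF Up_\<G> Up_mean V, of e k] g unfolding ip_def by auto
  qed
  have lim2: "(\<lambda>k. ip (?E k) ?G) \<longlonglongrightarrow> 0"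
  proof -
    have "(ip (?E k) ?G)\<^sup>2 \<le> err e * factor * ratio ^ k * ip ?G ?G" for k
      by (rule order_trans[OF ip_Cauchy_Schwarz[OF sE sqG] mult_right_mono[OF est_error ip_self_nonneg]])
    moreover have "(\<lambda>k. err e * factor * ratio ^ k * ip ?G ?G) \<longlonglongrightarrow> err e * factor * 0 * ip ?G ?G"
      using ratio by (intro tendsto_intros LIMSEQ_power_zero) auto
    ultimately have "(\<lambda>k. (ip (?E k) ?G)\<^sup>2) \<longlonglongrightarrow> 0"
      by (intro Lim_null_comparison[of "\<lambda>k. (ip (?E k) ?G)\<^sup>2" "\<lambda>k. err e * factor * ratio ^ k * ip ?G ?G"]) auto
    then show ?thesis by (simp add: power_tendsto_0_iff)
  qed
  have "(\<lambda>k. ip (?Up k) ?G - ip (?E k) ?G) \<longlonglongrightarrow> 0 - 0" by (rule tendsto_diff[OF lim1 lim2])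
  then have "(\<lambda>k. ip (\<lambda>\<omega>. U e \<omega> - est e \<omega>) ?G) \<longlonglongrightarrow> 0" by (simp add: const[symmetric])
  then show ?thesis unfolding ip_def by (rule LIMSEQ_unique[OF tendsto_const])
qed

lemma est_set_integral:
  assumes A: "A \<in> sets (gen_sigma M {0..T} y)"
  shows "(LINT \<omega>:A|M. U e \<omega> - est e \<omega>) = 0"
proof (rule fourier_unique_sigma[OF _ _ _ _ A])
  show "integrable M (\<lambda>\<omega>. U e \<omega> - est e \<omega>)" by (intro sq_integrable sq_diff sq_U sq_est)
  show "y t \<in> borel_measurable M" if "t \<in> {0..T}" for t by (rule y_measurable[OF that])
  fix F :: "(real \<times> (real ^ 'r)) set" and \<theta> :: "real \<times> (real ^ 'r) \<Rightarrow> real"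
  assume F: "F \<subseteq> {0..T} \<times> Basis"
  have eq: "(\<Sum>j\<in>F. \<theta> j * (y (fst j) \<omega> \<bullet> snd j)) = (\<Sum>j\<in>F. \<theta> j * Y j \<omega>)" for \<omega>
    using F by (intro sum.cong refl arg_cong[where f = "(*) _"] inner_y_eq) auto
  show "expectation (\<lambda>\<omega>. (U e \<omega> - est e \<omega>) * cos (\<Sum>j\<in>F. \<theta> j * (y (fst j) \<omega> \<bullet> snd j))) = 0"
    "expectation (\<lambda>\<omega>. (U e \<omega> - est e \<omega>) * sin (\<Sum>j\<in>F. \<theta> j * (y (fst j) \<omega> \<bullet> snd j))) = 0"
    unfolding eq using est_error_trig[OF F] by auto
qed

abbreviation "times0 \<equiv> (\<lambda>i. real i * T / real n) ` {1..n}"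

lemma times0: "t \<in> times0 \<Longrightarrow> t \<in> time 0 ` {..N 0} \<and> t \<in> {0..T}"
proof -
  assume "t \<in> times0"
  then obtain i where "t = real i * T / real n" "i \<in> {1..n}" by (rule imageE)
  then have "t = time 0 i" "i \<le> N 0" by (simp_all add: time_def N_def)
  then show ?thesis using time_bounds by auto
qed

text \<open>The grid of \<open>p 0\<close> contains all times at which the discrete estimate observes.\<close>

lemma p0_set_integral:
  assumes A: "A \<in> sets (gen_sigma M times0 y)"
  shows "(LINT \<omega>:A|M. U e \<omega> - p e 0 \<omega>) = 0"
proof (rule fourier_unique_sigma[OF _ _ _ _ A])
  show "integrable M (\<lambda>\<omega>. U e \<omega> - p e 0 \<omega>)" by (rule sq_integrable[OF sq_Up])
  show "y t \<in> borel_measurable M" if "t \<in> times0" for t using times0[OF that] by (intro y_measurable) simp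
  fix F :: "(real \<times> (real ^ 'r)) set" and \<theta> :: "real \<times> (real ^ 'r) \<Rightarrow> real"
  assume F: "F \<subseteq> times0 \<times> Basis"
  have F': "F \<subseteq> {0..T} \<times> Basis" "F \<subseteq> grid 0"
    using F times0 unfolding grid_def by blast+
  have eq: "(\<Sum>j\<in>F. \<theta> j * (y (fst j) \<omega> \<bullet> snd j)) = (\<Sum>j\<in>F. \<theta> j * Y j \<omega>)" for \<omega>
    using F'(1) by (intro sum.cong refl arg_cong[where f = "(*) _"] inner_y_eq) auto
  have "ip (\<lambda>\<omega>. U e \<omega> - p e 0 \<omega>) (\<lambda>\<omega>. \<Sum>j\<in>F. \<theta> j * Y j \<omega>) = 0"
    unfolding ip_Y_comb[OF F'(1) sq_Up]
    by (rule sum.neutral) (use subsetD[OF F'(2)] in \<open>simp add: p_orth\<close>)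
  then show "expectation (\<lambda>\<omega>. (U e \<omega> - p e 0 \<omega>) * cos (\<Sum>j\<in>F. \<theta> j * (y (fst j) \<omega> \<bullet> snd j))) = 0"
    "expectation (\<lambda>\<omega>. (U e \<omega> - p e 0 \<omega>) * sin (\<Sum>j\<in>F. \<theta> j * (y (fst j) \<omega> \<bullet> snd j))) = 0"
    unfolding eq using gaussian_correlation_bound[OF Up_\<G> Up_mean Y_comb_\<G>[OF F'(1)], of e 0 \<theta>] by auto
qed

lemma y_0: "AE \<omega> in M. y 0 \<omega> = 0"
proof -
  have "C 0 = 0" using C_scaleR[of 0 0] gen_0 by simp
  from w_0 show ?thesis by eventually_elim (simp add: y_eq I_def \<open>C 0 = 0\<close>)
qed

lemma integrable_z: "integrable M (\<lambda>\<omega>. S T (x \<omega>))" "integrable M (\<lambda>\<omega>. (norm (S T (x \<omega>)))\<^sup>2)"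
proof -
  have m [measurable]: "(\<lambda>\<omega>. S T (x \<omega>)) \<in> borel_measurable M"
    by (rule measurable_compose[OF x_measurable])
       (intro borel_measurable_continuous_onI linear_continuous_on blinfun.bounded_linear_right)
  have le: "norm (S T \<xi>) \<le> norm (S T) * norm \<xi>" for \<xi> by (rule norm_blinfun)
  show "integrable M (\<lambda>\<omega>. S T (x \<omega>))"
  proof (rule Bochner_Integration.integrable_bound)
    show "integrable M (\<lambda>\<omega>. norm (S T) * norm (x \<omega>))" by (intro integrable_mult_right sq_integrable norm_x)
  qed (use m le in auto)
  show "integrable M (\<lambda>\<omega>. (norm (S T (x \<omega>)))\<^sup>2)"
  proof (rule Bochner_Integration.integrable_bound)
    show "integrable M (\<lambda>\<omega>. (norm (S T) * norm (x \<omega>))\<^sup>2)" using sq_cmult[OF norm_x(1)] by (simp add: sq_def)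
    show "AE \<omega> in M. norm ((norm (S T (x \<omega>)))\<^sup>2) \<le> norm ((norm (S T) * norm (x \<omega>))\<^sup>2)"
      using power_mono[OF le norm_ge_zero] by simp
  qed simp
qed

text \<open>A coordinate of a conditional expectation is characterised by its measurability and the
  integrals of the error.\<close>

lemma cond_exp_coordinate:
  assumes F: "sets F \<subseteq> sets M" "space F = space M" and Z: "is_cond_exp M F (\<lambda>\<omega>. S T (x \<omega>)) Z"
    and q: "q \<in> borel_measurable F" "integrable M q"
    and q0: "\<And>A. A \<in> sets F \<Longrightarrow> (LINT \<omega>:A|M. U e \<omega> - q \<omega>) = 0"
  shows "AE \<omega> in M. e \<bullet> Z \<omega> = q \<omega>"
proof (rule cond_exp_unique[OF F])
  have Zm: "Z \<in> borel_measurable F" and Zi: "integrable M Z" using Z by (auto simp: is_cond_exp_def)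
  show "(\<lambda>\<omega>. e \<bullet> Z \<omega>) \<in> borel_measurable F" using Zm by measurable
  show "integrable M (\<lambda>\<omega>. e \<bullet> Z \<omega>)" by (rule integrable_inner_right[OF Zi])
  fix A assume A: "A \<in> sets F"
  then have AM: "A \<in> sets M" using F by blast
  have inner: "(LINT \<omega>:A|M. e \<bullet> X \<omega>) = e \<bullet> (LINT \<omega>:A|M. X \<omega>)" if "integrable M X" for X :: "'w \<Rightarrow> 'x"
    unfolding set_lebesgue_integral_def
    using integral_inner_right[OF integrable_mult_indicator[OF AM that], of e] by simp
  have "(LINT \<omega>:A|M. e \<bullet> Z \<omega>) = e \<bullet> (LINT \<omega>:A|M. S T (x \<omega>))"
    unfolding inner[OF Zi] using Z A by (simp add: is_cond_exp_def)
  also have "\<dots> = (LINT \<omega>:A|M. U e \<omega>)" unfolding U_def by (rule inner[OF integrable_z(1), symmetric])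
  also have "\<dots> = (LINT \<omega>:A|M. U e \<omega> - q \<omega>) + (LINT \<omega>:A|M. q \<omega>)"
    unfolding set_lebesgue_integral_def
    using integrable_mult_indicator[OF AM sq_integrable[OF sq_U[of e]]] integrable_mult_indicator[OF AM q(2)]
    by (simp add: right_diff_distrib)
  finally show "(LINT \<omega>:A|M. e \<bullet> Z \<omega>) = (LINT \<omega>:A|M. q \<omega>)" using q0[OF A] by simp
qed (rule q)+

lemma continuous_estimate_coordinate:
  assumes "is_cond_exp M (gen_sigma M {0..T} y) (\<lambda>\<omega>. S T (x \<omega>)) Z"
  shows "AE \<omega> in M. e \<bullet> Z \<omega> = est e \<omega>"
proof (rule cond_exp_coordinate[OF sets_gen_sigma_le space_gen_sigma assms])
  let ?F = "gen_sigma M {0..T} y"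
  have Ym: "Y j \<in> borel_measurable ?F" if "j \<in> grid k" for j k
  proof (cases "fst j < 0")
    case True
    then show ?thesis by (cases j) (simp add: Y_const)
  next
    case False
    then have "y (fst j) \<in> borel_measurable ?F" using grid_le[OF that] by (intro measurable_gen_sigma) simp
    then show ?thesis unfolding Y_def[abs_def] using False by simp
  qed
  have [measurable]: "p e k \<in> borel_measurable ?F" for k
    unfolding p_def by (intro borel_measurable_sum borel_measurable_times borel_measurable_const Ym)
  show "est e \<in> borel_measurable ?F" unfolding est_def by measurable
qed (auto intro: y_measurable sq_integrable sq_est est_set_integral)

lemma discrete_estimate_coordinate:
  assumes "is_cond_exp M (gen_sigma M times0 y) (\<lambda>\<omega>. S T (x \<omega>)) Z"
  shows "AE \<omega> in M. e \<bullet> Z \<omega> = p e 0 \<omega>"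
proof -
  let ?F = "gen_sigma M times0 y"
  \<comment> \<open>The grid contains the time \<open>0\<close>, where the observation vanishes almost surely.\<close>
  define q where "q \<omega> = (\<Sum>j\<in>grid 0. coef e 0 j * (if fst j = 0 then 0 else Y j \<omega>))" for \<omega>
  have qm: "(\<lambda>\<omega>. if fst j = 0 then 0 else Y j \<omega>) \<in> borel_measurable ?F" if j_grid: "j \<in> grid 0" for j
  proof (cases "fst j \<le> 0")
    case True
    then show ?thesis by (cases j; cases "fst j = 0") (simp_all add: Y_const)
  next
    case False
    then obtain i b where j: "j = (time 0 i, b)" "i \<le> n" using j_grid by (auto simp: grid_def N_def)
    then have "i \<noteq> 0" using False by (intro notI) (simp add: time_def)
    then have "time 0 i \<in> times0" using j by (auto simp: time_def N_def)
    then have "y (fst j) \<in> borel_measurable ?F" unfolding j by (intro measurable_gen_sigma) simp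
    then show ?thesis unfolding Y_def[abs_def] using False by simp
  qed
  have qF: "q \<in> borel_measurable ?F"
    unfolding q_def[abs_def] by (intro borel_measurable_sum borel_measurable_times borel_measurable_const qm)
  have sub: "sets ?F \<subseteq> sets M"
    by (rule sets_gen_sigma_le) (use times0 y_measurable in blast)
  have qM: "q \<in> borel_measurable M"
    using qF sub by (auto simp: measurable_def)
  have ae: "AE \<omega> in M. p e 0 \<omega> = q \<omega>"
    using y_0
  proof eventually_elim
    case (elim \<omega>)
    then show ?case unfolding p_def q_def by (intro sum.cong) (auto simp: Y_def)
  qed
  have pM: "p e 0 \<in> borel_measurable M" by (rule sq_measurable[OF sq_p])
  have "AE \<omega> in M. e \<bullet> Z \<omega> = q \<omega>"
  proof (rule cond_exp_coordinate[OF sub space_gen_sigma assms qF])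
    show "integrable M q" using integrable_cong_AE_imp[OF sq_integrable[OF sq_p] qM] ae by simp
    fix A assume A: "A \<in> sets ?F"
    then have AM: "A \<in> sets M" using sub by blast
    have "(LINT \<omega>:A|M. U e \<omega> - q \<omega>) = (LINT \<omega>:A|M. U e \<omega> - p e 0 \<omega>)"
      unfolding set_lebesgue_integral_def
    proof (rule integral_cong_AE)
      show "AE \<omega> in M. indicator A \<omega> *\<^sub>R (U e \<omega> - q \<omega>) = indicator A \<omega> *\<^sub>R (U e \<omega> - p e 0 \<omega>)"
        using ae by eventually_elim simp
    qed (use qM pM AM sq_measurable[OF sq_U[of e]] in measurable)
    then show "(LINT \<omega>:A|M. U e \<omega> - q \<omega>) = 0" using p0_set_integral[OF A] by simp
  qed
  then show ?thesis using ae by eventually_elim simp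
qed

section \<open>The estimate\<close>

text \<open>The bound holds for every coordinate with the same factor, and the projections onto finite
  orthonormal sets turn it into a bound for the norm.\<close>

theorem estimate_difference:
  assumes Zn: "is_cond_exp M (gen_sigma M times0 y) (\<lambda>\<omega>. S T (x \<omega>)) Zn"
    and Z: "is_cond_exp M (gen_sigma M {0..T} y) (\<lambda>\<omega>. S T (x \<omega>)) Z"
  shows "expectation (\<lambda>\<omega>. (norm (Zn \<omega> - Z \<omega>))\<^sup>2) \<le> factor * expectation (\<lambda>\<omega>. (norm (S T (x \<omega>) - Zn \<omega>))\<^sup>2)"
proof -
  obtain E :: "nat \<Rightarrow> 'x set" where "projecting E" using projecting_exists by blast
  note E = projectingD[OF this]
  have i: "integrable M Zn" "integrable M Z" using Zn Z by (auto simp: is_cond_exp_def)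
  note [measurable] = borel_measurable_integrable[OF i(1)] borel_measurable_integrable[OF i(2)]
    borel_measurable_integrable[OF integrable_z(1)]
  have Elim: "(\<lambda>n. \<Sum>e\<in>E n. (e \<bullet> v)\<^sup>2) \<longlonglongrightarrow> (norm v)\<^sup>2" for v
    unfolding E(2) by (intro tendsto_intros E(4))
  have aen: "AE \<omega> in M. e \<bullet> (S T (x \<omega>) - Zn \<omega>) = U e \<omega> - p e 0 \<omega>" for e
    using discrete_estimate_coordinate[OF Zn, of e] by eventually_elim (simp add: U_def inner_diff_right)
  have aed: "AE \<omega> in M. e \<bullet> (Zn \<omega> - Z \<omega>) = p e 0 \<omega> - est e \<omega>" for e
    using discrete_estimate_coordinate[OF Zn, of e] continuous_estimate_coordinate[OF Z, of e]
    by eventually_elim (simp add: inner_diff_right)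
  have n1: "sq (\<lambda>\<omega>. e \<bullet> (S T (x \<omega>) - Zn \<omega>))" for e
    by (rule sq_cong_AE[OF sq_Up]) (use aen[of e] in \<open>auto elim: eventually_mono\<close>)
  have n2: "expectation (\<lambda>\<omega>. (e \<bullet> (S T (x \<omega>) - Zn \<omega>))\<^sup>2) = err e" for e
    unfolding err_def ip_self
    by (rule integral_cong_AE) (use aen[of e] sq_measurable[OF sq_Up] in \<open>auto elim: eventually_mono\<close>)
  have sd: "sq (\<lambda>\<omega>. p e 0 \<omega> - est e \<omega>)" for e using sq_p sq_est by (rule sq_diff)
  have d1: "sq (\<lambda>\<omega>. e \<bullet> (Zn \<omega> - Z \<omega>))" for e
    by (rule sq_cong_AE[OF sd[of e]]) (use aed[of e] in \<open>auto elim: eventually_mono\<close>)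
  have d2: "expectation (\<lambda>\<omega>. (e \<bullet> (Zn \<omega> - Z \<omega>))\<^sup>2) \<le> factor * err e" for e
  proof -
    have "expectation (\<lambda>\<omega>. (e \<bullet> (Zn \<omega> - Z \<omega>))\<^sup>2) = ip (\<lambda>\<omega>. est e \<omega> - p e 0 \<omega>) (\<lambda>\<omega>. est e \<omega> - p e 0 \<omega>)"
      unfolding ip_self
      by (rule integral_cong_AE) (use aed[of e] sq_measurable[OF sq_p] sq_measurable[OF sq_est] in
          \<open>auto elim: eventually_mono simp: power2_commute\<close>)
    then show ?thesis using est_error[of e 0] by (simp add: mult.commute)
  qed
  have err_le: "err e \<le> expectation (\<lambda>\<omega>. (e \<bullet> S T (x \<omega>))\<^sup>2)" for e
  proof -
    have "(\<lambda>\<omega>. U e \<omega>) = (\<lambda>\<omega>. (U e \<omega> - p e 0 \<omega>) + p e 0 \<omega>)" by simp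
    then have "ip (U e) (U e) = ip (\<lambda>\<omega>. (U e \<omega> - p e 0 \<omega>) + p e 0 \<omega>) (\<lambda>\<omega>. (U e \<omega> - p e 0 \<omega>) + p e 0 \<omega>)" by simp
    also have "\<dots> = err e + 2 * ip (\<lambda>\<omega>. U e \<omega> - p e 0 \<omega>) (p e 0) + ip (p e 0) (p e 0)"
      using ip_commute[of "p e 0" "\<lambda>\<omega>. U e \<omega> - p e 0 \<omega>"]
      by (simp only: ip_add_left[OF sq_Up sq_p sq_add[OF sq_Up sq_p]] ip_add_right[OF sq_Up sq_p sq_Up]
          ip_add_right[OF sq_Up sq_p sq_p] err_def)
    finally have "err e \<le> ip (U e) (U e)"
      using Up_orth_p[of 0 0 e] ip_self_nonneg[of "p e 0"] by linarith
    then show ?thesis by (simp add: ip_self U_def)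
  qed
  define Q where "Q n \<omega> = (\<Sum>e\<in>E n. (e \<bullet> (S T (x \<omega>) - Zn \<omega>))\<^sup>2)" for n \<omega>
  define W where "W n \<omega> = (\<Sum>e\<in>E n. (e \<bullet> (Zn \<omega> - Z \<omega>))\<^sup>2)" for n \<omega>
  have Qi: "integrable M (Q n)" "expectation (Q n) = (\<Sum>e\<in>E n. err e)" for n
    unfolding Q_def[abs_def] using n1 n2
    by (auto simp: sq_def Bochner_Integration.integral_sum)
  have Wi: "integrable M (W n)" "expectation (W n) \<le> (\<Sum>e\<in>E n. factor * err e)" for n
    unfolding W_def[abs_def] using d1
    by (auto simp: sq_def Bochner_Integration.integral_sum intro!: sum_mono d2)
  have zi: "integrable M (\<lambda>\<omega>. \<Sum>e\<in>E n. (e \<bullet> S T (x \<omega>))\<^sup>2)" for n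
    using sq_U by (auto simp: sq_def U_def)
  have Qle: "expectation (Q n) \<le> expectation (\<lambda>\<omega>. (norm (S T (x \<omega>)))\<^sup>2)" for n
  proof -
    have "expectation (Q n) \<le> (\<Sum>e\<in>E n. expectation (\<lambda>\<omega>. (e \<bullet> S T (x \<omega>))\<^sup>2))"
      unfolding Qi(2) by (intro sum_mono err_le)
    also have "\<dots> = expectation (\<lambda>\<omega>. \<Sum>e\<in>E n. (e \<bullet> S T (x \<omega>))\<^sup>2)"
      using sq_U by (subst Bochner_Integration.integral_sum) (auto simp: sq_def U_def)
    also have "\<dots> \<le> expectation (\<lambda>\<omega>. (norm (S T (x \<omega>)))\<^sup>2)"
      by (rule integral_mono[OF zi integrable_z(2) E(3)])
    finally show ?thesis .
  qed
  have err_int: "integrable M (\<lambda>\<omega>. (norm (S T (x \<omega>) - Zn \<omega>))\<^sup>2)"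
  proof (rule integrable_limit(1)[where Q = Q, OF Qi(1) _ Qle])
    show "0 \<le> Q n \<omega>" for n \<omega> by (simp add: Q_def sum_nonneg)
    show "AE \<omega> in M. (\<lambda>n. Q n \<omega>) \<longlonglongrightarrow> (norm (S T (x \<omega>) - Zn \<omega>))\<^sup>2"
      unfolding Q_def by (rule AE_I2) (rule Elim)
  qed measurable
  have Wle: "expectation (W n) \<le> factor * expectation (\<lambda>\<omega>. (norm (S T (x \<omega>) - Zn \<omega>))\<^sup>2)" for n
  proof -
    have "expectation (W n) \<le> factor * expectation (Q n)"
      using Wi(2)[of n] by (simp add: Qi(2) sum_distrib_left)
    also have "expectation (Q n) \<le> expectation (\<lambda>\<omega>. (norm (S T (x \<omega>) - Zn \<omega>))\<^sup>2)"
      unfolding Q_def by (rule integral_mono[OF Qi(1)[unfolded Q_def] err_int E(3)])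
    finally show ?thesis using factor_nonneg by (simp add: mult_left_mono)
  qed
  show ?thesis
  proof (rule integrable_limit(2)[where Q = W, OF Wi(1) _ Wle])
    show "0 \<le> W n \<omega>" for n \<omega> by (simp add: W_def sum_nonneg)
    show "AE \<omega> in M. (\<lambda>n. W n \<omega>) \<longlonglongrightarrow> (norm (Zn \<omega> - Z \<omega>))\<^sup>2"
      unfolding W_def by (rule AE_I2) (rule Elim)
  qed measurable
qed

end

theorem theorem3p4:
  fixes M :: "'w measure"
    and S :: "real \<Rightarrow> 'x::{real_inner, banach, second_countable_topology} \<Rightarrow>\<^sub>L 'x"
    and C :: "'x \<Rightarrow> real ^ 'r"
    and R :: "real ^ 'r ^ 'r"
    and x :: "'w \<Rightarrow> 'x" and m :: 'x and P0 :: "'x \<Rightarrow> 'x"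
    and w :: "real \<Rightarrow> 'w \<Rightarrow> real ^ 'r"
    and c :: "real \<Rightarrow> real"
    and T \<nu> \<eta> :: real and n :: nat
    and zhat_n zhat :: "'w \<Rightarrow> 'x"
  assumes "prob_space M" and "0 < T" and "0 < n"
    and "analytic_semigroup S"
    and "sectorial (gen_dom S) (\<lambda>u. - gen S u)"
    and "bounded_op_on (gen_dom S) (\<lambda>u. norm u + norm (gen S u)) C"
    and "gaussian M x m P0"
    and "pos_def R" and "brownian_motion M w R"
    and "prob_space.indep_set M (sets (vimage_algebra (space M) x borel))
           (sets (gen_sigma M {0..} w))"
    and "\<bar>\<eta> - \<nu>\<bar> < 1 / 2"
    and "bounded_op_on (neg_gen_dom S \<nu>) (\<lambda>u. norm (neg_gen_power S \<nu> u)) C"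
    and "AE \<omega> in M. x \<omega> \<in> neg_gen_dom S \<eta>"
    and "\<And>\<kappa> t. 0 \<le> \<kappa> \<Longrightarrow> 0 < t \<Longrightarrow> t \<le> T \<Longrightarrow>
           onorm (\<lambda>\<xi>. neg_gen_power S \<kappa> (S t \<xi>)) \<le> c \<kappa> / t powr \<kappa>"
    and "is_cond_exp M
           (gen_sigma M ((\<lambda>i. real i * T / real n) ` {1..n}) (output_process S C x w))
           (\<lambda>\<omega>. S T (x \<omega>)) zhat_n"
    and "is_cond_exp M (gen_sigma M {0..T} (output_process S C x w)) (\<lambda>\<omega>. S T (x \<omega>)) zhat"
  shows "prob_space.expectation M (\<lambda>\<omega>. (norm (zhat_n \<omega> - zhat \<omega>))\<^sup>2)
    \<le> M_const c \<nu> \<eta>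
        (op_norm_on (neg_gen_dom S \<nu>) (\<lambda>u. norm (neg_gen_power S \<nu> u)) C)
        (prob_space.expectation M (\<lambda>\<omega>. (norm (S T (x \<omega>) - zhat_n \<omega>))\<^sup>2))
        (prob_space.expectation M (\<lambda>\<omega>. (norm (neg_gen_power S \<eta> (x \<omega>)))\<^sup>2))
        (min_eig R)
      * T powr (1 + 2 * (\<eta> - \<nu>)) / real n powr (1 + 2 * (\<eta> - \<nu>))"
proof -
  interpret prob_space M by (rule assms(1))
  interpret observation_problem S c T \<eta> \<nu> M x m P0 w R C n
    apply unfold_locales
    apply (rule assms(4))
    apply (rule assms(5))
    apply (rule assms(11))
    apply (rule assms(2))
    apply (rule assms(14); assumption)
    apply (rule assms(7))
    apply (rule assms(9))
    apply (rule assms(8))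
    apply (rule assms(10))
    apply (rule assms(6))
    apply (rule assms(12))
    apply (rule assms(13))
    apply (rule assms(3))
    done
  have "factor = M_const c \<nu> \<eta> normC 1 ex lam * T powr (1 + 2 * (\<eta> - \<nu>)) / real n powr (1 + 2 * (\<eta> - \<nu>))"
    unfolding factor_def M_const_def Kc_def pw_def using assms(2) by (simp add: powr_divide)
  then have "factor * err = M_const c \<nu> \<eta> normC err ex lam * T powr (1 + 2 * (\<eta> - \<nu>)) / real n powr (1 + 2 * (\<eta> - \<nu>))" for err
    by (simp add: M_const_def)
  then show ?thesis
    using estimate_difference[OF assms(15,16)] unfolding ex_def lam_def by simp
qed

end
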